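(* Let $\tilde q(\cdot)$ be an extremal curve and let $X$, $b$ and the Jacobi curve $\mathcal L_s$ be as defined in the context. Let $\tau$ be a moment of time such that $b(\tau)=0$ and $b(\tau+\varepsilon)=b_m\varepsilon^m+\dots$ (Taylor expansion to the right of $\tau$ with first nonzero coefficient $b_m$) is negative for all sufficiently small $\varepsilon>0$. Assume that: 1. $\sigma(X(\tau),\dot X(\tau))\neq0$, and moreover $4\sigma(X(\tau),\dot X(\tau))+b_2\neq0$ if $m=2$; 2. for some $\varepsilon>0$, $\dim\mathrm{span}\{\ddot X(s),\dot X(s),X(s)\}$ is constant for $s\in[\tau,\tau+\varepsilon]$. Then, if the right limit $\mathcal L_{\tau+}=\lim_{s\to\tau+}\mathcal L_s$ of the Jacobi curve exists, it is equal to $$\mathcal L_{\tau+}=\mathcal L_\tau^{X(\tau)}.$$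
   Context: Optimal control problem: $\dot q=f(q,u)$, $q\in M$, $\dim M=n$, $u\in U$, $q(0)=q_0$, $q(T)=q_T$, $T$ fixed, minimize $\int_0^T L(u,q)\,dt$. Here $f,L$ are analytic in both variables, $U$ is a polytope or a one-dimensional smooth manifold, and controls are $L^\infty$ functions. An extremal consists of a control $\tilde u(t)$, its trajectory $\tilde q(t)$, a number $\nu\in\{0,1\}$ and a curve $\lambda(t)\in T^*_{\tilde q(t)}M$ satisfying, with $h(u,\lambda)=\langle\lambda,f(q,u)\rangle-\nu L(u,q)$, the Hamiltonian system $\dot\lambda=\vec h_{\tilde u(t)}(\lambda)$ and the first-order extremality condition $\partial h(u,\lambda(t))/\partial u|_{u=\tilde u(t)}=0$ for the variations used. The extremal control takes values on vertices or one-dimensional edges of $U$. Only one-dimensional variations $v(\tau)\in\mathbb R$ are used: variations of $u$ along the edge when $\tilde u(\tau)$ is on an edge, and time variations (replacing $h(\tilde u(\tau),\cdot)$ by $(1+\alpha)h(\tilde u(\tau),\cdot)$, $v=\alpha$) when $\tilde u(\tau)$ is at a vertex. The form $\sigma$ is the canonical symplectic form: in Darboux coordinates $(p,q)$, $\sigma(\lambda_1,\lambda_2)=\lambda_1^TJ\lambda_2$ with $J=\begin{pmatrix}0&\mathrm{id}_n\\-\mathrm{id}_n&0\end{pmatrix}$, and $\vec h=-J\nabla h$. Let $\Phi_t$ be the flow from time $0$ to $t$ of $\dot\lambda=\vec h_{\tilde u(t)}(\lambda)$. Where control variations are used, $$b(\tau)=\frac{\partial^2}{\partial u^2}\Big|_{u=\tilde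 u(\tau)}h(u,\lambda(\tau)),\qquad X(\tau)=\frac{\partial}{\partial u}\Big|_{u=\tilde u(\tau)}\overrightarrow{\big(h(u,\cdot)\circ\Phi_\tau\big)}(\lambda(0))\in T_{\lambda(0)}(T^*M);$$ where time variations are used, $\partial/\partial u$ is replaced by the derivative in $\alpha$ at $\alpha=0$, so $b(\tau)=0$ and $X(\tau)=\overrightarrow{(h(\tilde u(\tau),\cdot)\circ\Phi_\tau)}(\lambda(0))$. Standing assumption: $b$, $X$, $\tilde u$ are piecewise analytic. At the point $\tau$, the values and derivatives of $X$ and the expansion of $b$ are those of the analytic piece to the right of $\tau$. Jacobi curve: $\mathcal L_0=T_{\lambda(0)}(T^*_{q_0}M)$ (the vertical Lagrangian subspace). For $t>0$ and a finite-dimensional $V\subset L^\infty([0,t],\mathbb R)$ let $\mathcal L_t(V)$ be the set of vectors $\eta_0+\int_0^tX(\tau)v(\tau)\,d\tau$ with $\eta_0\in T_{\lambda(0)}(T^*_{q_0}M)$, $v\in V$, such that $$\int_0^t\Big(\sigma\Big(\eta_0+\int_0^\tau X(\theta)v(\theta)\,d\theta,\,X(\tau)w(\tau)\Big)+b(\tau)v(\tau)w(\tau)\Big)d\tau=0\quad\forall w\in V.$$ It is a Lagrangian plane. $\mathcal L_t$ is the limit in the Lagrangian Grassmannian of the net $V\mapsto\mathcal L_t(V)$ over all finite-dimensional $V\subset L^\infty([0,t],\mathbb R)$ ordered by inclusion (when it exists). For a vector $X$ and a Lagrangian plane $\Lambda$, $\Lambda^X=(\Lambda\cap(\mathbb RX)^\angle)+\mathbb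 RX$, where $\angle$ denotes the $\sigma$-orthogonal complement. *)

theory Defs
  imports "HOL-Analysis.Analysis"
begin

section \<open>Real-analytic and piecewise analytic maps\<close>

text \<open>Local expansion into an unconditionally convergent multi-index power series; a multi-index
  is a function supported on \<open>Basis\<close>.\<close>

definition real_analytic_at :: "('a::euclidean_space \<Rightarrow> 'b::real_normed_vector) \<Rightarrow> 'a \<Rightarrow> bool" where
  "real_analytic_at F x \<longleftrightarrow>
     (\<exists>r>0. \<exists>c. \<forall>y\<in>ball x r.
        ((\<lambda>\<alpha>. (\<Prod>i\<in>Basis. ((y - x) \<bullet> i) ^ \<alpha> i) *\<^sub>R c \<alpha>) has_sum F y)
          {\<alpha> :: 'a \<Rightarrow> nat. \<forall>i. i \<notin> Basis \<longrightarrow> \<alpha> i = 0})"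

definition real_analytic_on :: "('a::euclidean_space \<Rightarrow> 'b::real_normed_vector) \<Rightarrow> 'a set \<Rightarrow> bool" where
  "real_analytic_on F S \<longleftrightarrow> (\<forall>x\<in>S. real_analytic_at F x)"

definition piecewise_on :: "real \<Rightarrow> (real \<Rightarrow> real \<Rightarrow> bool) \<Rightarrow> bool" where
  "piecewise_on T Q \<longleftrightarrow>
     (\<exists>(N::nat) s. s 0 = 0 \<and> s N = T \<and> (\<forall>i<N. s i < s (Suc i) \<and> Q (s i) (s (Suc i))))"

text \<open>At a break point the value is that of the piece to the right, and every piece extends
  analytically to a neighbourhood of its closed interval.\<close>

definition piecewise_analytic :: "real \<Rightarrow> (real \<Rightarrow> 'b::real_normed_vector) \<Rightarrow> bool" where
  "piecewise_analytic T g \<longleftrightarrow>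
     piecewise_on T (\<lambda>r s. \<exists>G. real_analytic_on G {r..s} \<and> (\<forall>t\<in>{r..<s}. g t = G t))"

definition right_deriv :: "(real \<Rightarrow> 'b::real_normed_vector) \<Rightarrow> real \<Rightarrow> 'b" where
  "right_deriv g t = vector_derivative g (at_right t)"


section \<open>The symplectic space of pairs (p, q) and Lagrangian planes\<close>

definition Jmap :: "'e \<times> 'e \<Rightarrow> 'e \<times> 'e::real_inner" where
  "Jmap z = (snd z, - fst z)"

definition sigma :: "'e \<times> 'e \<Rightarrow> 'e \<times> 'e::real_inner \<Rightarrow> real" where
  "sigma z w = z \<bullet> Jmap w"

definition gradient :: "('a::real_inner \<Rightarrow> real) \<Rightarrow> 'a \<Rightarrow> 'a" where
  "gradient F z = (THE D. GDERIV F z :> D)"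

definition skew_compl :: "('e \<times> 'e) set \<Rightarrow> ('e \<times> 'e::real_inner) set" where
  "skew_compl S = {z. \<forall>w\<in>S. sigma z w = 0}"

definition lagrangian_plane :: "('e \<times> 'e::real_inner) set \<Rightarrow> bool" where
  "lagrangian_plane \<Lambda> \<longleftrightarrow> subspace \<Lambda> \<and> skew_compl \<Lambda> = \<Lambda>"

definition plane_add_vector :: "('e \<times> 'e) set \<Rightarrow> 'e \<times> 'e \<Rightarrow> ('e \<times> 'e::real_inner) set" where
  "plane_add_vector \<Lambda> x = {y + z | y z. y \<in> \<Lambda> \<inter> skew_compl (span {x}) \<and> z \<in> span {x}}"

text \<open>The Grassmannian topology, metrized by the norm distance of orthogonal projections.\<close>

definition plane_dist :: "'a::euclidean_space set \<Rightarrow> 'a set \<Rightarrow> real" where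
  "plane_dist A B = onorm (\<lambda>x. closest_point A x - closest_point B x)"


section \<open>Analytic manifolds and cotangent bundles\<close>

type_synonym ('m, 'n) chart = "'m set \<times> ('m \<Rightarrow> real ^ 'n)"

abbreviation chart_dom :: "('m, 'n::finite) chart \<Rightarrow> 'm set" where
  "chart_dom \<equiv> fst"

abbreviation chart_map :: "('m, 'n::finite) chart \<Rightarrow> 'm \<Rightarrow> real ^ 'n" where
  "chart_map \<equiv> snd"

definition chart_inv :: "('m, 'n::finite) chart \<Rightarrow> real ^ 'n \<Rightarrow> 'm" where
  "chart_inv \<kappa> = inv_into (chart_dom \<kappa>) (chart_map \<kappa>)"

definition transition :: "('m, 'n::finite) chart \<Rightarrow> ('m, 'n) chart \<Rightarrow> real ^ 'n \<Rightarrow> real ^ 'n" where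
  "transition \<kappa> \<kappa>' = chart_map \<kappa>' \<circ> chart_inv \<kappa>"

text \<open>The differential of the coordinate change from \<open>\<kappa>\<close> to \<open>\<kappa>'\<close> at the point \<open>q\<close>.\<close>

definition dtransition ::
  "('m, 'n::finite) chart \<Rightarrow> ('m, 'n) chart \<Rightarrow> 'm \<Rightarrow> real ^ 'n \<Rightarrow> real ^ 'n" where
  "dtransition \<kappa> \<kappa>' q = frechet_derivative (transition \<kappa> \<kappa>') (at (chart_map \<kappa> q))"

definition analytic_atlas :: "('m::topological_space, 'n::finite) chart set \<Rightarrow> bool" where
  "analytic_atlas A \<longleftrightarrow>
     (\<forall>\<kappa>\<in>A. open (chart_dom \<kappa>) \<and> open (chart_map \<kappa> ` chart_dom \<kappa>) \<and>
        homeomorphism (chart_dom \<kappa>) (chart_map \<kappa> ` chart_dom \<kappa>) (chart_map \<kappa>) (chart_inv \<kappa>)) \<and>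
     (\<Union>\<kappa>\<in>A. chart_dom \<kappa>) = UNIV \<and>
     (\<forall>\<kappa>\<in>A. \<forall>\<kappa>'\<in>A. real_analytic_on (transition \<kappa> \<kappa>')
        (chart_map \<kappa> ` (chart_dom \<kappa> \<inter> chart_dom \<kappa>')))"

text \<open>A point of the cotangent bundle is a base point together with the components of the covector
  in every chart around the base point, related by the transformation law of covectors.
  (Components in other charts are irrelevant.)\<close>

type_synonym ('m, 'n) cot_point = "'m \<times> (('m, 'n) chart \<Rightarrow> real ^ 'n)"

definition cotangent_bundle :: "('m, 'n::finite) chart set \<Rightarrow> ('m, 'n) cot_point set" where
  "cotangent_bundle A =
     {(q, \<xi>). \<forall>\<kappa>\<in>A. \<forall>\<kappa>'\<in>A. q \<in> chart_dom \<kappa> \<inter> chart_dom \<kappa>' \<longrightarrow>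
        \<xi> \<kappa> = adjoint (dtransition \<kappa> \<kappa>' q) (\<xi> \<kappa>')}"

text \<open>Canonical (Darboux) coordinates (p, q) on the cotangent bundle induced by a chart, and the
  point with given coordinates.\<close>

definition cot_coords ::
  "('m, 'n::finite) chart \<Rightarrow> ('m, 'n) cot_point \<Rightarrow> (real ^ 'n) \<times> (real ^ 'n)" where
  "cot_coords \<kappa> \<mu> = (snd \<mu> \<kappa>, chart_map \<kappa> (fst \<mu>))"

definition cot_from_coords ::
  "('m, 'n::finite) chart \<Rightarrow> (real ^ 'n) \<times> (real ^ 'n) \<Rightarrow> ('m, 'n) cot_point" where
  "cot_from_coords \<kappa> z =
     (chart_inv \<kappa> (snd z), \<lambda>\<kappa>'. adjoint (dtransition \<kappa>' \<kappa> (chart_inv \<kappa> (snd z))) (fst z))"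

text \<open>The value at a point \<open>\<mu>\<close> of the Hamiltonian vector field \<open>-J\<nabla>F\<close> of a function \<open>F\<close> on the
  cotangent bundle, in canonical coordinates.\<close>

definition hamiltonian_field ::
  "('m, 'n::finite) chart \<Rightarrow> (('m, 'n) cot_point \<Rightarrow> real) \<Rightarrow> ('m, 'n) cot_point
     \<Rightarrow> (real ^ 'n) \<times> (real ^ 'n)" where
  "hamiltonian_field \<kappa> F \<mu> = - Jmap (gradient (\<lambda>z. F (cot_from_coords \<kappa> z)) (cot_coords \<kappa> \<mu>))"


section \<open>The optimal control problem\<close>

text \<open>A vector field depending on the control is given by its components in all charts.\<close>

record ('m, 'n, 'u) control_problem =
  atlas :: "('m, 'n) chart set"
  controls :: "'u set"
  dynamics :: "('m, 'n) chart \<Rightarrow> 'm \<Rightarrow> 'u \<Rightarrow> real ^ 'n"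
  running_cost :: "'u \<Rightarrow> 'm \<Rightarrow> real"
  horizon :: real
  q_start :: 'm
  q_end :: 'm

text \<open>One-dimensional manifolds of controls are embedded in a Euclidean space, with analytic local
  coordinates, since the problem is required to be analytic in the control.\<close>

definition local_coordinate :: "'u::euclidean_space set \<Rightarrow> (real \<Rightarrow> 'u) \<Rightarrow> real set \<Rightarrow> bool" where
  "local_coordinate U \<gamma> I \<longleftrightarrow>
     open I \<and> connected I \<and> real_analytic_on \<gamma> I \<and>
     (\<forall>s\<in>I. vector_derivative \<gamma> (at s) \<noteq> 0) \<and>
     openin (top_of_set U) (\<gamma> ` I) \<and> (\<exists>g. homeomorphism I (\<gamma> ` I) \<gamma> g)"

definition one_dim_manifold :: "'u::euclidean_space set \<Rightarrow> bool" where
  "one_dim_manifold U \<longleftrightarrow> (\<forall>u\<in>U. \<exists>\<gamma> I. local_coordinate U \<gamma> I \<and> u \<in> \<gamma> ` I)"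

text \<open>Analyticity in the control means that dynamics and cost extend analytically to an open
  neighbourhood \<open>W\<close> of the control set; the control set itself may have empty interior, and edge
  coordinates may leave it beyond a vertex.\<close>

definition optimal_control_problem ::
  "('m::{t2_space, second_countable_topology}, 'n::finite, 'u::euclidean_space) control_problem
     \<Rightarrow> bool" where
  "optimal_control_problem P \<longleftrightarrow>
     analytic_atlas (atlas P) \<and> 0 < horizon P \<and>
     (polytope (controls P) \<or> one_dim_manifold (controls P)) \<and>
     (\<exists>W. open W \<and> controls P \<subseteq> W \<and>
        (\<forall>\<kappa>\<in>atlas P.
           real_analytic_on (\<lambda>(x, u). dynamics P \<kappa> (chart_inv \<kappa> x) u)
             (chart_map \<kappa> ` chart_dom \<kappa> \<times> W) \<and>
           real_analytic_on (\<lambda>(x, u). running_cost P u (chart_inv \<kappa> x))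
             (chart_map \<kappa> ` chart_dom \<kappa> \<times> W)) \<and>
        (\<forall>\<kappa>\<in>atlas P. \<forall>\<kappa>'\<in>atlas P. \<forall>q\<in>chart_dom \<kappa> \<inter> chart_dom \<kappa>'. \<forall>u\<in>W.
           dynamics P \<kappa>' q u = dtransition \<kappa> \<kappa>' q (dynamics P \<kappa> q u)))"

text \<open>The function \<open>h(u,\<lambda>) = \<langle>\<lambda>, f(q,u)\<rangle> - \<nu> L(u,q)\<close>; the pairing does not depend on the chart.\<close>

definition hamiltonian ::
  "('m, 'n::finite, 'u) control_problem \<Rightarrow> real \<Rightarrow> 'u \<Rightarrow> ('m, 'n) cot_point \<Rightarrow> real" where
  "hamiltonian P \<nu> u \<mu> =
     (let \<kappa> = (SOME \<kappa>. \<kappa> \<in> atlas P \<and> fst \<mu> \<in> chart_dom \<kappa>)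
      in snd \<mu> \<kappa> \<bullet> dynamics P \<kappa> (fst \<mu>) u - \<nu> * running_cost P u (fst \<mu>))"

text \<open>Both differential equations are understood in the sense of Caratheodory, i.e. as integral
  equations in every chart.\<close>

definition trajectory ::
  "('m::topological_space, 'n::finite, 'u) control_problem \<Rightarrow> (real \<Rightarrow> 'u) \<Rightarrow> (real \<Rightarrow> 'm) \<Rightarrow> bool" where
  "trajectory P u q \<longleftrightarrow>
     continuous_on {0..horizon P} q \<and>
     (\<forall>\<kappa>\<in>atlas P. \<forall>r s. 0 \<le> r \<and> r \<le> s \<and> s \<le> horizon P \<and> q ` {r..s} \<subseteq> chart_dom \<kappa> \<longrightarrow>
        ((\<lambda>t. dynamics P \<kappa> (q t) (u t)) has_integral
           (chart_map \<kappa> (q s) - chart_map \<kappa> (q r))) {r..s})"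

definition hamiltonian_curve ::
  "('m::topological_space, 'n::finite, 'u) control_problem \<Rightarrow> real \<Rightarrow> (real \<Rightarrow> 'u)
     \<Rightarrow> (real \<Rightarrow> ('m, 'n) cot_point) \<Rightarrow> bool" where
  "hamiltonian_curve P \<nu> u lam \<longleftrightarrow>
     lam ` {0..horizon P} \<subseteq> cotangent_bundle (atlas P) \<and>
     continuous_on {0..horizon P} (fst \<circ> lam) \<and>
     (\<forall>\<kappa>\<in>atlas P. \<forall>r s. 0 \<le> r \<and> r \<le> s \<and> s \<le> horizon P \<and> (fst \<circ> lam) ` {r..s} \<subseteq> chart_dom \<kappa> \<longrightarrow>
        ((\<lambda>t. hamiltonian_field \<kappa> (hamiltonian P \<nu> (u t)) (lam t)) has_integral
           (cot_coords \<kappa> (lam s) - cot_coords \<kappa> (lam r))) {r..s})"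


section \<open>One-dimensional variations and extremals\<close>

text \<open>The variation used at a given time. In \<open>Control_Variation g\<close> the curve \<open>g\<close> is an edge
  coordinate recentred so that \<open>g 0\<close> is the value of the control at that time.\<close>

datatype 'u variation = Time_Variation | Control_Variation "real \<Rightarrow> 'u"

fun varied_hamiltonian ::
  "('m, 'n::finite, 'u) control_problem \<Rightarrow> real \<Rightarrow> 'u \<Rightarrow> 'u variation \<Rightarrow> real
     \<Rightarrow> ('m, 'n) cot_point \<Rightarrow> real" where
  "varied_hamiltonian P \<nu> w Time_Variation v = (\<lambda>\<mu>. (1 + v) * hamiltonian P \<nu> w \<mu>)"
| "varied_hamiltonian P \<nu> w (Control_Variation g) v = hamiltonian P \<nu> (g v)"

text \<open>On each time piece the control rests at a vertex, or moves inside an edge with a fixed (for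
  polytopes: affine) coordinate, or moves in a coordinate domain of a one-dimensional manifold.
  The coordinate \<open>c\<close> of the control is analytic up to the ends of the piece; the ends themselves may
  be vertices of the polytope.\<close>

definition variation_piece ::
  "'u::euclidean_space set \<Rightarrow> (real \<Rightarrow> 'u) \<Rightarrow> (real \<Rightarrow> 'u variation) \<Rightarrow> real \<Rightarrow> real \<Rightarrow> bool" where
  "variation_piece U u var r s \<longleftrightarrow>
     polytope U \<and>
       (\<exists>w. w extreme_point_of U \<and> (\<forall>t\<in>{r..<s}. u t = w \<and> var t = Time_Variation)) \<or>
     polytope U \<and>
       (\<exists>E a e c. E edge_of U \<and> e \<noteq> 0 \<and> affine hull E = range (\<lambda>x. a + x *\<^sub>R e) \<and>
          real_analytic_on c {r..s} \<and> (\<forall>t\<in>{r<..<s}. u t \<in> rel_interior E) \<and>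
          (\<forall>t\<in>{r..<s}. u t = a + c t *\<^sub>R e \<and>
             var t = Control_Variation (\<lambda>v. a + (c t + v) *\<^sub>R e))) \<or>
     one_dim_manifold U \<and>
       (\<exists>\<gamma> I c. local_coordinate U \<gamma> I \<and> real_analytic_on c {r..s} \<and> c ` {r..s} \<subseteq> I \<and>
          (\<forall>t\<in>{r..<s}. u t = \<gamma> (c t) \<and> var t = Control_Variation (\<lambda>v. \<gamma> (c t + v))))"

definition extremal ::
  "('m::topological_space, 'n::finite, 'u::euclidean_space) control_problem \<Rightarrow> real
     \<Rightarrow> (real \<Rightarrow> 'u) \<Rightarrow> (real \<Rightarrow> 'u variation) \<Rightarrow> (real \<Rightarrow> 'm) \<Rightarrow> (real \<Rightarrow> ('m, 'n) cot_point) \<Rightarrow> bool"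
  where
  "extremal P \<nu> u var q lam \<longleftrightarrow>
     \<nu> \<in> {0, 1} \<and>
     u ` {0..horizon P} \<subseteq> controls P \<and>
     piecewise_on (horizon P) (variation_piece (controls P) u var) \<and>
     q 0 = q_start P \<and> q (horizon P) = q_end P \<and> trajectory P u q \<and>
     (\<forall>t\<in>{0..horizon P}. fst (lam t) = q t) \<and> hamiltonian_curve P \<nu> u lam \<and>
     (\<forall>t\<in>{0..<horizon P}.
        ((\<lambda>v. varied_hamiltonian P \<nu> (u t) (var t) v (lam t)) has_real_derivative 0) (at 0))"

text \<open>\<open>\<Phi>\<close> is the flow from time 0 of the Hamiltonian system near \<open>\<mu>\<close>, a point over the domain of
  \<open>\<kappa>\<close>.\<close>

definition hamiltonian_flow ::
  "('m::topological_space, 'n::finite, 'u) control_problem \<Rightarrow> real \<Rightarrow> (real \<Rightarrow> 'u)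
     \<Rightarrow> ('m, 'n) chart \<Rightarrow> ('m, 'n) cot_point \<Rightarrow> (real \<Rightarrow> ('m, 'n) cot_point \<Rightarrow> ('m, 'n) cot_point) \<Rightarrow> bool"
  where
  "hamiltonian_flow P \<nu> u \<kappa> \<mu> \<Phi> \<longleftrightarrow>
     (\<forall>\<^sub>F z in nhds (cot_coords \<kappa> \<mu>).
        \<Phi> 0 (cot_from_coords \<kappa> z) = cot_from_coords \<kappa> z \<and>
        hamiltonian_curve P \<nu> u (\<lambda>t. \<Phi> t (cot_from_coords \<kappa> z)))"

definition second_variation_b ::
  "('m, 'n::finite, 'u) control_problem \<Rightarrow> real \<Rightarrow> (real \<Rightarrow> 'u) \<Rightarrow> (real \<Rightarrow> 'u variation)
     \<Rightarrow> (real \<Rightarrow> ('m, 'n) cot_point) \<Rightarrow> real \<Rightarrow> real" where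
  "second_variation_b P \<nu> u var lam t =
     (deriv ^^ 2) (\<lambda>v. varied_hamiltonian P \<nu> (u t) (var t) v (lam t)) 0"

text \<open>\<open>X(t)\<close>, an element of the tangent space at \<open>\<lambda>(0)\<close> of the cotangent bundle, in the canonical
  coordinates induced by a chart \<open>\<kappa>\<close> around the initial point.\<close>

definition second_variation_X ::
  "('m, 'n::finite, 'u) control_problem \<Rightarrow> real \<Rightarrow> (real \<Rightarrow> 'u) \<Rightarrow> (real \<Rightarrow> 'u variation)
     \<Rightarrow> (real \<Rightarrow> ('m, 'n) cot_point) \<Rightarrow> (real \<Rightarrow> ('m, 'n) cot_point \<Rightarrow> ('m, 'n) cot_point)
     \<Rightarrow> ('m, 'n) chart \<Rightarrow> real \<Rightarrow> (real ^ 'n) \<times> (real ^ 'n)" where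
  "second_variation_X P \<nu> u var lam \<Phi> \<kappa> t =
     vector_derivative
       (\<lambda>v. hamiltonian_field \<kappa> (varied_hamiltonian P \<nu> (u t) (var t) v \<circ> \<Phi> t) (lam 0)) (at 0)"


section \<open>The Jacobi curve\<close>

definition vertical :: "('e \<times> 'e::real_inner) set" where
  "vertical = {z. snd z = 0}"

definition Linf :: "real \<Rightarrow> (real \<Rightarrow> real) set" where
  "Linf t = {v \<in> borel_measurable (lebesgue_on {0..t}). \<exists>C. AE s in lebesgue_on {0..t}. \<bar>v s\<bar> \<le> C}"

text \<open>Finite-dimensional subspaces, represented by functions rather than classes of functions; the
  planes below depend on the classes only.\<close>

definition fin_dim_subspaces :: "real \<Rightarrow> (real \<Rightarrow> real) set set" where
  "fin_dim_subspaces t =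
     {V. \<exists>B. finite B \<and> B \<subseteq> Linf t \<and> V = {\<lambda>s. \<Sum>g\<in>B. c g * g s | c. True}}"

definition fin_dim_at_top :: "real \<Rightarrow> (real \<Rightarrow> real) set filter" where
  "fin_dim_at_top t =
     (INF V0\<in>fin_dim_subspaces t. principal {V \<in> fin_dim_subspaces t. V0 \<subseteq> V})"

definition jacobi_approx ::
  "(real \<Rightarrow> 'e \<times> 'e) \<Rightarrow> (real \<Rightarrow> real) \<Rightarrow> real \<Rightarrow> (real \<Rightarrow> real) set \<Rightarrow> ('e \<times> 'e::euclidean_space) set"
  where
  "jacobi_approx X b t V =
     {\<eta> + integral {0..t} (\<lambda>s. v s *\<^sub>R X s) | \<eta> v. \<eta> \<in> vertical \<and> v \<in> V \<and>
        (\<forall>w\<in>V. integral {0..t} (\<lambda>s.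
           sigma (\<eta> + integral {0..s} (\<lambda>\<theta>. v \<theta> *\<^sub>R X \<theta>)) (w s *\<^sub>R X s) + b s * v s * w s) = 0)}"

text \<open>\<open>\<Lambda>\<close> is the plane \<open>\<L>\<^sub>t\<close> of the Jacobi curve. At time 0 the Jacobi curve starts at the vertical
  plane.\<close>

definition is_jacobi_plane ::
  "(real \<Rightarrow> 'e \<times> 'e) \<Rightarrow> (real \<Rightarrow> real) \<Rightarrow> real \<Rightarrow> ('e \<times> 'e::euclidean_space) set \<Rightarrow> bool" where
  "is_jacobi_plane X b t \<Lambda> \<longleftrightarrow>
     (if t = 0 then \<Lambda> = vertical
      else lagrangian_plane \<Lambda> \<and>
        ((\<lambda>V. plane_dist (jacobi_approx X b t V) \<Lambda>) \<longlongrightarrow> 0) (fin_dim_at_top t))"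

end

theory Submission
  imports Defs "HOL-Library.Quadratic_Discriminant"
begin

text \<open>Put \<open>A = \<sigma>(X, X')\<close>. An integration by parts (Goh transformation) turns the second variation on
  \<open>[\<tau>, s]\<close> into \<open>\<integral> A W\<^sup>2 - b v\<^sup>2\<close> up to small terms, where \<open>W\<close> is the primitive of the variation \<open>v\<close>
  vanishing at \<open>s\<close>. Comparison with Hardy's inequality \<open>\<integral> (t - \<tau>)\<^sup>2 v\<^sup>2 \<ge> 1/4 \<integral> W\<^sup>2\<close> gives a dichotomy.
  If \<open>A(\<tau>) > 0\<close>, or \<open>m = 1\<close>, or \<open>m = 2\<close> and \<open>4 \<bar>A(\<tau>)\<bar> \<le> \<bar>b\<^sub>2\<bar>\<close>, then the form is coercive, and adjoining
  suitable variations concentrated near \<open>\<tau>\<close> to the approximating subspaces forces the vectors of the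
  Jacobi planes to become orthogonal to \<open>X(\<tau>)\<close> and to the part of the plane at \<open>\<tau>\<close> orthogonal to
  \<open>X(\<tau>)\<close>; these vectors span a Lagrangian plane, which is therefore the limit. In all other cases
  the form has infinite positive and negative index on every interval \<open>[\<tau>, s]\<close>, and then the net
  defining the Jacobi plane at \<open>s\<close> cannot converge.\<close>

section \<open>Essentially bounded functions and their primitives\<close>

text \<open>What shapes the coercive case is a missing trace: the form degenerates at
  \<open>\<tau>\<close>, so it bounds the mass of \<open>W\<close> but not \<open>W(\<tau>)\<close>,
  while the end point of a trajectory is \<open>\<eta> - W(\<tau>) X(\<tau>)\<close> up to that
  mass. The jump along \<open>X(\<tau>)\<close> is free, so only pairings with vectors orthogonal to
  \<open>X(\<tau>)\<close> can be controlled. On a finite-dimensional space of variations after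
  \<open>\<tau>\<close> a bound for \<open>W(\<tau>)\<close> exists but depends on the space; if
  \<open>X(\<tau>)\<close> lies in the plane at \<open>\<tau>\<close>, the space before
  \<open>\<tau>\<close> must be chosen last.

  In the indefinite case an isotropic variation orthogonal to the approximating space may be
  adjoined, and its end point enters the plane. All refined planes stay close to one another, which
  leaves no room for new end points. Duality in L2 then represents the plane by exact solutions of
  the Jacobi equation with bounded control. Boundedness makes their initial vectors orthogonal to
  \<open>X(\<tau>)\<close> and to its derivative; a Lagrangian plane of such vectors would force
  \<open>A(\<tau>) = 0\<close>.\<close>

definition ess_bdd :: "real \<Rightarrow> real \<Rightarrow> (real \<Rightarrow> 'a::euclidean_space) \<Rightarrow> bool" where
  "ess_bdd a b f \<longleftrightarrow>
     f \<in> borel_measurable (lebesgue_on {a..b}) \<and> (\<exists>C. AE x in lebesgue_on {a..b}. norm (f x) \<le> C)"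

lemma ess_bddI:
  assumes "f \<in> borel_measurable (lebesgue_on {a..b})" "\<And>x. x \<in> {a..b} \<Longrightarrow> norm (f x) \<le> C"
  shows "ess_bdd a b f"
  unfolding ess_bdd_def using assms by (auto intro!: exI[of _ C] AE_I2)

lemma ess_bdd_continuous:
  assumes "continuous_on {a..b} f" shows "ess_bdd a b f"
proof -
  have "bounded (f ` {a..b})"
    using assms by (intro compact_imp_bounded compact_continuous_image) auto
  then obtain C where "\<forall>y\<in>f ` {a..b}. norm y \<le> C" by (auto simp only: bounded_iff)
  hence "\<And>x. x \<in> {a..b} \<Longrightarrow> norm (f x) \<le> C" by blast
  moreover have "f \<in> borel_measurable (lebesgue_on {a..b})"
    using assms by (intro continuous_imp_measurable_on_sets_lebesgue) auto
  ultimately show ?thesis by (intro ess_bddI)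
qed

lemma ess_bdd_const: "ess_bdd a b (\<lambda>x. c)"
  by (intro ess_bdd_continuous continuous_intros)

lemma ess_bdd_bound:
  assumes "ess_bdd a b f"
  obtains C where "C \<ge> 0" "AE x in lebesgue_on {a..b}. norm (f x) \<le> C"
proof -
  obtain C where C: "AE x in lebesgue_on {a..b}. norm (f x) \<le> C" using assms by (auto simp: ess_bdd_def)
  have "AE x in lebesgue_on {a..b}. norm (f x) \<le> \<bar>C\<bar>" using C by eventually_elim auto
  thus ?thesis using that[of "\<bar>C\<bar>"] by auto
qed

lemma ess_bdd_bilinear:
  assumes B: "bounded_bilinear pr" and f: "ess_bdd a b f" and g: "ess_bdd a b g"
  shows "ess_bdd a b (\<lambda>x. pr (f x) (g x))"
proof -
  interpret bounded_bilinear pr by fact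
  obtain K where K: "K > 0" "\<And>x y. norm (pr x y) \<le> norm x * norm y * K" using pos_bounded by blast
  obtain C where C: "C \<ge> 0" "AE x in lebesgue_on {a..b}. norm (f x) \<le> C" using f by (rule ess_bdd_bound)
  obtain D where D: "D \<ge> 0" "AE x in lebesgue_on {a..b}. norm (g x) \<le> D" using g by (rule ess_bdd_bound)
  have "AE x in lebesgue_on {a..b}. norm (pr (f x) (g x)) \<le> C * D * K"
    using C(2) D(2)
  proof eventually_elim
    case (elim x)
    have "norm (f x) * norm (g x) * K \<le> C * D * K"
      using elim C(1) K(1) by (intro mult_right_mono mult_mono) auto
    thus ?case using K(2)[of "f x" "g x"] by linarith
  qed
  moreover have "(\<lambda>x. pr (f x) (g x)) \<in> borel_measurable (lebesgue_on {a..b})"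
    using f g unfolding ess_bdd_def
    by (intro borel_measurable_continuous_Pair[where H=pr]) (auto intro!: continuous_on continuous_on_fst continuous_on_snd continuous_on_id)
  ultimately show ?thesis unfolding ess_bdd_def by blast
qed

lemma ess_bdd_add:
  assumes f: "ess_bdd a b f" and g: "ess_bdd a b g"
  shows "ess_bdd a b (\<lambda>x. f x + g x)"
proof -
  obtain C where C: "C \<ge> 0" "AE x in lebesgue_on {a..b}. norm (f x) \<le> C" using f by (rule ess_bdd_bound)
  obtain D where D: "D \<ge> 0" "AE x in lebesgue_on {a..b}. norm (g x) \<le> D" using g by (rule ess_bdd_bound)
  have "AE x in lebesgue_on {a..b}. norm (f x + g x) \<le> C + D"
    using C(2) D(2) by eventually_elim (smt (verit) norm_triangle_ineq)
  thus ?thesis using f g unfolding ess_bdd_def by (auto intro!: borel_measurable_add)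
qed

lemma ess_bdd_linear:
  assumes h: "bounded_linear h" and f: "ess_bdd a b f"
  shows "ess_bdd a b (\<lambda>x. h (f x))"
proof -
  obtain K where K: "K > 0" "\<And>x. norm (h x) \<le> norm x * K" using bounded_linear.pos_bounded[OF h] by blast
  obtain C where C: "C \<ge> 0" "AE x in lebesgue_on {a..b}. norm (f x) \<le> C" using f by (rule ess_bdd_bound)
  have "AE x in lebesgue_on {a..b}. norm (h (f x)) \<le> C * K"
    using C(2) by eventually_elim (smt (verit) K mult_right_mono)
  moreover have "h \<in> borel_measurable borel"
    using h by (intro borel_measurable_continuous_onI linear_continuous_on)
  hence "(\<lambda>x. h (f x)) \<in> borel_measurable (lebesgue_on {a..b})"
    using f unfolding ess_bdd_def by (auto intro: measurable_compose)
  ultimately show ?thesis unfolding ess_bdd_def by blast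
qed

lemmas ess_bdd_scaleR = ess_bdd_bilinear[OF bounded_bilinear_scaleR]
lemmas ess_bdd_mult = ess_bdd_bilinear[OF bounded_bilinear_mult]
lemmas ess_bdd_minus = ess_bdd_linear[OF bounded_linear_minus[OF bounded_linear_ident]]

lemma ess_bdd_diff: "ess_bdd a b f \<Longrightarrow> ess_bdd a b g \<Longrightarrow> ess_bdd a b (\<lambda>x. f x - g x)"
  using ess_bdd_add[of a b f "\<lambda>x. - g x"] ess_bdd_minus[of a b g] by simp

lemma ess_bdd_cmult: "ess_bdd a b f \<Longrightarrow> ess_bdd a b (\<lambda>x. (c::real) * f x)"
  by (intro ess_bdd_mult ess_bdd_const)

lemma ess_bdd_sum:
  assumes "\<And>i. i \<in> I \<Longrightarrow> ess_bdd a b (f i)"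
  shows "ess_bdd a b (\<lambda>x. \<Sum>i\<in>I. f i x)"
  using assms
proof (induction I rule: infinite_finite_induct)
  case (insert x F)
  thus ?case by (auto intro!: ess_bdd_add)
qed (auto simp: ess_bdd_const)

lemma ess_bdd_subinterval:
  assumes f: "ess_bdd a b f" and s: "{c..d} \<subseteq> {a..b}"
  shows "ess_bdd c d f"
proof -
  have m: "f \<in> borel_measurable (lebesgue_on {c..d})"
    using f s unfolding ess_bdd_def by (blast intro: measurable_restrict_mono)
  obtain C where C: "AE x in lebesgue_on {a..b}. norm (f x) \<le> C" using f by (auto simp: ess_bdd_def)
  hence "AE x in lebesgue. x \<in> {a..b} \<longrightarrow> norm (f x) \<le> C"
    by (subst (asm) AE_restrict_space_iff) auto
  hence "AE x in lebesgue. x \<in> {c..d} \<longrightarrow> norm (f x) \<le> C" 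
    by eventually_elim (use s in auto)
  hence "AE x in lebesgue_on {c..d}. norm (f x) \<le> C"
    by (subst AE_restrict_space_iff) auto
  thus ?thesis using m unfolding ess_bdd_def by blast
qed

lemma ess_bdd_restrict:
  assumes f: "ess_bdd a b f" and S: "S \<in> sets lebesgue"
  shows "ess_bdd a b (\<lambda>x. if x \<in> S then f x else 0)"
proof -
  have "(\<lambda>x. if x \<in> S then f x else 0) \<in> borel_measurable (lebesgue_on {a..b})"
  proof (rule measurable_If_set)
    show "S \<inter> space (lebesgue_on {a..b}) \<in> sets (lebesgue_on {a..b})"
      using S by (auto simp: sets_restrict_space space_restrict_space)
  qed (use f in \<open>auto simp: ess_bdd_def\<close>)
  moreover obtain C where C: "C \<ge> 0" "AE x in lebesgue_on {a..b}. norm (f x) \<le> C" using f by (rule ess_bdd_bound)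
  hence "AE x in lebesgue_on {a..b}. norm (if x \<in> S then f x else 0) \<le> C"
    by (auto elim!: eventually_mono)
  ultimately show ?thesis unfolding ess_bdd_def by blast
qed

section \<open>Integrals of essentially bounded functions\<close>

lemma AE_lebesgue_on_negligible:
  assumes "AE x in lebesgue_on {a..b::real}. P x"
  obtains N where "negligible N" "\<And>x. x \<in> {a..b} - N \<Longrightarrow> P x"
proof -
  have "AE x in lebesgue. x \<in> {a..b} \<longrightarrow> P x"
    using assms by (subst (asm) AE_restrict_space_iff) auto
  then obtain N where "\<And>x. x \<in> space lebesgue - N \<Longrightarrow> x \<in> {a..b} \<longrightarrow> P x" "N \<in> null_sets lebesgue"
    by (rule AE_E3) blast
  hence "negligible N" "\<And>x. x \<in> {a..b} - N \<Longrightarrow> P x" by (auto simp: negligible_iff_null_sets)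
  thus ?thesis by (rule that)
qed

lemma ess_bdd_absolutely_integrable:
  assumes f: "ess_bdd a b f" shows "f absolutely_integrable_on {a..b}"
proof -
  obtain C where C: "C \<ge> 0" "AE x in lebesgue_on {a..b}. norm (f x) \<le> C" using f by (rule ess_bdd_bound)
  have fin: "emeasure (lebesgue_on {a..b}) (space (lebesgue_on {a..b})) < \<infinity>"
    by (cases "a \<le> b") (simp_all add: emeasure_restrict_space space_restrict_space)
  have "integrable (lebesgue_on {a..b}) f"
  proof (rule Bochner_Integration.integrable_bound)
    show "integrable (lebesgue_on {a..b}) (\<lambda>x. C)"
      using fin by (intro finite_measure.integrable_const finite_measureI) auto
    show "f \<in> borel_measurable (lebesgue_on {a..b})" using f by (simp add: ess_bdd_def)
    show "AE x in lebesgue_on {a..b}. norm (f x) \<le> norm C" using C by auto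
  qed
  thus ?thesis by (subst (asm) integrable_restrict_space) (auto simp: set_integrable_def)
qed

lemma ess_bdd_integrable:
  assumes f: "ess_bdd a b f" shows "f integrable_on {a..b}"
  using ess_bdd_absolutely_integrable[OF f] set_lebesgue_integral_eq_integral(1) by blast

lemma ess_bdd_norm_integrable: "ess_bdd a b f \<Longrightarrow> (\<lambda>x. norm (f x)) integrable_on {a..b}"
  using ess_bdd_absolutely_integrable[of a b f] absolutely_integrable_on_def by blast

lemma integral_bound_ae:
  assumes f: "ess_bdd a b f" and "a \<le> b" and C: "AE x in lebesgue_on {a..b}. norm (f x) \<le> C"
  shows "norm (integral {a..b} f) \<le> C * (b - a)"
proof -
  obtain N where N: "negligible N" "\<And>x. x \<in> {a..b} - N \<Longrightarrow> norm (f x) \<le> C"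
    using AE_lebesgue_on_negligible[OF C] by blast
  \<comment> \<open>A negative essential bound makes every point exceptional, so the interval is a
    single point.\<close>
  have 1: ?thesis if "C < 0"
  proof -
    have "{a..b} \<subseteq> N" using N(2) that by (metis Diff_iff norm_ge_zero not_less order_trans subsetI)
    hence "negligible {a..b}" using N(1) negligible_subset by blast
    hence "a = b" using \<open>a \<le> b\<close> by (simp add: negligible_interval(1)[where 'a=real, unfolded cbox_interval])
    thus ?thesis by simp
  qed
  have 2: ?thesis if "C \<ge> 0"
  proof -
    have "norm (integral {a..b} f) \<le> integral {a..b} (\<lambda>x. norm (f x))"
      using ess_bdd_integrable[OF f] ess_bdd_norm_integrable[OF f] by (intro integral_norm_bound_integral) auto
    also have "\<dots> = integral {a..b} (\<lambda>x. if x \<in> N then 0 else norm (f x))"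
      by (rule integral_spike[OF N(1)]) auto
    also have "\<dots> \<le> integral {a..b} (\<lambda>x. C)"
    proof (rule integral_le)
      show "(\<lambda>x. if x \<in> N then 0 else norm (f x)) integrable_on {a..b}"
        by (rule integrable_spike[OF ess_bdd_norm_integrable[OF f] N(1)]) auto
      show "(if x \<in> N then 0 else norm (f x)) \<le> C" if "x \<in> {a..b}" for x
        using N(2)[of x] that \<open>C \<ge> 0\<close> by auto
    qed auto
    also have "\<dots> = C * (b - a)" using \<open>a \<le> b\<close> by simp
    finally show ?thesis .
  qed
  from 1 2 show ?thesis by linarith
qed


text \<open>Absolute continuity is encoded by the integral identity instead of a derivative:
  controls are merely measurable and bounded, so \<open>F\<close> is a Lipschitz function with
  density \<open>f\<close>. The integrations by parts with controls below rest on this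
  identity.\<close>

definition prim :: "real \<Rightarrow> real \<Rightarrow> (real \<Rightarrow> 'a::euclidean_space) \<Rightarrow> (real \<Rightarrow> 'a) \<Rightarrow> bool" where
  "prim a b F f \<longleftrightarrow> ess_bdd a b f \<and> (\<forall>x\<in>{a..b}. (f has_integral F x - F a) {a..x})"

lemma prim_ess_bdd: "prim a b F f \<Longrightarrow> ess_bdd a b f"
  by (simp add: prim_def)

lemma prim_increment:
  assumes F: "prim a b F f" and xy: "a \<le> x" "x \<le> y" "y \<le> b"
  shows "(f has_integral F y - F x) {x..y}"
proof -
  have "f integrable_on {x..y}"
    using xy by (intro ess_bdd_integrable ess_bdd_subinterval[OF prim_ess_bdd[OF F]]) auto
  then obtain i where i: "(f has_integral i) {x..y}" by blast
  have "(f has_integral (F x - F a) + i) {a..y}"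
    using F xy i by (intro has_integral_combine[of a x y]) (auto simp: prim_def)
  moreover have "(f has_integral F y - F a) {a..y}" using F xy by (auto simp: prim_def)
  ultimately have "(F x - F a) + i = F y - F a" by (rule has_integral_unique)
  hence "i = F y - F x" by (simp add: algebra_simps)
  thus ?thesis using i by simp
qed

lemma prim_integral:
  "prim a b F f \<Longrightarrow> a \<le> x \<Longrightarrow> x \<le> y \<Longrightarrow> y \<le> b \<Longrightarrow> integral {x..y} f = F y - F x"
  using prim_increment integral_unique by blast

lemma prim_subinterval:
  assumes "prim a b F f" "a \<le> c" "d \<le> b"
  shows "prim c d F f"
  using assms prim_increment[OF assms(1)] ess_bdd_subinterval[of a b f c d] by (auto simp: prim_def)

lemma prim_integral_left:
  assumes f: "ess_bdd a b f" shows "prim a b (\<lambda>x. c + integral {a..x} f) f"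
  unfolding prim_def
proof (intro conjI ballI)
  fix x assume x: "x \<in> {a..b}"
  have "f integrable_on {a..x}" using f x by (intro ess_bdd_integrable ess_bdd_subinterval[OF f]) auto
  thus "(f has_integral c + integral {a..x} f - (c + integral {a..a} f)) {a..x}" by auto
qed fact

lemma prim_integral_right:
  assumes f: "ess_bdd a b f" shows "prim a b (\<lambda>x. c - integral {x..b} f) f"
  unfolding prim_def
proof (intro conjI ballI)
  fix x assume x: "x \<in> {a..b}"
  have "integral {a..x} f + integral {x..b} f = integral {a..b} f"
    using x by (intro Henstock_Kurzweil_Integration.integral_combine ess_bdd_integrable f) auto
  moreover have "f integrable_on {a..x}" using f x by (intro ess_bdd_integrable ess_bdd_subinterval[OF f]) auto
  ultimately show "(f has_integral c - integral {x..b} f - (c - integral {a..b} f)) {a..x}"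
    by (metis (no_types, lifting) add_diff_cancel_right' diff_add_cancel diff_diff_eq2 integrable_integral add_diff_cancel_left cancel_ab_semigroup_add_class.diff_right_commute)
qed fact

lemma prim_C1:
  assumes F: "\<And>x. x \<in> {a..b} \<Longrightarrow> (F has_vector_derivative f x) (at x within {a..b})"
    and f: "continuous_on {a..b} f"
  shows "prim a b F f"
  unfolding prim_def
proof (intro conjI ballI ess_bdd_continuous f)
  fix x assume x: "x \<in> {a..b}"
  show "(f has_integral F x - F a) {a..x}"
  proof (rule fundamental_theorem_of_calculus)
    fix y assume "y \<in> {a..x}"
    thus "(F has_vector_derivative f y) (at y within {a..x})"
      using x by (intro has_vector_derivative_within_subset[OF F]) auto
  qed (use x in auto)
qed

lemma prim_lipschitz:
  assumes F: "prim a b F f"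
  obtains C where "C \<ge> 0" "\<And>x y. a \<le> x \<Longrightarrow> x \<le> y \<Longrightarrow> y \<le> b \<Longrightarrow> norm (F y - F x) \<le> C * (y - x)"
    "AE x in lebesgue_on {a..b}. norm (f x) \<le> C"
proof -
  have f: "ess_bdd a b f" using F by (simp add: prim_def)
  then obtain C where C: "C \<ge> 0" "AE x in lebesgue_on {a..b}. norm (f x) \<le> C" by (rule ess_bdd_bound)
  show ?thesis
  proof (rule that[OF C(1) _ C(2)])
    fix x y assume xy: "a \<le> x" "x \<le> y" "y \<le> b"
    have sub: "{x..y} \<subseteq> {a..b}" using xy by auto
    have "AE x in lebesgue. x \<in> {a..b} \<longrightarrow> norm (f x) \<le> C"
      using C(2) by (subst (asm) AE_restrict_space_iff) auto
    hence "AE z in lebesgue. z \<in> {x..y} \<longrightarrow> norm (f z) \<le> C" 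
      by eventually_elim (use sub in auto)
    hence "AE z in lebesgue_on {x..y}. norm (f z) \<le> C"
      by (subst AE_restrict_space_iff) auto
    hence "norm (integral {x..y} f) \<le> C * (y - x)"
      using xy by (intro integral_bound_ae ess_bdd_subinterval[OF f sub])
    thus "norm (F y - F x) \<le> C * (y - x)" using prim_integral[OF F xy] by simp
  qed
qed

lemma prim_continuous: assumes F: "prim a b F f" shows "continuous_on {a..b} F"
proof -
  obtain C where C: "C \<ge> 0" "\<And>x y. a \<le> x \<Longrightarrow> x \<le> y \<Longrightarrow> y \<le> b \<Longrightarrow> norm (F y - F x) \<le> C * (y - x)"
    using F by (rule prim_lipschitz) blast
  have "dist (F x) (F y) \<le> C * dist x y" if "x \<in> {a..b}" "y \<in> {a..b}" for x y
    using C(2)[of x y] C(2)[of y x] that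
    by (cases "x \<le> y") (auto simp: dist_norm norm_minus_commute abs_if)
  hence "C-lipschitz_on {a..b} F" using C(1) by (intro lipschitz_onI) auto
  thus ?thesis by (rule lipschitz_on_continuous_on)
qed

lemma prim_linear:
  assumes h: "bounded_linear h" and F: "prim a b F f"
  shows "prim a b (\<lambda>x. h (F x)) (\<lambda>x. h (f x))"
proof -
  have "((\<lambda>x. h (f x)) has_integral h (F x) - h (F a)) {a..x}" if "x \<in> {a..b}" for x
    using has_integral_linear[of f "F x - F a" "{a..x}" h] F h that linear_diff[of h "F x" "F a"]
    by (auto simp: prim_def o_def bounded_linear.linear)
  thus ?thesis using F h by (auto simp: prim_def ess_bdd_linear)
qed

lemma prim_add:
  assumes F: "prim a b F f" and G: "prim a b G g"
  shows "prim a b (\<lambda>x. F x + G x) (\<lambda>x. f x + g x)"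
proof -
  have "((\<lambda>x. f x + g x) has_integral F x + G x - (F a + G a)) {a..x}" if "x \<in> {a..b}" for x
    using has_integral_add[of f "F x - F a" "{a..x}" g "G x - G a"] F G that
    by (auto simp: prim_def algebra_simps)
  thus ?thesis using F G by (auto simp: prim_def ess_bdd_add)
qed

lemmas prim_minus = prim_linear[OF bounded_linear_minus[OF bounded_linear_ident]]

lemma prim_diff: "prim a b F f \<Longrightarrow> prim a b G g \<Longrightarrow> prim a b (\<lambda>x. F x - G x) (\<lambda>x. f x - g x)"
  using prim_add[of a b F f "\<lambda>x. - G x" "\<lambda>x. - g x"] prim_minus[of a b G g] by simp

text \<open>Increments of second order force the derivative to vanish at every point. In the product
  rule for primitives this takes the place of differentiability almost everywhere.\<close>

lemma quadratic_increment_constant: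
  fixes D :: "real \<Rightarrow> 'a::real_normed_vector"
  assumes "\<And>x y. a \<le> x \<Longrightarrow> x \<le> y \<Longrightarrow> y \<le> b \<Longrightarrow> norm (D y - D x) \<le> C * (y - x)^2" and x: "a \<le> x" "x \<le> b"
  shows "D x = D a"
proof -
  have est: "norm (D y - D x) \<le> C * (y - x)^2" if "x \<in> {a..b}" "y \<in> {a..b}" for x y
    using assms(1)[of x y] assms(1)[of y x] that
    by (cases "x \<le> y") (auto simp: norm_minus_commute power2_commute)
  have "(D has_vector_derivative 0) (at y within {a..b})" if y: "y \<in> {a..b}" for y
    unfolding has_vector_derivative_def has_derivative_within_alt
  proof (intro conjI allI impI)
    fix e :: real assume e: "e > 0"
    show "\<exists>d>0. \<forall>z\<in>{a..b}. norm (z - y) < d \<longrightarrow> norm (D z - D y - (z - y) *\<^sub>R 0) \<le> e * norm (z - y)"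
    proof (intro exI[of _ "e / (\<bar>C\<bar> + 1)"] conjI ballI impI)
      fix z assume z: "z \<in> {a..b}" "norm (z - y) < e / (\<bar>C\<bar> + 1)"
      have "\<bar>C\<bar> * \<bar>z - y\<bar> \<le> e"
      proof -
        have "\<bar>z - y\<bar> * (\<bar>C\<bar> + 1) < e" using z(2) by (simp add: pos_less_divide_eq)
        thus ?thesis by (simp add: algebra_simps)
      qed
      hence "\<bar>C\<bar> * \<bar>z - y\<bar> * \<bar>z - y\<bar> \<le> e * \<bar>z - y\<bar>" by (intro mult_right_mono) auto
      moreover have "C * (z - y)^2 \<le> \<bar>C\<bar> * \<bar>z - y\<bar> * \<bar>z - y\<bar>"
        by (simp add: power2_eq_square mult.assoc abs_mult_self_eq mult_right_mono)
      ultimately show "norm (D z - D y - (z - y) *\<^sub>R 0) \<le> e * norm (z - y)"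
        using est[OF y z(1)] by simp
    qed (use e in auto)
  qed (auto intro: bounded_linear_zero)
  then obtain c where "\<And>y. y \<in> {a..b} \<Longrightarrow> D y = c"
    using has_vector_derivative_zero_constant[of "{a..b}" D] convex_real_interval(5)[of a b] by blast
  thus ?thesis using x by auto
qed

lemma ess_bdd_AE_sub:
  assumes "AE x in lebesgue_on {a..b::real}. P x" "{c..d} \<subseteq> {a..b}"
  shows "AE x in lebesgue_on {c..d}. P x"
proof -
  have "AE x in lebesgue. x \<in> {a..b} \<longrightarrow> P x"
    using assms(1) by (subst (asm) AE_restrict_space_iff) auto
  hence "AE z in lebesgue. z \<in> {c..d} \<longrightarrow> P z" 
    by eventually_elim (use assms(2) in auto)
  thus ?thesis by (subst AE_restrict_space_iff) auto
qed

text \<open>No Fubini argument is needed: the defect of the product rule has increments of second order.\<close>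

lemma prim_bilinear:
  assumes B: "bounded_bilinear pr" and F: "prim a b F f" and G: "prim a b G g"
  shows "prim a b (\<lambda>x. pr (F x) (G x)) (\<lambda>x. pr (f x) (G x) + pr (F x) (g x))"
proof -
  interpret bounded_bilinear pr by fact
  have f: "ess_bdd a b f" and g: "ess_bdd a b g" using F G by (auto simp: prim_def)
  have cF: "ess_bdd a b F" and cG: "ess_bdd a b G"
    using F G by (auto intro: ess_bdd_continuous prim_continuous)
  define h where "h = (\<lambda>x. pr (f x) (G x) + pr (F x) (g x))"
  have h: "ess_bdd a b h"
    unfolding h_def by (intro ess_bdd_add ess_bdd_bilinear[OF B] f g cF cG)
  obtain C where C: "C \<ge> 0" "\<And>x y. a \<le> x \<Longrightarrow> x \<le> y \<Longrightarrow> y \<le> b \<Longrightarrow> norm (F y - F x) \<le> C * (y - x)"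
    "AE x in lebesgue_on {a..b}. norm (f x) \<le> C" using F by (rule prim_lipschitz) blast
  obtain D where D: "D \<ge> 0" "\<And>x y. a \<le> x \<Longrightarrow> x \<le> y \<Longrightarrow> y \<le> b \<Longrightarrow> norm (G y - G x) \<le> D * (y - x)"
    "AE x in lebesgue_on {a..b}. norm (g x) \<le> D" using G by (rule prim_lipschitz) blast
  obtain K where K: "K > 0" "\<And>x y. norm (pr x y) \<le> norm x * norm y * K" using pos_bounded by blast
  define E where "E = (\<lambda>x. pr (F x) (G x) - integral {a..x} h)"
  have inc: "norm (E y - E x) \<le> (2 * C * D * K) * (y - x)^2" if xy: "a \<le> x" "x \<le> y" "y \<le> b" for x y
  proof -
    have sub: "{x..y} \<subseteq> {a..b}" using xy by auto
    have "integral {a..x} h + integral {x..y} h = integral {a..y} h"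
      using xy by (intro Henstock_Kurzweil_Integration.integral_combine ess_bdd_integrable ess_bdd_subinterval[OF h]) auto
    hence 1: "E y - E x = pr (F y) (G y) - pr (F x) (G x) - integral {x..y} h"
      unfolding E_def by (simp add: algebra_simps)
    have bl1: "bounded_linear (\<lambda>z. pr z (G y))" by (rule bounded_linear_left)
    have bl2: "bounded_linear (\<lambda>z. pr (F x) z)" by (rule bounded_linear_right)
    have i1: "((\<lambda>t. pr (f t) (G y)) has_integral pr (F y - F x) (G y)) {x..y}"
      using has_integral_linear[OF prim_increment[OF F xy] bl1] by (simp add: o_def)
    have i2: "((\<lambda>t. pr (F x) (g t)) has_integral pr (F x) (G y - G x)) {x..y}"
      using has_integral_linear[OF prim_increment[OF G xy] bl2] by (simp add: o_def)
    have i3: "(h has_integral integral {x..y} h) {x..y}"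
      using ess_bdd_integrable[OF ess_bdd_subinterval[OF h sub]] by blast
    \<comment> \<open>Freezing \<open>G\<close> at the right end and \<open>F\<close> at the left
      end makes the increment of the product exact. The error \<open>k\<close> is then an increment
      of one function times the density of the other, hence of size \<open>y - x\<close>, and of
      second order after integration.\<close>
    define k where "k = (\<lambda>t. pr (f t) (G y - G t) + pr (F x - F t) (g t))"
    have "((\<lambda>t. pr (f t) (G y) + pr (F x) (g t) - h t) has_integral
        pr (F y - F x) (G y) + pr (F x) (G y - G x) - integral {x..y} h) {x..y}"
      by (intro has_integral_diff has_integral_add i1 i2 i3)
    also have "(\<lambda>t. pr (f t) (G y) + pr (F x) (g t) - h t) = k"
      by (auto simp: k_def h_def diff_left diff_right)
    finally have 2: "integral {x..y} k = E y - E x"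
      unfolding 1 by (simp add: integral_unique diff_left diff_right)
    have k: "ess_bdd x y k" unfolding k_def
      by (intro ess_bdd_add ess_bdd_bilinear[OF B] ess_bdd_diff ess_bdd_const
          ess_bdd_subinterval[OF f sub] ess_bdd_subinterval[OF g sub] ess_bdd_subinterval[OF cF sub] ess_bdd_subinterval[OF cG sub])
    have sp: "AE t in lebesgue_on {x..y}. t \<in> {x..y}" by (auto intro!: AE_I2)
    have "AE t in lebesgue_on {x..y}. norm (k t) \<le> 2 * C * D * K * (y - x)"
      using ess_bdd_AE_sub[OF C(3) sub] ess_bdd_AE_sub[OF D(3) sub] sp
    proof eventually_elim
      case (elim t)
      have "norm (pr (f t) (G y - G t)) \<le> norm (f t) * norm (G y - G t) * K" by (rule K)
      also have "\<dots> \<le> C * (D * (y - t)) * K"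
        using elim xy C D(1,2) K(1) by (intro mult_right_mono mult_mono) auto
      also have "\<dots> \<le> C * (D * (y - x)) * K"
        using elim xy C D(1) K(1) by (intro mult_right_mono mult_left_mono) auto
      finally have a1: "norm (pr (f t) (G y - G t)) \<le> C * (D * (y - x)) * K" .
      have "norm (pr (F x - F t) (g t)) \<le> norm (F x - F t) * norm (g t) * K" by (rule K)
      also have "\<dots> \<le> (C * (t - x)) * D * K"
        using elim xy C(1) C(2)[of x t] D(1) K(1) by (intro mult_right_mono mult_mono) (auto simp: norm_minus_commute)
      also have "\<dots> \<le> (C * (y - x)) * D * K"
        using elim xy C D(1) K(1) by (intro mult_right_mono mult_left_mono) auto
      finally have a2: "norm (pr (F x - F t) (g t)) \<le> (C * (y - x)) * D * K" .
      have "norm (k t) \<le> norm (pr (f t) (G y - G t)) + norm (pr (F x - F t) (g t))"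
        unfolding k_def by (rule norm_triangle_ineq)
      also have "\<dots> \<le> 2 * C * D * K * (y - x)" using a1 a2 by (simp add: algebra_simps)
      finally show ?case .
    qed
    hence "norm (integral {x..y} k) \<le> 2 * C * D * K * (y - x) * (y - x)"
      using xy by (intro integral_bound_ae k)
    thus ?thesis unfolding 2 by (simp add: power2_eq_square mult.assoc)
  qed
  have const: "E x = E a" if "x \<in> {a..b}" for x
    using inc by (rule quadratic_increment_constant) (use that in auto)
  hence eq: "integral {a..x} h = pr (F x) (G x) - pr (F a) (G a)" if "x \<in> {a..b}" for x
    using const[OF that] unfolding E_def by (simp add: algebra_simps)
  have "(h has_integral pr (F x) (G x) - pr (F a) (G a)) {a..x}" if "x \<in> {a..b}" for x
  proof -
    have "h integrable_on {a..x}" using that by (intro ess_bdd_integrable ess_bdd_subinterval[OF h]) auto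
    thus ?thesis using eq[OF that] by (metis integrable_integral)
  qed
  thus ?thesis using h unfolding prim_def h_def by blast
qed

lemmas prim_mult = prim_bilinear[OF bounded_bilinear_mult]
lemmas prim_scaleR = prim_bilinear[OF bounded_bilinear_scaleR]

lemma prim_cong:
  assumes "prim a b F f" "\<And>x. x \<in> {a..b} \<Longrightarrow> f x = g x" "\<And>x. x \<in> {a..b} \<Longrightarrow> F x = G x"
  shows "prim a b G g"
proof -
  have m: "g \<in> borel_measurable (lebesgue_on {a..b}) \<longleftrightarrow> f \<in> borel_measurable (lebesgue_on {a..b})"
    by (rule measurable_cong) (use assms(2) in auto)
  have ae: "(AE x in lebesgue_on {a..b}. norm (g x) \<le> C) \<longleftrightarrow> (AE x in lebesgue_on {a..b}. norm (f x) \<le> C)" for C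
    by (rule AE_cong) (use assms(2) in auto)
  have hi: "(g has_integral i) {a..x} \<longleftrightarrow> (f has_integral i) {a..x}" if "x \<in> {a..b}" for x i
    by (rule has_integral_cong) (use assms(2) that in auto)
  show ?thesis using assms(1,3) hi by (auto simp: prim_def ess_bdd_def m ae)
qed

section \<open>Symplectic linear algebra\<close>

lemma sigma_eq: "sigma z w = fst z \<bullet> snd w - snd z \<bullet> fst w"
  by (simp add: sigma_def Jmap_def inner_prod_def)

lemma bounded_linear_Jmap: "bounded_linear (Jmap :: 'e \<times> 'e \<Rightarrow> 'e \<times> 'e::real_inner)"
  unfolding Jmap_def
  by (intro bounded_linear_Pair bounded_linear_minus bounded_linear_fst bounded_linear_snd)

lemma bounded_bilinear_sigma: "bounded_bilinear (sigma :: 'e \<times> 'e \<Rightarrow> 'e \<times> 'e::real_inner \<Rightarrow> real)"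
  using bounded_bilinear.comp[OF bounded_bilinear_inner bounded_linear_ident bounded_linear_Jmap] by (simp add: sigma_def[abs_def])

interpretation sigma: bounded_bilinear "sigma :: 'e \<times> 'e \<Rightarrow> 'e \<times> 'e::real_inner \<Rightarrow> real"
  by (rule bounded_bilinear_sigma)

lemma sigma_self [simp]: "sigma z z = 0"
  by (simp add: sigma_eq inner_commute)

lemma sigma_swap: "sigma z w = - sigma w z"
  by (simp add: sigma_eq inner_commute)

lemma norm_Jmap [simp]: "norm (Jmap z) = norm z"
  by (simp add: Jmap_def norm_prod_def add.commute)

lemma sigma_le: "\<bar>sigma z w\<bar> \<le> norm z * norm w"
  unfolding sigma_def using Cauchy_Schwarz_ineq2[of z "Jmap w"] by simp

lemma subspace_skew_compl: "subspace (skew_compl S)"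
  by (auto simp: subspace_def skew_compl_def sigma.add_left sigma.scaleR_left sigma.zero_left)

lemma lagrangian_vertical: "lagrangian_plane (vertical :: ('e \<times> 'e::real_inner) set)"
  unfolding lagrangian_plane_def
proof (intro conjI equalityI subsetI)
  show "subspace (vertical :: ('e \<times> 'e) set)" by (auto simp: subspace_def vertical_def)
  fix z :: "'e \<times> 'e" assume "z \<in> skew_compl vertical"
  hence "sigma z (snd z, 0) = 0" by (simp add: skew_compl_def vertical_def)
  thus "z \<in> vertical" by (simp add: sigma_eq vertical_def)
next
  fix z :: "'e \<times> 'e" assume "z \<in> vertical"
  thus "z \<in> skew_compl vertical" by (auto simp: skew_compl_def vertical_def sigma_eq)
qed

lemma dim_skew_compl:
  fixes S :: "('e \<times> 'e::euclidean_space) set"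
  assumes S: "subspace S" shows "dim (skew_compl S) + dim S = 2 * DIM('e)"
proof -
  have lin: "linear (Jmap :: 'e \<times> 'e \<Rightarrow> _)" using bounded_linear_Jmap by (rule bounded_linear.linear)
  have inj: "inj (Jmap :: 'e \<times> 'e \<Rightarrow> _)" by (rule injI) (auto simp: Jmap_def prod_eq_iff)
  have sub: "subspace (Jmap ` S)" using S lin by (rule linear_subspace_image[rotated])
  have eq: "skew_compl S = {y \<in> UNIV. \<forall>x\<in>Jmap ` S. orthogonal x y}"
    by (auto simp: skew_compl_def sigma_def orthogonal_def inner_commute)
  have "dim (skew_compl S) + dim (Jmap ` S) = dim (UNIV :: ('e \<times> 'e) set)"
    unfolding eq by (intro dim_subspace_orthogonal_to_vectors sub) auto
  moreover have "dim (Jmap ` S) = dim S"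
    by (rule dim_image_eq[OF lin]) (use inj inj_on_subset in blast)
  ultimately show ?thesis by simp
qed

lemma lagrangian_dim:
  fixes S :: "('e \<times> 'e::euclidean_space) set"
  assumes "lagrangian_plane S" shows "dim S = DIM('e)"
  using dim_skew_compl[of S] assms by (simp add: lagrangian_plane_def)

lemma lagrangian_subspace: "lagrangian_plane S \<Longrightarrow> subspace S"
  by (simp add: lagrangian_plane_def)

lemma lagrangian_isotropic: "lagrangian_plane S \<Longrightarrow> x \<in> S \<Longrightarrow> y \<in> S \<Longrightarrow> sigma x y = 0"
  by (auto simp: lagrangian_plane_def skew_compl_def)

lemma isotropic_maximal:
  fixes S :: "('e \<times> 'e::euclidean_space) set"
  assumes S: "subspace S" "\<And>x y. x \<in> S \<Longrightarrow> y \<in> S \<Longrightarrow> sigma x y = 0" and d: "DIM('e) \<le> dim S"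
  shows "skew_compl S = S"
proof -
  have "S \<subseteq> skew_compl S" using S(2) by (auto simp: skew_compl_def)
  moreover have "dim (skew_compl S) \<le> dim S" using dim_skew_compl[OF S(1)] d by simp
  ultimately show ?thesis
    using subspace_dim_equal[OF S(1) subspace_skew_compl] by auto
qed

text \<open>The last two hypotheses put \<open>M\<close> into the skew complement of the plane on
  the right. No dimension count is needed: one inclusion is the maximality of \<open>M\<close>, the
  other subtracts a multiple of \<open>x\<close> and uses the maximality of
  \<open>L\<close>.\<close>

lemma plane_add_vector_eqI:
  fixes x :: "'e \<times> 'e::real_inner"
  assumes L: "lagrangian_plane L" and M: "lagrangian_plane M"
    and 1: "\<And>z. z \<in> M \<Longrightarrow> sigma z x = 0"
    and 2: "\<And>z d. z \<in> M \<Longrightarrow> d \<in> L \<Longrightarrow> sigma d x = 0 \<Longrightarrow> sigma z d = 0"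
  shows "M = plane_add_vector L x"
proof -
  have sk: "z \<in> skew_compl (span {x}) \<longleftrightarrow> sigma z x = 0" for z
    by (auto simp: skew_compl_def span_singleton sigma.scaleR_right)
  have subL: "subspace L" "skew_compl L = L" and subM: "subspace M" "skew_compl M = M"
    using L M by (auto simp: lagrangian_plane_def)
  have eq: "plane_add_vector L x = {d + c *\<^sub>R x | d c. d \<in> L \<and> sigma d x = 0}"
    unfolding plane_add_vector_def Int_iff sk by (auto simp only: span_singleton image_iff; blast)
  have "d + c *\<^sub>R x \<in> M" if "d \<in> L" "sigma d x = 0" for d c
  proof -
    have "sigma (d + c *\<^sub>R x) z = 0" if z: "z \<in> M" for z
      using 1[OF z] 2[OF z \<open>d \<in> L\<close> \<open>sigma d x = 0\<close>] sigma_swap[of x z] sigma_swap[of d z]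
      by (simp add: sigma.add_left sigma.scaleR_left)
    thus ?thesis using subM(2) by (auto simp: skew_compl_def)
  qed
  moreover have "\<exists>d c. z = d + c *\<^sub>R x \<and> d \<in> L \<and> sigma d x = 0" if z: "z \<in> M" for z
  proof (cases "\<forall>l\<in>L. sigma l x = 0")
    case True
    have "sigma z l = 0" if "l \<in> L" for l using 2[OF z that] True that by auto
    hence "z \<in> L" using subL(2) by (auto simp: skew_compl_def)
    thus ?thesis using True by (intro exI[of _ z] exI[of _ 0]) auto
  next
    case False
    then obtain l where l: "l \<in> L" "sigma l x \<noteq> 0" by auto
    \<comment> \<open>Chosen so that \<open>z - c x\<close> pairs to zero with \<open>l\<close>. It
      already pairs to zero with the vectors of \<open>L\<close> orthogonal to \<open>x\<close>, and
      these together with \<open>l\<close> span \<open>L\<close>.\<close>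
    define c where "c = sigma l z / sigma l x"
    have "sigma (z - c *\<^sub>R x) k = 0" if k: "k \<in> L" for k
    proof -
      define d where "d = k - (sigma k x / sigma l x) *\<^sub>R l"
      have "d \<in> L" unfolding d_def using subL(1) k l(1) by (intro subspace_diff subspace_scale)
      moreover have dx: "sigma d x = 0" using l by (simp add: d_def sigma.diff_left sigma.scaleR_left)
      ultimately have "sigma z d = 0" using 2 z by blast
      hence "sigma (z - c *\<^sub>R x) d = 0"
        using dx sigma_swap[of x d] by (simp add: sigma.diff_left sigma.scaleR_left)
      moreover have "sigma (z - c *\<^sub>R x) l = 0"
        using l(2) sigma_swap[of z l] sigma_swap[of x l] by (simp add: sigma.diff_left sigma.scaleR_left c_def)
      moreover have "k = d + (sigma k x / sigma l x) *\<^sub>R l" by (simp add: d_def)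
      ultimately show ?thesis by (metis sigma.add_right sigma.scaleR_right add_0 scaleR_zero_right)
    qed
    hence "z - c *\<^sub>R x \<in> L" using subL(2) by (auto simp: skew_compl_def)
    moreover have "sigma (z - c *\<^sub>R x) x = 0" using 1[OF z] by (simp add: sigma.diff_left sigma.scaleR_left)
    ultimately show ?thesis by (intro exI[of _ "z - c *\<^sub>R x"] exI[of _ c]) auto
  qed
  ultimately show ?thesis unfolding eq by blast
qed

section \<open>Orthogonal projections and the distance of subspaces\<close>

lemma closest_point_subspace_unique:
  fixes A :: "'a::euclidean_space set"
  assumes A: "subspace A" and y: "y \<in> A" "\<And>a. a \<in> A \<Longrightarrow> (x - y) \<bullet> a = 0"
  shows "closest_point A x = y"
proof -
  have "dist x y \<le> dist x z" if z: "z \<in> A" for z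
  proof -
    have "(x - y) \<bullet> (y - z) = 0" using y(2) subspace_diff[OF A y(1) z] by blast
    hence "orthogonal (x - y) (y - z)" by (simp add: orthogonal_def)
    hence "(norm ((x - y) + (y - z)))\<^sup>2 = (norm (x - y))\<^sup>2 + (norm (y - z))\<^sup>2"
      by (rule norm_add_Pythagorean)
    hence "(norm (x - y))\<^sup>2 \<le> (norm (x - z))\<^sup>2" by simp
    thus ?thesis by (simp add: dist_norm abs_le_square_iff[symmetric])
  qed
  thus ?thesis
    using closest_point_unique[OF subspace_imp_convex[OF A] closed_subspace[OF A] y(1)] by metis
qed

lemma closest_point_subspace:
  fixes A :: "'a::euclidean_space set"
  assumes A: "subspace A"
  shows "closest_point A x \<in> A" "a \<in> A \<Longrightarrow> (x - closest_point A x) \<bullet> a = 0"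
proof -
  obtain y z where yz: "y \<in> span A" "\<And>w. w \<in> span A \<Longrightarrow> orthogonal z w" "x = y + z"
    by (rule orthogonal_subspace_decomp_exists[of A x]) blast
  have sp: "span A = A" using A by (simp add: span_eq_iff)
  have "closest_point A x = y"
    using yz sp by (intro closest_point_subspace_unique[OF A]) (auto simp: orthogonal_def)
  thus "closest_point A x \<in> A" "a \<in> A \<Longrightarrow> (x - closest_point A x) \<bullet> a = 0"
    using yz sp by (auto simp: orthogonal_def)
qed

lemma linear_closest_point_subspace:
  fixes A :: "'a::euclidean_space set"
  assumes A: "subspace A" shows "linear (closest_point A)"
proof (rule linearI)
  have c: "closest_point A x \<in> A" "\<forall>a\<in>A. x \<bullet> a = closest_point A x \<bullet> a" for x
    using closest_point_subspace(1)[OF A, of x] closest_point_subspace(2)[OF A, where x=x]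
    by (simp_all add: inner_diff_left)
  show "closest_point A (x + y) = closest_point A x + closest_point A y" for x y
    using c[of x] c[of y] A by (intro closest_point_subspace_unique subspace_add)
      (auto simp: inner_diff_left inner_add_left)
  show "closest_point A (r *\<^sub>R x) = r *\<^sub>R closest_point A x" for r x
    using c[of x] A by (intro closest_point_subspace_unique subspace_scale) (auto simp: inner_diff_left)
qed

text \<open>A vector of \<open>A\<close> is its own projection to \<open>A\<close>, so its
  projection to \<open>B\<close> differs from it by at most the operator norm. Closeness of planes
  enters the estimates below in this form.\<close>

lemma plane_dist_nearby:
  fixes A B :: "'a::euclidean_space set"
  assumes A: "subspace A" and B: "subspace B" and x: "x \<in> A"
  shows "\<exists>y\<in>B. norm (x - y) \<le> plane_dist A B * norm x"
proof -
  have "linear (\<lambda>x. closest_point A x - closest_point B x)"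
    by (intro linear_compose_sub linear_closest_point_subspace A B)
  hence "bounded_linear (\<lambda>x. closest_point A x - closest_point B x)"
    by (simp add: linear_conv_bounded_linear)
  from onorm[OF this, of x] have "norm (closest_point A x - closest_point B x) \<le> plane_dist A B * norm x"
    unfolding plane_dist_def .
  moreover have "closest_point A x = x" using x by (rule closest_point_self)
  ultimately show ?thesis using closest_point_subspace(1)[OF B] by metis
qed

lemma plane_dist_commute: "plane_dist A B = plane_dist B A"
  using onorm_neg[of "\<lambda>x. closest_point A x - closest_point B x"] by (simp add: plane_dist_def)

section \<open>Finite linear systems and semidefinite matrices\<close>

lemma homogeneous_system:
  fixes f :: "'k \<Rightarrow> 'i \<Rightarrow> real"
  assumes "finite K" "finite I" "card K < card I"
  shows "\<exists>c. (\<exists>i\<in>I. c i \<noteq> 0) \<and> (\<forall>k\<in>K. (\<Sum>i\<in>I. c i * f k i) = 0)"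
  using assms
proof (induction K arbitrary: I f rule: finite_induct)
  case empty
  hence "I \<noteq> {}" by auto
  thus ?case by (intro exI[of _ "\<lambda>_. 1"]) auto
next
  case (insert k K)
  show ?case
  proof (cases "\<forall>i\<in>I. f k i = 0")
    case True
    obtain c where "\<exists>i\<in>I. c i \<noteq> 0" "\<forall>k\<in>K. (\<Sum>i\<in>I. c i * f k i) = 0"
      using insert.IH[of I f] insert.prems insert.hyps by (auto simp: Suc_lessD)
    thus ?thesis using True by (intro exI[of _ c]) auto
  next
    case False
    then obtain j where j: "j \<in> I" "f k j \<noteq> 0" by auto
    \<comment> \<open>Gaussian elimination: equation \<open>k\<close> removes the unknown
      \<open>j\<close> from the other equations.\<close>
    define g where "g = (\<lambda>l i. f l i - f k i / f k j * f l j)"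
    obtain c where c: "\<exists>i\<in>I - {j}. c i \<noteq> 0" "\<forall>l\<in>K. (\<Sum>i\<in>I - {j}. c i * g l i) = 0"
    proof -
      have "card K < card (I - {j})" using insert.prems insert.hyps j by simp
      thus ?thesis using insert.IH[of "I - {j}" g] insert.prems that by blast
    qed
    define S where "S = (\<Sum>i\<in>I - {j}. c i * f k i)"
    define d where "d = (\<lambda>i. if i = j then - S / f k j else c i)"
    have split: "(\<Sum>i\<in>I. d i * f l i) = - S / f k j * f l j + (\<Sum>i\<in>I - {j}. c i * f l i)" for l
      using insert.prems j by (subst sum.remove[of I j]) (auto simp: d_def intro!: sum.cong)
    have "(\<Sum>i\<in>I. d i * f l i) = 0" if "l \<in> K" for l
    proof -
      have "(\<Sum>i\<in>I - {j}. c i * g l i) = (\<Sum>i\<in>I - {j}. c i * f l i) - S / f k j * f l j"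
        unfolding g_def S_def by (simp add: right_diff_distrib sum_subtractf sum_divide_distrib sum_distrib_right mult.assoc)
      thus ?thesis using c(2) that unfolding split by auto
    qed
    moreover have "(\<Sum>i\<in>I. d i * f k i) = 0" unfolding split using j by (simp add: S_def)
    moreover have "\<exists>i\<in>I. d i \<noteq> 0" using c(1) by (auto simp: d_def)
    ultimately show ?thesis by (intro exI[of _ d]) auto
  qed
qed

lemma nonneg_affine_imp_zero:
  assumes "\<And>t::real. 0 \<le> 2 * t * a + t^2 * b" shows "a = 0"
proof (rule ccontr)
  assume a: "a \<noteq> 0"
  have "0 \<le> 2 * (- a / (\<bar>b\<bar> + 1)) * a + (- a / (\<bar>b\<bar> + 1))^2 * b" by (rule assms)
  also have "(- a / (\<bar>b\<bar> + 1))^2 * b \<le> (- a / (\<bar>b\<bar> + 1))^2 * (\<bar>b\<bar> + 1)"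
    by (intro mult_left_mono) auto
  also have "(- a / (\<bar>b\<bar> + 1))^2 * (\<bar>b\<bar> + 1) = a^2 / (\<bar>b\<bar> + 1)"
    by (simp add: power2_eq_square)
  finally have "0 \<le> - (a^2 / (\<bar>b\<bar> + 1))" by (simp add: power2_eq_square)
  moreover have "a^2 / (\<bar>b\<bar> + 1) > 0" using a by simp
  ultimately show False by linarith
qed

text \<open>Solvability of a positive semidefinite symmetric system whose right-hand side annihilates the
  kernel: a finite-dimensional Riesz theorem.\<close>

lemma psd_solve:
  fixes M :: "'i \<Rightarrow> 'i \<Rightarrow> real"
  assumes "finite B" and sym: "\<And>i j. M i j = M j i"
    and "\<And>c. 0 \<le> (\<Sum>i\<in>B. \<Sum>j\<in>B. c i * c j * M i j)"
    and "\<And>c. (\<Sum>i\<in>B. \<Sum>j\<in>B. c i * c j * M i j) = 0 \<Longrightarrow> (\<Sum>i\<in>B. c i * l i) = 0"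
  shows "\<exists>u. \<forall>j\<in>B. (\<Sum>i\<in>B. u i * M i j) = l j"
  using assms(1,3,4)
proof (induction B arbitrary: l rule: finite_induct)
  case empty thus ?case by auto
next
  case (insert g B)
  define Q where "Q = (\<lambda>c. \<Sum>i\<in>B. \<Sum>j\<in>B. c i * c j * M i j)"
  have big: "(\<Sum>i\<in>insert g B. \<Sum>j\<in>insert g B. c i * c j * M i j) =
      Q c + 2 * c g * (\<Sum>j\<in>B. c j * M g j) + (c g)^2 * M g g" for c
  proof -
    have "(\<Sum>i\<in>insert g B. \<Sum>j\<in>insert g B. c i * c j * M i j) =
        (c g * c g * M g g + (\<Sum>j\<in>B. c g * c j * M g j)) + ((\<Sum>i\<in>B. c i * c g * M i g) + Q c)"
      using insert.hyps by (simp add: Q_def sum.distrib)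
    also have "(\<Sum>i\<in>B. c i * c g * M i g) = c g * (\<Sum>j\<in>B. c j * M g j)"
      unfolding sum_distrib_left by (intro sum.cong refl) (simp add: sym[of _ g])
    also have "(\<Sum>j\<in>B. c g * c j * M g j) = c g * (\<Sum>j\<in>B. c j * M g j)"
      unfolding sum_distrib_left by (intro sum.cong refl) simp
    finally show ?thesis by (simp add: power2_eq_square algebra_simps)
  qed
  have upd: "Q (c(g := t)) = Q c" "(\<Sum>j\<in>B. (c(g := t)) j * h j) = (\<Sum>j\<in>B. c j * h j)" for c t h
    unfolding Q_def using insert.hyps by (auto intro!: sum.cong)
  have pos: "0 \<le> Q c + 2 * t * (\<Sum>j\<in>B. c j * M g j) + t^2 * M g g" for c t
    using insert.prems(1)[of "c(g := t)"] unfolding big upd by simp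
  have Qpos: "0 \<le> Q c" for c using pos[of c 0] by simp
  \<comment> \<open>The column of the new index is an admissible right-hand side: where
    \<open>Q c = 0\<close>, positivity for every value \<open>t\<close> of the new coordinate leaves
    no room for a mixed term.\<close>
  have "\<exists>u. \<forall>j\<in>B. (\<Sum>i\<in>B. u i * M i j) = M g j"
  proof (rule insert.IH)
    show "(\<Sum>i\<in>B. c i * M g i) = 0" if "(\<Sum>i\<in>B. \<Sum>j\<in>B. c i * c j * M i j) = 0" for c
    proof (rule nonneg_affine_imp_zero[where b = "M g g"])
      show "0 \<le> 2 * t * (\<Sum>i\<in>B. c i * M g i) + t^2 * M g g" for t
        using pos[of c t] that by (simp add: Q_def)
    qed
  qed (use Qpos in \<open>auto simp: Q_def\<close>)
  then obtain w where w: "\<And>j. j \<in> B \<Longrightarrow> (\<Sum>i\<in>B. w i * M i j) = M g j" by auto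
  have "\<exists>u. \<forall>j\<in>B. (\<Sum>i\<in>B. u i * M i j) = l j"
  proof (rule insert.IH)
    show "(\<Sum>i\<in>B. c i * l i) = 0" if "(\<Sum>i\<in>B. \<Sum>j\<in>B. c i * c j * M i j) = 0" for c
    proof -
      have "(\<Sum>i\<in>insert g B. \<Sum>j\<in>insert g B. (c(g := 0)) i * (c(g := 0)) j * M i j) = 0"
        unfolding big upd using that by (simp add: Q_def)
      from insert.prems(2)[OF this] have "(\<Sum>i\<in>B. (c(g := 0)) i * l i) = 0" using insert.hyps by simp
      thus ?thesis by (simp only: upd)
    qed
  qed (use Qpos in \<open>auto simp: Q_def\<close>)
  then obtain u where u: "\<And>j. j \<in> B \<Longrightarrow> (\<Sum>i\<in>B. u i * M i j) = l j" by auto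
  \<comment> \<open>\<open>\<alpha>\<close> is the Schur complement of the new diagonal entry and
    \<open>lg\<close> the reduced right-hand side. If \<open>\<alpha> = 0\<close>, the vector with
    entries \<open>- w\<close> and \<open>1\<close> is in the kernel, so \<open>lg = 0\<close> too
    and the new unknown may be set to \<open>0\<close>.\<close>
  define \<alpha> where "\<alpha> = M g g - (\<Sum>i\<in>B. w i * M i g)"
  define lg where "lg = l g - (\<Sum>i\<in>B. w i * l i)"
  have Qw: "Q w = (\<Sum>i\<in>B. w i * M i g)"
  proof -
    have "Q w = (\<Sum>j\<in>B. \<Sum>i\<in>B. w i * w j * M i j)" unfolding Q_def by (rule sum.swap)
    also have "\<dots> = (\<Sum>j\<in>B. w j * (\<Sum>i\<in>B. w i * M i j))"
      unfolding sum_distrib_left by (intro sum.cong refl) simp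
    also have "\<dots> = (\<Sum>j\<in>B. w j * M j g)" by (intro sum.cong refl) (simp add: w sym[of g])
    finally show ?thesis .
  qed
  have lg0: "lg = 0" if "\<alpha> = 0"
  proof -
    define c where "c = (\<lambda>i. - w i)(g := 1)"
    have "Q (\<lambda>i. - w i) = Q w" by (simp add: Q_def)
    moreover have "(\<Sum>j\<in>B. - w j * M g j) = - (\<Sum>i\<in>B. w i * M i g)"
      unfolding sum_negf[symmetric] by (intro sum.cong refl) (simp add: sym[of g])
    ultimately have "(\<Sum>i\<in>insert g B. \<Sum>j\<in>insert g B. c i * c j * M i j) = 0"
      unfolding big c_def upd using that Qw by (simp add: \<alpha>_def)
    from insert.prems(2)[OF this] show ?thesis
      using insert.hyps upd(2)[of "\<lambda>i. - w i" 1 l] by (simp add: c_def lg_def sum_negf)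
  qed
  define \<beta> where "\<beta> = (if \<alpha> = 0 then 0 else lg / \<alpha>)"
  have \<beta>: "\<beta> * \<alpha> = lg" using lg0 by (auto simp: \<beta>_def)
  define v where "v = (\<lambda>i. u i - \<beta> * w i)(g := \<beta>)"
  have vsum: "(\<Sum>i\<in>insert g B. v i * M i j) = \<beta> * M g j + (\<Sum>i\<in>B. u i * M i j) - \<beta> * (\<Sum>i\<in>B. w i * M i j)" for j
  proof -
    have "(\<Sum>i\<in>insert g B. v i * M i j) = \<beta> * M g j + (\<Sum>i\<in>B. (u i - \<beta> * w i) * M i j)"
      using insert.hyps upd(2)[of "\<lambda>i. u i - \<beta> * w i" \<beta> "\<lambda>i. M i j"] by (simp add: v_def)
    thus ?thesis by (simp add: left_diff_distrib sum_subtractf sum_distrib_left mult.assoc)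
  qed
  have "(\<Sum>i\<in>B. u i * M i g) = (\<Sum>i\<in>B. w i * l i)"
  proof -
    have "(\<Sum>i\<in>B. u i * M i g) = (\<Sum>i\<in>B. u i * (\<Sum>k\<in>B. w k * M k i))"
      by (intro sum.cong refl) (simp add: w sym[of g])
    also have "\<dots> = (\<Sum>k\<in>B. \<Sum>i\<in>B. u i * (w k * M k i))" unfolding sum_distrib_left by (rule sum.swap)
    also have "\<dots> = (\<Sum>k\<in>B. w k * (\<Sum>i\<in>B. u i * M i k))"
      unfolding sum_distrib_left by (intro sum.cong refl) (simp add: sym)
    also have "\<dots> = (\<Sum>k\<in>B. w k * l k)" by (intro sum.cong refl) (simp add: u)
    finally show ?thesis .
  qed
  hence "(\<Sum>i\<in>insert g B. v i * M i g) = l g"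
    using \<beta> unfolding vsum by (simp add: \<alpha>_def lg_def algebra_simps)
  moreover have "(\<Sum>i\<in>insert g B. v i * M i j) = l j" if "j \<in> B" for j
    unfolding vsum using u[OF that] w[OF that] by simp
  ultimately show ?case by blast
qed

text \<open>Once the functional is represented as \<open>P u\<close>, the Cauchy-Schwarz inequality
  gives the constant \<open>P u u\<close>; the case \<open>P c c = 0\<close> is separate because the
  form may be degenerate.\<close>

lemma psd_functional_bound:
  fixes M :: "'i \<Rightarrow> 'i \<Rightarrow> real"
  assumes B: "finite B" and sym: "\<And>i j. M i j = M j i"
    and pos: "\<And>c. 0 \<le> (\<Sum>i\<in>B. \<Sum>j\<in>B. c i * c j * M i j)"
    and ker: "\<And>c. (\<Sum>i\<in>B. \<Sum>j\<in>B. c i * c j * M i j) = 0 \<Longrightarrow> (\<Sum>i\<in>B. c i * l i) = 0"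
  shows "\<exists>K\<ge>0. \<forall>c. (\<Sum>i\<in>B. c i * l i)^2 \<le> K * (\<Sum>i\<in>B. \<Sum>j\<in>B. c i * c j * M i j)"
proof -
  define P where "P = (\<lambda>c d. \<Sum>i\<in>B. \<Sum>j\<in>B. c i * d j * M i j)"
  obtain u where u: "\<And>j. j \<in> B \<Longrightarrow> (\<Sum>i\<in>B. u i * M i j) = l j"
    using psd_solve[OF assms] by auto
  have l: "(\<Sum>i\<in>B. c i * l i) = P u c" for c
  proof -
    have "P u c = (\<Sum>j\<in>B. \<Sum>i\<in>B. u i * c j * M i j)" unfolding P_def by (rule sum.swap)
    also have "\<dots> = (\<Sum>j\<in>B. c j * (\<Sum>i\<in>B. u i * M i j))"
      unfolding sum_distrib_left by (intro sum.cong refl) simp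
    finally show ?thesis by (simp add: u cong: sum.cong)
  qed
  have symP: "P c d = P d c" for c d
    unfolding P_def by (subst sum.swap, intro sum.cong refl) (simp add: sym mult.commute)
  have exp: "P (\<lambda>i. x * c i + y * d i) (\<lambda>i. x * c i + y * d i) = x^2 * P c c + 2 * x * y * P c d + y^2 * P d d" for x y c d
  proof -
    have "P (\<lambda>i. x * c i + y * d i) (\<lambda>i. x * c i + y * d i) = x^2 * P c c + x * y * P c d + x * y * P d c + y^2 * P d d"
      unfolding P_def sum_distrib_left sum.distrib[symmetric]
      by (intro sum.cong refl) (simp add: algebra_simps power2_eq_square)
    thus ?thesis by (simp add: symP[of d c])
  qed
  have CS: "(P u c)^2 \<le> P u u * P c c" for c
  proof -
    have pu: "0 \<le> P u u" "0 \<le> P c c" using pos by (auto simp: P_def)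
    have q: "0 \<le> x^2 * P u u + 2 * x * y * P u c + y^2 * P c c" for x y
      using pos[of "\<lambda>i. x * u i + y * c i"] exp[of x u y c] by (simp add: P_def)
    show ?thesis
    proof (cases "P c c = 0")
      case True
      have "P u c = 0"
      proof (rule nonneg_affine_imp_zero[where b = "P u u"])
        show "0 \<le> 2 * t * P u c + t^2 * P u u" for t using q[of t 1] True by (simp add: algebra_simps)
      qed
      thus ?thesis using True by simp
    next
      case False
      hence p: "P c c > 0" using pu by simp
      have "0 \<le> (P c c)^2 * P u u + 2 * P c c * (- P u c) * P u c + (- P u c)^2 * P c c" by (rule q)
      hence "0 \<le> P c c * (P u u * P c c - (P u c)^2)" by (simp add: power2_eq_square algebra_simps)
      thus ?thesis using p by (simp add: zero_le_mult_iff)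
    qed
  qed
  show ?thesis
    using CS pos[of u] unfolding l by (intro exI[of _ "P u u"]) (auto simp: P_def)
qed

section \<open>Approximating planes\<close>

definition fspan :: "(real \<Rightarrow> real) set \<Rightarrow> (real \<Rightarrow> real) set" where
  "fspan B = {\<lambda>s. \<Sum>g\<in>B. c g * g s | c. True}"

text \<open>Linear subspaces of functions, stated pointwise so that facts about spans follow from
  \<open>fspan_le\<close>, the minimality of the span.\<close>

definition fclosed :: "(real \<Rightarrow> real) set \<Rightarrow> bool" where
  "fclosed V \<longleftrightarrow> (\<lambda>_. 0) \<in> V \<and> (\<forall>f\<in>V. \<forall>g\<in>V. (\<lambda>x. f x + g x) \<in> V) \<and> (\<forall>c. \<forall>f\<in>V. (\<lambda>x. c * f x) \<in> V)"

lemma fspan_le: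
  assumes "fclosed V" "B \<subseteq> V" shows "fspan B \<subseteq> V"
proof -
  have "(\<lambda>s. \<Sum>g\<in>B. c g * g s) \<in> V" for c
    using assms(2)
  proof (induction B rule: infinite_finite_induct)
    case (insert x F)
    thus ?case using assms(1) by (auto simp: fclosed_def)
  qed (use assms(1) in \<open>auto simp: fclosed_def\<close>)
  thus ?thesis by (auto simp: fspan_def)
qed

lemma fclosed_fspan: "fclosed (fspan B)"
  unfolding fclosed_def
proof (intro conjI ballI allI)
  show "(\<lambda>_. 0) \<in> fspan B" unfolding fspan_def by (auto intro!: exI[of _ "\<lambda>_. 0"])
  fix f assume "f \<in> fspan B"
  then obtain c where f: "f = (\<lambda>s. \<Sum>g\<in>B. c g * g s)" by (auto simp: fspan_def)
  show "(\<lambda>x. k * f x) \<in> fspan B" for k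
    unfolding fspan_def f by (auto intro!: exI[of _ "\<lambda>g. k * c g"] simp: sum_distrib_left mult.assoc)
  fix h assume "h \<in> fspan B"
  then obtain d where h: "h = (\<lambda>s. \<Sum>g\<in>B. d g * g s)" by (auto simp: fspan_def)
  show "(\<lambda>x. f x + h x) \<in> fspan B"
    unfolding fspan_def f h by (auto intro!: exI[of _ "\<lambda>g. c g + d g"] simp: sum.distrib distrib_right)
qed

lemma fspan_superset:
  assumes "finite B" shows "B \<subseteq> fspan B"
proof
  fix f assume "f \<in> B"
  hence "f = (\<lambda>s. \<Sum>g\<in>B. (if g = f then 1 else 0) * g s)"
    using assms by (auto simp: if_distrib[of "\<lambda>x. x * _"] sum.delta cong: if_cong)
  thus "f \<in> fspan B"
    unfolding fspan_def by (intro CollectI exI[of _ "\<lambda>g. if g = f then 1 else 0"]) auto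
qed

lemma fspan_mono: "finite B' \<Longrightarrow> B \<subseteq> B' \<Longrightarrow> fspan B \<subseteq> fspan B'"
  using fspan_le[OF fclosed_fspan] fspan_superset by blast

lemma Linf_iff: "v \<in> Linf t \<longleftrightarrow> ess_bdd 0 t v"
  by (simp add: Linf_def ess_bdd_def)

lemma fclosed_ess_bdd: "fclosed {v. ess_bdd a b v}"
  by (auto simp: fclosed_def ess_bdd_const intro!: ess_bdd_add ess_bdd_cmult)

lemma fspan_ess_bdd: "(\<And>g. g \<in> B \<Longrightarrow> ess_bdd a b g) \<Longrightarrow> v \<in> fspan B \<Longrightarrow> ess_bdd a b v"
  using fspan_le[OF fclosed_ess_bdd[of a b], of B] by auto

lemma fin_dim_subspaces_eq: "fin_dim_subspaces t = {fspan B | B. finite B \<and> (\<forall>g\<in>B. ess_bdd 0 t g)}"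
  unfolding fin_dim_subspaces_def fspan_def using Linf_iff by blast

text \<open>The spans are directed, since the union of two spanning sets spans a space containing
  both. Convergence along the net therefore concerns all spans beyond one fixed span.\<close>

lemma fin_dim_at_top_tendsto_zero:
  fixes f :: "(real \<Rightarrow> real) set \<Rightarrow> real"
  assumes f: "(f \<longlongrightarrow> 0) (fin_dim_at_top t)" and e: "e > 0"
  obtains B where "finite B" "\<And>g. g \<in> B \<Longrightarrow> ess_bdd 0 t g"
    "\<And>B'. finite B' \<Longrightarrow> (\<And>g. g \<in> B' \<Longrightarrow> ess_bdd 0 t g) \<Longrightarrow> fspan B \<subseteq> fspan B' \<Longrightarrow> \<bar>f (fspan B')\<bar> < e"
proof -
  have "eventually (\<lambda>V. \<bar>f V\<bar> < e) (fin_dim_at_top t)"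
    using tendstoD[OF f e] by simp
  hence "\<exists>V0\<in>fin_dim_subspaces t. eventually (\<lambda>V. \<bar>f V\<bar> < e) (principal {V \<in> fin_dim_subspaces t. V0 \<subseteq> V})"
    unfolding fin_dim_at_top_def
  proof (subst (asm) eventually_INF_base)
    show "fin_dim_subspaces t \<noteq> {}" unfolding fin_dim_subspaces_eq by (auto intro!: exI[of _ "{}"])
    fix V W assume "V \<in> fin_dim_subspaces t" "W \<in> fin_dim_subspaces t"
    then obtain B C where BC: "V = fspan B" "W = fspan C" "finite B" "finite C" "\<forall>g\<in>B. ess_bdd 0 t g" "\<forall>g\<in>C. ess_bdd 0 t g"
      unfolding fin_dim_subspaces_eq by blast
    have "fspan (B \<union> C) \<in> fin_dim_subspaces t" unfolding fin_dim_subspaces_eq using BC by blast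
    moreover have "V \<subseteq> fspan (B \<union> C)" "W \<subseteq> fspan (B \<union> C)"
      unfolding BC(1,2) using fspan_mono[of "B \<union> C" B] fspan_mono[of "B \<union> C" C] BC(3,4) by simp_all
    ultimately show "\<exists>x\<in>fin_dim_subspaces t. principal {V \<in> fin_dim_subspaces t. x \<subseteq> V}
        \<le> inf (principal {Va \<in> fin_dim_subspaces t. V \<subseteq> Va}) (principal {V \<in> fin_dim_subspaces t. W \<subseteq> V})"
      by (intro bexI[of _ "fspan (B \<union> C)"]) (auto simp: inf_principal)
  qed
  then obtain V0 where V0: "V0 \<in> fin_dim_subspaces t" "\<And>V. V \<in> fin_dim_subspaces t \<Longrightarrow> V0 \<subseteq> V \<Longrightarrow> \<bar>f V\<bar> < e"
    unfolding eventually_principal by blast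
  then obtain B where B: "V0 = fspan B" "finite B" "\<forall>g\<in>B. ess_bdd 0 t g"
    unfolding fin_dim_subspaces_eq by blast
  show ?thesis
  proof (rule that[of B])
    fix B' assume B': "finite B'" "\<And>g. g \<in> B' \<Longrightarrow> ess_bdd 0 t g" "fspan B \<subseteq> fspan B'"
    have "fspan B' \<in> fin_dim_subspaces t" unfolding fin_dim_subspaces_eq using B' by blast
    thus "\<bar>f (fspan B')\<bar> < e" using V0(2) B(1) B'(3) by blast
  qed (use B in auto)
qed

section \<open>Trajectories and the bilinear form of the second variation\<close>

definition traj :: "(real \<Rightarrow> 'a::euclidean_space) \<Rightarrow> real \<Rightarrow> 'a \<Rightarrow> (real \<Rightarrow> real) \<Rightarrow> real \<Rightarrow> 'a" where
  "traj X a \<eta> v t = \<eta> + integral {a..t} (\<lambda>\<theta>. v \<theta> *\<^sub>R X \<theta>)"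

text \<open>Initial time \<open>a\<close> and initial vector \<open>\<eta>\<close> are free, so that
  the form can be restarted at \<open>\<tau>\<close> with the state reached there. Only the left
  argument carries an initial vector, so the form is not symmetric.\<close>

definition jform :: "(real \<Rightarrow> 'e \<times> 'e::euclidean_space) \<Rightarrow> (real \<Rightarrow> real) \<Rightarrow> real \<Rightarrow> real \<Rightarrow> 'e \<times> 'e \<Rightarrow> (real \<Rightarrow> real)
    \<Rightarrow> (real \<Rightarrow> real) \<Rightarrow> real" where
  "jform X b a s \<eta> v w = integral {a..s} (\<lambda>t. sigma (traj X a \<eta> v t) (w t *\<^sub>R X t) + b t * v t * w t)"

lemma jacobi_approx_eq:
  "jacobi_approx X b t V = {traj X 0 \<eta> v t | \<eta> v. \<eta> \<in> vertical \<and> v \<in> V \<and> (\<forall>w\<in>V. jform X b 0 t \<eta> v w = 0)}"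
  unfolding jacobi_approx_def traj_def jform_def ..

lemma traj_start [simp]: "traj X a \<eta> v a = \<eta>"
  by (simp add: traj_def)

context
  fixes X :: "real \<Rightarrow> 'e \<times> 'e::euclidean_space" and b :: "real \<Rightarrow> real" and a s :: real
  assumes X: "ess_bdd a s X" and b: "ess_bdd a s b"
begin

lemma prim_traj: "ess_bdd a s v \<Longrightarrow> prim a s (traj X a \<eta> v) (\<lambda>t. v t *\<^sub>R X t)"
  using prim_integral_left[OF ess_bdd_scaleR[OF _ X], of v \<eta>] by (simp add: traj_def[abs_def])

lemma traj_ess_bdd: "ess_bdd a s v \<Longrightarrow> ess_bdd a s (traj X a \<eta> v)"
  by (rule ess_bdd_continuous, rule prim_continuous, rule prim_traj)

lemma ess_bdd_jform:
  assumes "ess_bdd a s v" "ess_bdd a s w"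
  shows "ess_bdd a s (\<lambda>t. sigma (traj X a \<eta> v t) (w t *\<^sub>R X t) + b t * v t * w t)"
  by (intro ess_bdd_add ess_bdd_bilinear[OF bounded_bilinear_sigma] ess_bdd_mult ess_bdd_scaleR X b assms traj_ess_bdd)

lemma traj_add:
  assumes "ess_bdd a s v" "ess_bdd a s w" "t \<le> s"
  shows "traj X a (\<eta> + \<xi>) (\<lambda>x. v x + w x) t = traj X a \<eta> v t + traj X a \<xi> w t"
proof -
  have "(\<lambda>\<theta>. u \<theta> *\<^sub>R X \<theta>) integrable_on {a..t}" if "ess_bdd a s u" for u
    using ess_bdd_scaleR[OF that X] assms(3) by (intro ess_bdd_integrable ess_bdd_subinterval[of a s _ a t]) auto
  thus ?thesis using assms by (simp add: traj_def scaleR_add_left Henstock_Kurzweil_Integration.integral_add)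
qed

lemma traj_scale: "traj X a (c *\<^sub>R \<eta>) (\<lambda>x. c * v x) t = c *\<^sub>R traj X a \<eta> v t"
  using Henstock_Kurzweil_Integration.integral_cmul[of "{a..t}" c "\<lambda>\<theta>. v \<theta> *\<^sub>R X \<theta>"]
  by (simp add: traj_def scaleR_add_right)

lemma jform_add_left:
  assumes v: "ess_bdd a s v" and v': "ess_bdd a s v'" and w: "ess_bdd a s w"
  shows "jform X b a s (\<eta> + \<eta>') (\<lambda>x. v x + v' x) w = jform X b a s \<eta> v w + jform X b a s \<eta>' v' w"
proof -
  have "jform X b a s (\<eta> + \<eta>') (\<lambda>x. v x + v' x) w = integral {a..s} (\<lambda>t.
     (sigma (traj X a \<eta> v t) (w t *\<^sub>R X t) + b t * v t * w t) + (sigma (traj X a \<eta>' v' t) (w t *\<^sub>R X t) + b t * v' t * w t))"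
    unfolding jform_def
    by (intro integral_cong) (simp add: traj_add[OF v v'] sigma.add_left algebra_simps)
  also have "\<dots> = jform X b a s \<eta> v w + jform X b a s \<eta>' v' w"
    unfolding jform_def by (intro Henstock_Kurzweil_Integration.integral_add ess_bdd_integrable ess_bdd_jform v v' w)
  finally show ?thesis .
qed

lemma jform_scale_left: "jform X b a s (c *\<^sub>R \<eta>) (\<lambda>x. c * v x) w = c * jform X b a s \<eta> v w"
proof -
  have "jform X b a s (c *\<^sub>R \<eta>) (\<lambda>x. c * v x) w = integral {a..s} (\<lambda>t.
     c * (sigma (traj X a \<eta> v t) (w t *\<^sub>R X t) + b t * v t * w t))"
    unfolding jform_def by (intro integral_cong) (simp add: traj_scale sigma.scaleR_left algebra_simps)
  thus ?thesis by (simp add: jform_def)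
qed

lemma jform_add_right:
  assumes v: "ess_bdd a s v" and w: "ess_bdd a s w" and w': "ess_bdd a s w'"
  shows "jform X b a s \<eta> v (\<lambda>x. w x + w' x) = jform X b a s \<eta> v w + jform X b a s \<eta> v w'"
proof -
  have "jform X b a s \<eta> v (\<lambda>x. w x + w' x) = integral {a..s} (\<lambda>t.
     (sigma (traj X a \<eta> v t) (w t *\<^sub>R X t) + b t * v t * w t) + (sigma (traj X a \<eta> v t) (w' t *\<^sub>R X t) + b t * v t * w' t))"
    unfolding jform_def
    by (intro integral_cong) (simp add: sigma.scaleR_right sigma.add_right scaleR_add_left algebra_simps)
  also have "\<dots> = jform X b a s \<eta> v w + jform X b a s \<eta> v w'"
    unfolding jform_def by (intro Henstock_Kurzweil_Integration.integral_add ess_bdd_integrable ess_bdd_jform v w w')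
  finally show ?thesis .
qed

lemma jform_scale_right: "jform X b a s \<eta> v (\<lambda>x. c * w x) = c * jform X b a s \<eta> v w"
proof -
  have "jform X b a s \<eta> v (\<lambda>x. c * w x) = integral {a..s} (\<lambda>t.
     c * (sigma (traj X a \<eta> v t) (w t *\<^sub>R X t) + b t * v t * w t))"
    unfolding jform_def by (intro integral_cong) (simp add: sigma.scaleR_right algebra_simps)
  thus ?thesis by (simp add: jform_def)
qed

text \<open>Green's formula: the antisymmetric part of the form integrates the derivative of the
  pairing of two trajectories. It yields both the isotropy of the approximating planes and the
  duality between a variation and its residual.\<close>

lemma jform_swap:
  assumes as: "a \<le> s" and v: "ess_bdd a s v" and w: "ess_bdd a s w"
  shows "jform X b a s \<eta> v w - jform X b a s \<xi> w v =
    sigma (traj X a \<eta> v s) (traj X a \<xi> w s) - sigma \<eta> \<xi>"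
proof -
  have P: "prim a s (\<lambda>t. sigma (traj X a \<eta> v t) (traj X a \<xi> w t))
    (\<lambda>t. sigma (v t *\<^sub>R X t) (traj X a \<xi> w t) + sigma (traj X a \<eta> v t) (w t *\<^sub>R X t))"
    by (intro prim_bilinear[OF bounded_bilinear_sigma] prim_traj v w)
  have "jform X b a s \<eta> v w - jform X b a s \<xi> w v = integral {a..s} (\<lambda>t.
     (sigma (traj X a \<eta> v t) (w t *\<^sub>R X t) + b t * v t * w t) - (sigma (traj X a \<xi> w t) (v t *\<^sub>R X t) + b t * w t * v t))"
    unfolding jform_def by (intro Henstock_Kurzweil_Integration.integral_diff[symmetric] ess_bdd_integrable ess_bdd_jform v w)
  also have "\<dots> = integral {a..s} (\<lambda>t. sigma (v t *\<^sub>R X t) (traj X a \<xi> w t) + sigma (traj X a \<eta> v t) (w t *\<^sub>R X t))"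
    by (intro integral_cong) (subst (3) sigma_swap, simp add: algebra_simps)
  also have "\<dots> = sigma (traj X a \<eta> v s) (traj X a \<xi> w s) - sigma \<eta> \<xi>"
    using prim_integral[OF P] as by simp
  finally show ?thesis .
qed

lemma jform_zero_fspan:
  assumes v: "ess_bdd a s v" and B: "\<And>g. g \<in> B \<Longrightarrow> ess_bdd a s g" "\<And>g. g \<in> B \<Longrightarrow> jform X b a s \<eta> v g = 0"
    and w: "w \<in> fspan B"
  shows "jform X b a s \<eta> v w = 0"
proof -
  have "fclosed {w. ess_bdd a s w \<and> jform X b a s \<eta> v w = 0}"
    unfolding fclosed_def
    using jform_scale_right[of \<eta> v 0 "\<lambda>_. 0"]
    by (auto simp: ess_bdd_const jform_add_right[OF v] jform_scale_right
        intro: ess_bdd_add ess_bdd_cmult)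
  from fspan_le[OF this, of B] show ?thesis using B w by auto
qed

end

section \<open>Approximating planes are isotropic subspaces\<close>

lemma subspace_jacobi_approx:
  fixes X :: "real \<Rightarrow> 'e \<times> 'e::euclidean_space"
  assumes X: "ess_bdd 0 s X" and b: "ess_bdd 0 s b" and B: "\<And>g. g \<in> B \<Longrightarrow> ess_bdd 0 s g"
  shows "subspace (jacobi_approx X b s (fspan B))"
  unfolding subspace_def
proof (intro conjI ballI allI)
  let ?V = "fspan B"
  have bd: "ess_bdd 0 s v" if "v \<in> ?V" for v using fspan_ess_bdd[OF B that] .
  have vs: "subspace (vertical :: ('e \<times> 'e) set)" using lagrangian_vertical by (rule lagrangian_subspace)
  have cl: "fclosed ?V" by (rule fclosed_fspan)
  {
    fix x c assume "x \<in> jacobi_approx X b s ?V"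
    then obtain \<eta> v where x: "x = traj X 0 \<eta> v s" "\<eta> \<in> vertical" "v \<in> ?V" "\<forall>w\<in>?V. jform X b 0 s \<eta> v w = 0"
      unfolding jacobi_approx_eq by blast
    have "c *\<^sub>R x = traj X 0 (c *\<^sub>R \<eta>) (\<lambda>x. c * v x) s" by (simp add: x traj_scale[OF X b])
    moreover have "c *\<^sub>R \<eta> \<in> vertical" using x(2) vs by (simp add: subspace_def)
    moreover have "(\<lambda>x. c * v x) \<in> ?V" using cl x(3) by (simp add: fclosed_def)
    moreover have "\<forall>w\<in>?V. jform X b 0 s (c *\<^sub>R \<eta>) (\<lambda>x. c * v x) w = 0" using x(4) by (simp add: jform_scale_left[OF X b])
    ultimately show "c *\<^sub>R x \<in> jacobi_approx X b s ?V" unfolding jacobi_approx_eq by blast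
    fix y assume "y \<in> jacobi_approx X b s ?V"
    then obtain \<xi> u where y: "y = traj X 0 \<xi> u s" "\<xi> \<in> vertical" "u \<in> ?V" "\<forall>w\<in>?V. jform X b 0 s \<xi> u w = 0"
      unfolding jacobi_approx_eq by blast
    have "x + y = traj X 0 (\<eta> + \<xi>) (\<lambda>x. v x + u x) s" using bd x(3) y(3) by (simp add: x y traj_add[OF X b])
    moreover have "\<eta> + \<xi> \<in> vertical" using x(2) y(2) vs by (simp add: subspace_def)
    moreover have "(\<lambda>x. v x + u x) \<in> ?V" using cl x(3) y(3) by (simp add: fclosed_def)
    moreover have "\<forall>w\<in>?V. jform X b 0 s (\<eta> + \<xi>) (\<lambda>x. v x + u x) w = 0"
      using x(3,4) y(3,4) bd by (simp add: jform_add_left[OF X b])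
    ultimately show "x + y \<in> jacobi_approx X b s ?V" unfolding jacobi_approx_eq by blast
  }
  have "traj X 0 0 (\<lambda>_. 0) s = 0" "\<forall>w\<in>?V. jform X b 0 s 0 (\<lambda>_. 0) w = 0"
    by (simp_all add: traj_def jform_def sigma.zero_left)
  moreover have "(\<lambda>_. 0) \<in> ?V" using cl by (simp add: fclosed_def)
  moreover have "0 \<in> (vertical :: ('e \<times> 'e) set)" using vs by (simp add: subspace_def)
  ultimately show "0 \<in> jacobi_approx X b s ?V"
    unfolding jacobi_approx_eq by (intro CollectI exI[of _ 0] exI[of _ "\<lambda>_. 0"]) auto
qed

lemma isotropic_jacobi_approx:
  fixes X :: "real \<Rightarrow> 'e \<times> 'e::euclidean_space"
  assumes X: "ess_bdd 0 s X" and b: "ess_bdd 0 s b" and s: "0 \<le> s" and B: "\<And>g. g \<in> B \<Longrightarrow> ess_bdd 0 s g"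
    and "x \<in> jacobi_approx X b s (fspan B)" "y \<in> jacobi_approx X b s (fspan B)"
  shows "sigma x y = 0"
proof -
  obtain \<eta> v where x: "x = traj X 0 \<eta> v s" "\<eta> \<in> vertical" "v \<in> fspan B" "\<forall>w\<in>fspan B. jform X b 0 s \<eta> v w = 0"
    using assms(5) unfolding jacobi_approx_eq by blast
  obtain \<xi> u where y: "y = traj X 0 \<xi> u s" "\<xi> \<in> vertical" "u \<in> fspan B" "\<forall>w\<in>fspan B. jform X b 0 s \<xi> u w = 0"
    using assms(6) unfolding jacobi_approx_eq by blast
  have "sigma x y = sigma \<eta> \<xi>"
    using jform_swap[OF X b s, of v u \<eta> \<xi>] fspan_ess_bdd[OF B] x y by simp
  also have "\<dots> = 0" using x(2) y(2) lagrangian_isotropic[OF lagrangian_vertical] by blast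
  finally show ?thesis .
qed

section \<open>Splitting the variations at an intermediate time\<close>

definition cut_le :: "real \<Rightarrow> (real \<Rightarrow> real) \<Rightarrow> real \<Rightarrow> real" where
  "cut_le \<tau> v = (\<lambda>x. if x \<le> \<tau> then v x else 0)"

definition cut_gt :: "real \<Rightarrow> (real \<Rightarrow> real) \<Rightarrow> real \<Rightarrow> real" where
  "cut_gt \<tau> v = (\<lambda>x. if x \<le> \<tau> then 0 else v x)"

text \<open>Boundedness is asked on \<open>[a, \<tau>]\<close> only: a variation known up to
  \<open>\<tau>\<close> extends by zero to other intervals.\<close>

lemma ess_bdd_cut_le:
  assumes v: "ess_bdd a \<tau> v" shows "ess_bdd a s (cut_le \<tau> v)"
proof -
  have "(\<lambda>x. if x \<in> {a..\<tau>} then v x else 0) \<in> borel_measurable lebesgue"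
    using v by (subst borel_measurable_if) (auto simp: ess_bdd_def)
  hence "(\<lambda>x. if x \<in> {a..\<tau>} then v x else 0) \<in> borel_measurable (lebesgue_on {a..s})"
    by (rule measurable_restrict_space1)
  moreover have "(\<lambda>x. if x \<in> {a..\<tau>} then v x else 0) \<in> borel_measurable (lebesgue_on {a..s}) \<longleftrightarrow>
      cut_le \<tau> v \<in> borel_measurable (lebesgue_on {a..s})"
    by (rule measurable_cong) (auto simp: cut_le_def)
  ultimately have m: "cut_le \<tau> v \<in> borel_measurable (lebesgue_on {a..s})" by blast
  obtain C where C: "C \<ge> 0" "AE x in lebesgue_on {a..\<tau>}. norm (v x) \<le> C" using v by (rule ess_bdd_bound)
  hence "AE x in lebesgue. x \<in> {a..\<tau>} \<longrightarrow> norm (v x) \<le> C"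
    by (subst (asm) AE_restrict_space_iff) auto
  hence "AE x in lebesgue. x \<in> {a..s} \<longrightarrow> norm (cut_le \<tau> v x) \<le> C"
    by eventually_elim (use C(1) in \<open>auto simp: cut_le_def\<close>)
  hence "AE x in lebesgue_on {a..s}. norm (cut_le \<tau> v x) \<le> C"
    by (subst AE_restrict_space_iff) auto
  thus ?thesis using m by (auto simp: ess_bdd_def)
qed

lemma ess_bdd_cut_gt:
  assumes v: "ess_bdd a s v" shows "ess_bdd a s (cut_gt \<tau> v)"
proof -
  have "cut_gt \<tau> v = (\<lambda>x. if x \<in> {\<tau><..} then v x else 0)" by (auto simp: cut_gt_def)
  thus ?thesis using ess_bdd_restrict[OF v, of "{\<tau><..}"] by simp
qed

lemma fspan_cut: "finite B \<Longrightarrow> fspan (cut_le \<tau> ` B) = cut_le \<tau> ` fspan B"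
proof (intro equalityI)
  assume fin: "finite B"
  have "fclosed (cut_le \<tau> ` fspan B)"
    unfolding fclosed_def
  proof (intro conjI ballI allI)
    note c = fclosed_fspan[of B, unfolded fclosed_def]
    show "(\<lambda>_. 0) \<in> cut_le \<tau> ` fspan B"
      by (rule image_eqI[of _ _ "\<lambda>_. 0"]) (use c in \<open>auto simp: cut_le_def\<close>)
    fix f assume "f \<in> cut_le \<tau> ` fspan B"
    then obtain f' where f: "f' \<in> fspan B" "f = cut_le \<tau> f'" by auto
    show "(\<lambda>x. k * f x) \<in> cut_le \<tau> ` fspan B" for k
      by (rule image_eqI[of _ _ "\<lambda>x. k * f' x"]) (use c f in \<open>auto simp: cut_le_def\<close>)
    fix g assume "g \<in> cut_le \<tau> ` fspan B"
    then obtain g' where g: "g' \<in> fspan B" "g = cut_le \<tau> g'" by auto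
    show "(\<lambda>x. f x + g x) \<in> cut_le \<tau> ` fspan B"
      by (rule image_eqI[of _ _ "\<lambda>x. f' x + g' x"]) (use c f g in \<open>auto simp: cut_le_def\<close>)
  qed
  thus "fspan (cut_le \<tau> ` B) \<subseteq> cut_le \<tau> ` fspan B"
    using fspan_superset[OF fin] by (intro fspan_le) auto
  have "fclosed {v. cut_le \<tau> v \<in> fspan (cut_le \<tau> ` B)}"
    unfolding fclosed_def
  proof (intro conjI ballI allI)
    note c = fclosed_fspan[of "cut_le \<tau> ` B", unfolded fclosed_def]
    have z: "cut_le \<tau> (\<lambda>_. 0) = (\<lambda>_. 0)" by (auto simp: cut_le_def)
    show "(\<lambda>_. 0) \<in> {v. cut_le \<tau> v \<in> fspan (cut_le \<tau> ` B)}" using c by (auto simp: z)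
    fix f assume f: "f \<in> {v. cut_le \<tau> v \<in> fspan (cut_le \<tau> ` B)}"
    have m: "cut_le \<tau> (\<lambda>x. k * f x) = (\<lambda>x. k * cut_le \<tau> f x)" for k by (auto simp: cut_le_def)
    show "(\<lambda>x. k * f x) \<in> {v. cut_le \<tau> v \<in> fspan (cut_le \<tau> ` B)}" for k using c f by (auto simp: m)
    fix g assume g: "g \<in> {v. cut_le \<tau> v \<in> fspan (cut_le \<tau> ` B)}"
    have p: "cut_le \<tau> (\<lambda>x. f x + g x) = (\<lambda>x. cut_le \<tau> f x + cut_le \<tau> g x)" by (auto simp: cut_le_def)
    show "(\<lambda>x. f x + g x) \<in> {v. cut_le \<tau> v \<in> fspan (cut_le \<tau> ` B)}" using c f g by (auto simp: p)
  qed
  from fspan_le[OF this, of B] show "cut_le \<tau> ` fspan B \<subseteq> fspan (cut_le \<tau> ` B)"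
    using fspan_superset[of "cut_le \<tau> ` B"] fin by auto
qed

lemma traj_cong: "(\<And>x. x \<in> {a..t} \<Longrightarrow> v x = w x) \<Longrightarrow> traj X a \<eta> v t = traj X a \<eta> w t"
  unfolding traj_def by (auto intro!: integral_cong arg_cong[of _ _ "\<lambda>x. \<eta> + x"])

lemma jform_cong:
  assumes "\<And>x. x \<in> {a..s} \<Longrightarrow> v x = v' x" "\<And>x. x \<in> {a..s} \<Longrightarrow> w x = w' x"
  shows "jform X b a s \<eta> v w = jform X b a s \<eta> v' w'"
  unfolding jform_def
proof (intro integral_cong)
  fix t assume t: "t \<in> {a..s}"
  have "traj X a \<eta> v t = traj X a \<eta> v' t" by (rule traj_cong) (use assms t in auto)
  thus "sigma (traj X a \<eta> v t) (w t *\<^sub>R X t) + b t * v t * w t = sigma (traj X a \<eta> v' t) (w' t *\<^sub>R X t) + b t * v' t * w' t"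
    using assms t by simp
qed

lemma jacobi_approx_cut:
  assumes "finite B" shows "jacobi_approx X b \<tau> (fspan (cut_le \<tau> ` B)) = jacobi_approx X b \<tau> (fspan B)"
proof -
  have 1: "traj X 0 \<eta> (cut_le \<tau> v) \<tau> = traj X 0 \<eta> v \<tau>" for \<eta> v
    by (rule traj_cong) (auto simp: cut_le_def)
  have 2: "jform X b 0 \<tau> \<eta> (cut_le \<tau> v) (cut_le \<tau> w) = jform X b 0 \<tau> \<eta> v w" for \<eta> v w
    by (rule jform_cong) (auto simp: cut_le_def)
  show ?thesis
    unfolding jacobi_approx_eq fspan_cut[OF assms]
  proof (intro set_eqI iffI)
    fix z assume "z \<in> {traj X 0 \<eta> v \<tau> |\<eta> v. \<eta> \<in> vertical \<and> v \<in> cut_le \<tau> ` fspan B \<and>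
       (\<forall>w\<in>cut_le \<tau> ` fspan B. jform X b 0 \<tau> \<eta> v w = 0)}"
    then obtain \<eta> v where "z = traj X 0 \<eta> (cut_le \<tau> v) \<tau>" "\<eta> \<in> vertical" "v \<in> fspan B"
       "\<forall>w\<in>fspan B. jform X b 0 \<tau> \<eta> (cut_le \<tau> v) (cut_le \<tau> w) = 0" by auto
    thus "z \<in> {traj X 0 \<eta> v \<tau> |\<eta> v. \<eta> \<in> vertical \<and> v \<in> fspan B \<and> (\<forall>w\<in>fspan B. jform X b 0 \<tau> \<eta> v w = 0)}"
      unfolding 1 2 by blast
  next
    fix z assume "z \<in> {traj X 0 \<eta> v \<tau> |\<eta> v. \<eta> \<in> vertical \<and> v \<in> fspan B \<and> (\<forall>w\<in>fspan B. jform X b 0 \<tau> \<eta> v w = 0)}"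
    then obtain \<eta> v where z: "z = traj X 0 \<eta> v \<tau>" "\<eta> \<in> vertical" "v \<in> fspan B"
       "\<forall>w\<in>fspan B. jform X b 0 \<tau> \<eta> v w = 0" by auto
    have "z = traj X 0 \<eta> (cut_le \<tau> v) \<tau>" "\<forall>w\<in>cut_le \<tau> ` fspan B. jform X b 0 \<tau> \<eta> (cut_le \<tau> v) w = 0"
      using z 1 2 by auto
    thus "z \<in> {traj X 0 \<eta> v \<tau> |\<eta> v. \<eta> \<in> vertical \<and> v \<in> cut_le \<tau> ` fspan B \<and>
       (\<forall>w\<in>cut_le \<tau> ` fspan B. jform X b 0 \<tau> \<eta> v w = 0)}" using z by blast
  qed
qed

lemma fspan_Un:
  assumes "finite B" "finite C" "v \<in> fspan (B \<union> C)"
  obtains f g where "f \<in> fspan B" "g \<in> fspan C" "v = (\<lambda>x. f x + g x)"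
proof -
  have "fclosed {\<lambda>x. f x + g x | f g. f \<in> fspan B \<and> g \<in> fspan C}"
    unfolding fclosed_def
  proof (intro conjI ballI allI)
    note c = fclosed_fspan[of B, unfolded fclosed_def] and d = fclosed_fspan[of C, unfolded fclosed_def]
    show "(\<lambda>_. 0) \<in> {\<lambda>x. f x + g x | f g. f \<in> fspan B \<and> g \<in> fspan C}"
      using c d by (auto intro!: exI[of _ "\<lambda>_. 0"])
    fix f assume "f \<in> {\<lambda>x. f x + g x | f g. f \<in> fspan B \<and> g \<in> fspan C}"
    then obtain f1 f2 where f: "f1 \<in> fspan B" "f2 \<in> fspan C" "f = (\<lambda>x. f1 x + f2 x)" by auto
    show "(\<lambda>x. k * f x) \<in> {\<lambda>x. f x + g x | f g. f \<in> fspan B \<and> g \<in> fspan C}" for k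
    proof -
      have "(\<lambda>x. k * f1 x) \<in> fspan B" "(\<lambda>x. k * f2 x) \<in> fspan C" "(\<lambda>x. k * f x) = (\<lambda>x. k * f1 x + k * f2 x)"
        using c d f by (auto simp: algebra_simps)
      thus ?thesis
        by (intro CollectI exI[of _ "\<lambda>x. k * f1 x"] exI[of _ "\<lambda>x. k * f2 x"]) auto
    qed
    fix g assume "g \<in> {\<lambda>x. f x + g x | f g. f \<in> fspan B \<and> g \<in> fspan C}"
    then obtain g1 g2 where g: "g1 \<in> fspan B" "g2 \<in> fspan C" "g = (\<lambda>x. g1 x + g2 x)" by auto
    have "(\<lambda>x. f1 x + g1 x) \<in> fspan B" "(\<lambda>x. f2 x + g2 x) \<in> fspan C"
      "(\<lambda>x. f x + g x) = (\<lambda>x. (f1 x + g1 x) + (f2 x + g2 x))"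
      using c d f g by (auto simp: algebra_simps)
    thus "(\<lambda>x. f x + g x) \<in> {\<lambda>x. f x + g x | f g. f \<in> fspan B \<and> g \<in> fspan C}"
      by (intro CollectI exI[of _ "\<lambda>x. f1 x + g1 x"] exI[of _ "\<lambda>x. f2 x + g2 x"]) auto
  qed
  moreover have "B \<union> C \<subseteq> {\<lambda>x. f x + g x | f g. f \<in> fspan B \<and> g \<in> fspan C}"
  proof -
    have z: "(\<lambda>_. 0) \<in> fspan B" "(\<lambda>_. 0) \<in> fspan C" using fclosed_fspan by (auto simp: fclosed_def)
    have "\<exists>f g. v = (\<lambda>x. f x + g x) \<and> f \<in> fspan B \<and> g \<in> fspan C" if "v \<in> B" for v
      using that fspan_superset[OF assms(1)] z by (intro exI[of _ v] exI[of _ "\<lambda>_. 0"]) auto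
    moreover have "\<exists>f g. v = (\<lambda>x. f x + g x) \<and> f \<in> fspan B \<and> g \<in> fspan C" if "v \<in> C" for v
      using that fspan_superset[OF assms(2)] z by (intro exI[of _ "\<lambda>_. 0"] exI[of _ v]) auto
    ultimately show ?thesis by blast
  qed
  ultimately have "v \<in> {\<lambda>x. f x + g x | f g. f \<in> fspan B \<and> g \<in> fspan C}"
    using fspan_le assms(3) by blast
  thus ?thesis using that by blast
qed

lemma fspan_vanish: "v \<in> fspan B \<Longrightarrow> (\<And>g. g \<in> B \<Longrightarrow> g x = 0) \<Longrightarrow> v x = 0"
  by (auto simp: fspan_def intro!: sum.neutral)

text \<open>Test functions living before \<open>\<tau>\<close> say that the state at
  \<open>\<tau>\<close> belongs to the approximating plane there; those living after
  \<open>\<tau>\<close> give a problem on \<open>[\<tau>, s]\<close> with that state as initial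
  vector. The two halves overlap in one point, which integrals ignore.\<close>

lemma jacobi_approx_split:
  fixes X :: "real \<Rightarrow> 'e \<times> 'e::euclidean_space"
  assumes X: "ess_bdd 0 s X" and b: "ess_bdd 0 s b" and \<tau>: "0 \<le> \<tau>" "\<tau> \<le> s"
    and B1: "finite B1" "\<And>g. g \<in> B1 \<Longrightarrow> ess_bdd 0 s g" "\<And>g x. g \<in> B1 \<Longrightarrow> \<tau> < x \<Longrightarrow> g x = 0"
    and B2: "finite B2" "\<And>g. g \<in> B2 \<Longrightarrow> ess_bdd 0 s g" "\<And>g x. g \<in> B2 \<Longrightarrow> x \<le> \<tau> \<Longrightarrow> g x = 0"
    and z: "z \<in> jacobi_approx X b s (fspan (B1 \<union> B2))"
  obtains \<eta> v where "\<eta> \<in> jacobi_approx X b \<tau> (fspan B1)" "v \<in> fspan B2" "z = traj X \<tau> \<eta> v s"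
    "\<And>w. w \<in> fspan B2 \<Longrightarrow> jform X b \<tau> s \<eta> v w = 0"
proof -
  obtain \<eta>0 v0 where z0: "z = traj X 0 \<eta>0 v0 s" "\<eta>0 \<in> vertical" "v0 \<in> fspan (B1 \<union> B2)"
    "\<forall>w\<in>fspan (B1 \<union> B2). jform X b 0 s \<eta>0 v0 w = 0"
    using z unfolding jacobi_approx_eq by blast
  obtain f g where fg: "f \<in> fspan B1" "g \<in> fspan B2" "v0 = (\<lambda>x. f x + g x)"
    using fspan_Un[OF B1(1) B2(1) z0(3)] by blast
  have f0: "f x = 0" if "\<tau> < x" for x using fspan_vanish[OF fg(1)] B1(3) that by blast
  have g0: "g x = 0" if "x \<le> \<tau>" for x using fspan_vanish[OF fg(2)] B2(3) that by blast
  have fb: "ess_bdd 0 s f" and gb: "ess_bdd 0 s g" using fspan_ess_bdd B1(2) B2(2) fg by blast+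
  have v0: "ess_bdd 0 s v0" unfolding fg by (intro ess_bdd_add fb gb)
  note T = prim_traj[OF X b v0, of \<eta>0]
  have tr1: "traj X 0 \<eta>0 v0 t = traj X 0 \<eta>0 f t" if "t \<le> \<tau>" for t
    using that g0 by (intro traj_cong) (auto simp: fg)
  define \<eta> where "\<eta> = traj X 0 \<eta>0 f \<tau>"
  have tr2: "traj X 0 \<eta>0 v0 t = traj X \<tau> \<eta> g t" if "\<tau> \<le> t" "t \<le> s" for t
  proof -
    have "traj X 0 \<eta>0 v0 t = traj X 0 \<eta>0 v0 \<tau> + integral {\<tau>..t} (\<lambda>\<theta>. v0 \<theta> *\<^sub>R X \<theta>)"
      using prim_integral[OF T, of \<tau> t] that \<tau> by simp
    also have "integral {\<tau>..t} (\<lambda>\<theta>. v0 \<theta> *\<^sub>R X \<theta>) = integral {\<tau>..t} (\<lambda>\<theta>. g \<theta> *\<^sub>R X \<theta>)"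
      by (rule integral_spike[of "{\<tau>}"]) (use f0 in \<open>auto simp: fg\<close>)
    finally show ?thesis using tr1 by (simp add: traj_def[of X \<tau>] \<eta>_def)
  qed
  have split: "jform X b 0 s \<eta>0 v0 w = jform X b 0 \<tau> \<eta>0 f w + jform X b \<tau> s \<eta> g w" if w: "ess_bdd 0 s w" for w
  proof -
    let ?h = "\<lambda>t. sigma (traj X 0 \<eta>0 v0 t) (w t *\<^sub>R X t) + b t * v0 t * w t"
    have "jform X b 0 s \<eta>0 v0 w = integral {0..\<tau>} ?h + integral {\<tau>..s} ?h"
      unfolding jform_def using \<tau>
      by (intro Henstock_Kurzweil_Integration.integral_combine[symmetric] ess_bdd_integrable ess_bdd_jform[OF X b] v0 w)
    also have "integral {0..\<tau>} ?h = jform X b 0 \<tau> \<eta>0 f w"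
      unfolding jform_def by (intro integral_cong) (simp add: tr1, simp add: fg g0)
    also have "integral {\<tau>..s} ?h = jform X b \<tau> s \<eta> g w"
      unfolding jform_def by (rule integral_spike[of "{\<tau>}"], simp, simp add: tr2, simp add: fg f0)
    finally show ?thesis .
  qed
  have "\<eta> \<in> jacobi_approx X b \<tau> (fspan B1)"
    unfolding jacobi_approx_eq
  proof (intro CollectI exI conjI ballI)
    fix w assume w: "w \<in> fspan B1"
    have "w \<in> fspan (B1 \<union> B2)" using w fspan_mono[of "B1 \<union> B2" B1] B1 B2 by auto
    hence "jform X b 0 s \<eta>0 v0 w = 0" using z0 by blast
    moreover have "jform X b \<tau> s \<eta> g w = 0"
    proof -
      have "w x = 0" if "\<tau> < x" for x using fspan_vanish[OF w] B1(3) that by blast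
      hence "jform X b \<tau> s \<eta> g w = integral {\<tau>..s} (\<lambda>t. 0)"
        unfolding jform_def by (intro integral_spike[of "{\<tau>}"]) (auto simp: sigma.zero_right)
      thus ?thesis by simp
    qed
    ultimately show "jform X b 0 \<tau> \<eta>0 f w = 0" using split[OF fspan_ess_bdd[OF B1(2) w]] by simp
  qed (use \<eta>_def z0 fg in auto)
  moreover have "jform X b \<tau> s \<eta> g w = 0" if w: "w \<in> fspan B2" for w
  proof -
    have "w \<in> fspan (B1 \<union> B2)" using w fspan_mono[of "B1 \<union> B2" B2] B1 B2 by auto
    hence "jform X b 0 s \<eta>0 v0 w = 0" using z0 by blast
    moreover have "jform X b 0 \<tau> \<eta>0 f w = 0"
    proof -
      have "w x = 0" if "x \<le> \<tau>" for x using fspan_vanish[OF w] B2(3) that by blast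
      hence "jform X b 0 \<tau> \<eta>0 f w = integral {0..\<tau>} (\<lambda>t. 0)"
        unfolding jform_def by (intro integral_cong) (auto simp: sigma.zero_right)
      thus ?thesis by simp
    qed
    ultimately show ?thesis using split[OF fspan_ess_bdd[OF B2(2) w]] by simp
  qed
  ultimately show ?thesis using that[of \<eta> g] fg(2) tr2[of s] \<tau> z0(1) by auto
qed

text \<open>The part of the approximating subspace living on \<open>[0, \<tau>]\<close> may be chosen after the part
  living on \<open>(\<tau>, s]\<close>.\<close>

lemma jacobi_plane_refine:
  fixes X :: "real \<Rightarrow> 'e \<times> 'e::euclidean_space"
  assumes X: "ess_bdd 0 s X" and b: "ess_bdd 0 s b" and \<tau>: "0 \<le> \<tau>" "\<tau> \<le> s"
    and L: "is_jacobi_plane X b \<tau> L" and e: "e > 0"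
    and B0: "finite B0" "\<And>g. g \<in> B0 \<Longrightarrow> ess_bdd 0 s g"
    and B2: "finite B2" "\<And>g. g \<in> B2 \<Longrightarrow> ess_bdd 0 s g" "\<And>g x. g \<in> B2 \<Longrightarrow> x \<le> \<tau> \<Longrightarrow> g x = 0"
      "cut_gt \<tau> ` B0 \<subseteq> B2"
  obtains B \<Lambda> where "finite B" "\<And>g. g \<in> B \<Longrightarrow> ess_bdd 0 s g" "fspan B0 \<subseteq> fspan B"
    "subspace \<Lambda>" "\<And>x y. x \<in> \<Lambda> \<Longrightarrow> y \<in> \<Lambda> \<Longrightarrow> sigma x y = 0" "plane_dist \<Lambda> L < e"
    "\<And>z. z \<in> jacobi_approx X b s (fspan B) \<Longrightarrow> \<exists>\<eta>\<in>\<Lambda>. \<exists>v\<in>fspan B2. z = traj X \<tau> \<eta> v s \<and>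
       (\<forall>w\<in>fspan B2. jform X b \<tau> s \<eta> v w = 0)"
proof -
  have X\<tau>: "ess_bdd 0 \<tau> X" and b\<tau>: "ess_bdd 0 \<tau> b" and B0\<tau>: "\<And>g. g \<in> B0 \<Longrightarrow> ess_bdd 0 \<tau> g"
    using ess_bdd_subinterval[OF X, of 0 \<tau>] ess_bdd_subinterval[OF b, of 0 \<tau>] ess_bdd_subinterval[OF B0(2), of _ 0 \<tau>] \<tau> by auto
  obtain C where C: "finite C" "\<And>g. g \<in> C \<Longrightarrow> ess_bdd 0 \<tau> g"
    "plane_dist (jacobi_approx X b \<tau> (fspan (C \<union> B0))) L < e"
  \<comment> \<open>At time \<open>0\<close> every approximating plane is the vertical plane, and
    there is no net to follow.\<close>
  proof (cases "\<tau> = 0")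
    case True
    have "jacobi_approx X b \<tau> (fspan B0) = vertical"
    proof -
      have "(\<lambda>_. 0) \<in> fspan B0" using fclosed_fspan by (auto simp: fclosed_def)
      thus ?thesis unfolding jacobi_approx_eq True by (auto simp: traj_def jform_def)
    qed
    moreover have "L = vertical" using L True by (simp add: is_jacobi_plane_def)
    moreover have "plane_dist vertical (vertical :: ('e \<times> 'e) set) = 0"
      using onorm_zero by (simp add: plane_dist_def)
    ultimately show ?thesis using that[of "{}"] e by simp
  next
    case False
    hence "((\<lambda>V. plane_dist (jacobi_approx X b \<tau> V) L) \<longlongrightarrow> 0) (fin_dim_at_top \<tau>)"
      using L by (simp add: is_jacobi_plane_def)
    from fin_dim_at_top_tendsto_zero[OF this e] obtain C where C: "finite C" "\<And>g. g \<in> C \<Longrightarrow> ess_bdd 0 \<tau> g"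
      "\<And>B'. finite B' \<Longrightarrow> (\<And>g. g \<in> B' \<Longrightarrow> ess_bdd 0 \<tau> g) \<Longrightarrow> fspan C \<subseteq> fspan B' \<Longrightarrow>
         \<bar>plane_dist (jacobi_approx X b \<tau> (fspan B')) L\<bar> < e" by blast
    have "\<bar>plane_dist (jacobi_approx X b \<tau> (fspan (C \<union> B0))) L\<bar> < e"
      by (rule C(3)) (use C(1,2) B0 B0\<tau> fspan_mono[of "C \<union> B0" C] in auto)
    thus ?thesis using that[of C] C(1,2) by auto
  qed
  \<comment> \<open>Cutting at \<open>\<tau>\<close> leaves the approximating plane at
    \<open>\<tau>\<close> unchanged, while the cut functions of \<open>B0\<close> before and after
    \<open>\<tau>\<close> add up to those of \<open>B0\<close> again.\<close>
  define B1 where "B1 = cut_le \<tau> ` (C \<union> B0)"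
  define \<Lambda> where "\<Lambda> = jacobi_approx X b \<tau> (fspan (C \<union> B0))"
  have \<Lambda>: "\<Lambda> = jacobi_approx X b \<tau> (fspan B1)"
    unfolding \<Lambda>_def B1_def using C B0 by (intro jacobi_approx_cut[symmetric]) auto
  have B1: "finite B1" "\<And>g. g \<in> B1 \<Longrightarrow> ess_bdd 0 s g" "\<And>g x. g \<in> B1 \<Longrightarrow> \<tau> < x \<Longrightarrow> g x = 0"
    using C B0 B0\<tau> by (auto simp: B1_def cut_le_def[of \<tau>] intro!: ess_bdd_cut_le[unfolded cut_le_def])
  have CB: "\<And>g. g \<in> C \<union> B0 \<Longrightarrow> ess_bdd 0 \<tau> g" using C B0\<tau> by auto
  show ?thesis
  proof (rule that[of "B1 \<union> B2" \<Lambda>])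
    show "fspan B0 \<subseteq> fspan (B1 \<union> B2)"
    proof (intro fspan_le fclosed_fspan subsetI)
      fix g assume g: "g \<in> B0"
      have "cut_le \<tau> g \<in> B1" "cut_gt \<tau> g \<in> B2" using g B2(4) by (auto simp: B1_def)
      hence "cut_le \<tau> g \<in> fspan (B1 \<union> B2)" "cut_gt \<tau> g \<in> fspan (B1 \<union> B2)"
        using fspan_superset[of "B1 \<union> B2"] B1(1) B2(1) by auto
      hence "(\<lambda>x. cut_le \<tau> g x + cut_gt \<tau> g x) \<in> fspan (B1 \<union> B2)"
        using fclosed_fspan unfolding fclosed_def by blast
      also have "(\<lambda>x. cut_le \<tau> g x + cut_gt \<tau> g x) = g" by (auto simp: cut_le_def cut_gt_def)
      finally show "g \<in> fspan (B1 \<union> B2)" .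
    qed
    show "subspace \<Lambda>" unfolding \<Lambda>_def by (rule subspace_jacobi_approx[OF X\<tau> b\<tau> CB])
    show "sigma x y = 0" if "x \<in> \<Lambda>" "y \<in> \<Lambda>" for x y
      using isotropic_jacobi_approx[OF X\<tau> b\<tau> \<tau>(1) CB] that unfolding \<Lambda>_def by blast
    show "plane_dist \<Lambda> L < e" using C(3) by (simp add: \<Lambda>_def)
    show "\<exists>\<eta>\<in>\<Lambda>. \<exists>v\<in>fspan B2. z = traj X \<tau> \<eta> v s \<and> (\<forall>w\<in>fspan B2. jform X b \<tau> s \<eta> v w = 0)"
      if zz: "z \<in> jacobi_approx X b s (fspan (B1 \<union> B2))" for z
    proof -
      obtain \<eta> v where "\<eta> \<in> jacobi_approx X b \<tau> (fspan B1)" "v \<in> fspan B2" "z = traj X \<tau> \<eta> v s"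
        "\<And>w. w \<in> fspan B2 \<Longrightarrow> jform X b \<tau> s \<eta> v w = 0"
      proof (rule jacobi_approx_split[OF X b \<tau> B1(1) B1(2) _ B2(1) B2(2) _ zz])
        show "g x = 0" if "g \<in> B1" "\<tau> < x" for g x using B1(3) that by blast
        show "g x = 0" if "g \<in> B2" "x \<le> \<tau>" for g x using B2(3) that by blast
      qed (assumption | rule that)+
      thus ?thesis unfolding \<Lambda> by blast
    qed
  qed (use B1 B2 in auto)
qed

section \<open>The Goh transformation\<close>

lemma ess_bdd_norm: "ess_bdd a b f \<Longrightarrow> ess_bdd a b (\<lambda>x. norm (f x))"
  unfolding ess_bdd_def by auto

lemma ess_bdd_abs: "ess_bdd a b (f :: real \<Rightarrow> real) \<Longrightarrow> ess_bdd a b (\<lambda>x. \<bar>f x\<bar>)"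
  using ess_bdd_norm[of a b f] by simp

lemma ess_bdd_power2: "ess_bdd a b (f :: real \<Rightarrow> real) \<Longrightarrow> ess_bdd a b (\<lambda>x. (f x)\<^sup>2)"
  using ess_bdd_mult[of a b f f] by (simp add: power2_eq_square)

lemma integral_ess_bdd_le:
  assumes "ess_bdd a b f" "ess_bdd a b g" "\<And>x. x \<in> {a..b} \<Longrightarrow> f x \<le> (g x :: real)"
  shows "integral {a..b} f \<le> integral {a..b} g"
  using assms by (intro integral_le ess_bdd_integrable)

lemma integral_ess_bdd_nonneg:
  assumes "ess_bdd a b f" "\<And>x. x \<in> {a..b} \<Longrightarrow> 0 \<le> (f x :: real)"
  shows "0 \<le> integral {a..b} f"
  using assms by (intro integral_nonneg ess_bdd_integrable)

lemma integral_ess_bdd_norm_le: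
  assumes "ess_bdd a b f" "ess_bdd a b g" "\<And>x. x \<in> {a..b} \<Longrightarrow> norm (f x) \<le> (g x :: real)"
  shows "norm (integral {a..b} f) \<le> integral {a..b} g"
  using assms by (intro integral_norm_bound_integral ess_bdd_integrable)

lemma integral_ess_bdd_add:
  "ess_bdd a b f \<Longrightarrow> ess_bdd a b g \<Longrightarrow> integral {a..b} (\<lambda>x. f x + g x) = integral {a..b} f + integral {a..b} g"
  by (intro Henstock_Kurzweil_Integration.integral_add ess_bdd_integrable)

lemma integral_ess_bdd_diff:
  "ess_bdd a b f \<Longrightarrow> ess_bdd a b g \<Longrightarrow> integral {a..b} (\<lambda>x. f x - g x) = integral {a..b} f - integral {a..b} g"
  by (intro Henstock_Kurzweil_Integration.integral_diff ess_bdd_integrable)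

lemma integral_ess_bdd_sum:
  "(\<And>i. i \<in> I \<Longrightarrow> ess_bdd a b (f i)) \<Longrightarrow> integral {a..b} (\<lambda>x. \<Sum>i\<in>I. f i x) = (\<Sum>i\<in>I. integral {a..b} (f i))"
proof (induction I rule: infinite_finite_induct)
  case (insert x F)
  thus ?case by (simp add: integral_ess_bdd_add ess_bdd_sum)
qed auto

lemma integral_le_combine:
  assumes "ess_bdd a b f" "a \<le> c" "c \<le> d" "d \<le> b" "\<And>x. x \<in> {a..b} \<Longrightarrow> 0 \<le> (f x :: real)"
  shows "integral {c..d} f \<le> integral {a..b} f"
  using assms by (intro integral_subset_le ess_bdd_integrable ess_bdd_subinterval[OF assms(1)]) auto

section \<open>Terminal primitives and weighted inequalities\<close>

definition tailW :: "real \<Rightarrow> (real \<Rightarrow> real) \<Rightarrow> real \<Rightarrow> real" where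
  "tailW s v t = - integral {t..s} v"

lemma prim_tailW: "ess_bdd a s v \<Longrightarrow> prim a s (tailW s v) v"
  using prim_integral_right[of a s v 0] by (simp add: tailW_def[abs_def])

lemma tailW_end [simp]: "tailW s v s = 0"
  by (simp add: tailW_def)

lemma tailW_sum:
  assumes "\<And>g. g \<in> B \<Longrightarrow> ess_bdd a s g" "a \<le> t"
  shows "tailW s (\<lambda>x. \<Sum>g\<in>B. c g * g x) t = (\<Sum>g\<in>B. c g * tailW s g t)"
proof -
  have "integral {t..s} (\<lambda>x. \<Sum>g\<in>B. c g * g x) = (\<Sum>g\<in>B. integral {t..s} (\<lambda>x. c g * g x))"
    using assms by (intro integral_ess_bdd_sum ess_bdd_cmult) (auto intro: ess_bdd_subinterval[of a s _ t s])
  thus ?thesis by (simp add: tailW_def sum_negf)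
qed

lemma bilinear_sum_expand:
  fixes c :: "'i \<Rightarrow> real"
  shows "(\<Sum>i\<in>B. c i * f i) * (\<Sum>j\<in>B. c j * g j) = (\<Sum>i\<in>B. \<Sum>j\<in>B. c i * c j * (f i * g j))"
  by (simp add: sum_product mult_ac)

lemma inverse_sqrt_integral:
  assumes "\<tau> \<le> s"
  shows "((\<lambda>t. 1 / sqrt (t - \<tau>)) has_integral 2 * sqrt (s - \<tau>)) {\<tau>..s}"
proof -
  have "((\<lambda>t. 1 / sqrt (t - \<tau>)) has_integral 2 * sqrt (s - \<tau>) - 2 * sqrt (\<tau> - \<tau>)) {\<tau>..s}"
  proof (rule fundamental_theorem_of_calculus_interior[OF assms])
    fix t assume "t \<in> {\<tau><..<s}"
    hence "((\<lambda>t. 2 * sqrt (t - \<tau>)) has_real_derivative 1 / sqrt (t - \<tau>)) (at t)"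
      by (auto intro!: derivative_eq_intros simp: field_simps)
    thus "((\<lambda>t. 2 * sqrt (t - \<tau>)) has_vector_derivative 1 / sqrt (t - \<tau>)) (at t)"
      by (simp add: has_real_derivative_iff_has_vector_derivative)
  qed (intro continuous_intros)
  thus ?thesis by simp
qed

text \<open>The Cauchy-Schwarz inequality with the weights \<open>1 / sqrt (t - \<tau>)\<close> and
  \<open>sqrt (t - \<tau>)\<close>; the first integrates to \<open>2 * sqrt (s - \<tau>)\<close>. It
  is derived from the arithmetic-geometric mean with a free parameter \<open>l\<close>.\<close>

lemma integral_abs_square_le:
  assumes W: "continuous_on {\<tau>..s} W" and s: "\<tau> \<le> s"
  shows "(integral {\<tau>..s} (\<lambda>t. \<bar>W t\<bar>))\<^sup>2 \<le> 2 * sqrt (s - \<tau>) * integral {\<tau>..s} (\<lambda>t. sqrt (t - \<tau>) * (W t)\<^sup>2)"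
proof -
  define N where "N = integral {\<tau>..s} (\<lambda>t. \<bar>W t\<bar>)"
  define I where "I = integral {\<tau>..s} (\<lambda>t. sqrt (t - \<tau>) * (W t)\<^sup>2)"
  define y where "y = sqrt (s - \<tau>)"
  have intN: "(\<lambda>t. \<bar>W t\<bar>) integrable_on {\<tau>..s}"
    by (intro integrable_continuous_interval continuous_intros W)
  have intI: "(\<lambda>t. sqrt (t - \<tau>) * (W t)\<^sup>2) integrable_on {\<tau>..s}"
    by (intro integrable_continuous_interval continuous_intros W)
  have N0: "N \<ge> 0" unfolding N_def by (intro integral_nonneg intN) auto
  have I0: "I \<ge> 0" unfolding I_def by (intro integral_nonneg intI) auto
  have y0: "y \<ge> 0" by (simp add: y_def s)
  have est: "N \<le> l * y + I / (2 * l)" if l: "l > 0" for l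
  proof -
    have "N \<le> integral {\<tau>..s} (\<lambda>t. l / 2 * (1 / sqrt (t - \<tau>)) + 1 / (2 * l) * (sqrt (t - \<tau>) * (W t)\<^sup>2))"
      unfolding N_def
    proof -
      have "integral {\<tau>..s} (\<lambda>t. \<bar>W t\<bar>) = integral {\<tau>..s} (\<lambda>t. if t = \<tau> then 0 else \<bar>W t\<bar>)"
        by (rule integral_spike[of "{\<tau>}"]) auto
      also have "\<dots> \<le> integral {\<tau>..s} (\<lambda>t. l / 2 * (1 / sqrt (t - \<tau>)) + 1 / (2 * l) * (sqrt (t - \<tau>) * (W t)\<^sup>2))"
      proof (rule integral_le)
        show "(\<lambda>t. if t = \<tau> then 0 else \<bar>W t\<bar>) integrable_on {\<tau>..s}"
          by (rule integrable_spike[OF intN, of "{\<tau>}"]) auto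
        show "(\<lambda>t. l / 2 * (1 / sqrt (t - \<tau>)) + 1 / (2 * l) * (sqrt (t - \<tau>) * (W t)\<^sup>2)) integrable_on {\<tau>..s}"
          using inverse_sqrt_integral[OF s] by (intro integrable_add integrable_on_mult_right intI) blast
        fix t assume t: "t \<in> {\<tau>..s}"
        show "(if t = \<tau> then 0 else \<bar>W t\<bar>) \<le> l / 2 * (1 / sqrt (t - \<tau>)) + 1 / (2 * l) * (sqrt (t - \<tau>) * (W t)\<^sup>2)"
        proof (cases "t = \<tau>")
          case False
          define z where "z = sqrt (t - \<tau>)"
          have z: "z > 0" using False t by (simp add: z_def)
          have "0 \<le> (l - z * \<bar>W t\<bar>)\<^sup>2" by simp
          hence "2 * l * z * \<bar>W t\<bar> \<le> l\<^sup>2 + z\<^sup>2 * (W t)\<^sup>2" by (simp add: power2_diff power_mult_distrib)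
          hence "\<bar>W t\<bar> \<le> (l\<^sup>2 + z\<^sup>2 * (W t)\<^sup>2) / (2 * l * z)"
            using z l by (simp add: pos_le_divide_eq mult_ac)
          also have "\<dots> = l / 2 * (1 / z) + 1 / (2 * l) * (z * (W t)\<^sup>2)"
            using z l by (simp add: field_simps power2_eq_square)
          finally show ?thesis using False by (simp add: z_def)
        qed (use l in auto)
      qed
      finally show "integral {\<tau>..s} (\<lambda>t. \<bar>W t\<bar>)
          \<le> integral {\<tau>..s} (\<lambda>t. l / 2 * (1 / sqrt (t - \<tau>)) + 1 / (2 * l) * (sqrt (t - \<tau>) * (W t)\<^sup>2))" .
    qed
    also have "\<dots> = l * y + I / (2 * l)"
    proof (rule integral_unique)
      have "((\<lambda>t. l / 2 * (1 / sqrt (t - \<tau>)) + 1 / (2 * l) * (sqrt (t - \<tau>) * (W t)\<^sup>2)) has_integral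
         l / 2 * (2 * sqrt (s - \<tau>)) + 1 / (2 * l) * I) {\<tau>..s}"
        unfolding I_def
        by (intro has_integral_add has_integral_mult_right inverse_sqrt_integral s integrable_integral intI)
      thus "((\<lambda>t. l / 2 * (1 / sqrt (t - \<tau>)) + 1 / (2 * l) * (sqrt (t - \<tau>) * (W t)\<^sup>2)) has_integral l * y + I / (2 * l)) {\<tau>..s}"
        by (simp add: y_def)
    qed
    finally show ?thesis .
  qed
  have "N\<^sup>2 \<le> 2 * y * I"
  proof (cases "N = 0")
    case True thus ?thesis using I0 y0 by simp
  next
    case False
    hence N: "N > 0" using N0 by simp
    show ?thesis
    proof (cases "y = 0")
      case True
      have "N \<le> I / (2 * l)" if "l > 0" for l using est[OF that] True by simp
      from this[of "(I + 1) / N"] have "N \<le> I * N / (2 * (I + 1))" using N I0 by simp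
      also have "\<dots> \<le> N / 2" using N I0 by (simp add: field_simps)
      finally show ?thesis using N by simp
    next
      case False
      hence y: "y > 0" using y0 by simp
      \<comment> \<open>The parameter \<open>l = N / (2 * y)\<close> lets the first term take
        exactly half of \<open>N\<close>.\<close>
      have "N \<le> N / (2 * y) * y + I / (2 * (N / (2 * y)))" using N y by (intro est) auto
      hence "N \<le> N / 2 + I * y / N" using y N by simp
      hence "N / 2 \<le> I * y / N" by linarith
      hence "N / 2 * N \<le> I * y" using N by (simp add: pos_le_divide_eq)
      thus ?thesis by (simp add: power2_eq_square algebra_simps)
    qed
  qed
  thus ?thesis by (simp add: N_def I_def y_def)
qed

text \<open>\<open>1 / (t - \<tau>)\<close> fails to be integrable only logarithmically. Truncated
  at \<open>m\<close>, where \<open>ln ((s - \<tau>) / (m - \<tau>)) = 1 / \<delta>\<close>, and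
  scaled by \<open>\<delta>\<close>, it has mass one, and the weight \<open>t - \<tau>\<close> turns
  its square into \<open>\<delta>\<close> times itself. Unit mass thus costs arbitrarily little in
  this weighted norm.\<close>

lemma log_kernel:
  fixes \<tau> s \<delta> :: real
  assumes s: "\<tau> < s" and \<delta>: "\<delta> > 0"
  obtains w where "ess_bdd a s w" "\<And>t. t \<le> \<tau> \<Longrightarrow> w t = 0" "\<And>t. w t \<ge> 0" "integral {\<tau>..s} w = 1"
    "integral {\<tau>..s} (\<lambda>t. (t - \<tau>) * (w t)\<^sup>2) \<le> \<delta>"
proof -
  define m where "m = \<tau> + (s - \<tau>) * exp (- (1 / \<delta>))"
  define x where "x = (s - \<tau>) * exp (- (1 / \<delta>))"
  have "x \<le> s - \<tau>" unfolding x_def using s \<delta> by (intro mult_left_le) auto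
  hence "\<tau> + (s - \<tau>) * exp (- (1 / \<delta>)) \<le> s" unfolding x_def[symmetric] by linarith
  moreover have "0 < (s - \<tau>) * exp (- (1 / \<delta>))" using s by simp
  ultimately have m: "\<tau> < m" "m \<le> s" by (simp_all add: m_def)
  define k where "k = (\<lambda>t. \<delta> / (max t m - \<tau>))"
  define w where "w = (\<lambda>t. if t \<in> {m..} then k t else 0)"
  have k: "ess_bdd a s k" unfolding k_def using m
    by (intro ess_bdd_continuous continuous_intros) auto
  have w: "ess_bdd a s w" unfolding w_def by (rule ess_bdd_restrict[OF k]) simp
  have h: "((\<lambda>t. \<delta> / (t - \<tau>)) has_integral 1) {m..s}"
  proof -
    have "((\<lambda>t. \<delta> / (t - \<tau>)) has_integral \<delta> * ln (s - \<tau>) - \<delta> * ln (m - \<tau>)) {m..s}"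
    proof (rule fundamental_theorem_of_calculus[OF m(2)])
      fix t assume "t \<in> {m..s}"
      hence "((\<lambda>t. \<delta> * ln (t - \<tau>)) has_real_derivative \<delta> / (t - \<tau>)) (at t within {m..s})"
        using m by (auto intro!: derivative_eq_intros)
      thus "((\<lambda>t. \<delta> * ln (t - \<tau>)) has_vector_derivative \<delta> / (t - \<tau>)) (at t within {m..s})"
        by (simp add: has_real_derivative_iff_has_vector_derivative)
    qed
    also have "\<delta> * ln (s - \<tau>) - \<delta> * ln (m - \<tau>) = 1"
    proof -
      have "ln (m - \<tau>) = ln (s - \<tau>) + ln (exp (- (1 / \<delta>)))"
        using s by (subst ln_mult_pos[symmetric]) (auto simp: m_def)
      hence "ln (m - \<tau>) = ln (s - \<tau>) - 1 / \<delta>" by simp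
      thus ?thesis using \<delta> by (simp add: right_diff_distrib)
    qed
    finally show ?thesis .
  qed
  have wk: "w t = (if t \<in> {m..s} then \<delta> / (t - \<tau>) else 0)" if "t \<in> {\<tau>..s}" for t
    using that by (auto simp: w_def k_def)
  have i1: "(w has_integral 1) {\<tau>..s}"
  proof -
    have "((\<lambda>t. if t \<in> {m..s} then \<delta> / (t - \<tau>) else 0) has_integral 1) {\<tau>..s}"
      using h m by (subst has_integral_restrict) auto
    thus ?thesis using wk by (subst has_integral_cong[of _ w "\<lambda>t. if t \<in> {m..s} then \<delta> / (t - \<tau>) else 0"]) auto
  qed
  have "integral {\<tau>..s} (\<lambda>t. (t - \<tau>) * (w t)\<^sup>2) = integral {\<tau>..s} (\<lambda>t. \<delta> * w t)"
    by (rule integral_cong) (use m in \<open>auto simp: wk power2_eq_square\<close>)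
  also have "\<dots> = \<delta>" using i1 by (simp add: integral_unique)
  finally have "integral {\<tau>..s} (\<lambda>t. (t - \<tau>) * (w t)\<^sup>2) \<le> \<delta>" by simp
  moreover have "w t \<ge> 0" for t using m \<delta> by (auto simp: w_def k_def)
  moreover have "w t = 0" if "t \<le> \<tau>" for t using m that by (auto simp: w_def)
  ultimately show ?thesis using that w integral_unique[OF i1] by blast
qed

text \<open>The factor \<open>\<beta>\<close> records that \<open>b\<close> vanishes at
  \<open>\<tau>\<close> and supplies the weight \<open>(t - \<tau>) \<beta>^2\<close> without
  division. The Goh estimates use this much regularity and no analyticity.\<close>

locale jacobi_piece =
  fixes X X1 :: "real \<Rightarrow> 'e \<times> 'e::euclidean_space" and b \<beta> :: "real \<Rightarrow> real" and \<tau> r :: real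
  assumes r: "0 < r"
    and X: "\<And>t. t \<in> {\<tau>..\<tau> + r} \<Longrightarrow> (X has_vector_derivative X1 t) (at t within {\<tau>..\<tau> + r})"
    and X1: "continuous_on {\<tau>..\<tau> + r} X1"
    and \<beta>: "continuous_on {\<tau>..\<tau> + r} \<beta>"
    and b: "\<And>t. t \<in> {\<tau>..\<tau> + r} \<Longrightarrow> b t = (t - \<tau>) * \<beta> t"
begin

definition A :: "real \<Rightarrow> real" where "A t = sigma (X t) (X1 t)"

text \<open>The leading part, with opposite sign, of the form in the Goh variable
  \<open>W = tailW s v\<close>; \<open>energy_identity\<close> lists the remaining terms.\<close>

definition qform :: "real \<Rightarrow> (real \<Rightarrow> real) \<Rightarrow> real" where
  "qform s v = integral {\<tau>..s} (\<lambda>t. A t * (tailW s v t)\<^sup>2 - b t * (v t)\<^sup>2)"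

definition massW :: "real \<Rightarrow> (real \<Rightarrow> real) \<Rightarrow> real" where
  "massW s v = integral {\<tau>..s} (\<lambda>t. \<bar>tailW s v t\<bar>)"

lemma contX: "continuous_on {\<tau>..\<tau> + r} X"
  unfolding continuous_on_eq_continuous_within by (intro ballI) (rule has_vector_derivative_continuous, erule X)

lemma contA: "continuous_on {\<tau>..\<tau> + r} A"
  unfolding A_def[abs_def] by (intro sigma.continuous_on contX X1)

lemma contb: "continuous_on {\<tau>..\<tau> + r} b"
proof -
  have "continuous_on {\<tau>..\<tau> + r} (\<lambda>t. (t - \<tau>) * \<beta> t)" by (intro continuous_intros \<beta>)
  thus ?thesis by (rule continuous_on_eq) (simp add: b)
qed

lemma primX: "s \<le> \<tau> + r \<Longrightarrow> prim \<tau> s X X1"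
  using prim_subinterval[OF prim_C1[OF X X1]] by auto

lemma bdd_on: "continuous_on {\<tau>..\<tau> + r} f \<Longrightarrow> s \<le> \<tau> + r \<Longrightarrow> ess_bdd \<tau> s f"
  by (rule ess_bdd_continuous, erule continuous_on_subset) auto

lemmas bX = bdd_on[OF contX] and bX1 = bdd_on[OF X1] and bb = bdd_on[OF contb] and bA = bdd_on[OF contA]
  and b\<beta> = bdd_on[OF \<beta>]

lemma bW: "ess_bdd \<tau> s v \<Longrightarrow> ess_bdd \<tau> s (tailW s v)"
  by (rule ess_bdd_continuous, rule prim_continuous, rule prim_tailW)

lemma bid: "ess_bdd \<tau> s (\<lambda>t. t - c)"
  by (intro ess_bdd_continuous continuous_intros)

lemma X_bounds:
  obtains C where "C \<ge> 1" "\<And>t. t \<in> {\<tau>..\<tau> + r} \<Longrightarrow> norm (X t) \<le> C" "\<And>t. t \<in> {\<tau>..\<tau> + r} \<Longrightarrow> norm (X1 t) \<le> C"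
    "\<And>t. t \<in> {\<tau>..\<tau> + r} \<Longrightarrow> \<bar>A t\<bar> \<le> C"
proof -
  have bd: "\<exists>C. \<forall>t\<in>{\<tau>..\<tau> + r}. norm (f t) \<le> C" if "continuous_on {\<tau>..\<tau> + r} f" for f :: "real \<Rightarrow> 'z::real_normed_vector"
    using compact_imp_bounded[OF compact_continuous_image[OF that]] by (auto simp: bounded_iff)
  obtain C1 where C1: "\<forall>t\<in>{\<tau>..\<tau> + r}. norm (X t) \<le> C1" using bd[OF contX] by blast
  obtain C2 where C2: "\<forall>t\<in>{\<tau>..\<tau> + r}. norm (X1 t) \<le> C2" using bd[OF X1] by blast
  obtain C3 where C3: "\<forall>t\<in>{\<tau>..\<tau> + r}. norm (A t) \<le> C3" using bd[OF contA] by blast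
  show ?thesis
  proof (rule that[of "max 1 (max C1 (max C2 C3))"])
    show "norm (X t) \<le> max 1 (max C1 (max C2 C3))" if "t \<in> {\<tau>..\<tau> + r}" for t
      using bspec[OF C1 that] by (simp add: le_max_iff_disj)
    show "norm (X1 t) \<le> max 1 (max C1 (max C2 C3))" if "t \<in> {\<tau>..\<tau> + r}" for t
      using bspec[OF C2 that] by (simp add: le_max_iff_disj)
    show "\<bar>A t\<bar> \<le> max 1 (max C1 (max C2 C3))" if "t \<in> {\<tau>..\<tau> + r}" for t
      using bspec[OF C3 that] by (simp add: le_max_iff_disj)
  qed simp
qed

text \<open>Goh transformation: \<open>U\<close> removes the part of the trajectory that is not controlled by the
  primitive \<open>W\<close> of the variation.\<close>

definition U :: "real \<Rightarrow> 'e \<times> 'e \<Rightarrow> (real \<Rightarrow> real) \<Rightarrow> real \<Rightarrow> 'e \<times> 'e" where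
  "U s \<eta> v t = traj X \<tau> \<eta> v t - tailW s v t *\<^sub>R X t"

text \<open>The contribution \<open>v X\<close> cancels in the derivative and only \<open>W\<close>
  remains, however large \<open>v\<close> is.\<close>

lemma prim_U:
  assumes s: "s \<le> \<tau> + r" and v: "ess_bdd \<tau> s v"
  shows "prim \<tau> s (U s \<eta> v) (\<lambda>t. - (tailW s v t *\<^sub>R X1 t))"
proof -
  have "prim \<tau> s (\<lambda>t. traj X \<tau> \<eta> v t - tailW s v t *\<^sub>R X t) (\<lambda>t. v t *\<^sub>R X t - (v t *\<^sub>R X t + tailW s v t *\<^sub>R X1 t))"
    by (intro prim_diff prim_scaleR primX s prim_tailW v prim_traj[OF bX[OF s] bb[OF s] v])
  thus ?thesis by (rule prim_cong) (auto simp: U_def)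
qed

lemma bU: "s \<le> \<tau> + r \<Longrightarrow> ess_bdd \<tau> s v \<Longrightarrow> ess_bdd \<tau> s (U s \<eta> v)"
  by (rule ess_bdd_continuous, rule prim_continuous, rule prim_U)

text \<open>\<open>W\<close> vanishes at \<open>s\<close>, so \<open>U\<close> and the trajectory
  have the same end point, and \<open>U\<close> varies by at most a multiple of the mass of
  \<open>W\<close>.\<close>

lemma U_close:
  assumes s: "s \<le> \<tau> + r" and v: "ess_bdd \<tau> s v" and t: "t \<in> {\<tau>..s}"
    and C: "\<And>t. t \<in> {\<tau>..\<tau> + r} \<Longrightarrow> norm (X1 t) \<le> C"
  shows "norm (U s \<eta> v t - traj X \<tau> \<eta> v s) \<le> C * massW s v"
proof -
  have C0: "C \<ge> 0" using order_trans[OF norm_ge_zero C[of \<tau>]] r by (meson atLeastAtMost_iff le_add_same_cancel1 less_imp_le order_refl)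
  have sub: "{t..s} \<subseteq> {\<tau>..s}" using t by auto
  have "norm (traj X \<tau> \<eta> v s - U s \<eta> v t) = norm (integral {t..s} (\<lambda>t. - (tailW s v t *\<^sub>R X1 t)))"
    using prim_integral[OF prim_U[OF s v], of t s \<eta>] t by (simp add: U_def)
  also have "\<dots> \<le> integral {t..s} (\<lambda>t. C * \<bar>tailW s v t\<bar>)"
  proof (rule integral_ess_bdd_norm_le)
    show "ess_bdd t s (\<lambda>t. - (tailW s v t *\<^sub>R X1 t))"
      by (rule ess_bdd_subinterval[OF prim_ess_bdd[OF prim_U[OF s v]] sub])
    show "ess_bdd t s (\<lambda>t. C * \<bar>tailW s v t\<bar>)"
      by (rule ess_bdd_subinterval[OF ess_bdd_cmult[OF ess_bdd_abs[OF bW[OF v]]] sub])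
    fix x assume "x \<in> {t..s}"
    hence "norm (X1 x) \<le> C" using C t s by auto
    thus "norm (- (tailW s v x *\<^sub>R X1 x)) \<le> C * \<bar>tailW s v x\<bar>"
      by (simp add: mult.commute mult_right_mono)
  qed
  also have "\<dots> \<le> integral {\<tau>..s} (\<lambda>t. C * \<bar>tailW s v t\<bar>)"
    using t C0 by (intro integral_le_combine[of \<tau> s] ess_bdd_cmult ess_bdd_abs bW v) auto
  also have "\<dots> = C * massW s v" by (simp add: massW_def)
  finally show ?thesis by (simp add: norm_minus_commute)
qed

lemma massW_nonneg: "ess_bdd \<tau> s v \<Longrightarrow> 0 \<le> massW s v"
  unfolding massW_def by (intro integral_ess_bdd_nonneg ess_bdd_abs bW) auto

text \<open>The term with \<open>v\<close> disappears because \<open>sigma (X t) (X t) = 0\<close>;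
  inserting \<open>U + W X\<close> for the trajectory produces the coefficient
  \<open>A\<close>.\<close>

lemma prim_g:
  assumes s: "s \<le> \<tau> + r" and v: "ess_bdd \<tau> s v"
  shows "prim \<tau> s (\<lambda>t. sigma (traj X \<tau> \<eta> v t) (X t)) (\<lambda>t. sigma (U s \<eta> v t) (X1 t) + A t * tailW s v t)"
proof -
  have "prim \<tau> s (\<lambda>t. sigma (traj X \<tau> \<eta> v t) (X t)) (\<lambda>t. sigma (v t *\<^sub>R X t) (X t) + sigma (traj X \<tau> \<eta> v t) (X1 t))"
    by (intro prim_bilinear[OF bounded_bilinear_sigma] primX s prim_traj[OF bX[OF s] bb[OF s] v])
  thus ?thesis
  proof (rule prim_cong)
    fix t show "sigma (v t *\<^sub>R X t) (X t) + sigma (traj X \<tau> \<eta> v t) (X1 t) = sigma (U s \<eta> v t) (X1 t) + A t * tailW s v t"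
      by (simp add: U_def A_def sigma.scaleR_left sigma.diff_left)
  qed simp
qed

text \<open>Integration by parts of the product of \<open>W\<close> with the pairing of trajectory
  and \<open>X\<close>. The boundary term at \<open>s\<close> vanishes with \<open>W\<close>; the
  one at \<open>\<tau>\<close> couples \<open>W(\<tau>)\<close> to the initial vector.\<close>

lemma energy_identity:
  assumes s: "\<tau> \<le> s" "s \<le> \<tau> + r" and v: "ess_bdd \<tau> s v"
  shows "jform X b \<tau> s \<eta> v v = - qform s v - sigma \<eta> (X \<tau>) * tailW s v \<tau>
    - integral {\<tau>..s} (\<lambda>t. sigma (U s \<eta> v t) (X1 t) * tailW s v t)"
proof -
  let ?g = "\<lambda>t. sigma (traj X \<tau> \<eta> v t) (X t)" and ?W = "tailW s v"
  let ?k = "\<lambda>t. sigma (U s \<eta> v t) (X1 t)"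
  note bd = bW[OF v] bA[OF s(2)] bU[OF s(2) v] bX1[OF s(2)] bb[OF s(2)] bX[OF s(2)] v
    ess_bdd_continuous[OF prim_continuous[OF prim_g[OF s(2) v]]]
  have P: "prim \<tau> s (\<lambda>t. ?g t * ?W t) (\<lambda>t. (?k t + A t * ?W t) * ?W t + ?g t * v t)"
    by (intro prim_mult prim_g s(2) v prim_tailW)
  have 1: "integral {\<tau>..s} (\<lambda>t. (?k t + A t * ?W t) * ?W t + ?g t * v t) = - sigma \<eta> (X \<tau>) * ?W \<tau>"
    using prim_integral[OF P, of \<tau> s] s by simp
  have 2: "integral {\<tau>..s} (\<lambda>t. ?g t * v t + b t * (v t)\<^sup>2) = jform X b \<tau> s \<eta> v v"
    unfolding jform_def by (simp add: sigma.scaleR_right power2_eq_square mult.commute mult.left_commute)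
  have bk: "ess_bdd \<tau> s (\<lambda>t. ?k t * ?W t)"
    by (intro ess_bdd_mult ess_bdd_bilinear[OF bounded_bilinear_sigma] bd)
  have bq: "ess_bdd \<tau> s (\<lambda>t. A t * (?W t)\<^sup>2 - b t * (v t)\<^sup>2)"
    by (intro ess_bdd_diff ess_bdd_mult ess_bdd_power2 bd)
  have b2: "ess_bdd \<tau> s (\<lambda>t. ?g t * v t + b t * (v t)\<^sup>2)"
    by (intro ess_bdd_add ess_bdd_mult ess_bdd_power2 bd)
  have "integral {\<tau>..s} (\<lambda>t. (?k t + A t * ?W t) * ?W t + ?g t * v t) =
      integral {\<tau>..s} (\<lambda>t. (?k t * ?W t + (A t * (?W t)\<^sup>2 - b t * (v t)\<^sup>2)) + (?g t * v t + b t * (v t)\<^sup>2))"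
    by (intro integral_cong) (simp add: algebra_simps power2_eq_square)
  also have "\<dots> = integral {\<tau>..s} (\<lambda>t. ?k t * ?W t) + qform s v + integral {\<tau>..s} (\<lambda>t. ?g t * v t + b t * (v t)\<^sup>2)"
    unfolding qform_def by (subst integral_ess_bdd_add[OF ess_bdd_add[OF bk bq] b2], subst integral_ess_bdd_add[OF bk bq]) simp
  finally show ?thesis using 1 2 by simp
qed

lemma energy_bound:
  assumes s: "\<tau> \<le> s" "s \<le> \<tau> + r" and v: "ess_bdd \<tau> s v" and J: "jform X b \<tau> s \<eta> v v = 0"
    and C: "C \<ge> 1" "\<And>t. t \<in> {\<tau>..\<tau> + r} \<Longrightarrow> norm (X1 t) \<le> C"
  shows "qform s v \<le> \<bar>sigma \<eta> (X \<tau>)\<bar> * \<bar>tailW s v \<tau>\<bar>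
    + (norm (traj X \<tau> \<eta> v s) + C * massW s v) * C * massW s v"
proof -
  let ?Z = "norm (traj X \<tau> \<eta> v s) + C * massW s v"
  have "\<bar>integral {\<tau>..s} (\<lambda>t. sigma (U s \<eta> v t) (X1 t) * tailW s v t)\<bar> \<le> integral {\<tau>..s} (\<lambda>t. ?Z * C * \<bar>tailW s v t\<bar>)"
    unfolding real_norm_def[symmetric]
  proof (rule integral_ess_bdd_norm_le)
    show "ess_bdd \<tau> s (\<lambda>t. sigma (U s \<eta> v t) (X1 t) * tailW s v t)"
      by (intro ess_bdd_mult ess_bdd_bilinear[OF bounded_bilinear_sigma] bU bX1 bW s v)
    show "ess_bdd \<tau> s (\<lambda>t. ?Z * C * norm (tailW s v t))" by (intro ess_bdd_cmult ess_bdd_norm bW v)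
    fix t assume t: "t \<in> {\<tau>..s}"
    have "norm (U s \<eta> v t) \<le> ?Z"
      using U_close[OF s(2) v t C(2), of \<eta>] norm_triangle_sub[of "U s \<eta> v t" "traj X \<tau> \<eta> v s"] by linarith
    moreover have "norm (X1 t) \<le> C" using C t s by auto
    ultimately have "norm (U s \<eta> v t) * norm (X1 t) \<le> ?Z * C"
      using C(1) by (intro mult_mono) (auto intro: order_trans[OF norm_ge_zero])
    hence "\<bar>sigma (U s \<eta> v t) (X1 t)\<bar> \<le> ?Z * C" using sigma_le order_trans by blast
    thus "norm (sigma (U s \<eta> v t) (X1 t) * tailW s v t) \<le> ?Z * C * norm (tailW s v t)"
      by (simp add: abs_mult mult_right_mono)
  qed
  also have "\<dots> = ?Z * C * massW s v" by (simp add: massW_def)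
  finally have "\<bar>integral {\<tau>..s} (\<lambda>t. sigma (U s \<eta> v t) (X1 t) * tailW s v t)\<bar> \<le> ?Z * C * massW s v" .
  moreover have "- sigma \<eta> (X \<tau>) * tailW s v \<tau> \<le> \<bar>sigma \<eta> (X \<tau>)\<bar> * \<bar>tailW s v \<tau>\<bar>"
    by (metis abs_ge_self abs_minus_cancel abs_mult)
  ultimately show ?thesis using energy_identity[OF s v, of \<eta>] J by linarith
qed

lemma start_close:
  assumes s: "\<tau> \<le> s" "s \<le> \<tau> + r" and v: "ess_bdd \<tau> s v"
    and C: "\<And>t. t \<in> {\<tau>..\<tau> + r} \<Longrightarrow> norm (X1 t) \<le> C"
  shows "norm (\<eta> - tailW s v \<tau> *\<^sub>R X \<tau> - traj X \<tau> \<eta> v s) \<le> C * massW s v"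
  using U_close[OF s(2) v _ C, of \<tau> \<eta>] s by (simp add: U_def)

text \<open>A test function of unit mass reads off the value at \<open>\<tau>\<close> of the pairing
  of trajectory and \<open>X\<close>. The errors are the oscillation of this pairing, which
  \<open>prim_g\<close> bounds through \<open>W\<close> alone, and the term with \<open>b\<close>,
  which costs weighted norms of \<open>v\<close> and \<open>w\<close>.\<close>

lemma kernel_bound:
  assumes s: "\<tau> \<le> s" "s \<le> \<tau> + r" and v: "ess_bdd \<tau> s v" and w: "ess_bdd \<tau> s w"
    and J: "jform X b \<tau> s \<eta> v w = 0"
    and C: "C \<ge> 1" "\<And>t. t \<in> {\<tau>..\<tau> + r} \<Longrightarrow> norm (X1 t) \<le> C" "\<And>t. t \<in> {\<tau>..\<tau> + r} \<Longrightarrow> \<bar>A t\<bar> \<le> C"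
    and w1: "\<And>t. w t \<ge> 0" "integral {\<tau>..s} w = 1" "integral {\<tau>..s} (\<lambda>t. (t - \<tau>) * (w t)\<^sup>2) \<le> \<delta>\<^sup>2" "\<delta> > 0"
  shows "\<bar>sigma \<eta> (X \<tau>)\<bar> \<le> C * massW s v + (norm (traj X \<tau> \<eta> v s) + C * massW s v) * C * (s - \<tau>)
     + \<delta> / 2 * (integral {\<tau>..s} (\<lambda>t. (t - \<tau>) * (\<beta> t)\<^sup>2 * (v t)\<^sup>2) + 1)"
proof -
  let ?g = "\<lambda>t. sigma (traj X \<tau> \<eta> v t) (X t)" and ?W = "tailW s v"
  let ?k = "\<lambda>t. sigma (U s \<eta> v t) (X1 t)"
  let ?Z = "norm (traj X \<tau> \<eta> v s) + C * massW s v"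
  let ?M = "C * massW s v + ?Z * C * (s - \<tau>)"
  note bd = bW[OF v] bA[OF s(2)] bU[OF s(2) v] bX1[OF s(2)] bb[OF s(2)] bX[OF s(2)] v w b\<beta>[OF s(2)]
    ess_bdd_continuous[OF prim_continuous[OF prim_g[OF s(2) v]]]
  note P = prim_g[OF s(2) v, of \<eta>]
  have inc: "\<bar>?g t - ?g \<tau>\<bar> \<le> ?M" if t: "t \<in> {\<tau>..s}" for t
  proof -
    have "norm (?g t - ?g \<tau>) = norm (integral {\<tau>..t} (\<lambda>t. ?k t + A t * ?W t))"
      using prim_integral[OF P, of \<tau> t] t by simp
    also have "\<dots> \<le> integral {\<tau>..t} (\<lambda>x. ?Z * C + C * \<bar>?W x\<bar>)"
    proof (rule integral_ess_bdd_norm_le)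
      have sub: "{\<tau>..t} \<subseteq> {\<tau>..s}" using t by auto
      show "ess_bdd \<tau> t (\<lambda>t. ?k t + A t * ?W t)" by (rule ess_bdd_subinterval[OF prim_ess_bdd[OF P] sub])
      show "ess_bdd \<tau> t (\<lambda>x. ?Z * C + C * \<bar>?W x\<bar>)"
        by (rule ess_bdd_subinterval[OF _ sub]) (intro ess_bdd_add ess_bdd_const ess_bdd_cmult ess_bdd_abs bd)
      fix x assume x: "x \<in> {\<tau>..t}"
      hence xs: "x \<in> {\<tau>..s}" "x \<in> {\<tau>..\<tau> + r}" using t s by auto
      have "norm (U s \<eta> v x) \<le> ?Z"
        using U_close[OF s(2) v xs(1) C(2), of \<eta>] norm_triangle_sub[of "U s \<eta> v x" "traj X \<tau> \<eta> v s"] by linarith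
      hence "norm (U s \<eta> v x) * norm (X1 x) \<le> ?Z * C"
        using C(1) C(2)[OF xs(2)] by (intro mult_mono) (auto intro: order_trans[OF norm_ge_zero])
      hence "\<bar>?k x\<bar> \<le> ?Z * C" using sigma_le order_trans by blast
      moreover have "\<bar>A x * ?W x\<bar> \<le> C * \<bar>?W x\<bar>" using C(3)[OF xs(2)] by (simp add: abs_mult mult_right_mono)
      ultimately show "norm (?k x + A x * ?W x) \<le> ?Z * C + C * \<bar>?W x\<bar>" by simp
    qed
    also have "\<dots> \<le> integral {\<tau>..s} (\<lambda>x. ?Z * C + C * \<bar>?W x\<bar>)"
    proof (rule integral_le_combine)
      show "ess_bdd \<tau> s (\<lambda>x. ?Z * C + C * \<bar>?W x\<bar>)"
        by (rule ess_bdd_add[OF ess_bdd_const ess_bdd_cmult[OF ess_bdd_abs[OF bW[OF v]]]])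
      have "0 \<le> ?Z * C" using C(1) massW_nonneg[OF v] by (intro mult_nonneg_nonneg add_nonneg_nonneg) auto
      thus "0 \<le> ?Z * C + C * \<bar>?W x\<bar>" for x using C(1) by simp
    qed (use t in auto)
    also have "\<dots> = ?M"
      using s by (subst integral_ess_bdd_add[OF ess_bdd_const ess_bdd_cmult[OF ess_bdd_abs[OF bW[OF v]]]])
        (simp add: massW_def)
    finally show ?thesis by simp
  qed
  have M0: "0 \<le> ?M" using inc[of \<tau>] s by simp
  have gw: "ess_bdd \<tau> s (\<lambda>t. (?g t - ?g \<tau>) * w t)" "ess_bdd \<tau> s (\<lambda>t. b t * v t * w t)" "ess_bdd \<tau> s (\<lambda>t. ?g \<tau> * w t)"
    by (intro ess_bdd_mult ess_bdd_diff ess_bdd_const bd)+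
  have "0 = integral {\<tau>..s} (\<lambda>t. ?g \<tau> * w t + ((?g t - ?g \<tau>) * w t + b t * v t * w t))"
    using J unfolding jform_def by (simp add: sigma.scaleR_right algebra_simps)
  also have "\<dots> = ?g \<tau> + integral {\<tau>..s} (\<lambda>t. (?g t - ?g \<tau>) * w t) + integral {\<tau>..s} (\<lambda>t. b t * v t * w t)"
    using w1(2) gw by (simp add: integral_ess_bdd_add ess_bdd_add)
  finally have eq: "sigma \<eta> (X \<tau>) = - integral {\<tau>..s} (\<lambda>t. (?g t - ?g \<tau>) * w t) - integral {\<tau>..s} (\<lambda>t. b t * v t * w t)"
    by simp
  have e1: "\<bar>integral {\<tau>..s} (\<lambda>t. (?g t - ?g \<tau>) * w t)\<bar> \<le> ?M"
  proof -
    have "norm (integral {\<tau>..s} (\<lambda>t. (?g t - ?g \<tau>) * w t)) \<le> integral {\<tau>..s} (\<lambda>t. ?M * w t)"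
      by (rule integral_ess_bdd_norm_le[OF gw(1) ess_bdd_cmult[OF w]])
        (use inc w1(1) in \<open>auto simp: abs_mult intro!: mult_right_mono\<close>)
    thus ?thesis using w1(2) by simp
  qed
  have e2: "\<bar>integral {\<tau>..s} (\<lambda>t. b t * v t * w t)\<bar> \<le> \<delta> / 2 * (integral {\<tau>..s} (\<lambda>t. (t - \<tau>) * (\<beta> t)\<^sup>2 * (v t)\<^sup>2) + 1)"
  proof -
    let ?f = "\<lambda>t. (t - \<tau>) * (\<beta> t)\<^sup>2 * (v t)\<^sup>2" and ?h = "\<lambda>t. (t - \<tau>) * (w t)\<^sup>2"
    have fh: "ess_bdd \<tau> s ?f" "ess_bdd \<tau> s ?h" by (intro ess_bdd_mult ess_bdd_power2 bid bd)+
    have "norm (integral {\<tau>..s} (\<lambda>t. b t * v t * w t)) \<le> integral {\<tau>..s} (\<lambda>t. \<delta> / 2 * ?f t + 1 / (2 * \<delta>) * ?h t)"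
    proof (rule integral_ess_bdd_norm_le[OF gw(2)])
      show "ess_bdd \<tau> s (\<lambda>t. \<delta> / 2 * ?f t + 1 / (2 * \<delta>) * ?h t)" by (intro ess_bdd_add ess_bdd_cmult fh)
      fix t assume t: "t \<in> {\<tau>..s}"
      hence tt: "t \<in> {\<tau>..\<tau> + r}" "t - \<tau> \<ge> 0" using s by auto
      \<comment> \<open>Weighted arithmetic-geometric mean: the parameter \<open>\<delta>\<close>
        balances the small norm of \<open>w\<close> against the merely bounded norm of
        \<open>v\<close>.\<close>
      have "0 \<le> (t - \<tau>) * (\<delta> * \<bar>\<beta> t * v t\<bar> - \<bar>w t\<bar>)\<^sup>2" using tt by simp
      also have "\<dots> = \<delta>\<^sup>2 * ?f t + ?h t - 2 * \<delta> * ((t - \<tau>) * \<bar>\<beta> t * v t\<bar> * \<bar>w t\<bar>)"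
        by (simp add: power2_diff power_mult_distrib algebra_simps)
      also have "(t - \<tau>) * \<bar>\<beta> t * v t\<bar> * \<bar>w t\<bar> = \<bar>b t * v t * w t\<bar>" using tt by (simp add: b abs_mult)
      finally have "\<bar>b t * v t * w t\<bar> \<le> (\<delta>\<^sup>2 * ?f t + ?h t) / (2 * \<delta>)"
        using w1(4) by (simp add: pos_le_divide_eq mult_ac)
      also have "\<dots> = \<delta> / 2 * ?f t + 1 / (2 * \<delta>) * ?h t" using w1(4) by (simp add: field_simps power2_eq_square)
      finally show "norm (b t * v t * w t) \<le> \<delta> / 2 * ?f t + 1 / (2 * \<delta>) * ?h t" by simp
    qed
    also have "\<dots> = \<delta> / 2 * integral {\<tau>..s} ?f + 1 / (2 * \<delta>) * integral {\<tau>..s} ?h"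
      using fh by (simp only: integral_ess_bdd_add ess_bdd_cmult Henstock_Kurzweil_Integration.integral_mult_right)
    also have "1 / (2 * \<delta>) * integral {\<tau>..s} ?h \<le> 1 / (2 * \<delta>) * \<delta>\<^sup>2"
      using w1(3,4) by (intro mult_left_mono) auto
    also have "1 / (2 * \<delta>) * \<delta>\<^sup>2 = \<delta> / 2" using w1(4) by (simp add: power2_eq_square)
    finally show ?thesis by (simp add: algebra_simps)
  qed
  show ?thesis unfolding eq using e1 e2 by linarith
qed

end

section \<open>Coercive second variations\<close>

lemma eventually_mult_le:
  fixes k l :: real assumes "0 < l" shows "eventually (\<lambda>y. k * y \<le> l) (at_right 0)"
proof -
  have "((\<lambda>y. k * y) \<longlongrightarrow> k * 0) (at_right 0)" by (intro tendsto_intros)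
  hence "eventually (\<lambda>y. k * y < l) (at_right 0)" using assms by (intro order_tendstoD) auto
  thus ?thesis by eventually_elim simp
qed

lemma eventually_at_right_0_obtain:
  assumes "eventually P (at_right (0::real))" obtains y where "y > 0" "P y"
proof -
  have "eventually (\<lambda>y. P y \<and> y > 0) (at_right (0::real))"
    using assms eventually_at_right_less by (rule eventually_conj)
  thus ?thesis using that eventually_happens'[of "at_right (0::real)"] by auto
qed

lemma cut_gt_below: "x \<le> \<tau> \<Longrightarrow> cut_gt \<tau> v x = 0"
  by (simp add: cut_gt_def)

text \<open>The component \<open>p\<close> of \<open>x\<close> orthogonal to \<open>L\<close> is
  nonzero and reads off the coefficient \<open>k\<close>; then \<open>norm l\<close> follows from
  the triangle inequality.\<close>

lemma subspace_distance_bound: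
  fixes L :: "'a::euclidean_space set"
  assumes L: "subspace L" and x: "x \<notin> L"
  obtains D where "D > 0" "\<And>l k. l \<in> L \<Longrightarrow> norm l + \<bar>k\<bar> \<le> D * norm (l - k *\<^sub>R x)"
proof -
  define p where "p = x - closest_point L x"
  have cp: "closest_point L x \<in> L" "\<And>a. a \<in> L \<Longrightarrow> (x - closest_point L x) \<bullet> a = 0"
    using closest_point_subspace[OF L] by blast+
  have p0: "p \<noteq> 0" using x cp(1) by (auto simp: p_def)
  hence np: "norm p > 0" by simp
  have k: "\<bar>k\<bar> * norm p \<le> norm (l - k *\<^sub>R x)" if l: "l \<in> L" for l k
  proof -
    have "p \<bullet> l = 0" "p \<bullet> closest_point L x = 0" using cp l by (auto simp: p_def)
    moreover have "x = p + closest_point L x" by (simp add: p_def)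
    then have "p \<bullet> x = p \<bullet> p + p \<bullet> closest_point L x" by (metis inner_right_distrib)
    ultimately have "p \<bullet> (l - k *\<^sub>R x) = - k * (norm p)\<^sup>2"
      by (simp add: inner_diff_right power2_norm_eq_inner)
    hence "\<bar>k\<bar> * norm p * norm p = \<bar>p \<bullet> (l - k *\<^sub>R x)\<bar>" by (simp add: abs_mult power2_eq_square)
    also have "\<dots> \<le> norm p * norm (l - k *\<^sub>R x)" by (rule Cauchy_Schwarz_ineq2)
    finally have "norm p * (\<bar>k\<bar> * norm p) \<le> norm p * norm (l - k *\<^sub>R x)" by (simp add: mult_ac)
    thus ?thesis using np by simp
  qed
  show ?thesis
  proof (rule that[of "1 + (1 + norm x) / norm p"])
    show "0 < 1 + (1 + norm x) / norm p" using np by (simp add: add_pos_nonneg)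
    fix l k assume l: "l \<in> L"
    let ?n = "norm (l - k *\<^sub>R x)"
    have kb: "\<bar>k\<bar> \<le> ?n / norm p" using k[OF l] np by (simp add: pos_le_divide_eq)
    have "norm l \<le> ?n + norm (k *\<^sub>R x)" using norm_triangle_sub[of l "k *\<^sub>R x"] by linarith
    also have "\<dots> = ?n + \<bar>k\<bar> * norm x" by simp
    also have "\<dots> \<le> ?n + ?n / norm p * norm x" using kb by (intro add_left_mono mult_right_mono) auto
    finally have "norm l + \<bar>k\<bar> \<le> ?n + ?n / norm p * norm x + ?n / norm p" using kb by linarith
    also have "\<dots> = (1 + (1 + norm x) / norm p) * ?n" by (simp add: algebra_simps add_divide_distrib)
    finally show "norm l + \<bar>k\<bar> \<le> (1 + (1 + norm x) / norm p) * ?n" .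
  qed
qed

text \<open>Absorption. Here \<open>q\<close> is the form, \<open>N\<close> the mass of
  \<open>W\<close>, \<open>\<kappa>\<close> the modulus of \<open>W(\<tau>)\<close>,
  \<open>E\<close> the norm of the initial vector, \<open>g\<close> its pairing with
  \<open>X(\<tau>)\<close> and \<open>y = sqrt (s - \<tau>)\<close>. Each of
  \<open>g * \<kappa>\<close>, \<open>C * N\<close> and \<open>C^2 * N^2\<close> is at most
  \<open>q / 4\<close> plus a multiple of \<open>y\<close>, so \<open>q\<close> tends to 0 with
  \<open>y\<close>.\<close>

lemma energy_arith_inside:
  fixes q N \<kappa> E g C c y K \<epsilon> :: real
  assumes nn: "q \<ge> 0" "N \<ge> 0" "\<kappa> \<ge> 0" "\<epsilon> \<ge> 0" "C \<ge> 1" "c > 0" "y > 0" "K \<ge> 0"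
    and q: "q \<le> g * \<kappa> + (1 + C * N) * C * N" and N: "N\<^sup>2 \<le> 2 * y / c * q"
    and E: "E \<le> 1 + C * \<kappa> + C * N" and g: "g \<le> \<epsilon> * E" and K: "\<kappa>\<^sup>2 \<le> K * q"
    and small: "C\<^sup>2 * (2 * y / c) \<le> 1/4" "\<epsilon> * ((1 + 2 * C) * K + C) \<le> 1/4" "\<epsilon> \<le> y"
  shows "q \<le> 4 * (1 + 2 * C\<^sup>2 / c) * y"
proof -
  have CN: "C\<^sup>2 * N\<^sup>2 \<le> q / 4"
  proof -
    have "C\<^sup>2 * N\<^sup>2 \<le> C\<^sup>2 * (2 * y / c * q)" using N by (intro mult_left_mono) auto
    also have "\<dots> = C\<^sup>2 * (2 * y / c) * q" by simp
    also have "\<dots> \<le> 1/4 * q" using small(1) nn(1) by (rule mult_right_mono)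
    finally show ?thesis by simp
  qed
  have Nq: "N\<^sup>2 \<le> q"
  proof -
    have "1 * N\<^sup>2 \<le> C\<^sup>2 * N\<^sup>2" using nn(5) by (intro mult_right_mono) auto
    thus ?thesis using CN nn(1) by linarith
  qed
  have a1: "\<kappa> \<le> 1 + \<kappa>\<^sup>2" using sum_power2_ge_zero[of "\<kappa> - 1" 0] nn(3) by (simp add: power2_diff) 
  have a2: "N * \<kappa> \<le> N\<^sup>2 + \<kappa>\<^sup>2" using sum_squares_bound[of N \<kappa>] mult_nonneg_nonneg[OF nn(2,3)] by linarith
  have "g * \<kappa> \<le> \<epsilon> * E * \<kappa>" using g nn(3) by (rule mult_right_mono)
  also have "\<dots> \<le> \<epsilon> * (1 + C * \<kappa> + C * N) * \<kappa>"
    using E nn by (intro mult_right_mono mult_left_mono) auto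
  also have "\<dots> = \<epsilon> * (\<kappa> + C * \<kappa>\<^sup>2 + C * (N * \<kappa>))" by (simp add: algebra_simps power2_eq_square)
  also have "\<dots> \<le> \<epsilon> * ((1 + \<kappa>\<^sup>2) + C * \<kappa>\<^sup>2 + C * (N\<^sup>2 + \<kappa>\<^sup>2))"
    using a1 a2 nn by (intro mult_left_mono add_mono) auto
  also have "\<dots> = \<epsilon> * (1 + ((1 + 2 * C) * \<kappa>\<^sup>2 + C * N\<^sup>2))" by (simp add: algebra_simps)
  also have "\<dots> \<le> \<epsilon> * (1 + ((1 + 2 * C) * (K * q) + C * q))"
    using K Nq nn by (intro mult_left_mono add_mono) auto
  also have "\<dots> = \<epsilon> + \<epsilon> * ((1 + 2 * C) * K + C) * q" by (simp add: algebra_simps)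
  also have "\<dots> \<le> y + 1/4 * q" using small(2,3) nn(1) by (intro add_mono mult_right_mono) auto
  finally have g1: "g * \<kappa> \<le> y + q / 4" by simp
  have "C * N \<le> q / 4 + 2 * C\<^sup>2 * y / c"
  proof -
    have "0 \<le> (c * N - 4 * y * C)\<^sup>2" by simp
    hence "8 * y * c * (C * N) \<le> c\<^sup>2 * N\<^sup>2 + 16 * y\<^sup>2 * C\<^sup>2"
      by (simp add: power2_diff power_mult_distrib algebra_simps)
    also have "c\<^sup>2 * N\<^sup>2 \<le> c\<^sup>2 * (2 * y / c * q)" using N by (intro mult_left_mono) auto
    also have "c\<^sup>2 * (2 * y / c * q) = 2 * y * c * q" using nn by (simp add: power2_eq_square)
    finally have "8 * y * c * (C * N) \<le> 8 * y * c * (q / 4 + 2 * C\<^sup>2 * y / c)"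
      using nn by (simp add: algebra_simps power2_eq_square)
    thus ?thesis using nn by (simp add: mult_le_cancel_left)
  qed
  hence "q \<le> y + q / 4 + (q / 4 + 2 * C\<^sup>2 * y / c) + q / 4"
    using q g1 CN by (simp add: algebra_simps power2_eq_square)
  hence "q \<le> 4 * (y + 2 * C\<^sup>2 * y / c)" by simp
  also have "\<dots> = 4 * (1 + 2 * C\<^sup>2 / c) * y" by (simp add: algebra_simps)
  finally show ?thesis .
qed

text \<open>Now \<open>g\<close> is not small, but \<open>E\<close> and \<open>\<kappa>\<close> are
  bounded in terms of \<open>N\<close>. The part of \<open>g * \<kappa>\<close> quadratic in
  \<open>N\<close> is absorbed for small \<open>y\<close>; the outcome is a bound for
  \<open>q\<close>, without decay.\<close>

lemma energy_arith_outside: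
  fixes q N \<kappa> E g C c y D :: real
  assumes nn: "q \<ge> 0" "N \<ge> 0" "\<kappa> \<ge> 0" "E \<ge> 0" "C \<ge> 1" "c > 0" "y > 0" "D \<ge> 0"
    and q: "q \<le> g * \<kappa> + (1 + C * N) * C * N" and N: "N\<^sup>2 \<le> 2 * y / c * q"
    and E: "E + \<kappa> \<le> D * (1 + C * N)" and g: "g \<le> C * E"
    and small: "(2 * C * D\<^sup>2 + 2) * C\<^sup>2 * (2 * y / c) \<le> 1/2"
  shows "q \<le> 2 * (2 * C * D\<^sup>2 + 2)"
proof -
  let ?K = "2 * C * D\<^sup>2 + 2"
  have sq: "(1 + C * N)\<^sup>2 \<le> 2 * (1 + C\<^sup>2 * N\<^sup>2)"
    using zero_le_power2[of "1 - C * N"] by (simp add: power2_eq_square algebra_simps)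
  have "g * \<kappa> \<le> C * E * \<kappa>" using g nn(3) by (rule mult_right_mono)
  also have "\<dots> \<le> C * (D * (1 + C * N)) * (D * (1 + C * N))"
    using E nn by (intro mult_mono mult_left_mono) auto
  also have "\<dots> = C * D\<^sup>2 * (1 + C * N)\<^sup>2" by (simp add: power2_eq_square algebra_simps)
  also have "\<dots> \<le> C * D\<^sup>2 * (2 * (1 + C\<^sup>2 * N\<^sup>2))" using nn sq by (intro mult_left_mono) auto
  finally have 1: "g * \<kappa> \<le> 2 * C * D\<^sup>2 * (1 + C\<^sup>2 * N\<^sup>2)" by (simp add: algebra_simps)
  have "C * N \<le> 1 + C\<^sup>2 * N\<^sup>2" 
  proof -
    have "0 \<le> C * N" using nn by simp
    moreover have "2 * (C * N) \<le> 1 + C\<^sup>2 * N\<^sup>2"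
      using zero_le_power2[of "1 - C * N"] by (simp add: power2_diff power_mult_distrib)
    ultimately show ?thesis by linarith
  qed
  hence 2: "(1 + C * N) * C * N \<le> 2 * (1 + C\<^sup>2 * N\<^sup>2)" by (simp add: power2_eq_square algebra_simps)
  have "q \<le> ?K * (1 + C\<^sup>2 * N\<^sup>2)" using q 1 2 by (simp add: algebra_simps)
  also have "\<dots> = ?K + ?K * C\<^sup>2 * N\<^sup>2" by (simp add: algebra_simps)
  also have "?K * C\<^sup>2 * N\<^sup>2 \<le> ?K * C\<^sup>2 * (2 * y / c * q)" using N nn by (intro mult_left_mono) auto
  also have "\<dots> = ?K * C\<^sup>2 * (2 * y / c) * q" by simp
  also have "\<dots> \<le> 1/2 * q" using small nn(1) by (rule mult_right_mono)
  finally show ?thesis by simp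
qed

lemma quadratic_sum_expand:
  fixes k p q :: "'i \<Rightarrow> real"
  shows "(\<Sum>f\<in>B. \<Sum>g\<in>B. k f * k g * (x * (p f * p g) - y * (q f * q g))) =
    x * (\<Sum>g\<in>B. k g * p g)\<^sup>2 - y * (\<Sum>g\<in>B. k g * q g)\<^sup>2"
proof -
  have sq: "z * (\<Sum>g\<in>B. k g * h g)\<^sup>2 = (\<Sum>f\<in>B. \<Sum>g\<in>B. k f * k g * (z * (h f * h g)))" for z and h :: "'i \<Rightarrow> real"
  proof -
    have "z * (\<Sum>g\<in>B. k g * h g)\<^sup>2 = z * (\<Sum>f\<in>B. \<Sum>g\<in>B. k f * k g * (h f * h g))"
      by (simp only: power2_eq_square bilinear_sum_expand)
    also have "\<dots> = (\<Sum>f\<in>B. \<Sum>g\<in>B. k f * k g * (z * (h f * h g)))"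
      unfolding sum_distrib_left by (intro sum.cong refl) (simp add: mult_ac)
    finally show ?thesis .
  qed
  show ?thesis unfolding sq sum_subtractf[symmetric] right_diff_distrib ..
qed

text \<open>The weight \<open>sqrt (t - \<tau>)\<close> is the gain left over in the borderline case
  of Hardy's inequality, and its reciprocal is still integrable, so it controls the mass of
  \<open>W\<close>. The second inequality bounds the norm of \<open>v\<close> that occurs in
  \<open>kernel_bound\<close>.\<close>

locale coercive_piece = jacobi_piece +
  fixes c :: real
  assumes c: "0 < c"
    and coercive_W: "\<And>s v. \<tau> < s \<Longrightarrow> s \<le> \<tau> + r \<Longrightarrow> ess_bdd \<tau> s v \<Longrightarrow>
      c * integral {\<tau>..s} (\<lambda>t. sqrt (t - \<tau>) * (tailW s v t)\<^sup>2) \<le> qform s v"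
    and coercive_v: "\<And>s v. \<tau> < s \<Longrightarrow> s \<le> \<tau> + r \<Longrightarrow> ess_bdd \<tau> s v \<Longrightarrow>
      c * integral {\<tau>..s} (\<lambda>t. (t - \<tau>) * (\<beta> t)\<^sup>2 * (v t)\<^sup>2) \<le> qform s v"
begin

lemma contW: "ess_bdd \<tau> s v \<Longrightarrow> continuous_on {\<tau>..s} (tailW s v)"
  by (rule prim_continuous, rule prim_tailW)

lemma mass_square:
  assumes s: "\<tau> < s" "s \<le> \<tau> + r" and v: "ess_bdd \<tau> s v"
  shows "(massW s v)\<^sup>2 \<le> 2 * sqrt (s - \<tau>) / c * qform s v"
proof -
  let ?I = "integral {\<tau>..s} (\<lambda>t. sqrt (t - \<tau>) * (tailW s v t)\<^sup>2)"
  have "(massW s v)\<^sup>2 \<le> 2 * sqrt (s - \<tau>) * ?I"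
    unfolding massW_def by (rule integral_abs_square_le[OF contW[OF v]]) (use s in auto)
  also have "?I \<le> qform s v / c" using coercive_W[OF s v] c by (simp add: pos_le_divide_eq mult.commute)
  hence "2 * sqrt (s - \<tau>) * ?I \<le> 2 * sqrt (s - \<tau>) * (qform s v / c)"
    using s by (intro mult_left_mono) auto
  finally show ?thesis by simp
qed

lemma qform_nonneg:
  assumes s: "\<tau> < s" "s \<le> \<tau> + r" and v: "ess_bdd \<tau> s v"
  shows "0 \<le> qform s v"
proof -
  have "0 \<le> 2 * sqrt (s - \<tau>) / c * qform s v"
    using mass_square[OF s v] by (meson order_trans zero_le_power2)
  moreover have "0 < 2 * sqrt (s - \<tau>) / c" using s c by simp
  ultimately show ?thesis using mult_pos_neg[of "2 * sqrt (s - \<tau>) / c" "qform s v"] by linarith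
qed

text \<open>Uniformly in \<open>v\<close> there is no such bound, as variations like those of
  \<open>log_kernel\<close> show. On a finite-dimensional space it exists, since a vanishing form
  forces \<open>W = 0\<close>; the constant depends on the space.\<close>

lemma start_bound:
  assumes s: "\<tau> < s" "s \<le> \<tau> + r" and B: "finite B" "\<And>g. g \<in> B \<Longrightarrow> ess_bdd \<tau> s g"
  obtains K where "K \<ge> 0" "\<And>v. v \<in> fspan B \<Longrightarrow> (tailW s v \<tau>)\<^sup>2 \<le> K * qform s v"
proof -
  define h where "h = (\<lambda>f g t. A t * (tailW s f t * tailW s g t) - b t * (f t * g t))"
  define M where "M = (\<lambda>f g. if f \<in> B \<and> g \<in> B then integral {\<tau>..s} (h f g) else 0)"
  have bh: "ess_bdd \<tau> s (h f g)" if "f \<in> B" "g \<in> B" for f g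
    unfolding h_def using s that
    by (intro ess_bdd_diff ess_bdd_mult bA bb bW B(2)) auto
  have q: "qform s (\<lambda>x. \<Sum>g\<in>B. k g * g x) = (\<Sum>f\<in>B. \<Sum>g\<in>B. k f * k g * M f g)" for k
  proof -
    have W: "tailW s (\<lambda>x. \<Sum>g\<in>B. k g * g x) t = (\<Sum>g\<in>B. k g * tailW s g t)" if "\<tau> \<le> t" for t
      using tailW_sum[of B \<tau> s t k] B(2) that by blast
    have "qform s (\<lambda>x. \<Sum>g\<in>B. k g * g x) = integral {\<tau>..s} (\<lambda>t. \<Sum>f\<in>B. \<Sum>g\<in>B. k f * k g * h f g t)"
      unfolding qform_def
    proof (intro integral_cong)
      fix t assume t: "t \<in> {\<tau>..s}"
      show "A t * (tailW s (\<lambda>x. \<Sum>g\<in>B. k g * g x) t)\<^sup>2 - b t * (\<Sum>g\<in>B. k g * g t)\<^sup>2 = (\<Sum>f\<in>B. \<Sum>g\<in>B. k f * k g * h f g t)"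
        using t by (simp add: W h_def quadratic_sum_expand)
    qed
    also have "\<dots> = (\<Sum>f\<in>B. \<Sum>g\<in>B. integral {\<tau>..s} (\<lambda>t. k f * k g * h f g t))"
      by (subst integral_ess_bdd_sum, intro ess_bdd_sum ess_bdd_cmult bh, assumption, assumption,
          intro sum.cong refl integral_ess_bdd_sum ess_bdd_cmult bh, assumption, assumption)
    also have "\<dots> = (\<Sum>f\<in>B. \<Sum>g\<in>B. k f * k g * M f g)"
      by (intro sum.cong refl) (simp add: M_def)
    finally show ?thesis .
  qed
  have bk: "ess_bdd \<tau> s (\<lambda>x. \<Sum>g\<in>B. k g * g x)" for k
    by (intro ess_bdd_sum ess_bdd_cmult B(2))
  have Wt: "tailW s (\<lambda>x. \<Sum>g\<in>B. k g * g x) \<tau> = (\<Sum>g\<in>B. k g * tailW s g \<tau>)" for k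
    using tailW_sum[of B \<tau> s \<tau> k] B(2) by blast
  have "\<exists>K\<ge>0. \<forall>k. (\<Sum>g\<in>B. k g * tailW s g \<tau>)\<^sup>2 \<le> K * (\<Sum>f\<in>B. \<Sum>g\<in>B. k f * k g * M f g)"
  proof (rule psd_functional_bound[OF B(1)])
    show "M f g = M g f" for f g by (simp add: M_def h_def mult.commute)
    show "0 \<le> (\<Sum>f\<in>B. \<Sum>g\<in>B. k f * k g * M f g)" for k
      using qform_nonneg[OF s bk, of k] unfolding q .
    show "(\<Sum>g\<in>B. k g * tailW s g \<tau>) = 0" if "(\<Sum>f\<in>B. \<Sum>g\<in>B. k f * k g * M f g) = 0" for k
    proof -
      let ?v = "\<lambda>x. \<Sum>g\<in>B. k g * g x"
      have "(massW s ?v)\<^sup>2 \<le> 0" using mass_square[OF s bk, of k] that unfolding q by simp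
      hence "integral {\<tau>..s} (\<lambda>t. \<bar>tailW s ?v t\<bar>) = 0" by (simp add: massW_def)
      hence "\<bar>tailW s ?v \<tau>\<bar> = 0"
      proof -
        have "continuous_on {\<tau>..s} (\<lambda>t. \<bar>tailW s ?v t\<bar>)" by (rule continuous_on_rabs[OF contW[OF bk]])
        hence "\<forall>t\<in>{\<tau>..s}. \<bar>tailW s ?v t\<bar> = 0"
          using integral_eq_0_iff[of \<tau> s "\<lambda>t. \<bar>tailW s ?v t\<bar>"] s(1) \<open>integral {\<tau>..s} (\<lambda>t. \<bar>tailW s ?v t\<bar>) = 0\<close> by simp
        thus ?thesis using s by simp
      qed
      thus ?thesis by (simp add: Wt)
    qed
  qed
  then obtain K where K: "K \<ge> 0" "\<And>k. (\<Sum>g\<in>B. k g * tailW s g \<tau>)\<^sup>2 \<le> K * (\<Sum>f\<in>B. \<Sum>g\<in>B. k f * k g * M f g)" by blast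
  show ?thesis
  proof (rule that[OF K(1)])
    fix v assume "v \<in> fspan B"
    then obtain k where "v = (\<lambda>x. \<Sum>g\<in>B. k g * g x)" by (auto simp: fspan_def)
    thus "(tailW s v \<tau>)\<^sup>2 \<le> K * qform s v" using K(2)[of k] by (simp only: Wt q)
  qed
qed

text \<open>By \<open>start_close\<close> the end point is
  \<open>\<eta> - W(\<tau>) X(\<tau>)\<close> up to the mass of \<open>W\<close>. For
  \<open>y\<close> orthogonal to \<open>X(\<tau>)\<close> the uncontrolled value
  \<open>W(\<tau>)\<close> drops out.\<close>

lemma end_pairings:
  assumes s: "\<tau> \<le> s" "s \<le> \<tau> + r" and v: "ess_bdd \<tau> s v"
    and C: "\<And>t. t \<in> {\<tau>..\<tau> + r} \<Longrightarrow> norm (X1 t) \<le> C"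
  shows "\<bar>sigma (traj X \<tau> \<eta> v s) y\<bar> \<le> \<bar>sigma \<eta> y\<bar> + \<bar>tailW s v \<tau>\<bar> * \<bar>sigma (X \<tau>) y\<bar> + C * massW s v * norm y"
proof -
  let ?R = "\<eta> - tailW s v \<tau> *\<^sub>R X \<tau> - traj X \<tau> \<eta> v s"
  have "sigma (traj X \<tau> \<eta> v s) y = sigma \<eta> y - tailW s v \<tau> * sigma (X \<tau>) y - sigma ?R y"
    by (simp add: sigma.diff_left sigma.scaleR_left)
  moreover have "\<bar>sigma ?R y\<bar> \<le> C * massW s v * norm y"
    using sigma_le[of ?R y] mult_right_mono[OF start_close[OF s v C, of \<eta>], of "norm y"] by simp
  moreover have "\<bar>tailW s v \<tau> * sigma (X \<tau>) y\<bar> = \<bar>tailW s v \<tau>\<bar> * \<bar>sigma (X \<tau>) y\<bar>" by (rule abs_mult)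
  ultimately show ?thesis by linarith
qed


end

context coercive_piece
begin

text \<open>All vectors of a suitable approximating plane are almost \<open>\<sigma>\<close>-orthogonal to \<open>X \<tau>\<close> and to
  \<open>L \<inter> (X \<tau>)\<^sup>\<angle>\<close>. If \<open>X \<tau> \<in> L\<close>, the part of the approximating subspace before \<open>\<tau>\<close> has to be
  refined depending on the part after \<open>\<tau>\<close>; otherwise a logarithmic kernel is adjoined.\<close>

lemma coercive_refinement_inside:
  assumes \<tau>: "0 \<le> \<tau>" and glob: "\<And>s. s \<le> \<tau> + r \<Longrightarrow> ess_bdd 0 s X" "\<And>s. s \<le> \<tau> + r \<Longrightarrow> ess_bdd 0 s b"
    and L: "lagrangian_plane L" "is_jacobi_plane X b \<tau> L" and XL: "X \<tau> \<in> L" and d: "d \<in> L"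
    and e: "e > 0"
  shows "\<exists>S>0. S \<le> r \<and> (\<forall>s. \<tau> < s \<and> s \<le> \<tau> + S \<longrightarrow> (\<forall>B0 :: (real \<Rightarrow> real) set. finite B0 \<and> (\<forall>g\<in>B0. ess_bdd 0 s g) \<longrightarrow>
    (\<exists>B. finite B \<and> (\<forall>g\<in>B. ess_bdd 0 s g) \<and> fspan B0 \<subseteq> fspan B \<and>
      (\<forall>z\<in>jacobi_approx X b s (fspan B). norm z = 1 \<longrightarrow> \<bar>sigma z (X \<tau>)\<bar> \<le> e \<and> \<bar>sigma z d\<bar> \<le> e))))"
proof -
  obtain C where C: "C \<ge> 1" "\<And>t. t \<in> {\<tau>..\<tau> + r} \<Longrightarrow> norm (X t) \<le> C" "\<And>t. t \<in> {\<tau>..\<tau> + r} \<Longrightarrow> norm (X1 t) \<le> C"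
    "\<And>t. t \<in> {\<tau>..\<tau> + r} \<Longrightarrow> \<bar>A t\<bar> \<le> C" by (rule X_bounds) blast
  define D where "D = 1 + C + norm d"
  have D: "D \<ge> 1" "norm d \<le> D" "norm (X \<tau>) \<le> D" "C \<le> D"
    using C(1) C(2)[of \<tau>] r by (auto simp: D_def intro: add_increasing2 add_increasing)
  \<comment> \<open>The factor of \<open>y\<close> in \<open>energy_arith_inside\<close>. Below,
    \<open>\<nu>\<close> is the mass of \<open>W\<close> that the final pairings tolerate.\<close>
  define Q0 where "Q0 = 4 * (1 + 2 * C\<^sup>2 / c)"
  have Q0: "Q0 > 0" unfolding Q0_def using c by (intro mult_pos_pos add_pos_nonneg) auto
  define \<nu> where "\<nu> = min 1 (e / (2 * C * D))"
  have CD: "C * D > 0" using C(1) D(1) by auto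
  have \<nu>: "\<nu> > 0" "\<nu> \<le> 1" "C * D * \<nu> \<le> e / 2"
  proof -
    show "\<nu> > 0" using e CD by (simp add: \<nu>_def mult.assoc)
    show "\<nu> \<le> 1" by (simp add: \<nu>_def)
    have "\<nu> \<le> e / (2 * (C * D))" by (simp add: \<nu>_def mult.assoc)
    thus "C * D * \<nu> \<le> e / 2" using CD by (simp add: pos_le_divide_eq mult_ac)
  qed
  have "eventually (\<lambda>y. 0 < y \<and> 1 * y \<le> 1 \<and> (C\<^sup>2 * (2 / c)) * y \<le> 1/4 \<and> (2 / c * Q0) * y \<le> \<nu>\<^sup>2 \<and> 1 * y \<le> sqrt r) (at_right 0)"
    using \<nu> r by (intro eventually_conj eventually_mult_le eventually_at_right_less) auto
  then obtain y0 where y0: "y0 > 0" and ysmall: "\<And>y. 0 < y \<Longrightarrow> y < y0 \<Longrightarrow>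
      1 * y \<le> 1 \<and> (C\<^sup>2 * (2 / c)) * y \<le> 1/4 \<and> (2 / c * Q0) * y \<le> \<nu>\<^sup>2 \<and> 1 * y \<le> sqrt r"
    unfolding eventually_at_right_field by auto
  define S where "S = min r ((y0 / 2)\<^sup>2)"
  have S: "S > 0" "S \<le> r" using y0 r by (auto simp: S_def)
  show ?thesis
  proof (intro exI[of _ S] conjI allI impI S)
    fix s and B0 :: "(real \<Rightarrow> real) set" assume s0: "\<tau> < s \<and> s \<le> \<tau> + S" and B0: "finite B0 \<and> (\<forall>g\<in>B0. ess_bdd 0 s g)"
    hence s: "\<tau> < s" "\<tau> \<le> s" "s \<le> \<tau> + r" using S by auto
    define y where "y = sqrt (s - \<tau>)"
    have "y \<le> sqrt ((y0 / 2)\<^sup>2)" unfolding y_def using s0 by (intro real_sqrt_le_mono) (simp add: S_def min_def split: if_splits)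
    also have "\<dots> = y0 / 2" using y0 by simp
    finally have y: "0 < y" "y < y0" using y0 s by (auto simp: y_def)
    note ys = ysmall[OF y]
    define B2 where "B2 = cut_gt \<tau> ` B0"
    have B2: "finite B2" "\<And>g. g \<in> B2 \<Longrightarrow> ess_bdd 0 s g" "\<And>g x. g \<in> B2 \<Longrightarrow> x \<le> \<tau> \<Longrightarrow> g x = 0"
      using B0 by (auto simp: B2_def cut_gt_below intro: ess_bdd_cut_gt)
    have B2\<tau>: "\<And>g. g \<in> B2 \<Longrightarrow> ess_bdd \<tau> s g" using ess_bdd_subinterval[OF B2(2)] \<tau> by auto
    \<comment> \<open>\<open>K\<close> belongs to the variations after \<open>\<tau>\<close>; the
      accuracy \<open>\<epsilon>\<close> of the plane at \<open>\<tau>\<close> can be fixed only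
      now.\<close>
    obtain K where K: "K \<ge> 0" "\<And>v. v \<in> fspan B2 \<Longrightarrow> (tailW s v \<tau>)\<^sup>2 \<le> K * qform s v"
      by (rule start_bound[OF s(1,3) B2(1) B2\<tau>]) auto
    \<comment> \<open>Bounds the initial vector: the modulus of \<open>W(\<tau>)\<close> is at most
      \<open>1 + K * Q0\<close>, because a number is at most one plus its square, and the mass of
      \<open>W\<close> is at most 1.\<close>
    define E0 where "E0 = 1 + C * (1 + K * Q0) + C"
    have E0: "E0 > 0" unfolding E0_def using C(1) K Q0 by (intro add_pos_nonneg mult_nonneg_nonneg) auto
    have "eventually (\<lambda>\<epsilon>. 0 < \<epsilon> \<and> (D * ((1 + 2 * C) * K + C)) * \<epsilon> \<le> 1/4 \<and> D * \<epsilon> \<le> y \<and> (D * E0) * \<epsilon> \<le> e / 2) (at_right 0)"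
      using y e by (intro eventually_conj eventually_mult_le eventually_at_right_less) auto
    then obtain \<epsilon> where \<epsilon>: "\<epsilon> > 0" "(D * ((1 + 2 * C) * K + C)) * \<epsilon> \<le> 1/4" "D * \<epsilon> \<le> y" "(D * E0) * \<epsilon> \<le> e / 2"
      by (rule eventually_at_right_0_obtain) auto
    obtain B \<Lambda> where B: "finite B" "\<And>g. g \<in> B \<Longrightarrow> ess_bdd 0 s g" "fspan B0 \<subseteq> fspan B"
      and \<Lambda>: "subspace \<Lambda>" "\<And>x y. x \<in> \<Lambda> \<Longrightarrow> y \<in> \<Lambda> \<Longrightarrow> sigma x y = 0" "plane_dist \<Lambda> L < \<epsilon>"
      and z: "\<And>z. z \<in> jacobi_approx X b s (fspan B) \<Longrightarrow> \<exists>\<eta>\<in>\<Lambda>. \<exists>v\<in>fspan B2. z = traj X \<tau> \<eta> v s \<and>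
       (\<forall>w\<in>fspan B2. jform X b \<tau> s \<eta> v w = 0)"
    proof -
      assume *: "\<And>B \<Lambda>. finite B \<Longrightarrow> (\<And>g. g \<in> B \<Longrightarrow> ess_bdd 0 s g) \<Longrightarrow> fspan B0 \<subseteq> fspan B \<Longrightarrow>
        subspace \<Lambda> \<Longrightarrow> (\<And>x y. x \<in> \<Lambda> \<Longrightarrow> y \<in> \<Lambda> \<Longrightarrow> sigma x y = 0) \<Longrightarrow> plane_dist \<Lambda> L < \<epsilon> \<Longrightarrow>
        (\<And>z. z \<in> jacobi_approx X b s (fspan B) \<Longrightarrow> \<exists>\<eta>\<in>\<Lambda>. \<exists>v\<in>fspan B2. z = traj X \<tau> \<eta> v s \<and>
          (\<forall>w\<in>fspan B2. jform X b \<tau> s \<eta> v w = 0)) \<Longrightarrow> thesis"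
      show thesis
      proof (rule jacobi_plane_refine[OF glob(1)[OF s(3)] glob(2)[OF s(3)] \<tau> s(2) L(2) \<epsilon>(1) _ _ B2(1) B2(2)])
      show "finite B0" using B0 by blast
      show "ess_bdd 0 s g" if "g \<in> B0" for g using B0 that by blast
      show "g x = 0" if "g \<in> B2" "x \<le> \<tau>" for g x using that by (rule B2(3))
      show "cut_gt \<tau> ` B0 \<subseteq> B2" by (auto simp: B2_def)
      qed (assumption | fact *)+
    qed
    \<comment> \<open>\<open>\<Lambda>\<close> is isotropic and close to \<open>L\<close>, hence
      almost orthogonal to \<open>L\<close>. This includes \<open>X \<tau>\<close>, which lies in
      \<open>L\<close> here.\<close>
    have near: "\<bar>sigma \<eta> x\<bar> \<le> D * \<epsilon> * norm \<eta>" if "\<eta> \<in> \<Lambda>" "x \<in> L" "norm x \<le> D" for \<eta> x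
    proof -
      note h = that
      obtain x' where x': "x' \<in> \<Lambda>" "norm (x - x') \<le> plane_dist L \<Lambda> * norm x"
        using plane_dist_nearby[OF lagrangian_subspace[OF L(1)] \<Lambda>(1) h(2)] by blast
      have "plane_dist L \<Lambda> * norm x \<le> \<epsilon> * D"
        using \<Lambda>(3) that(3) \<epsilon>(1) plane_dist_commute[of L \<Lambda>] by (intro mult_mono) auto
      hence n: "norm (x - x') \<le> \<epsilon> * D" using x'(2) by linarith
      have "sigma \<eta> x = sigma \<eta> (x - x')" using \<Lambda>(2)[OF that(1) x'(1)] by (simp add: sigma.diff_right)
      hence "\<bar>sigma \<eta> x\<bar> \<le> norm \<eta> * norm (x - x')" using sigma_le by simp
      also have "\<dots> \<le> norm \<eta> * (\<epsilon> * D)" using n by (intro mult_left_mono) auto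
      finally show ?thesis by (simp add: mult_ac)
    qed
    have main: "\<bar>sigma z (X \<tau>)\<bar> \<le> e \<and> \<bar>sigma z d\<bar> \<le> e" if zz: "z \<in> jacobi_approx X b s (fspan B)" "norm z = 1" for z
    proof -
      obtain \<eta> v where \<eta>: "\<eta> \<in> \<Lambda>" and v: "v \<in> fspan B2" and zt: "z = traj X \<tau> \<eta> v s"
        and J: "\<forall>w\<in>fspan B2. jform X b \<tau> s \<eta> v w = 0" using z[OF zz(1)] by blast
      have bv: "ess_bdd \<tau> s v" using fspan_ess_bdd[OF B2\<tau> v] .
      let ?q = "qform s v" and ?N = "massW s v" and ?k = "\<bar>tailW s v \<tau>\<bar>"
      have N0: "?N \<ge> 0" by (rule massW_nonneg[OF bv])
      have q0: "?q \<ge> 0" by (rule qform_nonneg[OF s(1,3) bv])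
      have Nq: "?N\<^sup>2 \<le> 2 * y / c * ?q" using mass_square[OF s(1,3) bv] by (simp add: y_def)
      have kq: "?k\<^sup>2 \<le> K * ?q" using K(2)[OF v] by simp
      have E: "norm \<eta> \<le> 1 + C * ?k + C * ?N"
      proof -
        have "norm \<eta> \<le> norm (traj X \<tau> \<eta> v s) + norm (tailW s v \<tau> *\<^sub>R X \<tau>) + norm (\<eta> - tailW s v \<tau> *\<^sub>R X \<tau> - traj X \<tau> \<eta> v s)"
          using norm_triangle_ineq[of "traj X \<tau> \<eta> v s + tailW s v \<tau> *\<^sub>R X \<tau>" "\<eta> - tailW s v \<tau> *\<^sub>R X \<tau> - traj X \<tau> \<eta> v s"]
            norm_triangle_ineq[of "traj X \<tau> \<eta> v s" "tailW s v \<tau> *\<^sub>R X \<tau>"] by (simp add: algebra_simps)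
        moreover have "norm (tailW s v \<tau> *\<^sub>R X \<tau>) \<le> C * ?k"
          using C(2)[of \<tau>] r mult_right_mono[of "norm (X \<tau>)" C ?k] by (simp add: mult.commute)
        moreover have "norm (\<eta> - tailW s v \<tau> *\<^sub>R X \<tau> - traj X \<tau> \<eta> v s) \<le> C * ?N"
          by (rule start_close[OF s(2,3) bv C(3)])
        ultimately show ?thesis using zz(2) zt by simp
      qed
      have g: "\<bar>sigma \<eta> (X \<tau>)\<bar> \<le> D * \<epsilon> * norm \<eta>" by (rule near[OF \<eta> XL D(3)])
      have q: "?q \<le> \<bar>sigma \<eta> (X \<tau>)\<bar> * ?k + (1 + C * ?N) * C * ?N"
        using energy_bound[OF s(2,3) bv _ C(1) C(3), of \<eta>] J v zz(2) zt by simp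
      have "?q \<le> 4 * (1 + 2 * C\<^sup>2 / c) * y"
      proof (rule energy_arith_inside[OF q0 N0 _ _ C(1) c y(1) K(1) q Nq E g kq])
        show "C\<^sup>2 * (2 * y / c) \<le> 1/4" using ys by simp
        show "D * \<epsilon> * ((1 + 2 * C) * K + C) \<le> 1/4" using \<epsilon>(2) by (simp add: mult_ac)
        show "D * \<epsilon> \<le> y" by (rule \<epsilon>(3))
      qed (use D \<epsilon> in auto)
      hence qy: "?q \<le> Q0 * y" by (simp add: Q0_def)
      also have "\<dots> \<le> Q0 * 1" using ys Q0 by (intro mult_left_mono) auto
      finally have qQ: "?q \<le> Q0" by simp
      have "2 * y / c * ?q \<le> 2 * y / c * Q0" using qQ y c by (intro mult_left_mono) auto
      hence "?N\<^sup>2 \<le> 2 * y / c * Q0" using Nq by linarith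
      also have "\<dots> \<le> \<nu>\<^sup>2" using ys by (simp add: mult_ac)
      finally have "?N\<^sup>2 \<le> \<nu>\<^sup>2" .
      hence N\<nu>: "?N \<le> \<nu>" by (rule power2_le_imp_le) (use \<nu>(1) in simp)
      have "?k\<^sup>2 \<le> K * Q0" using kq mult_left_mono[OF qQ K(1)] by linarith
      moreover have "?k \<le> 1 + ?k\<^sup>2" 
      proof -
        have "2 * ?k \<le> ?k\<^sup>2 + 1" using sum_squares_bound[of ?k 1] by simp
        thus ?thesis using abs_ge_zero[of "tailW s v \<tau>"] by linarith
      qed
      ultimately have k1: "?k \<le> 1 + K * Q0" by linarith
      have "C * ?k \<le> C * (1 + K * Q0)" "C * ?N \<le> C * 1"
        using k1 N\<nu> \<nu>(2) C(1) by (intro mult_left_mono; simp)+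
      hence E1: "norm \<eta> \<le> E0" using E by (simp add: E0_def)
      have De: "D * \<epsilon> * norm \<eta> \<le> e / 2"
      proof -
        have "D * \<epsilon> * norm \<eta> \<le> D * \<epsilon> * E0" using E1 D \<epsilon> by (intro mult_left_mono) auto
        thus ?thesis using \<epsilon>(4) by (simp add: mult_ac)
      qed
      have CN: "C * ?N * k \<le> e / 2" if "0 \<le> k" "k \<le> D" for k
      proof -
        have "C * ?N * k \<le> C * \<nu> * D" using N\<nu> that C(1) D(1) N0 \<nu>(1) by (intro mult_mono) auto
        thus ?thesis using \<nu>(3) by (simp add: mult_ac)
      qed
      have sX: "sigma (X \<tau>) d = 0" using lagrangian_isotropic[OF L(1) XL d] .
      have "\<bar>sigma z (X \<tau>)\<bar> \<le> \<bar>sigma \<eta> (X \<tau>)\<bar> + C * ?N * norm (X \<tau>)"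
        using end_pairings[OF s(2,3) bv C(3), of \<eta> "X \<tau>"] by (simp add: zt)
      moreover have "\<bar>sigma z d\<bar> \<le> \<bar>sigma \<eta> d\<bar> + C * ?N * norm d"
        using end_pairings[OF s(2,3) bv C(3), of \<eta> d] sX by (simp add: zt)
      moreover have "\<bar>sigma \<eta> d\<bar> \<le> D * \<epsilon> * norm \<eta>" by (rule near[OF \<eta> d D(2)])
      ultimately show ?thesis using g De CN[OF norm_ge_zero D(3)] CN[OF norm_ge_zero D(2)] by linarith
    qed
    show "\<exists>B. finite B \<and> (\<forall>g\<in>B. ess_bdd 0 s g) \<and> fspan B0 \<subseteq> fspan B \<and>
      (\<forall>z\<in>jacobi_approx X b s (fspan B). norm z = 1 \<longrightarrow> \<bar>sigma z (X \<tau>)\<bar> \<le> e \<and> \<bar>sigma z d\<bar> \<le> e)"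
      using B main by blast
  qed
qed

lemma coercive_refinement_outside:
  assumes \<tau>: "0 \<le> \<tau>" and glob: "\<And>s. s \<le> \<tau> + r \<Longrightarrow> ess_bdd 0 s X" "\<And>s. s \<le> \<tau> + r \<Longrightarrow> ess_bdd 0 s b"
    and L: "lagrangian_plane L" "is_jacobi_plane X b \<tau> L" and XL: "X \<tau> \<notin> L"
    and d: "d \<in> L" "sigma d (X \<tau>) = 0" and e: "e > 0"
  shows "\<exists>S>0. S \<le> r \<and> (\<forall>s. \<tau> < s \<and> s \<le> \<tau> + S \<longrightarrow> (\<forall>B0 :: (real \<Rightarrow> real) set. finite B0 \<and> (\<forall>g\<in>B0. ess_bdd 0 s g) \<longrightarrow>
    (\<exists>B. finite B \<and> (\<forall>g\<in>B. ess_bdd 0 s g) \<and> fspan B0 \<subseteq> fspan B \<and>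
      (\<forall>z\<in>jacobi_approx X b s (fspan B). norm z = 1 \<longrightarrow> \<bar>sigma z (X \<tau>)\<bar> \<le> e \<and> \<bar>sigma z d\<bar> \<le> e))))"
proof -
  obtain C where C: "C \<ge> 1" "\<And>t. t \<in> {\<tau>..\<tau> + r} \<Longrightarrow> norm (X t) \<le> C" "\<And>t. t \<in> {\<tau>..\<tau> + r} \<Longrightarrow> norm (X1 t) \<le> C"
    "\<And>t. t \<in> {\<tau>..\<tau> + r} \<Longrightarrow> \<bar>A t\<bar> \<le> C" by (rule X_bounds) blast
  obtain D0 where D0: "D0 > 0" "\<And>l k. l \<in> L \<Longrightarrow> norm l + \<bar>k\<bar> \<le> D0 * norm (l - k *\<^sub>R X \<tau>)"
    using subspace_distance_bound[OF lagrangian_subspace[OF L(1)] XL] by blast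
  define D where "D = 2 * D0"
  define M where "M = 1 + C + norm d"
  have M: "M \<ge> 1" "norm d \<le> M" "norm (X \<tau>) \<le> M" "C \<le> M"
    using C(1) C(2)[of \<tau>] r by (auto simp: M_def intro: add_increasing2 add_increasing)
  \<comment> \<open>Half of the bound for the form in \<open>energy_arith_outside\<close>.\<close>
  define K1 where "K1 = 2 * C * D\<^sup>2 + 2"
  have K1: "K1 > 0" using C(1) by (auto simp: K1_def intro: add_nonneg_pos)
  define \<nu> where "\<nu> = min 1 (e / (4 * C * M))"
  have CM: "C * M > 0" using C(1) M(1) by auto
  have \<nu>: "\<nu> > 0" "\<nu> \<le> 1" "C * M * \<nu> \<le> e / 4"
  proof -
    show "\<nu> > 0" using e CM by (simp add: \<nu>_def mult.assoc)
    show "\<nu> \<le> 1" by (simp add: \<nu>_def)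
    have "\<nu> \<le> e / (4 * (C * M))" by (simp add: \<nu>_def mult.assoc)
    thus "C * M * \<nu> \<le> e / 4" using CM by (simp add: pos_le_divide_eq mult_ac)
  qed
  have "eventually (\<lambda>y. 0 < y \<and> 1 * y \<le> 1 \<and> (K1 * C\<^sup>2 * (2 / c)) * y \<le> 1/2 \<and> (4 / c * K1) * y \<le> \<nu>\<^sup>2 \<and>
      ((1 + C) * C + (K1 / c + 1)) * y \<le> e / 2) (at_right 0)"
    using \<nu> e by (intro eventually_conj eventually_mult_le eventually_at_right_less) auto
  then obtain y0 where y0: "y0 > 0" and ysmall: "\<And>y. 0 < y \<Longrightarrow> y < y0 \<Longrightarrow>
      1 * y \<le> 1 \<and> (K1 * C\<^sup>2 * (2 / c)) * y \<le> 1/2 \<and> (4 / c * K1) * y \<le> \<nu>\<^sup>2 \<and> ((1 + C) * C + (K1 / c + 1)) * y \<le> e / 2"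
    unfolding eventually_at_right_field by auto
  define S where "S = min r ((y0 / 2)\<^sup>2)"
  have S: "S > 0" "S \<le> r" using y0 r by (auto simp: S_def)
  \<comment> \<open>Transversality bounds \<open>W(\<tau>)\<close> independently of the variations
    after \<open>\<tau>\<close>, so \<open>\<epsilon>\<close> is fixed before them.\<close>
  have "eventually (\<lambda>\<epsilon>. 0 < \<epsilon> \<and> (D0 + 1) * \<epsilon> \<le> 1/2 \<and> (D * (1 + C) * M) * \<epsilon> \<le> e / 2) (at_right 0)"
    using e by (intro eventually_conj eventually_mult_le eventually_at_right_less) auto
  then obtain \<epsilon> where \<epsilon>: "\<epsilon> > 0" "(D0 + 1) * \<epsilon> \<le> 1/2" "(D * (1 + C) * M) * \<epsilon> \<le> e / 2"
    by (rule eventually_at_right_0_obtain) auto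
  show ?thesis
  proof (intro exI[of _ S] conjI allI impI S)
    fix s and B0 :: "(real \<Rightarrow> real) set" assume s0: "\<tau> < s \<and> s \<le> \<tau> + S" and B0: "finite B0 \<and> (\<forall>g\<in>B0. ess_bdd 0 s g)"
    hence s: "\<tau> < s" "\<tau> \<le> s" "s \<le> \<tau> + r" using S by auto
    define y where "y = sqrt (s - \<tau>)"
    have "y \<le> sqrt ((y0 / 2)\<^sup>2)" unfolding y_def using s0 by (intro real_sqrt_le_mono) (simp add: S_def min_def split: if_splits)
    also have "\<dots> = y0 / 2" using y0 by simp
    finally have y: "0 < y" "y < y0" using y0 s by (auto simp: y_def)
    note ys = ysmall[OF y]
    have y2: "s - \<tau> \<le> y"
    proof -
      have "s - \<tau> = y * y" using s by (simp add: y_def)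
      also have "\<dots> \<le> y * 1" using ys y by (intro mult_left_mono) auto
      finally show ?thesis by simp
    qed
    \<comment> \<open>The weighted norm is made at most \<open>y^2\<close> so that \<open>y\<close>
      can play the role of \<open>\<delta>\<close> in \<open>kernel_bound\<close>.\<close>
    obtain w where w: "ess_bdd 0 s w" "\<And>t. t \<le> \<tau> \<Longrightarrow> w t = 0" "\<And>t. w t \<ge> 0" "integral {\<tau>..s} w = 1"
      "integral {\<tau>..s} (\<lambda>t. (t - \<tau>) * (w t)\<^sup>2) \<le> y\<^sup>2"
      using log_kernel[OF s(1), of "y\<^sup>2" 0] y by auto
    define B2 where "B2 = insert w (cut_gt \<tau> ` B0)"
    have B2: "finite B2" "\<And>g. g \<in> B2 \<Longrightarrow> ess_bdd 0 s g" "\<And>g x. g \<in> B2 \<Longrightarrow> x \<le> \<tau> \<Longrightarrow> g x = 0"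
      using B0 w(1,2) by (auto simp: B2_def cut_gt_below intro: ess_bdd_cut_gt)
    have B2\<tau>: "\<And>g. g \<in> B2 \<Longrightarrow> ess_bdd \<tau> s g" using ess_bdd_subinterval[OF B2(2)] \<tau> by auto
    have w2: "w \<in> fspan B2" using fspan_superset[OF B2(1)] by (auto simp: B2_def)
    have w\<tau>: "ess_bdd \<tau> s w" by (rule B2\<tau>) (simp add: B2_def)
    obtain B \<Lambda> where B: "finite B" "\<And>g. g \<in> B \<Longrightarrow> ess_bdd 0 s g" "fspan B0 \<subseteq> fspan B"
      and \<Lambda>: "subspace \<Lambda>" "\<And>x y. x \<in> \<Lambda> \<Longrightarrow> y \<in> \<Lambda> \<Longrightarrow> sigma x y = 0" "plane_dist \<Lambda> L < \<epsilon>"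
      and z: "\<And>z. z \<in> jacobi_approx X b s (fspan B) \<Longrightarrow> \<exists>\<eta>\<in>\<Lambda>. \<exists>v\<in>fspan B2. z = traj X \<tau> \<eta> v s \<and>
       (\<forall>w\<in>fspan B2. jform X b \<tau> s \<eta> v w = 0)"
    proof -
      assume *: "\<And>B \<Lambda>. finite B \<Longrightarrow> (\<And>g. g \<in> B \<Longrightarrow> ess_bdd 0 s g) \<Longrightarrow> fspan B0 \<subseteq> fspan B \<Longrightarrow>
        subspace \<Lambda> \<Longrightarrow> (\<And>x y. x \<in> \<Lambda> \<Longrightarrow> y \<in> \<Lambda> \<Longrightarrow> sigma x y = 0) \<Longrightarrow> plane_dist \<Lambda> L < \<epsilon> \<Longrightarrow>
        (\<And>z. z \<in> jacobi_approx X b s (fspan B) \<Longrightarrow> \<exists>\<eta>\<in>\<Lambda>. \<exists>v\<in>fspan B2. z = traj X \<tau> \<eta> v s \<and>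
          (\<forall>w\<in>fspan B2. jform X b \<tau> s \<eta> v w = 0)) \<Longrightarrow> thesis"
      show thesis
      proof (rule jacobi_plane_refine[OF glob(1)[OF s(3)] glob(2)[OF s(3)] \<tau> s(2) L(2) \<epsilon>(1) _ _ B2(1) B2(2)])
      show "finite B0" using B0 by blast
      show "ess_bdd 0 s g" if "g \<in> B0" for g using B0 that by blast
      show "g x = 0" if "g \<in> B2" "x \<le> \<tau>" for g x using that by (rule B2(3))
      show "cut_gt \<tau> ` B0 \<subseteq> B2" by (auto simp: B2_def)
      qed (assumption | fact *)+
    qed
    have near: "\<bar>sigma \<eta> d\<bar> \<le> M * \<epsilon> * norm \<eta>" if "\<eta> \<in> \<Lambda>" for \<eta>
    proof -
      obtain x' where x': "x' \<in> \<Lambda>" "norm (d - x') \<le> plane_dist L \<Lambda> * norm d"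
        using plane_dist_nearby[OF lagrangian_subspace[OF L(1)] \<Lambda>(1) d(1)] by blast
      have "plane_dist L \<Lambda> * norm d \<le> \<epsilon> * M"
        using \<Lambda>(3) M(2) \<epsilon>(1) plane_dist_commute[of L \<Lambda>] by (intro mult_mono) auto
      hence n: "norm (d - x') \<le> \<epsilon> * M" using x'(2) by linarith
      have "sigma \<eta> d = sigma \<eta> (d - x')" using \<Lambda>(2)[OF that x'(1)] by (simp add: sigma.diff_right)
      hence "\<bar>sigma \<eta> d\<bar> \<le> norm \<eta> * norm (d - x')" using sigma_le by simp
      also have "\<dots> \<le> norm \<eta> * (\<epsilon> * M)" using n by (intro mult_left_mono) auto
      finally show ?thesis by (simp add: mult_ac)
    qed
    \<comment> \<open>Transversality to \<open>X \<tau>\<close> passes from \<open>L\<close> to the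
      nearby \<open>\<Lambda>\<close>: the error is at most half of \<open>norm \<eta>\<close> and
      is absorbed, which doubles the constant.\<close>
    have transversal: "norm \<eta> + \<bar>k\<bar> \<le> D * norm (\<eta> - k *\<^sub>R X \<tau>)" if "\<eta> \<in> \<Lambda>" for \<eta> k
    proof -
      note h = that
      obtain l where l: "l \<in> L" "norm (\<eta> - l) \<le> plane_dist \<Lambda> L * norm \<eta>"
        using plane_dist_nearby[OF \<Lambda>(1) lagrangian_subspace[OF L(1)] h] by blast
      have nl: "norm (\<eta> - l) \<le> \<epsilon> * norm \<eta>"
        using l(2) \<Lambda>(3) by (meson less_imp_le mult_right_mono norm_ge_zero order_trans)
      have "norm (l - k *\<^sub>R X \<tau>) \<le> norm (\<eta> - k *\<^sub>R X \<tau>) + norm (\<eta> - l)"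
        using norm_triangle_ineq4[of "\<eta> - k *\<^sub>R X \<tau>" "\<eta> - l"] by (simp add: algebra_simps)
      hence "D0 * norm (l - k *\<^sub>R X \<tau>) \<le> D0 * (norm (\<eta> - k *\<^sub>R X \<tau>) + \<epsilon> * norm \<eta>)"
        using nl D0(1) by (intro mult_left_mono) auto
      moreover have "norm \<eta> \<le> norm l + \<epsilon> * norm \<eta>" using nl norm_triangle_sub[of \<eta> l] by linarith
      ultimately have "norm \<eta> + \<bar>k\<bar> \<le> D0 * norm (\<eta> - k *\<^sub>R X \<tau>) + (D0 + 1) * \<epsilon> * norm \<eta>"
        using D0(2)[OF l(1), of k] by (simp add: algebra_simps)
      also have "(D0 + 1) * \<epsilon> * norm \<eta> \<le> 1/2 * norm \<eta>" using \<epsilon>(2) by (intro mult_right_mono) auto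
      finally show ?thesis by (simp add: D_def)
    qed
    have main: "\<bar>sigma z (X \<tau>)\<bar> \<le> e \<and> \<bar>sigma z d\<bar> \<le> e" if zz: "z \<in> jacobi_approx X b s (fspan B)" "norm z = 1" for z
    proof -
      obtain \<eta> v where \<eta>: "\<eta> \<in> \<Lambda>" and v: "v \<in> fspan B2" and zt: "z = traj X \<tau> \<eta> v s"
        and J: "\<forall>w\<in>fspan B2. jform X b \<tau> s \<eta> v w = 0" using z[OF zz(1)] by blast
      have bv: "ess_bdd \<tau> s v" using fspan_ess_bdd[OF B2\<tau> v] .
      let ?q = "qform s v" and ?N = "massW s v" and ?k = "\<bar>tailW s v \<tau>\<bar>"
      have N0: "?N \<ge> 0" by (rule massW_nonneg[OF bv])
      have q0: "?q \<ge> 0" by (rule qform_nonneg[OF s(1,3) bv])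
      have Nq: "?N\<^sup>2 \<le> 2 * y / c * ?q" using mass_square[OF s(1,3) bv] by (simp add: y_def)
      have E: "norm \<eta> + ?k \<le> D * (1 + C * ?N)"
      proof -
        have "norm (\<eta> - tailW s v \<tau> *\<^sub>R X \<tau>) \<le> norm z + norm (\<eta> - tailW s v \<tau> *\<^sub>R X \<tau> - z)"
          by (rule norm_triangle_sub)
        hence "norm (\<eta> - tailW s v \<tau> *\<^sub>R X \<tau>) \<le> 1 + C * ?N"
          using start_close[OF s(2,3) bv C(3), of \<eta>] zz(2) zt by simp
        hence "D * norm (\<eta> - tailW s v \<tau> *\<^sub>R X \<tau>) \<le> D * (1 + C * ?N)"
          using D0(1) by (intro mult_left_mono) (auto simp: D_def)
        thus ?thesis using transversal[OF \<eta>, of "tailW s v \<tau>"] by linarith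
      qed
      have g: "\<bar>sigma \<eta> (X \<tau>)\<bar> \<le> C * norm \<eta>"
      proof -
        have "norm \<eta> * norm (X \<tau>) \<le> norm \<eta> * C" using C(2)[of \<tau>] r by (intro mult_left_mono) auto
        thus ?thesis using sigma_le[of \<eta> "X \<tau>"] by (simp add: mult.commute)
      qed
      have q: "?q \<le> \<bar>sigma \<eta> (X \<tau>)\<bar> * ?k + (1 + C * ?N) * C * ?N"
        using energy_bound[OF s(2,3) bv _ C(1) C(3), of \<eta>] J v zz(2) zt by simp
      have qK: "?q \<le> 2 * K1"
        unfolding K1_def
      proof (rule energy_arith_outside[OF q0 N0 _ _ C(1) c y(1) _ q Nq E g])
        show "(2 * C * D\<^sup>2 + 2) * C\<^sup>2 * (2 * y / c) \<le> 1/2" using ys by (simp add: K1_def)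
      qed (use D0 in \<open>auto simp: D_def\<close>)
      have "2 * y / c * ?q \<le> 2 * y / c * (2 * K1)" using qK y c by (intro mult_left_mono) auto
      hence "?N\<^sup>2 \<le> 4 / c * K1 * y" using Nq by (simp add: mult_ac)
      also have "\<dots> \<le> \<nu>\<^sup>2" using ys by simp
      finally have "?N\<^sup>2 \<le> \<nu>\<^sup>2" .
      hence N\<nu>: "?N \<le> \<nu>" by (rule power2_le_imp_le) (use \<nu>(1) in simp)
      hence N1: "?N \<le> 1" using \<nu>(2) by simp
      have CN: "C * ?N * M \<le> e / 4"
      proof -
        have "C * ?N * M \<le> C * \<nu> * M" using N\<nu> C(1) M(1) N0 by (intro mult_right_mono mult_left_mono) auto
        thus ?thesis using \<nu>(3) by (simp add: mult_ac)
      qed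
      have CNx: "C * ?N * k \<le> e / 4" if "k \<le> M" for k
      proof -
        have "C * ?N * k \<le> C * ?N * M" using that C(1) N0 by (intro mult_left_mono) auto
        thus ?thesis using CN by linarith
      qed
      have CN1: "C * ?N \<le> e / 4"
      proof -
        have "C * ?N * 1 \<le> C * ?N * M" using M(1) C(1) N0 by (intro mult_left_mono) auto
        thus ?thesis using CN by linarith
      qed
      \<comment> \<open>\<open>X \<tau>\<close> is not in \<open>L\<close>, so isotropy says nothing
        about this pairing; testing with the logarithmic kernel makes it small.\<close>
      have g2: "\<bar>sigma \<eta> (X \<tau>)\<bar> \<le> e / 4 + e / 2"
      proof -
        have J1: "integral {\<tau>..s} (\<lambda>t. (t - \<tau>) * (\<beta> t)\<^sup>2 * (v t)\<^sup>2) \<le> 2 * K1 / c"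
          using coercive_v[OF s(1,3) bv] qK c by (simp add: pos_le_divide_eq mult.commute)
        have "\<bar>sigma \<eta> (X \<tau>)\<bar> \<le> C * ?N + (norm (traj X \<tau> \<eta> v s) + C * ?N) * C * (s - \<tau>)
            + y / 2 * (integral {\<tau>..s} (\<lambda>t. (t - \<tau>) * (\<beta> t)\<^sup>2 * (v t)\<^sup>2) + 1)"
          using J w2 by (intro kernel_bound[OF s(2,3) bv w\<tau> _ C(1,3,4) w(3,4,5) y(1)]) auto
        also have "(norm (traj X \<tau> \<eta> v s) + C * ?N) * C * (s - \<tau>) \<le> (1 + C * 1) * C * y"
          using zz(2) zt N1 N0 C(1) y2 s by (intro mult_mono add_mono mult_left_mono) auto
        also have "y / 2 * (integral {\<tau>..s} (\<lambda>t. (t - \<tau>) * (\<beta> t)\<^sup>2 * (v t)\<^sup>2) + 1) \<le> y / 2 * (2 * K1 / c + 1)"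
          using J1 y by (intro mult_left_mono) auto
        also have "C * ?N + (1 + C * 1) * C * y + y / 2 * (2 * K1 / c + 1) \<le> C * ?N + ((1 + C) * C + (K1 / c + 1)) * y"
          using y by (simp add: algebra_simps)
        also have "\<dots> \<le> e / 4 + e / 2" using CN1 ys by linarith
        finally show ?thesis by simp
      qed
      have sd: "\<bar>sigma \<eta> d\<bar> \<le> e / 2"
      proof -
        have "C * ?N \<le> C * 1" using N1 C(1) by (intro mult_left_mono) auto
        hence "D * (1 + C * ?N) \<le> D * (1 + C)" using D0(1) by (intro mult_left_mono) (auto simp: D_def)
        hence "norm \<eta> \<le> D * (1 + C)" using E by linarith
        hence "M * \<epsilon> * norm \<eta> \<le> M * \<epsilon> * (D * (1 + C))" using M \<epsilon> by (intro mult_left_mono) auto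
        moreover have "M * \<epsilon> * (D * (1 + C)) = (D * (1 + C) * M) * \<epsilon>" by (simp add: mult_ac)
        ultimately show ?thesis using near[OF \<eta>] \<epsilon>(3) by linarith
      qed
      have sX: "sigma (X \<tau>) d = 0" using d(2) sigma_swap[of "X \<tau>" d] by simp
      have "\<bar>sigma z (X \<tau>)\<bar> \<le> \<bar>sigma \<eta> (X \<tau>)\<bar> + C * ?N * norm (X \<tau>)"
        using end_pairings[OF s(2,3) bv C(3), of \<eta> "X \<tau>"] by (simp add: zt)
      moreover have "\<bar>sigma z d\<bar> \<le> \<bar>sigma \<eta> d\<bar> + C * ?N * norm d"
        using end_pairings[OF s(2,3) bv C(3), of \<eta> d] sX by (simp add: zt)
      ultimately show ?thesis using g2 sd CNx[OF M(3)] CNx[OF M(2)] e by linarith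
    qed
    show "\<exists>B. finite B \<and> (\<forall>g\<in>B. ess_bdd 0 s g) \<and> fspan B0 \<subseteq> fspan B \<and>
      (\<forall>z\<in>jacobi_approx X b s (fspan B). norm z = 1 \<longrightarrow> \<bar>sigma z (X \<tau>)\<bar> \<le> e \<and> \<bar>sigma z d\<bar> \<le> e)"
      using B main by blast
  qed
qed

text \<open>The plane at \<open>s\<close> is close to the approximating planes of all large spaces,
  in particular to the refined one. Each vector of the limit is thus approximated by vectors almost
  orthogonal to \<open>X \<tau>\<close> and \<open>d\<close>, and
  \<open>plane_add_vector_eqI\<close> identifies the limit.\<close>

theorem coercive_limit:
  assumes \<tau>: "0 \<le> \<tau>" and glob: "\<And>s. s \<le> \<tau> + r \<Longrightarrow> ess_bdd 0 s X" "\<And>s. s \<le> \<tau> + r \<Longrightarrow> ess_bdd 0 s b"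
    and L: "lagrangian_plane (LL \<tau>)" "is_jacobi_plane X b \<tau> (LL \<tau>)"
    and after: "\<forall>\<^sub>F s in at_right \<tau>. is_jacobi_plane X b s (LL s)"
    and lim: "lagrangian_plane Lp" "((\<lambda>s. plane_dist (LL s) Lp) \<longlongrightarrow> 0) (at_right \<tau>)"
  shows "Lp = plane_add_vector (LL \<tau>) (X \<tau>)"
proof -
  have key: "\<bar>sigma z (X \<tau>)\<bar> \<le> e \<and> \<bar>sigma z d\<bar> \<le> e"
    if z: "z \<in> Lp" and d: "d \<in> LL \<tau>" "sigma d (X \<tau>) = 0" and e: "e > 0" for z d e
  proof -
    define H where "H = norm (X \<tau>) + norm d"
    have H: "H \<ge> 0" "norm (X \<tau>) \<le> H" "norm d \<le> H" by (auto simp: H_def)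
    \<comment> \<open>\<open>z\<close> will be replaced by \<open>z1\<close> in the plane at
      \<open>s\<close> and then by \<open>z2\<close> in the refined plane. For
      \<open>\<epsilon> \<le> 1\<close> the error is at most \<open>3 * \<epsilon> * norm z\<close>
      and \<open>norm z2 \<le> 4 * norm z\<close>, whence the factor.\<close>
    have "eventually (\<lambda>y. 0 < y \<and> ((4 + 3 * H) * norm z) * y \<le> e \<and> 1 * y \<le> 1) (at_right 0)"
      using e by (intro eventually_conj eventually_mult_le eventually_at_right_less) auto
    then obtain \<epsilon> where \<epsilon>: "\<epsilon> > 0" "((4 + 3 * H) * norm z) * \<epsilon> \<le> e" "\<epsilon> \<le> 1"
      by (rule eventually_at_right_0_obtain) auto
    have "\<exists>S>0. S \<le> r \<and> (\<forall>s. \<tau> < s \<and> s \<le> \<tau> + S \<longrightarrow> (\<forall>B0 :: (real \<Rightarrow> real) set. finite B0 \<and> (\<forall>g\<in>B0. ess_bdd 0 s g) \<longrightarrow>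
      (\<exists>B. finite B \<and> (\<forall>g\<in>B. ess_bdd 0 s g) \<and> fspan B0 \<subseteq> fspan B \<and>
      (\<forall>z\<in>jacobi_approx X b s (fspan B). norm z = 1 \<longrightarrow> \<bar>sigma z (X \<tau>)\<bar> \<le> \<epsilon> \<and> \<bar>sigma z d\<bar> \<le> \<epsilon>))))"
      using coercive_refinement_inside[OF \<tau> glob L _ d(1) \<epsilon>(1)] coercive_refinement_outside[OF \<tau> glob L _ d \<epsilon>(1)]
      by (cases "X \<tau> \<in> LL \<tau>") simp_all
    then obtain S where S: "S > 0" "S \<le> r" and ref: "\<forall>s. \<tau> < s \<and> s \<le> \<tau> + S \<longrightarrow> (\<forall>B0 :: (real \<Rightarrow> real) set. finite B0 \<and> (\<forall>g\<in>B0. ess_bdd 0 s g) \<longrightarrow>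
      (\<exists>B. finite B \<and> (\<forall>g\<in>B. ess_bdd 0 s g) \<and> fspan B0 \<subseteq> fspan B \<and>
      (\<forall>z\<in>jacobi_approx X b s (fspan B). norm z = 1 \<longrightarrow> \<bar>sigma z (X \<tau>)\<bar> \<le> \<epsilon> \<and> \<bar>sigma z d\<bar> \<le> \<epsilon>)))"
      by (elim exE conjE) (rule that)
    have "eventually (\<lambda>s. plane_dist (LL s) Lp < \<epsilon>) (at_right \<tau>)" using lim(2) \<epsilon>(1) by (intro order_tendstoD)
    moreover have "eventually (\<lambda>s. s \<in> {\<tau><..<\<tau> + S}) (at_right \<tau>)" using S by (intro eventually_at_right_real) auto
    ultimately have "eventually (\<lambda>s. plane_dist (LL s) Lp < \<epsilon> \<and> s \<in> {\<tau><..<\<tau> + S} \<and> is_jacobi_plane X b s (LL s)) (at_right \<tau>)"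
      using after by eventually_elim auto
    then obtain s where s: "plane_dist (LL s) Lp < \<epsilon>" "\<tau> < s" "s < \<tau> + S" and J: "is_jacobi_plane X b s (LL s)"
      using eventually_happens'[of "at_right \<tau>"] by auto
    have sr: "s \<le> \<tau> + r" using s S by simp
    have J': "lagrangian_plane (LL s)" "((\<lambda>V. plane_dist (jacobi_approx X b s V) (LL s)) \<longlongrightarrow> 0) (fin_dim_at_top s)"
      using J s \<tau> by (auto simp: is_jacobi_plane_def split: if_splits)
    obtain B0 where B0: "finite B0" "\<And>g. g \<in> B0 \<Longrightarrow> ess_bdd 0 s g"
      "\<And>B'. finite B' \<Longrightarrow> (\<And>g. g \<in> B' \<Longrightarrow> ess_bdd 0 s g) \<Longrightarrow> fspan B0 \<subseteq> fspan B' \<Longrightarrow>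
        \<bar>plane_dist (jacobi_approx X b s (fspan B')) (LL s)\<bar> < \<epsilon>"
      using fin_dim_at_top_tendsto_zero[OF J'(2) \<epsilon>(1)] by blast
    obtain B where B: "finite B" "\<forall>g\<in>B. ess_bdd 0 s g" "fspan B0 \<subseteq> fspan B"
      and unit: "\<forall>z\<in>jacobi_approx X b s (fspan B). norm z = 1 \<longrightarrow> \<bar>sigma z (X \<tau>)\<bar> \<le> \<epsilon> \<and> \<bar>sigma z d\<bar> \<le> \<epsilon>"
    proof -
      have "finite B0 \<and> (\<forall>g\<in>B0. ess_bdd 0 s g)" using B0(1,2) by blast
      moreover have "\<tau> < s \<and> s \<le> \<tau> + S" using s by simp
      ultimately have "\<exists>B. finite B \<and> (\<forall>g\<in>B. ess_bdd 0 s g) \<and> fspan B0 \<subseteq> fspan B \<and>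
        (\<forall>z\<in>jacobi_approx X b s (fspan B). norm z = 1 \<longrightarrow> \<bar>sigma z (X \<tau>)\<bar> \<le> \<epsilon> \<and> \<bar>sigma z d\<bar> \<le> \<epsilon>)"
        using ref[rule_format, of s B0] by simp
      thus ?thesis by (elim exE conjE) (rule that)
    qed
    let ?J = "jacobi_approx X b s (fspan B)"
    have subJ: "subspace ?J" using B(2) by (intro subspace_jacobi_approx glob sr) auto
    have scaled: "\<bar>sigma x (X \<tau>)\<bar> \<le> \<epsilon> * norm x \<and> \<bar>sigma x d\<bar> \<le> \<epsilon> * norm x" if "x \<in> ?J" for x
    proof (cases "x = 0")
      case False
      have "(1 / norm x) *\<^sub>R x \<in> ?J" using subJ that by (rule subspace_scale)
      moreover have "norm ((1 / norm x) *\<^sub>R x) = 1" using False by simp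
      ultimately have "\<bar>sigma ((1 / norm x) *\<^sub>R x) (X \<tau>)\<bar> \<le> \<epsilon> \<and> \<bar>sigma ((1 / norm x) *\<^sub>R x) d\<bar> \<le> \<epsilon>"
        using unit by blast
      thus ?thesis using False by (simp add: sigma.scaleR_left abs_mult pos_divide_le_eq)
    qed (simp add: sigma.zero_left)
    have pd: "plane_dist ?J (LL s) < \<epsilon>" using B0(3)[of B] B by auto
    obtain z1 where z1: "z1 \<in> LL s" "norm (z - z1) \<le> plane_dist Lp (LL s) * norm z"
      using plane_dist_nearby[OF lagrangian_subspace[OF lim(1)] lagrangian_subspace[OF J'(1)] z] by blast
    obtain z2 where z2: "z2 \<in> ?J" "norm (z1 - z2) \<le> plane_dist (LL s) ?J * norm z1"
      using plane_dist_nearby[OF lagrangian_subspace[OF J'(1)] subJ z1(1)] by blast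
    have a1: "norm (z - z1) \<le> \<epsilon> * norm z"
      using z1(2) s(1) plane_dist_commute[of Lp "LL s"]
        mult_right_mono[of "plane_dist Lp (LL s)" \<epsilon> "norm z"] by simp
    have a2: "norm (z1 - z2) \<le> \<epsilon> * norm z1"
      using z2(2) pd plane_dist_commute[of "LL s" ?J]
        mult_right_mono[of "plane_dist (LL s) ?J" \<epsilon> "norm z1"] by simp
    have \<epsilon>z: "\<epsilon> * norm z \<le> norm z" using \<epsilon> by (simp add: mult_left_le_one_le)
    have n1: "norm z1 \<le> 2 * norm z" using a1 \<epsilon>z norm_triangle_ineq4[of z "z - z1"] by simp
    have a3: "norm (z1 - z2) \<le> \<epsilon> * (2 * norm z)" using a2 mult_left_mono[OF n1, of \<epsilon>] \<epsilon> by linarith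
    have n2: "norm z2 \<le> 4 * norm z" using a3 n1 \<epsilon>z norm_triangle_ineq4[of z1 "z1 - z2"] by simp
    have zz2: "norm (z - z2) \<le> \<epsilon> * (3 * norm z)" using a1 a3 norm_triangle_ineq[of "z - z1" "z1 - z2"] by simp
    have fin: "\<bar>sigma z x\<bar> \<le> e" if "\<bar>sigma z2 x\<bar> \<le> \<epsilon> * norm z2" "norm x \<le> H" for x
    proof -
      have "\<bar>sigma (z - z2) x\<bar> \<le> norm (z - z2) * norm x" by (rule sigma_le)
      also have "\<dots> \<le> \<epsilon> * (3 * norm z) * H" using zz2 that(2) \<epsilon> by (intro mult_mono) auto
      finally have 1: "\<bar>sigma (z - z2) x\<bar> \<le> \<epsilon> * (3 * norm z) * H" .
      have 2: "\<bar>sigma z2 x\<bar> \<le> \<epsilon> * (4 * norm z)"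
        using that(1) mult_left_mono[OF n2, of \<epsilon>] \<epsilon> by linarith
      have "\<bar>sigma z x\<bar> \<le> \<epsilon> * (3 * norm z) * H + \<epsilon> * (4 * norm z)"
        using 1 2 sigma.diff_left[of z z2 x] by linarith
      thus ?thesis using \<epsilon>(2) by (simp add: algebra_simps)
    qed
    show ?thesis using fin scaled[OF z2(1)] H by blast
  qed
  have zero: "x = 0" if "\<And>e. e > 0 \<Longrightarrow> \<bar>x\<bar> \<le> e" for x :: real
    using that[of "\<bar>x\<bar> / 2"] by (cases "x = 0") auto
  have 0: "0 \<in> LL \<tau>" using L(1) lagrangian_subspace subspace_0 by blast
  show ?thesis
  proof (rule plane_add_vector_eqI[OF L(1) lim(1)])
    show "sigma z (X \<tau>) = 0" if "z \<in> Lp" for z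
      by (rule zero) (use key[OF that 0] in \<open>auto simp: sigma.zero_left\<close>)
    show "sigma z d = 0" if "z \<in> Lp" "d \<in> LL \<tau>" "sigma d (X \<tau>) = 0" for z d
      by (rule zero) (use key[OF that] in auto)
  qed
qed

end

section \<open>Criteria for coercivity\<close>

context jacobi_piece
begin

lemma shrink:
  assumes "0 < r'" "r' \<le> r" shows "jacobi_piece X X1 b \<beta> \<tau> r'"
proof
  have sub: "{\<tau>..\<tau> + r'} \<subseteq> {\<tau>..\<tau> + r}" using assms by auto
  show "(X has_vector_derivative X1 t) (at t within {\<tau>..\<tau> + r'})" if "t \<in> {\<tau>..\<tau> + r'}" for t
    using has_vector_derivative_within_subset[OF X sub] that sub by blast
  show "continuous_on {\<tau>..\<tau> + r'} X1" "continuous_on {\<tau>..\<tau> + r'} \<beta>"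
    using X1 \<beta> sub continuous_on_subset by blast+
  show "b t = (t - \<tau>) * \<beta> t" if "t \<in> {\<tau>..\<tau> + r'}" for t using b that sub by blast
qed (use assms in auto)

text \<open>Jacobi's trick: adding the total derivative of \<open>P W\<^sup>2\<close> does not change the quadratic form, since
  \<open>P\<close> vanishes at \<open>\<tau>\<close> and \<open>W\<close> at \<open>s\<close>. Coercivity may thus be checked pointwise.\<close>

lemma qform_null_lagrangian:
  assumes s: "\<tau> \<le> s" "s \<le> \<tau> + r" and v: "ess_bdd \<tau> s v" and P: "prim \<tau> s P P'" "P \<tau> = 0"
  shows "qform s v = integral {\<tau>..s} (\<lambda>t. (A t + P' t) * (tailW s v t)\<^sup>2 + 2 * P t * tailW s v t * v t - b t * (v t)\<^sup>2)"
proof -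
  let ?W = "tailW s v"
  note pW = prim_tailW[OF v]
  have Q: "prim \<tau> s (\<lambda>t. P t * (?W t * ?W t)) (\<lambda>t. P' t * (?W t * ?W t) + P t * (v t * ?W t + ?W t * v t))"
    by (intro prim_mult P pW)
  have 0: "integral {\<tau>..s} (\<lambda>t. P' t * (?W t * ?W t) + P t * (v t * ?W t + ?W t * v t)) = 0"
    by (subst prim_integral[OF Q order_refl s(1) order_refl]) (simp add: P(2))
  have bq: "ess_bdd \<tau> s (\<lambda>t. A t * (?W t)\<^sup>2 - b t * (v t)\<^sup>2)"
    by (rule ess_bdd_diff[OF ess_bdd_mult[OF bA[OF s(2)] ess_bdd_power2[OF bW[OF v]]] ess_bdd_mult[OF bb[OF s(2)] ess_bdd_power2[OF v]]])
  have "qform s v = qform s v + integral {\<tau>..s} (\<lambda>t. P' t * (?W t * ?W t) + P t * (v t * ?W t + ?W t * v t))"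
    by (simp only: 0 add_0_right)
  also have "\<dots> = integral {\<tau>..s} (\<lambda>t. (A t * (?W t)\<^sup>2 - b t * (v t)\<^sup>2) + (P' t * (?W t * ?W t) + P t * (v t * ?W t + ?W t * v t)))"
    unfolding qform_def by (subst integral_ess_bdd_add[OF bq prim_ess_bdd[OF Q]]) simp
  also have "\<dots> = integral {\<tau>..s} (\<lambda>t. (A t + P' t) * (?W t)\<^sup>2 + 2 * P t * ?W t * v t - b t * (v t)\<^sup>2)"
    by (intro integral_cong) (simp add: algebra_simps power2_eq_square)
  finally show ?thesis .
qed

text \<open>It suffices to compare quadratic forms in two independent numbers \<open>W\<close> and
  \<open>v\<close> at each time. The time \<open>\<tau>\<close> itself is a negligible
  exception.\<close>

lemma coercive_pieceI:
  assumes c: "c > 0" and r': "0 < r'" "r' \<le> r"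
    and P: "prim \<tau> (\<tau> + r') P P'" "P \<tau> = 0"
    and pt: "\<And>t W v. \<tau> < t \<Longrightarrow> t \<le> \<tau> + r' \<Longrightarrow>
      c * (sqrt (t - \<tau>) * W\<^sup>2) \<le> (A t + P' t) * W\<^sup>2 + 2 * P t * W * v - b t * v\<^sup>2 \<and>
      c * ((t - \<tau>) * (\<beta> t)\<^sup>2 * v\<^sup>2) \<le> (A t + P' t) * W\<^sup>2 + 2 * P t * W * v - b t * v\<^sup>2"
  shows "coercive_piece X X1 b \<beta> \<tau> r' c"
proof -
  have both: "c * integral {\<tau>..s} f \<le> qform s v"
    if s: "\<tau> < s" "s \<le> \<tau> + r'" and v: "ess_bdd \<tau> s v" and f: "ess_bdd \<tau> s f"
      and le: "\<And>t. \<tau> < t \<Longrightarrow> t \<le> s \<Longrightarrow> c * f t \<le> (A t + P' t) * (tailW s v t)\<^sup>2 + 2 * P t * tailW s v t * v t - b t * (v t)\<^sup>2"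
    for s v f
  proof -
    have s': "\<tau> \<le> s" "s \<le> \<tau> + r" using s r' by auto
    let ?W = "tailW s v"
    let ?F = "\<lambda>t. (A t + P' t) * (?W t)\<^sup>2 + 2 * P t * ?W t * v t - b t * (v t)\<^sup>2"
    have Ps: "prim \<tau> s P P'" using prim_subinterval[OF P(1)] s by simp
    have bP: "ess_bdd \<tau> s P" by (rule ess_bdd_continuous[OF prim_continuous[OF Ps]])
    have bF: "ess_bdd \<tau> s ?F"
      by (rule ess_bdd_diff[OF ess_bdd_add[OF ess_bdd_mult[OF ess_bdd_add[OF bA[OF s'(2)] prim_ess_bdd[OF Ps]] ess_bdd_power2[OF bW[OF v]]]
            ess_bdd_mult[OF ess_bdd_mult[OF ess_bdd_cmult[OF bP] bW[OF v]] v]] ess_bdd_mult[OF bb[OF s'(2)] ess_bdd_power2[OF v]]])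
    have "c * integral {\<tau>..s} f = integral {\<tau>..s} (\<lambda>t. c * f t)" by simp
    also have "\<dots> = integral {\<tau>..s} (\<lambda>t. if t = \<tau> then ?F \<tau> else c * f t)"
      by (rule integral_spike[of "{\<tau>}"]) auto
    also have "\<dots> \<le> integral {\<tau>..s} ?F"
    proof (rule integral_le)
      have "(\<lambda>t. c * f t) integrable_on {\<tau>..s}" by (intro ess_bdd_integrable ess_bdd_cmult f)
      thus "(\<lambda>t. if t = \<tau> then ?F \<tau> else c * f t) integrable_on {\<tau>..s}"
        by (rule integrable_spike[of _ _ "{\<tau>}"]) auto
      show "?F integrable_on {\<tau>..s}" by (rule ess_bdd_integrable[OF bF])
      show "(if t = \<tau> then ?F \<tau> else c * f t) \<le> ?F t" if "t \<in> {\<tau>..s}" for t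
        using le[of t] that by (cases "t = \<tau>") auto
    qed
    also have "\<dots> = qform s v" by (rule qform_null_lagrangian[OF s' v Ps P(2), symmetric])
    finally show ?thesis .
  qed
  show ?thesis
  proof (intro coercive_piece.intro coercive_piece_axioms.intro shrink r' c)
    fix s and v :: "real \<Rightarrow> real" assume s: "\<tau> < s" "s \<le> \<tau> + r'" and v: "ess_bdd \<tau> s v"
    have s': "s \<le> \<tau> + r" using s r' by auto
    show "c * integral {\<tau>..s} (\<lambda>t. sqrt (t - \<tau>) * (tailW s v t)\<^sup>2) \<le> qform s v"
    proof (rule both[OF s v])
      show "ess_bdd \<tau> s (\<lambda>t. sqrt (t - \<tau>) * (tailW s v t)\<^sup>2)"
        by (rule ess_bdd_mult[OF ess_bdd_continuous ess_bdd_power2[OF bW[OF v]]]) (intro continuous_intros)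
    qed (use pt s in auto)
    show "c * integral {\<tau>..s} (\<lambda>t. (t - \<tau>) * (\<beta> t)\<^sup>2 * (v t)\<^sup>2) \<le> qform s v"
    proof (rule both[OF s v])
      show "ess_bdd \<tau> s (\<lambda>t. (t - \<tau>) * (\<beta> t)\<^sup>2 * (v t)\<^sup>2)"
        by (rule ess_bdd_mult[OF ess_bdd_mult[OF bid ess_bdd_power2[OF b\<beta>[OF s']]] ess_bdd_power2[OF v]])
    qed (use pt s in auto)
  qed
qed

lemma weight_eq: "t \<in> {\<tau>..\<tau> + r} \<Longrightarrow> \<beta> t \<le> 0 \<Longrightarrow> (t - \<tau>) * (\<beta> t)\<^sup>2 = \<bar>\<beta> t\<bar> * - b t"
  by (simp add: b power2_eq_square)

lemma \<beta>_bound: obtains K where "K \<ge> 1" "\<And>t. t \<in> {\<tau>..\<tau> + r} \<Longrightarrow> \<bar>\<beta> t\<bar> \<le> K"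
proof -
  have "bounded (\<beta> ` {\<tau>..\<tau> + r})" by (intro compact_imp_bounded compact_continuous_image \<beta>) auto
  then obtain K where K: "\<forall>x\<in>\<beta> ` {\<tau>..\<tau> + r}. norm x \<le> K" by (auto simp only: bounded_iff)
  show ?thesis
  proof (rule that[of "max 1 K"])
    show "\<bar>\<beta> t\<bar> \<le> max 1 K" if "t \<in> {\<tau>..\<tau> + r}" for t
      using K that by (auto simp: le_max_iff_disj)
  qed simp
qed

text \<open>Both terms of the form are nonnegative, so the correction \<open>P = 0\<close>
  works.\<close>

lemma coercive_positive:
  assumes a: "a > 0" and A: "\<And>t. t \<in> {\<tau>..\<tau> + r} \<Longrightarrow> a \<le> A t" and neg: "\<And>t. t \<in> {\<tau>..\<tau> + r} \<Longrightarrow> \<beta> t \<le> 0"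
  shows "\<exists>r' c. coercive_piece X X1 b \<beta> \<tau> r' c \<and> r' \<le> r"
proof -
  obtain K where K: "K \<ge> 1" "\<And>t. t \<in> {\<tau>..\<tau> + r} \<Longrightarrow> \<bar>\<beta> t\<bar> \<le> K" by (rule \<beta>_bound) blast
  define c where "c = min a (1 / K)"
  have c: "c > 0" "c \<le> a" "c * K \<le> 1" using a K by (auto simp: c_def min_def field_simps)
  have "coercive_piece X X1 b \<beta> \<tau> (min r 1) c"
  proof (rule coercive_pieceI[OF c(1), of _ "\<lambda>_. 0" "\<lambda>_. 0"])
    show "prim \<tau> (\<tau> + min r 1) (\<lambda>_. 0) (\<lambda>_. 0 :: real)" by (simp add: prim_def ess_bdd_const)
    fix t W v assume t: "\<tau> < t" "t \<le> \<tau> + min r 1"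
    hence tr: "t \<in> {\<tau>..\<tau> + r}" by auto
    have y: "sqrt (t - \<tau>) \<le> 1" using t by auto
    have bn: "- b t \<ge> 0" using b[OF tr] neg[OF tr] t by (simp add: mult_nonneg_nonpos)
    have "c * (sqrt (t - \<tau>) * W\<^sup>2) \<le> a * (1 * W\<^sup>2)" using y c a t by (intro mult_mono) auto
    also have "\<dots> \<le> A t * W\<^sup>2" using A[OF tr] by (simp add: mult_right_mono)
    also have "\<dots> \<le> A t * W\<^sup>2 - b t * v\<^sup>2" using mult_nonneg_nonneg[OF bn, of "v\<^sup>2"] by simp
    finally have 1: "c * (sqrt (t - \<tau>) * W\<^sup>2) \<le> A t * W\<^sup>2 - b t * v\<^sup>2" .
    have "c * ((t - \<tau>) * (\<beta> t)\<^sup>2 * v\<^sup>2) = c * \<bar>\<beta> t\<bar> * (- b t * v\<^sup>2)"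
      by (simp only: weight_eq[OF tr neg[OF tr]] mult_ac)
    also have "\<dots> \<le> 1 * (- b t * v\<^sup>2)"
    proof (rule mult_right_mono)
      have "c * \<bar>\<beta> t\<bar> \<le> c * K" using K(2)[OF tr] c by (intro mult_left_mono) auto
      thus "c * \<bar>\<beta> t\<bar> \<le> 1" using c by linarith
      show "0 \<le> - b t * v\<^sup>2" using bn by (intro mult_nonneg_nonneg) auto
    qed
    also have "\<dots> \<le> A t * W\<^sup>2 - b t * v\<^sup>2" using A[OF tr] a by (simp add: mult_nonneg_nonneg)
    finally show "c * (sqrt (t - \<tau>) * W\<^sup>2) \<le> (A t + 0) * W\<^sup>2 + 2 * 0 * W * v - b t * v\<^sup>2 \<and>
       c * ((t - \<tau>) * (\<beta> t)\<^sup>2 * v\<^sup>2) \<le> (A t + 0) * W\<^sup>2 + 2 * 0 * W * v - b t * v\<^sup>2"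
      using 1 by simp
  qed (use r in auto)
  thus ?thesis by (intro exI conjI) auto
qed

text \<open>The correction \<open>P = L * (t - \<tau>)\<close> lifts the coefficient of
  \<open>W^2\<close> above any negative \<open>A\<close>; with \<open>L = C + 2\<close> two units of
  \<open>W^2\<close> are left. One pays, together with half of \<open>- b * v^2\<close>, for the
  mixed term, whose \<open>v^2\<close> part is only of second order in \<open>t - \<tau>\<close>;
  the other gives coercivity.\<close>

lemma coercive_first_order:
  assumes c1: "c1 > 0" and neg: "\<And>t. t \<in> {\<tau>..\<tau> + r} \<Longrightarrow> \<beta> t \<le> - c1"
  shows "\<exists>r' c. coercive_piece X X1 b \<beta> \<tau> r' c \<and> r' \<le> r"
proof -
  obtain K where K: "K \<ge> 1" "\<And>t. t \<in> {\<tau>..\<tau> + r} \<Longrightarrow> \<bar>\<beta> t\<bar> \<le> K" by (rule \<beta>_bound) blast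
  obtain C where C: "C \<ge> 1" "\<And>t. t \<in> {\<tau>..\<tau> + r} \<Longrightarrow> \<bar>A t\<bar> \<le> C" by (rule X_bounds) blast
  define L where "L = C + 2"
  define r' where "r' = min (min r 1) (c1 / (2 * L\<^sup>2))"
  have L: "L > 0" using C by (simp add: L_def)
  have r': "0 < r'" "r' \<le> r" "r' \<le> 1" "r' \<le> c1 / (2 * L\<^sup>2)" using r c1 L by (auto simp: r'_def)
  define c where "c = 1 / (2 * K)"
  have c: "c > 0" "c \<le> 1" "c * K = 1/2" using K by (auto simp: c_def field_simps)
  have "coercive_piece X X1 b \<beta> \<tau> r' c"
  proof (rule coercive_pieceI[OF c(1), of _ "\<lambda>t. L * (t - \<tau>)" "\<lambda>_. L"])
    show "prim \<tau> (\<tau> + r') (\<lambda>t. L * (t - \<tau>)) (\<lambda>_. L)"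
      by (rule prim_C1) (auto intro!: derivative_eq_intros simp: has_real_derivative_iff_has_vector_derivative[symmetric])
    fix t W v assume t: "\<tau> < t" "t \<le> \<tau> + r'"
    hence tr: "t \<in> {\<tau>..\<tau> + r}" using r' by auto
    define x where "x = t - \<tau>"
    have x: "x > 0" "x \<le> 1" "x \<le> c1 / (2 * L\<^sup>2)" using t r' by (auto simp: x_def)
    have xL: "2 * L\<^sup>2 * x \<le> c1" using x(3) L by (simp add: pos_le_divide_eq mult_ac)
    define p where "p = - b t"
    have p: "c1 * x \<le> p" using b[OF tr] neg[OF tr] x(1) mult_left_mono[of c1 "- \<beta> t" x] by (simp add: p_def x_def mult.commute)
    have pv: "c1 * x * v\<^sup>2 \<le> p * v\<^sup>2" using p by (intro mult_right_mono) auto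
    have sq: "2 * L * x * W * v \<ge> - (c1 * x / 2 * v\<^sup>2) - W\<^sup>2"
    proof -
      have "0 \<le> (L * x * v + W)\<^sup>2" by simp
      hence "- 2 * L * x * W * v \<le> L\<^sup>2 * x * x * v\<^sup>2 + W\<^sup>2" by (simp add: power2_sum power_mult_distrib power2_eq_square algebra_simps)
      also have "L\<^sup>2 * x * x * v\<^sup>2 \<le> c1 / 2 * x * v\<^sup>2" using xL x by (intro mult_right_mono) auto
      finally show ?thesis by simp
    qed
    have AL: "2 * W\<^sup>2 \<le> (A t + L) * W\<^sup>2" using C(2)[OF tr] by (intro mult_right_mono) (auto simp: L_def)
    have F: "W\<^sup>2 + p * v\<^sup>2 / 2 \<le> (A t + L) * W\<^sup>2 + 2 * (L * x) * W * v + p * v\<^sup>2"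
      using sq AL pv by (simp add: algebra_simps)
    have p0: "0 \<le> p * v\<^sup>2" 
    proof -
      have "0 \<le> c1 * x" using x c1 by simp
      thus ?thesis using p by simp
    qed
    have "c * (sqrt x * W\<^sup>2) \<le> 1 * (1 * W\<^sup>2)" using c x by (intro mult_mono) auto
    hence 1: "c * (sqrt x * W\<^sup>2) \<le> W\<^sup>2 + p * v\<^sup>2 / 2" using p0 by simp
    have b0: "\<beta> t \<le> 0" using neg[OF tr] c1 by simp
    have "c * ((t - \<tau>) * (\<beta> t)\<^sup>2 * v\<^sup>2) = c * \<bar>\<beta> t\<bar> * (p * v\<^sup>2)"
      by (simp only: weight_eq[OF tr b0] mult_ac p_def)
    also have "\<dots> \<le> c * K * (p * v\<^sup>2)"
      using K(2)[OF tr] c p0 by (intro mult_right_mono mult_left_mono) auto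
    also have "\<dots> \<le> W\<^sup>2 + p * v\<^sup>2 / 2" unfolding c(3) by simp
    finally have 2: "c * ((t - \<tau>) * (\<beta> t)\<^sup>2 * v\<^sup>2) \<le> W\<^sup>2 + p * v\<^sup>2 / 2" .
    show "c * (sqrt (t - \<tau>) * W\<^sup>2) \<le> (A t + L) * W\<^sup>2 + 2 * (L * (t - \<tau>)) * W * v - b t * v\<^sup>2 \<and>
       c * ((t - \<tau>) * (\<beta> t)\<^sup>2 * v\<^sup>2) \<le> (A t + L) * W\<^sup>2 + 2 * (L * (t - \<tau>)) * W * v - b t * v\<^sup>2"
      using 1 2 F by (simp add: x_def p_def)
  qed (use r' in auto)
  thus ?thesis using r' by (intro exI conjI) auto
qed

end

text \<open>The borderline case of Hardy's inequality \<open>\<integral> x\<^sup>2 W'\<^sup>2 \<ge> 1/4 \<integral> W\<^sup>2\<close> is included; the gain comes from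
  the correction \<open>sqrt x\<close> in the Riccati function \<open>g = - (1 + sqrt x) / (2 x)\<close>.\<close>

lemma hardy_pointwise:
  fixes x y k \<alpha> C a p W v :: real
  assumes x: "0 < x" "x = y\<^sup>2" "0 < y" "y \<le> 1" and k: "k \<ge> 0" "k * x \<le> 1" and \<alpha>: "\<alpha> > 0"
    and a: "a \<ge> - \<alpha> - C * x" and p: "p \<ge> 4 * \<alpha> * x\<^sup>2 * (1 - k * x)"
    and small: "(\<alpha> * (6 * k + 1) + C) * y \<le> \<alpha> / 2" 
  defines "P \<equiv> 2 * \<alpha> * (x * (1 - k * x) * (1 + y))"
    and "P' \<equiv> 2 * \<alpha> * ((1 - 2 * k * x) * (1 + y) + y * (1 - k * x) / 2)"
  shows "\<alpha> / 2 * (y * W\<^sup>2) \<le> (a + P') * W\<^sup>2 + 2 * P * W * v + p * v\<^sup>2" (is "?l \<le> ?F")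
    and "x * (p * v\<^sup>2) \<le> 16 * ((a + P') * W\<^sup>2 + 2 * P * W * v + p * v\<^sup>2)"
proof -
  \<comment> \<open>\<open>ph = 4 * h * x^2\<close> is the part of \<open>p\<close> guaranteed by
    the hypothesis. With it the mixed term completes to the square \<open>D\<close> at the price
    \<open>G = P^2 / ph\<close>, so the Riccati inequality to check is
    \<open>a + P' - G \<ge> \<alpha> * y / 2\<close>.\<close>
  define h where "h = \<alpha> * (1 - k * x)"
  define G where "G = h * (1 + y)\<^sup>2"
  define ph where "ph = 4 * h * x\<^sup>2"
  define D where "D = h * (2 * x * v + (1 + y) * W)\<^sup>2"
  have h: "0 \<le> h" "h \<le> \<alpha>" using k x \<alpha> by (auto simp: h_def mult_left_le)
  have D0: "D \<ge> 0" using h by (simp add: D_def)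
  have Dexp: "D = ph * v\<^sup>2 + 2 * P * W * v + G * W\<^sup>2"
    by (simp add: D_def ph_def P_def G_def h_def power2_eq_square algebra_simps)
  \<comment> \<open>The leading \<open>\<alpha>\<close> cancels the Hardy constant in
    \<open>a\<close>. The next term \<open>\<alpha> * y\<close> is of order \<open>sqrt x\<close>
    and beats everything of order \<open>x\<close>, so half of it survives.\<close>
  have PG: "P' - G \<ge> \<alpha> + \<alpha> * y - \<alpha> * (6 * k + 1) * x"
  proof -
    have "P' - G = \<alpha> * (1 + y - (3 * k + 1) * x - 3 * k * x * y + k * x * x)"
      unfolding P'_def G_def h_def x(2) by (simp add: power2_eq_square field_simps)
    moreover have "1 + y - (3 * k + 1) * x - 3 * k * x * y + k * x * x \<ge> 1 + y - (6 * k + 1) * x"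
    proof -
      have "k * x * y \<le> k * x * 1" using k x by (intro mult_left_mono) auto
      moreover have "0 \<le> k * x * x" using k x by simp
      ultimately show ?thesis by (simp add: algebra_simps)
    qed
    ultimately have "P' - G \<ge> \<alpha> * (1 + y - (6 * k + 1) * x)" using \<alpha> by simp
    thus ?thesis by (simp add: algebra_simps)
  qed
  have "(\<alpha> * (6 * k + 1) + C) * x \<le> \<alpha> / 2 * y"
    using mult_right_mono[OF small, of y] x by (simp add: power2_eq_square mult_ac)
  hence aG: "a + P' - G \<ge> \<alpha> / 2 * y" using a PG by (simp add: algebra_simps)
  have F: "(a + P') * W\<^sup>2 + 2 * P * W * v + p * v\<^sup>2 = (a + P' - G) * W\<^sup>2 + (p - ph) * v\<^sup>2 + D"
    by (simp add: Dexp algebra_simps)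
  have pp: "p - ph \<ge> 0" using p by (simp add: ph_def h_def algebra_simps)
  have 1: "\<alpha> / 2 * y * W\<^sup>2 \<le> (a + P' - G) * W\<^sup>2" using aG by (intro mult_right_mono) auto
  have 2: "0 \<le> (p - ph) * v\<^sup>2" using pp by simp
  show "\<alpha> / 2 * (y * W\<^sup>2) \<le> (a + P') * W\<^sup>2 + 2 * P * W * v + p * v\<^sup>2"
    unfolding F using 1 2 D0 by simp
  have x1: "x \<le> 1" unfolding x(2) using x(3,4) by (simp add: power_le_one)
  have xy: "x \<le> y" unfolding x(2) power2_eq_square using x(3,4) by (simp add: mult_left_le)
  \<comment> \<open>\<open>2 * x * v\<close> is the base of the square in \<open>D\<close> minus
    \<open>(1 + y) * W\<close>. The resulting multiple of \<open>W^2\<close> becomes harmless after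
    multiplication by \<open>x \<le> y\<close>, when it is comparable to the gain.\<close>
  have vW: "ph * v\<^sup>2 \<le> 2 * D + 8 * \<alpha> * W\<^sup>2"
  proof -
    have "ph * v\<^sup>2 = h * (2 * x * v)\<^sup>2" by (simp add: ph_def power_mult_distrib)
    also have "\<dots> \<le> h * (2 * (2 * x * v + (1 + y) * W)\<^sup>2 + 2 * ((1 + y) * W)\<^sup>2)"
    proof (rule mult_left_mono[OF _ h(1)])
      have "0 \<le> ((2 * x * v + (1 + y) * W) + (1 + y) * W)\<^sup>2" by simp
      thus "(2 * x * v)\<^sup>2 \<le> 2 * (2 * x * v + (1 + y) * W)\<^sup>2 + 2 * ((1 + y) * W)\<^sup>2"
        by (simp add: power2_eq_square algebra_simps)
    qed
    also have "\<dots> = 2 * D + 2 * (h * (1 + y)\<^sup>2) * W\<^sup>2"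
      unfolding power_mult_distrib[of "1 + y" W] distrib_left D_def by (simp add: mult_ac)
    also have "h * (1 + y)\<^sup>2 \<le> \<alpha> * 2\<^sup>2" using h x by (intro mult_mono power_mono) auto
    hence "2 * D + 2 * (h * (1 + y)\<^sup>2) * W\<^sup>2 \<le> 2 * D + 2 * (\<alpha> * 2\<^sup>2) * W\<^sup>2"
      by (intro add_left_mono mult_right_mono mult_left_mono) auto
    finally show ?thesis by simp
  qed
  have "x * (p * v\<^sup>2) = x * ((p - ph) * v\<^sup>2) + x * (ph * v\<^sup>2)" by (simp add: algebra_simps)
  also have "\<dots> \<le> 1 * ((p - ph) * v\<^sup>2) + x * (2 * D + 8 * \<alpha> * W\<^sup>2)"
    using x1 x(1) 2 vW by (intro add_mono mult_right_mono mult_left_mono) auto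
  also have "x * (2 * D + 8 * \<alpha> * W\<^sup>2) = x * (2 * D) + x * (8 * \<alpha> * W\<^sup>2)" by (simp add: algebra_simps)
  also have "x * (2 * D) \<le> 1 * (2 * D)" using x1 D0 by (intro mult_right_mono) auto
  also have "x * (8 * \<alpha> * W\<^sup>2) \<le> y * (8 * \<alpha> * W\<^sup>2)" using xy \<alpha> by (intro mult_right_mono) auto
  finally have "x * (p * v\<^sup>2) \<le> (p - ph) * v\<^sup>2 + 2 * D + 16 * (\<alpha> / 2 * y * W\<^sup>2)" by (simp add: algebra_simps)
  also have "\<dots> \<le> 16 * ((a + P' - G) * W\<^sup>2 + (p - ph) * v\<^sup>2 + D)" using 1 2 D0 by simp
  finally show "x * (p * v\<^sup>2) \<le> 16 * ((a + P') * W\<^sup>2 + 2 * P * W * v + p * v\<^sup>2)" unfolding F .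
qed

context jacobi_piece
begin

lemma coercive_hardy:
  assumes \<alpha>: "\<alpha> > 0" and kC: "k \<ge> 0" "C \<ge> 0" "K > 0"
    and A: "\<And>t. t \<in> {\<tau>..\<tau> + r} \<Longrightarrow> - \<alpha> - C * (t - \<tau>) \<le> A t"
    and p: "\<And>t. t \<in> {\<tau>..\<tau> + r} \<Longrightarrow> 4 * \<alpha> * (t - \<tau>)\<^sup>2 * (1 - k * (t - \<tau>)) \<le> - b t"
    and neg: "\<And>t. t \<in> {\<tau>..\<tau> + r} \<Longrightarrow> \<beta> t \<le> 0" "\<And>t. t \<in> {\<tau>..\<tau> + r} \<Longrightarrow> \<bar>\<beta> t\<bar> \<le> K * (t - \<tau>)"
  shows "\<exists>r' c. coercive_piece X X1 b \<beta> \<tau> r' c \<and> r' \<le> r"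
proof -
  have "eventually (\<lambda>y. 0 < y \<and> 1 * y \<le> 1 \<and> k * y \<le> 1 \<and> (\<alpha> * (6 * k + 1) + C) * y \<le> \<alpha> / 2 \<and> 1 * y \<le> sqrt r) (at_right 0)"
    using \<alpha> r by (intro eventually_conj eventually_mult_le eventually_at_right_less) auto
  then obtain y0 where y0: "y0 > 0" "y0 \<le> 1" "k * y0 \<le> 1" "(\<alpha> * (6 * k + 1) + C) * y0 \<le> \<alpha> / 2" "y0 \<le> sqrt r"
    by (rule eventually_at_right_0_obtain) auto
  define r' where "r' = y0\<^sup>2"
  have r': "0 < r'" "r' \<le> r"
    using y0 r power_mono[OF y0(5), of 2] by (auto simp: r'_def)
  \<comment> \<open>\<open>1 / (16 * K)\<close> because the weighted square of \<open>v\<close> is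
    at most \<open>K * x * (- b * v^2)\<close>, and \<open>hardy_pointwise\<close> bounds
    \<open>x * (- b * v^2)\<close> by 16 times the integrand of the form.\<close>
  define c where "c = min (\<alpha> / 2) (1 / (16 * K))"
  have c: "c > 0" "c \<le> \<alpha> / 2" "16 * (c * K) \<le> 1"
  proof -
    show "c > 0" "c \<le> \<alpha> / 2" using \<alpha> kC by (auto simp: c_def)
    have "c \<le> 1 / (16 * K)" by (simp add: c_def)
    thus "16 * (c * K) \<le> 1" using kC by (simp add: pos_le_divide_eq mult_ac)
  qed
  define P where "P = (\<lambda>t. 2 * \<alpha> * ((t - \<tau>) * (1 - k * (t - \<tau>)) * (1 + sqrt (t - \<tau>))))"
  define P' where "P' = (\<lambda>t. 2 * \<alpha> * ((1 - 2 * k * (t - \<tau>)) * (1 + sqrt (t - \<tau>)) + sqrt (t - \<tau>) * (1 - k * (t - \<tau>)) / 2))"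
  have prim: "prim \<tau> (\<tau> + r') P P'"
    unfolding prim_def
  proof (intro conjI ballI)
    show "ess_bdd \<tau> (\<tau> + r') P'" unfolding P'_def by (intro ess_bdd_continuous continuous_intros) auto
    fix x assume x: "x \<in> {\<tau>..\<tau> + r'}"
    show "(P' has_integral P x - P \<tau>) {\<tau>..x}"
    proof (rule fundamental_theorem_of_calculus_interior)
      show "continuous_on {\<tau>..x} P" unfolding P_def by (intro continuous_intros)
      fix t assume "t \<in> {\<tau><..<x}"
      hence t: "t - \<tau> > 0" by simp
      have sq: "sqrt (t - \<tau>) * sqrt (t - \<tau>) = t - \<tau>" using t by simp
      have h0: "(P has_real_derivative 2 * \<alpha> * (((1 - k * (t - \<tau>)) + (t - \<tau>) * (- k)) * (1 + sqrt (t - \<tau>))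
          + (t - \<tau>) * (1 - k * (t - \<tau>)) * (inverse (sqrt (t - \<tau>)) / 2))) (at t)"
        unfolding P_def using t by (auto intro!: derivative_eq_intros simp: algebra_simps)
      have i: "(t - \<tau>) * inverse (sqrt (t - \<tau>)) = sqrt (t - \<tau>)"
        using t sq by (simp add: field_simps)
      have "(t - \<tau>) * (1 - k * (t - \<tau>)) * (inverse (sqrt (t - \<tau>)) / 2) =
          ((t - \<tau>) * inverse (sqrt (t - \<tau>))) * (1 - k * (t - \<tau>)) / 2" by simp
      hence h1: "(t - \<tau>) * (1 - k * (t - \<tau>)) * (inverse (sqrt (t - \<tau>)) / 2) = sqrt (t - \<tau>) * (1 - k * (t - \<tau>)) / 2"
        unfolding i .
      have h2: "(1 - k * (t - \<tau>)) + (t - \<tau>) * (- k) = 1 - 2 * k * (t - \<tau>)" by (simp add: algebra_simps)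
      have "(P has_real_derivative P' t) (at t)" using h0 unfolding h1 h2 P'_def .
      thus "(P has_vector_derivative P' t) (at t)" by (simp add: has_real_derivative_iff_has_vector_derivative)
    qed (use x in auto)
  qed
  have "coercive_piece X X1 b \<beta> \<tau> r' c"
  proof (rule coercive_pieceI[OF c(1) r' prim])
    fix t W v assume t: "\<tau> < t" "t \<le> \<tau> + r'"
    hence tr: "t \<in> {\<tau>..\<tau> + r}" using r' by auto
    define x where "x = t - \<tau>"
    define y where "y = sqrt x"
    have x: "0 < x" "x = y\<^sup>2" "0 < y" using t by (auto simp: x_def y_def)
    have "y \<le> sqrt (y0\<^sup>2)" unfolding y_def x_def using t by (intro real_sqrt_le_mono) (simp add: r'_def)
    hence yy: "y \<le> y0" using y0 by simp
    hence y1: "y \<le> 1" using y0 by simp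
    have xy: "x \<le> y" unfolding x(2) power2_eq_square using x(3) y1 by (simp add: mult_left_le)
    have kx: "k * x \<le> 1"
    proof -
      have "k * x \<le> k * y0" using xy yy kC by (intro mult_left_mono) auto
      thus ?thesis using y0 by linarith
    qed
    have sm: "(\<alpha> * (6 * k + 1) + C) * y \<le> \<alpha> / 2"
    proof -
      have "(\<alpha> * (6 * k + 1) + C) * y \<le> (\<alpha> * (6 * k + 1) + C) * y0"
        using yy \<alpha> kC by (intro mult_left_mono) auto
      thus ?thesis using y0 by linarith
    qed
    define F where "F = (A t + P' t) * W\<^sup>2 + 2 * P t * W * v - b t * v\<^sup>2"
    have PP: "P t = 2 * \<alpha> * (x * (1 - k * x) * (1 + y))" "P' t = 2 * \<alpha> * ((1 - 2 * k * x) * (1 + y) + y * (1 - k * x) / 2)"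
      by (simp_all add: P_def P'_def x_def y_def)
    have Ax: "A t \<ge> - \<alpha> - C * x" and px: "- b t \<ge> 4 * \<alpha> * x\<^sup>2 * (1 - k * x)" using A[OF tr] p[OF tr] by (auto simp: x_def)
    have h1: "\<alpha> / 2 * (y * W\<^sup>2) \<le> F" and h2: "x * (- b t * v\<^sup>2) \<le> 16 * F"
      using hardy_pointwise(1)[OF x y1 kC(1) kx \<alpha> Ax px sm, where W = W and v = v]
        hardy_pointwise(2)[OF x y1 kC(1) kx \<alpha> Ax px sm, where W = W and v = v] unfolding F_def PP by simp_all
    have "c * (y * W\<^sup>2) \<le> \<alpha> / 2 * (y * W\<^sup>2)" using c x by (intro mult_right_mono) auto
    hence 1: "c * (y * W\<^sup>2) \<le> F" using h1 by linarith
    have F0: "F \<ge> 0" 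
    proof -
      have "0 \<le> \<alpha> / 2 * (y * W\<^sup>2)" using \<alpha> x by simp
      thus ?thesis using h1 by linarith
    qed
    have bn: "0 \<le> - b t * v\<^sup>2" using b[OF tr] neg(1)[OF tr] t by (simp add: mult_nonneg_nonpos mult_nonneg_nonpos2 mult_nonpos_nonneg)
    have "c * ((t - \<tau>) * (\<beta> t)\<^sup>2 * v\<^sup>2) = c * (\<bar>\<beta> t\<bar> * (- b t * v\<^sup>2))"
      by (simp only: weight_eq[OF tr neg(1)[OF tr]] mult_ac)
    also have "\<dots> \<le> c * (K * x * (- b t * v\<^sup>2))"
      using neg(2)[OF tr] bn c by (intro mult_left_mono mult_right_mono) (auto simp: x_def)
    also have "\<dots> = c * K * (x * (- b t * v\<^sup>2))" by simp
    also have "\<dots> \<le> c * K * (16 * F)" using h2 c kC by (intro mult_left_mono) auto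
    also have "\<dots> = 16 * (c * K) * F" by simp
    also have "\<dots> \<le> 1 * F" using c(3) F0 by (rule mult_right_mono)
    finally show "c * (sqrt (t - \<tau>) * W\<^sup>2) \<le> (A t + P' t) * W\<^sup>2 + 2 * P t * W * v - b t * v\<^sup>2 \<and>
       c * ((t - \<tau>) * (\<beta> t)\<^sup>2 * v\<^sup>2) \<le> (A t + P' t) * W\<^sup>2 + 2 * P t * W * v - b t * v\<^sup>2"
      using 1 by (simp add: F_def x_def y_def)
  qed (auto simp: P_def)
  thus ?thesis using r' by (intro exI conjI) auto
qed

end

section \<open>Indefinite second variations\<close>

lemma AE_zero_of_integral_square:
  assumes h: "ess_bdd a b (h :: real \<Rightarrow> real)" and z: "integral {a..b} (\<lambda>x. (h x)\<^sup>2) = 0"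
  shows "AE x in lebesgue_on {a..b}. h x = 0"
proof -
  have "(\<lambda>x. (h x)\<^sup>2) absolutely_integrable_on {a..b}"
    by (rule ess_bdd_absolutely_integrable[OF ess_bdd_power2[OF h]])
  hence i: "integrable (lebesgue_on {a..b}) (\<lambda>x. (h x)\<^sup>2)"
    by (simp add: absolutely_integrable_imp_integrable)
  have "integral\<^sup>L (lebesgue_on {a..b}) (\<lambda>x. (h x)\<^sup>2) = 0"
    using lebesgue_integral_eq_integral[OF i] z by simp
  hence "AE x in lebesgue_on {a..b}. (h x)\<^sup>2 = 0"
    by (subst (asm) integral_nonneg_eq_0_iff_AE[OF i]) auto
  thus ?thesis by eventually_elim simp
qed

lemma two_roots:
  fixes a b c :: real
  assumes "a > 0" "c < 0"
  obtains t1 t2 where "t1 \<noteq> t2" "a + b * t1 + c * t1\<^sup>2 = 0" "a + b * t2 + c * t2\<^sup>2 = 0"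
proof -
  have "c * a < 0" using assms by (simp add: mult_neg_pos)
  hence D: "discrim c b a > 0" using zero_le_power2[of b] unfolding discrim_def by linarith
  have "\<exists>x y. x \<noteq> y \<and> c * x\<^sup>2 + b * x + a = 0 \<and> c * y\<^sup>2 + b * y + a = 0"
    using discriminant_pos_ex[of c b a] D assms by auto
  thus ?thesis using that by (auto simp: algebra_simps)
qed

text \<open>A test function vanishing up to \<open>\<tau>\<close> sees the past only through the
  state at \<open>\<tau>\<close>.\<close>

lemma jform_late:
  fixes X :: "real \<Rightarrow> 'e \<times> 'e::euclidean_space"
  assumes X: "ess_bdd 0 s X" and b: "ess_bdd 0 s b" and \<tau>: "0 \<le> \<tau>" "\<tau> \<le> s"
    and bu: "ess_bdd 0 s u" and bw: "ess_bdd 0 s w" and w0: "\<And>x. x \<le> \<tau> \<Longrightarrow> w x = 0"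
  shows "jform X b 0 s \<zeta> u w = jform X b \<tau> s (traj X 0 \<zeta> u \<tau>) u w"
proof -
  let ?h = "\<lambda>t. sigma (traj X 0 \<zeta> u t) (w t *\<^sub>R X t) + b t * u t * w t"
  have "jform X b 0 s \<zeta> u w = integral {0..\<tau>} ?h + integral {\<tau>..s} ?h"
    unfolding jform_def using \<tau>
    by (intro Henstock_Kurzweil_Integration.integral_combine[symmetric] ess_bdd_integrable ess_bdd_jform[OF X b] bu bw)
  also have "integral {0..\<tau>} ?h = integral {0..\<tau>} (\<lambda>t. 0)"
    by (rule integral_cong) (simp add: w0 sigma.zero_right)
  also have "integral {\<tau>..s} ?h = jform X b \<tau> s (traj X 0 \<zeta> u \<tau>) u w"
    unfolding jform_def
  proof (intro integral_cong)
    fix t assume t: "t \<in> {\<tau>..s}"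
    have "traj X 0 \<zeta> u t = traj X \<tau> (traj X 0 \<zeta> u \<tau>) u t"
      using prim_integral[OF prim_traj[OF X b bu, of \<zeta>] \<tau>(1), of t] t by (simp add: traj_def[of X \<tau>])
    thus "sigma (traj X 0 \<zeta> u t) (w t *\<^sub>R X t) + b t * u t * w t =
      sigma (traj X \<tau> (traj X 0 \<zeta> u \<tau>) u t) (w t *\<^sub>R X t) + b t * u t * w t" by simp
  qed
  finally show ?thesis by simp
qed

section \<open>Rigidity of approximating planes when the net converges\<close>

context
  fixes X :: "real \<Rightarrow> 'e \<times> 'e::euclidean_space" and b :: "real \<Rightarrow> real" and s :: real
    and B :: "(real \<Rightarrow> real) set" and Ls :: "('e \<times> 'e) set"
  assumes X: "ess_bdd 0 s X" and b: "ess_bdd 0 s b" and s: "0 \<le> s"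
    and B: "finite B" "\<And>g. g \<in> B \<Longrightarrow> ess_bdd 0 s g"
    and Ls: "lagrangian_plane Ls"
    and close: "\<And>B'. finite B' \<Longrightarrow> (\<And>g. g \<in> B' \<Longrightarrow> ess_bdd 0 s g) \<Longrightarrow> fspan B \<subseteq> fspan B' \<Longrightarrow>
      \<bar>plane_dist (jacobi_approx X b s (fspan B')) Ls\<bar> < 1/4"
begin

abbreviation "J0 \<equiv> jacobi_approx X b s (fspan B)"

lemma subspace_J0: "subspace J0"
  by (rule subspace_jacobi_approx[OF X b B(2)])

text \<open>The projection to \<open>J0\<close> is injective on \<open>Ls\<close>: a vector with
  projection 0 has its full norm as distance from \<open>J0\<close>, whereas closeness allows only a
  quarter of it.\<close>

lemma J0_dim: "DIM('e) \<le> dim J0"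
proof -
  have pd: "plane_dist Ls J0 < 1/4" using close[OF B] plane_dist_commute[of Ls J0] by simp
  have lin: "linear (closest_point J0)" by (rule linear_closest_point_subspace[OF subspace_J0])
  have sL: "subspace Ls" by (rule lagrangian_subspace[OF Ls])
  have "inj_on (closest_point J0) Ls"
  proof (subst linear_inj_on_iff_eq_0[OF lin sL], intro ballI impI)
    fix x assume x: "x \<in> Ls" "closest_point J0 x = 0"
    obtain y where y: "y \<in> J0" "norm (x - y) \<le> plane_dist Ls J0 * norm x"
      using plane_dist_nearby[OF sL subspace_J0 x(1)] by blast
    have "dist x (closest_point J0 x) \<le> dist x y"
      by (rule closest_point_le[OF closed_subspace[OF subspace_J0] y(1)])
    hence "norm x \<le> norm (x - y)" using x(2) by (simp add: dist_norm)
    also have "\<dots> \<le> plane_dist Ls J0 * norm x" by (rule y(2))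
    also have "\<dots> \<le> 1/4 * norm x" using pd by (intro mult_right_mono) auto
    finally show "x = 0" by simp
  qed
  hence "dim (closest_point J0 ` Ls) = dim Ls" using sL by (intro dim_image_eq[OF lin]) (simp add: span_eq_iff[THEN iffD2])
  moreover have "closest_point J0 ` Ls \<subseteq> J0" using closest_point_subspace(1)[OF subspace_J0] by blast
  ultimately show ?thesis using lagrangian_dim[OF Ls] dim_subset[of "closest_point J0 ` Ls" J0] by simp
qed

text \<open>After \<open>v\<close> is adjoined, its own end point \<open>z\<close> lies in the
  enlarged plane, since \<open>v\<close> is orthogonal to \<open>B\<close> and to itself. But
  \<open>z\<close> is perpendicular to \<open>J0\<close>, while passing from the enlarged plane
  through \<open>Ls\<close> to \<open>J0\<close> costs at most \<open>1/4 + 5/16 < 1\<close> of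
  \<open>norm z\<close>.\<close>

lemma isotropic_variation_zero:
  assumes \<eta>: "\<eta> \<in> vertical" and v: "ess_bdd 0 s v"
    and N: "\<And>w. w \<in> B \<Longrightarrow> jform X b 0 s \<eta> v w = 0" and q: "jform X b 0 s \<eta> v v = 0"
    and perp: "\<And>x. x \<in> J0 \<Longrightarrow> traj X 0 \<eta> v s \<bullet> x = 0"
  shows "traj X 0 \<eta> v s = 0"
proof (rule ccontr)
  define z where "z = traj X 0 \<eta> v s"
  assume "traj X 0 \<eta> v s \<noteq> 0"
  hence z0: "norm z > 0" by (simp add: z_def)
  let ?B = "insert v B"
  have fB: "finite ?B" "\<And>g. g \<in> ?B \<Longrightarrow> ess_bdd 0 s g" using B v by auto
  have sub: "fspan B \<subseteq> fspan ?B" by (rule fspan_mono) (use B in auto)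
  let ?J = "jacobi_approx X b s (fspan ?B)"
  have pd: "plane_dist ?J Ls < 1/4" "plane_dist Ls J0 < 1/4"
    using close[OF fB sub] close[OF B] plane_dist_commute[of Ls J0] by simp_all
  have "v \<in> fspan ?B" using fspan_superset[OF fB(1)] by blast
  moreover have "jform X b 0 s \<eta> v w = 0" if "w \<in> fspan ?B" for w
    using jform_zero_fspan[OF X b v fB(2) _ that] N q by blast
  ultimately have zJ: "z \<in> ?J" unfolding jacobi_approx_eq z_def using \<eta> by blast
  have sJ: "subspace ?J" by (rule subspace_jacobi_approx[OF X b fB(2)])
  have sL: "subspace Ls" by (rule lagrangian_subspace[OF Ls])
  obtain z1 where z1: "z1 \<in> Ls" "norm (z - z1) \<le> plane_dist ?J Ls * norm z"
    using plane_dist_nearby[OF sJ sL zJ] by blast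
  obtain z2 where z2: "z2 \<in> J0" "norm (z1 - z2) \<le> plane_dist Ls J0 * norm z1"
    using plane_dist_nearby[OF sL subspace_J0 z1(1)] by blast
  have a1: "norm (z - z1) \<le> 1/4 * norm z"
    using z1(2) mult_right_mono[of "plane_dist ?J Ls" "1/4" "norm z"] pd by simp
  have a2: "norm (z1 - z2) \<le> 1/4 * norm z1"
    using z2(2) mult_right_mono[of "plane_dist Ls J0" "1/4" "norm z1"] pd by simp
  have "norm z1 \<le> 5/4 * norm z" using a1 norm_triangle_ineq4[of z "z - z1"] by simp
  hence lt: "norm (z - z2) < norm z"
    using a1 a2 norm_triangle_ineq[of "z - z1" "z1 - z2"] z0 unfolding diff_add_cancel add_diff_eq by linarith
  have "z \<bullet> z2 = 0" using perp[OF z2(1)] by (simp add: z_def)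
  hence "(norm (z - z2))\<^sup>2 = (norm z)\<^sup>2 + (norm z2)\<^sup>2"
    unfolding power2_norm_eq_inner by (simp add: inner_diff_left inner_diff_right inner_commute)
  moreover have "(norm (z - z2))\<^sup>2 < (norm z)\<^sup>2" using lt by (intro power_strict_mono) auto
  ultimately show False by (smt (verit) zero_le_power2)
qed

text \<open>The variations on which an enlargement of the space could change the plane: orthogonal
  to \<open>B\<close> for the form, with end point Euclidean-perpendicular to the current plane.
  Finitely many linear conditions describe them.\<close>

definition Nperp :: "'e \<times> 'e \<Rightarrow> (real \<Rightarrow> real) \<Rightarrow> bool" where
  "Nperp \<eta> v \<longleftrightarrow> \<eta> \<in> vertical \<and> ess_bdd 0 s v \<and> (\<forall>w\<in>B. jform X b 0 s \<eta> v w = 0) \<and>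
     (\<forall>x\<in>J0. traj X 0 \<eta> v s \<bullet> x = 0)"

lemma Nperp_combine:
  assumes 1: "Nperp \<eta> v" and 2: "Nperp \<xi> w"
  shows "Nperp (\<eta> + t *\<^sub>R \<xi>) (\<lambda>x. v x + t * w x)"
    and "traj X 0 (\<eta> + t *\<^sub>R \<xi>) (\<lambda>x. v x + t * w x) s = traj X 0 \<eta> v s + t *\<^sub>R traj X 0 \<xi> w s"
    and "jform X b 0 s (\<eta> + t *\<^sub>R \<xi>) (\<lambda>x. v x + t * w x) (\<lambda>x. v x + t * w x) =
       jform X b 0 s \<eta> v v + (jform X b 0 s \<eta> v w + jform X b 0 s \<xi> w v) * t + jform X b 0 s \<xi> w w * t\<^sup>2"
proof -
  have bd: "ess_bdd 0 s v" "ess_bdd 0 s w" "ess_bdd 0 s (\<lambda>x. t * w x)" "ess_bdd 0 s (\<lambda>x. v x + t * w x)"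
    using 1 2 by (auto simp: Nperp_def intro: ess_bdd_cmult ess_bdd_add)
  have sv: "subspace (vertical :: ('e \<times> 'e) set)" by (rule lagrangian_subspace[OF lagrangian_vertical])
  show tr: "traj X 0 (\<eta> + t *\<^sub>R \<xi>) (\<lambda>x. v x + t * w x) s = traj X 0 \<eta> v s + t *\<^sub>R traj X 0 \<xi> w s"
    by (simp add: traj_add[OF X b bd(1,3)] traj_scale[OF X b])
  have jf: "jform X b 0 s (\<eta> + t *\<^sub>R \<xi>) (\<lambda>x. v x + t * w x) g = jform X b 0 s \<eta> v g + t * jform X b 0 s \<xi> w g"
    if "ess_bdd 0 s g" for g
    by (simp add: jform_add_left[OF X b bd(1,3) that] jform_scale_left[OF X b])
  show "Nperp (\<eta> + t *\<^sub>R \<xi>) (\<lambda>x. v x + t * w x)"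
    unfolding Nperp_def
  proof (intro conjI ballI)
    show "\<eta> + t *\<^sub>R \<xi> \<in> vertical" using 1 2 sv by (auto simp: Nperp_def intro: subspace_add subspace_scale)
    show "jform X b 0 s (\<eta> + t *\<^sub>R \<xi>) (\<lambda>x. v x + t * w x) g = 0" if "g \<in> B" for g
      using jf[OF B(2)[OF that]] 1 2 that by (simp add: Nperp_def)
    show "traj X 0 (\<eta> + t *\<^sub>R \<xi>) (\<lambda>x. v x + t * w x) s \<bullet> x = 0" if "x \<in> J0" for x
      using 1 2 that unfolding tr by (simp add: Nperp_def inner_add_left)
  qed (rule bd(4))
  have r: "jform X b 0 s \<zeta> u (\<lambda>x. v x + t * w x) = jform X b 0 s \<zeta> u v + t * jform X b 0 s \<zeta> u w"
    if "ess_bdd 0 s u" for \<zeta> u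
    by (simp add: jform_add_right[OF X b that bd(1,3)] jform_scale_right[OF X b])
  show "jform X b 0 s (\<eta> + t *\<^sub>R \<xi>) (\<lambda>x. v x + t * w x) (\<lambda>x. v x + t * w x) =
       jform X b 0 s \<eta> v v + (jform X b 0 s \<eta> v w + jform X b 0 s \<xi> w v) * t + jform X b 0 s \<xi> w w * t\<^sup>2"
    unfolding jf[OF bd(4)] r[OF bd(1)] r[OF bd(2)] by (simp add: algebra_simps power2_eq_square)
qed

text \<open>On the line from a positive vector in the direction of a negative one the form is a
  quadratic polynomial with two distinct real roots. Both roots give isotropic vectors with end
  point 0, and the two end points determine those of the given pair.\<close>

lemma indefinite_zero:
  assumes 1: "Nperp \<eta> v" "jform X b 0 s \<eta> v v > 0" and 2: "Nperp \<xi> w" "jform X b 0 s \<xi> w w < 0"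
  shows "traj X 0 \<eta> v s = 0 \<and> traj X 0 \<xi> w s = 0"
proof -
  obtain t1 t2 where t: "t1 \<noteq> t2"
    "jform X b 0 s \<eta> v v + (jform X b 0 s \<eta> v w + jform X b 0 s \<xi> w v) * t1 + jform X b 0 s \<xi> w w * t1\<^sup>2 = 0"
    "jform X b 0 s \<eta> v v + (jform X b 0 s \<eta> v w + jform X b 0 s \<xi> w v) * t2 + jform X b 0 s \<xi> w w * t2\<^sup>2 = 0"
    using two_roots[OF 1(2) 2(2)] by blast
  have z: "traj X 0 \<eta> v s + t *\<^sub>R traj X 0 \<xi> w s = 0"
    if "jform X b 0 s \<eta> v v + (jform X b 0 s \<eta> v w + jform X b 0 s \<xi> w v) * t + jform X b 0 s \<xi> w w * t\<^sup>2 = 0" for t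
    using isotropic_variation_zero[of "\<eta> + t *\<^sub>R \<xi>" "\<lambda>x. v x + t * w x"] Nperp_combine[OF 1(1) 2(1), of t] that
    by (simp add: Nperp_def)
  have "(t1 - t2) *\<^sub>R traj X 0 \<xi> w s = 0"
  proof -
    have "(t1 - t2) *\<^sub>R traj X 0 \<xi> w s = (traj X 0 \<eta> v s + t1 *\<^sub>R traj X 0 \<xi> w s) - (traj X 0 \<eta> v s + t2 *\<^sub>R traj X 0 \<xi> w s)"
      by (simp add: scaleR_diff_left)
    thus ?thesis unfolding z[OF t(2)] z[OF t(3)] by simp
  qed
  hence "traj X 0 \<xi> w s = 0" using t(1) by simp
  thus ?thesis using z[OF t(2)] by simp
qed

text \<open>If the second variation is indefinite on \<open>Nperp\<close>, adjoining any further variation to the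
  approximating subspace does not move the plane.\<close>

lemma indefinite_stationary:
  assumes p: "Nperp \<eta>p vp" "jform X b 0 s \<eta>p vp vp > 0" and n: "Nperp \<eta>n vn" "jform X b 0 s \<eta>n vn vn < 0"
    and v: "ess_bdd 0 s v" and N: "\<And>w. w \<in> B \<Longrightarrow> jform X b 0 s 0 v w = 0"
  shows "traj X 0 0 v s \<in> J0"
proof -
  \<comment> \<open>Subtracting the solution that ends at \<open>\<xi>\<close>, the projection of
    the end point, leaves orthogonality to \<open>B\<close> intact and moves the variation into
    \<open>Nperp\<close>.\<close>
  define \<xi> where "\<xi> = closest_point J0 (traj X 0 0 v s)"
  have \<xi>: "\<xi> \<in> J0" "\<And>a. a \<in> J0 \<Longrightarrow> (traj X 0 0 v s - \<xi>) \<bullet> a = 0"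
    using closest_point_subspace[OF subspace_J0] by (auto simp: \<xi>_def)
  obtain \<eta> u where u: "\<xi> = traj X 0 \<eta> u s" "\<eta> \<in> vertical" "u \<in> fspan B" "\<forall>w\<in>fspan B. jform X b 0 s \<eta> u w = 0"
    using \<xi>(1) unfolding jacobi_approx_eq by blast
  have bu: "ess_bdd 0 s u" using fspan_ess_bdd[OF B(2) u(3)] .
  define \<zeta> where "\<zeta> = 0 + (- 1) *\<^sub>R \<eta>"
  define z where "z = (\<lambda>x. v x + (- 1) * u x)"
  have bu': "ess_bdd 0 s (\<lambda>x. (- 1) * u x)" by (rule ess_bdd_cmult[OF bu])
  have tr: "traj X 0 \<zeta> z s = traj X 0 0 v s - \<xi>"
    unfolding \<zeta>_def z_def by (subst traj_add[OF X b v bu' order_refl], subst traj_scale[OF X b]) (simp add: u)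
  have jf: "jform X b 0 s \<zeta> z w = 0" if "w \<in> B" for w
    unfolding \<zeta>_def z_def
    using N[OF that] u(4) fspan_superset[OF B(1)] that
    by (subst jform_add_left[OF X b v bu' B(2)[OF that]], subst jform_scale_left[OF X b]) auto
  have "Nperp \<zeta> z"
    unfolding Nperp_def
  proof (intro conjI ballI)
    show "\<zeta> \<in> vertical" using u(2) by (simp add: \<zeta>_def vertical_def)
    show "ess_bdd 0 s z" unfolding z_def by (rule ess_bdd_add[OF v bu'])
  qed (use jf tr \<xi>(2) in auto)
  \<comment> \<open>If the form does not vanish on the difference, it is paired with the given
    vector of the opposite sign.\<close>
  consider "jform X b 0 s \<zeta> z z > 0" | "jform X b 0 s \<zeta> z z < 0" | "jform X b 0 s \<zeta> z z = 0" by linarith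
  hence "traj X 0 \<zeta> z s = 0"
  proof cases
    case 1 thus ?thesis using indefinite_zero[OF \<open>Nperp \<zeta> z\<close> 1 n] by blast
  next
    case 2 thus ?thesis using indefinite_zero[OF p \<open>Nperp \<zeta> z\<close> 2] by blast
  next
    case 3 thus ?thesis
      using isotropic_variation_zero[of \<zeta> z] \<open>Nperp \<zeta> z\<close> by (simp add: Nperp_def)
  qed
  hence "traj X 0 0 v s = \<xi>" using tr by simp
  thus ?thesis using \<xi>(1) by simp
qed

lemma traj_sum:
  assumes "finite I" "\<And>i. i \<in> I \<Longrightarrow> ess_bdd 0 s (f i)"
  shows "traj X 0 0 (\<lambda>x. \<Sum>i\<in>I. c i * f i x) s = (\<Sum>i\<in>I. c i *\<^sub>R traj X 0 0 (f i) s)"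
  using assms
proof (induction I rule: finite_induct)
  case empty thus ?case by (simp add: traj_def)
next
  case (insert i I)
  have 1: "ess_bdd 0 s (\<lambda>x. c i * f i x)" "ess_bdd 0 s (\<lambda>x. \<Sum>i\<in>I. c i * f i x)"
    using insert by (auto intro!: ess_bdd_cmult ess_bdd_sum)
  have "traj X 0 (0 + 0) (\<lambda>x. c i * f i x + (\<Sum>i\<in>I. c i * f i x)) s =
      traj X 0 (c i *\<^sub>R 0) (\<lambda>x. c i * f i x) s + traj X 0 0 (\<lambda>x. \<Sum>i\<in>I. c i * f i x) s"
    using traj_add[OF X b 1 order_refl, of 0 0] by simp
  thus ?case using insert by (simp only: traj_scale[OF X b] sum.insert) simp
qed

lemma jform_sum:
  assumes "finite I" "\<And>i. i \<in> I \<Longrightarrow> ess_bdd 0 s (f i)" "ess_bdd 0 s w"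
  shows "jform X b 0 s 0 (\<lambda>x. \<Sum>i\<in>I. c i * f i x) w = (\<Sum>i\<in>I. c i * jform X b 0 s 0 (f i) w)"
  using assms
proof (induction I rule: finite_induct)
  case empty
  have "jform X b 0 s 0 (\<lambda>x. 0) w = 0" using jform_scale_left[OF X b, of 0 0 "\<lambda>_. 0" w] by simp
  thus ?case by simp
next
  case (insert i I)
  have 1: "ess_bdd 0 s (\<lambda>x. c i * f i x)" "ess_bdd 0 s (\<lambda>x. \<Sum>i\<in>I. c i * f i x)"
    using insert by (auto intro!: ess_bdd_cmult ess_bdd_sum)
  have "jform X b 0 s (c i *\<^sub>R 0 + 0) (\<lambda>x. c i * f i x + (\<Sum>i\<in>I. c i * f i x)) w =
      c i * jform X b 0 s 0 (f i) w + jform X b 0 s 0 (\<lambda>x. \<Sum>i\<in>I. c i * f i x) w"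
    by (subst jform_add_left[OF X b 1 insert.prems(2)], subst jform_scale_left[OF X b]) simp
  thus ?case using insert by simp
qed

text \<open>There is one linear condition per test function and one per vector of a spanning set of
  the plane; a combination of one more function than there are conditions can meet them all.\<close>

lemma Nperp_in_family:
  assumes f: "\<And>i::nat. ess_bdd 0 s (f i)"
  obtains n c where "\<exists>i<n. c i \<noteq> 0" "Nperp 0 (\<lambda>x. \<Sum>i<n. c i * f i x)"
proof -
  obtain T where T: "T \<subseteq> J0" "finite T" "J0 \<subseteq> span T"
    using basis_exists[of J0] independent_imp_finite by metis
  define n where "n = card (Inl ` B \<union> Inr ` T :: ((real \<Rightarrow> real) + 'e \<times> 'e) set) + 1"
  define F where "F = (\<lambda>k i. case k of Inl g \<Rightarrow> jform X b 0 s 0 (f i) g | Inr x \<Rightarrow> traj X 0 0 (f i) s \<bullet> x)"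
  obtain c where c: "\<exists>i\<in>{..<n}. c i \<noteq> 0" "\<forall>k\<in>Inl ` B \<union> Inr ` T. (\<Sum>i\<in>{..<n}. c i * F k i) = 0"
    using homogeneous_system[of "Inl ` B \<union> Inr ` T" "{..<n}" F] B(1) T(2) by (auto simp: n_def)
  have "Nperp 0 (\<lambda>x. \<Sum>i<n. c i * f i x)"
    unfolding Nperp_def
  proof (intro conjI ballI)
    show "0 \<in> (vertical :: ('e \<times> 'e) set)" by (simp add: vertical_def)
    show "ess_bdd 0 s (\<lambda>x. \<Sum>i<n. c i * f i x)" by (intro ess_bdd_sum ess_bdd_cmult f)
    show "jform X b 0 s 0 (\<lambda>x. \<Sum>i<n. c i * f i x) g = 0" if "g \<in> B" for g
      using c(2)[rule_format, of "Inl g"] that by (subst jform_sum[OF _ f B(2)[OF that]]) (auto simp: F_def)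
    fix x assume x: "x \<in> J0"
    let ?z = "traj X 0 0 (\<lambda>x. \<Sum>i<n. c i * f i x) s"
    have "?z = (\<Sum>i<n. c i *\<^sub>R traj X 0 0 (f i) s)" by (rule traj_sum) (auto intro: f)
    hence "?z \<bullet> t = (\<Sum>i<n. c i * F (Inr t) i)" for t by (simp add: F_def inner_sum_left)
    hence "\<forall>t\<in>T. ?z \<bullet> t = 0" using c(2) by auto
    hence "T \<subseteq> {t. ?z \<bullet> t = 0}" by blast
    moreover have "subspace {t. ?z \<bullet> t = 0}" by (rule subspace_hyperplane)
    ultimately have "span T \<subseteq> {t. ?z \<bullet> t = 0}" by (rule span_minimal)
    thus "?z \<bullet> x = 0" using x T(3) by blast
  qed
  thus ?thesis using that c(1) by blast
qed

text \<open>In the situation of \<open>indefinite_stationary\<close>, duality turns every vector of the plane into the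
  end point of an exact solution of the Jacobi equation with bounded control.\<close>

lemma exact_fields:
  assumes stat: "\<And>v. ess_bdd 0 s v \<Longrightarrow> (\<And>w. w \<in> B \<Longrightarrow> jform X b 0 s 0 v w = 0) \<Longrightarrow> traj X 0 0 v s \<in> J0"
    and \<xi>: "\<xi> \<in> J0"
    and \<tau>: "0 \<le> \<tau>" "\<tau> \<le> s"
  obtains e u where "ess_bdd \<tau> s u" "traj X \<tau> e u s = \<xi>"
    "AE x in lebesgue_on {\<tau>..s}. sigma (traj X \<tau> e u x) (X x) + b x * u x = 0"
proof -
  obtain \<eta> v where v: "\<xi> = traj X 0 \<eta> v s" "\<eta> \<in> vertical" "v \<in> fspan B" "\<forall>w\<in>fspan B. jform X b 0 s \<eta> v w = 0"
    using \<xi> unfolding jacobi_approx_eq by blast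
  have bv: "ess_bdd 0 s v" using fspan_ess_bdd[OF B(2) v(3)] .
  have sub: "{\<tau>..s} \<subseteq> {0..s}" using \<tau> by auto
  have X\<tau>: "ess_bdd \<tau> s X" and b\<tau>: "ess_bdd \<tau> s b" using X b sub by (auto intro: ess_bdd_subinterval)
  have B\<tau>: "ess_bdd \<tau> s g" if "g \<in> B" for g by (rule ess_bdd_subinterval[OF B(2)[OF that] sub])
  \<comment> \<open>The initial vector from which the trajectory of \<open>g\<close> ends at 0:
    corrections by such trajectories do not move the end point. It is not confined to any
    plane.\<close>
  define st where "st = (\<lambda>g. - integral {\<tau>..s} (\<lambda>x. g x *\<^sub>R X x))"
  have st: "traj X \<tau> (st g) g s = 0" for g by (simp add: traj_def st_def)
  define res where "res = (\<lambda>e u x. sigma (traj X \<tau> e u x) (X x) + b x * u x)"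
  have bres: "ess_bdd \<tau> s (res e u)" if "ess_bdd \<tau> s u" for e u
    unfolding res_def
    by (rule ess_bdd_add[OF ess_bdd_bilinear[OF bounded_bilinear_sigma traj_ess_bdd[OF X\<tau> b\<tau> that] X\<tau>] ess_bdd_mult[OF b\<tau> that]])
  have jres: "jform X b \<tau> s e u w = integral {\<tau>..s} (\<lambda>x. res e u x * w x)" for e u w
    unfolding jform_def res_def by (intro integral_cong) (simp add: sigma.scaleR_right algebra_simps)
  \<comment> \<open>Residuals of the test functions. For variations living after
    \<open>\<tau>\<close>, orthogonality to \<open>B\<close> will turn into L2 orthogonality to
    these residuals.\<close>
  define k where "k = (\<lambda>g. res (st g) g)"
  have bk: "ess_bdd \<tau> s (k g)" if "g \<in> B" for g unfolding k_def by (rule bres[OF B\<tau>[OF that]])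
  define e0 where "e0 = traj X 0 \<eta> v \<tau>"
  define f where "f = res e0 v"
  have v\<tau>: "ess_bdd \<tau> s v" by (rule ess_bdd_subinterval[OF bv sub])
  have bf: "ess_bdd \<tau> s f" unfolding f_def by (rule bres[OF v\<tau>])
  have tr: "traj X 0 \<eta> v t = traj X \<tau> e0 v t" if "\<tau> \<le> t" "t \<le> s" for t
    using prim_integral[OF prim_traj[OF X b bv, of \<eta>] \<tau>(1) that] by (simp add: traj_def[of X \<tau>] e0_def)
  note late = jform_late[OF X b \<tau>]
  \<comment> \<open>The initial vector \<open>\<zeta>\<close> is chosen so that the trajectory of
    \<open>g\<close> ends at 0, which removes the boundary term of
    \<open>jform_swap\<close>.\<close>
  have dual: "jform X b 0 s 0 w g = integral {\<tau>..s} (\<lambda>x. k g x * w x)"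
    if g: "g \<in> B" and w: "ess_bdd 0 s w" "\<And>x. x \<le> \<tau> \<Longrightarrow> w x = 0" for g w
  proof -
    have w\<tau>: "ess_bdd \<tau> s w" by (rule ess_bdd_subinterval[OF w(1) sub])
    define gg where "gg = cut_gt \<tau> g"
    have s1: "jform X b 0 s 0 w g - jform X b 0 s \<zeta> g w = sigma (traj X 0 0 w s) (traj X 0 \<zeta> g s)" for \<zeta>
      using jform_swap[OF X b s w(1) B(2)[OF g], of 0 \<zeta>] by (simp add: sigma.zero_left)
    define \<zeta> where "\<zeta> = - integral {0..s} (\<lambda>x. g x *\<^sub>R X x)"
    have e: "traj X 0 \<zeta> g s = 0" by (simp add: traj_def \<zeta>_def)
    have e2: "traj X 0 \<zeta> g \<tau> = st g"
    proof -
      have "traj X 0 \<zeta> g s - traj X 0 \<zeta> g \<tau> = integral {\<tau>..s} (\<lambda>x. g x *\<^sub>R X x)"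
        using prim_integral[OF prim_traj[OF X b B(2)[OF g], of \<zeta>] \<tau>(1) \<tau>(2) order_refl] by simp
      thus ?thesis using e unfolding st_def by (metis add.inverse_inverse diff_0)
    qed
    have "jform X b 0 s 0 w g = jform X b 0 s \<zeta> g w" using s1[of \<zeta>] e by (simp add: sigma.zero_right)
    also have "\<dots> = jform X b \<tau> s (st g) g w" using late[where w = w and u = g and \<zeta> = \<zeta>, OF B(2)[OF g] w] e2 by simp
    finally show ?thesis by (simp add: jres k_def)
  qed
  \<comment> \<open>A late variation annihilated by all \<open>k g\<close> ends in the plane by
    \<open>stat\<close>, where isotropy makes its pairing with \<open>\<xi>\<close> vanish; hence
    \<open>f\<close> annihilates it too. This suggests that \<open>f\<close> is a combination of the
    \<open>k g\<close>.\<close>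
  have orth: "integral {\<tau>..s} (\<lambda>x. f x * w x) = 0"
    if w: "ess_bdd 0 s w" "\<And>x. x \<le> \<tau> \<Longrightarrow> w x = 0" and N: "\<And>g. g \<in> B \<Longrightarrow> integral {\<tau>..s} (\<lambda>x. k g x * w x) = 0" for w
  proof -
    have N0: "jform X b 0 s 0 w g = 0" if "g \<in> B" for g using dual[OF that w] N[OF that] by simp
    have "traj X 0 0 w s \<in> J0" by (rule stat[OF w(1) N0])
    hence "sigma \<xi> (traj X 0 0 w s) = 0" using isotropic_jacobi_approx[OF X b s B(2)] \<xi> by blast
    moreover have "jform X b 0 s 0 w v = 0" by (rule jform_zero_fspan[OF X b w(1) B(2) N0 v(3)])
    ultimately have "jform X b 0 s \<eta> v w = 0"
      using jform_swap[OF X b s bv w(1), of \<eta> 0] v(1) by (simp add: sigma.zero_right)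
    hence "jform X b \<tau> s e0 v w = 0" using late[where w = w and u = v and \<zeta> = \<eta>, OF bv w] by (simp add: e0_def)
    thus ?thesis by (simp add: jres f_def)
  qed
  define M where "M = (\<lambda>g h. if g \<in> B \<and> h \<in> B then integral {\<tau>..s} (\<lambda>x. k g x * k h x) else 0)"
  define l where "l = (\<lambda>g. integral {\<tau>..s} (\<lambda>x. k g x * f x))"
  have bK: "ess_bdd \<tau> s (\<lambda>x. \<Sum>g\<in>B. c g * k g x)" for c by (intro ess_bdd_sum ess_bdd_cmult bk)
  have Mc: "(\<Sum>g\<in>B. \<Sum>h\<in>B. c g * c h * M g h) = integral {\<tau>..s} (\<lambda>x. (\<Sum>g\<in>B. c g * k g x)\<^sup>2)" for c
  proof -
    have "integral {\<tau>..s} (\<lambda>x. (\<Sum>g\<in>B. c g * k g x)\<^sup>2) = integral {\<tau>..s} (\<lambda>x. \<Sum>g\<in>B. \<Sum>h\<in>B. c g * c h * (k g x * k h x))"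
      by (simp only: power2_eq_square bilinear_sum_expand)
    also have "\<dots> = (\<Sum>g\<in>B. \<Sum>h\<in>B. integral {\<tau>..s} (\<lambda>x. c g * c h * (k g x * k h x)))"
      by (subst integral_ess_bdd_sum, intro ess_bdd_sum ess_bdd_cmult ess_bdd_mult bk, assumption, assumption,
          intro sum.cong refl integral_ess_bdd_sum ess_bdd_cmult ess_bdd_mult bk, assumption, assumption)
    also have "\<dots> = (\<Sum>g\<in>B. \<Sum>h\<in>B. c g * c h * M g h)" by (intro sum.cong refl) (simp add: M_def)
    finally show ?thesis by simp
  qed
  have lc: "(\<Sum>g\<in>B. c g * l g) = integral {\<tau>..s} (\<lambda>x. (\<Sum>g\<in>B. c g * k g x) * f x)" for c
  proof -
    have "integral {\<tau>..s} (\<lambda>x. (\<Sum>g\<in>B. c g * k g x) * f x) = integral {\<tau>..s} (\<lambda>x. \<Sum>g\<in>B. c g * (k g x * f x))"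
      by (simp add: sum_distrib_right mult.assoc)
    also have "\<dots> = (\<Sum>g\<in>B. integral {\<tau>..s} (\<lambda>x. c g * (k g x * f x)))"
      by (intro integral_ess_bdd_sum ess_bdd_cmult ess_bdd_mult bk bf)
    finally show ?thesis by (simp add: l_def)
  qed
  \<comment> \<open>Coefficients of the L2 projection of \<open>f\<close> to the span of the
    residuals. The Gram matrix \<open>M\<close> may be singular, which \<open>psd_solve\<close>
    allows.\<close>
  have "\<exists>c. \<forall>h\<in>B. (\<Sum>g\<in>B. c g * M g h) = l h"
  proof (rule psd_solve[OF B(1)])
    show "M g h = M h g" for g h by (simp add: M_def mult.commute)
    show "0 \<le> (\<Sum>g\<in>B. \<Sum>h\<in>B. c g * c h * M g h)" for c
      unfolding Mc by (rule integral_ess_bdd_nonneg[OF ess_bdd_power2[OF bK]]) simp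
    show "(\<Sum>g\<in>B. c g * l g) = 0" if "(\<Sum>g\<in>B. \<Sum>h\<in>B. c g * c h * M g h) = 0" for c
    proof -
      have "AE x in lebesgue_on {\<tau>..s}. (\<Sum>g\<in>B. c g * k g x) = 0"
        using AE_zero_of_integral_square[OF bK] that unfolding Mc by blast
      then obtain N where N: "negligible N" "\<And>x. x \<in> {\<tau>..s} - N \<Longrightarrow> (\<Sum>g\<in>B. c g * k g x) = 0"
        using AE_lebesgue_on_negligible by blast
      have "integral {\<tau>..s} (\<lambda>x. (\<Sum>g\<in>B. c g * k g x) * f x) = integral {\<tau>..s} (\<lambda>x. 0)"
        by (rule integral_spike[OF N(1)]) (use N(2) in auto)
      thus ?thesis unfolding lc by simp
    qed
  qed
  then obtain c where c: "\<And>h. h \<in> B \<Longrightarrow> (\<Sum>g\<in>B. c g * M g h) = l h" by blast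
  define K where "K = (\<lambda>x. \<Sum>g\<in>B. c g * k g x)"
  define d where "d = (\<lambda>x. f x - K x)"
  have bd: "ess_bdd \<tau> s d" unfolding d_def K_def by (rule ess_bdd_diff[OF bf bK])
  \<comment> \<open>The remainder \<open>d\<close>, extended by zero, is itself an admissible late
    variation. It is orthogonal to the residuals, hence to \<open>f\<close>, and so its square
    integrates to 0.\<close>
  define dd where "dd = (\<lambda>x. if x \<in> {\<tau><..s} then d x else 0)"
  have bdd: "ess_bdd 0 s dd"
  proof -
    have "(\<lambda>x. if x \<in> {\<tau>..s} then d x else 0) \<in> borel_measurable lebesgue"
      using bd by (subst borel_measurable_if) (auto simp: ess_bdd_def)
    hence m: "(\<lambda>x. if x \<in> {\<tau>..s} then d x else 0) \<in> borel_measurable (lebesgue_on {0..s})"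
      by (rule measurable_restrict_space1)
    obtain C where C: "C \<ge> 0" "AE x in lebesgue_on {\<tau>..s}. norm (d x) \<le> C" using bd by (rule ess_bdd_bound)
    hence "AE x in lebesgue. x \<in> {\<tau>..s} \<longrightarrow> norm (d x) \<le> C" by (subst (asm) AE_restrict_space_iff) auto
    hence "AE x in lebesgue. x \<in> {0..s} \<longrightarrow> norm (if x \<in> {\<tau>..s} then d x else 0) \<le> C"
      by eventually_elim (use C(1) in auto)
    hence "AE x in lebesgue_on {0..s}. norm (if x \<in> {\<tau>..s} then d x else 0) \<le> C"
      by (subst AE_restrict_space_iff) auto
    hence "ess_bdd 0 s (\<lambda>x. if x \<in> {\<tau>..s} then d x else 0)" using m unfolding ess_bdd_def by blast
    from ess_bdd_restrict[OF this, of "{\<tau><..s}"] have "ess_bdd 0 s (\<lambda>x. if x \<in> {\<tau><..s} then (if x \<in> {\<tau>..s} then d x else 0) else 0)" by simp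
    also have "(\<lambda>x. if x \<in> {\<tau><..s} then (if x \<in> {\<tau>..s} then d x else 0) else 0) = dd" by (auto simp: dd_def)
    finally show ?thesis .
  qed
  have idd: "integral {\<tau>..s} (\<lambda>x. h x * dd x) = integral {\<tau>..s} (\<lambda>x. h x * d x)" for h
    by (rule integral_spike[of "{\<tau>}"]) (auto simp: dd_def)
  have kd: "integral {\<tau>..s} (\<lambda>x. k h x * d x) = 0" if h: "h \<in> B" for h
  proof -
    have "integral {\<tau>..s} (\<lambda>x. k h x * d x) = integral {\<tau>..s} (\<lambda>x. k h x * f x - (\<Sum>g\<in>B. c g * (k g x * k h x)))"
      by (intro integral_cong) (simp add: d_def K_def algebra_simps sum_distrib_left)
    also have "\<dots> = l h - integral {\<tau>..s} (\<lambda>x. \<Sum>g\<in>B. c g * (k g x * k h x))"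
      unfolding l_def by (intro integral_ess_bdd_diff ess_bdd_mult bk h bf ess_bdd_sum ess_bdd_cmult)
    also have "integral {\<tau>..s} (\<lambda>x. \<Sum>g\<in>B. c g * (k g x * k h x)) = (\<Sum>g\<in>B. integral {\<tau>..s} (\<lambda>x. c g * (k g x * k h x)))"
      by (intro integral_ess_bdd_sum ess_bdd_cmult ess_bdd_mult bk h)
    also have "\<dots> = (\<Sum>g\<in>B. c g * M g h)" by (intro sum.cong refl) (simp add: M_def h)
    finally show ?thesis using c[OF h] by simp
  qed
  have fd: "integral {\<tau>..s} (\<lambda>x. f x * d x) = 0"
    using orth[OF bdd] kd by (simp add: idd) (simp add: dd_def)
  have Kd: "integral {\<tau>..s} (\<lambda>x. K x * d x) = 0"
  proof -
    have "integral {\<tau>..s} (\<lambda>x. K x * d x) = integral {\<tau>..s} (\<lambda>x. \<Sum>g\<in>B. c g * (k g x * d x))"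
      by (simp add: K_def sum_distrib_right mult.assoc)
    also have "\<dots> = (\<Sum>g\<in>B. integral {\<tau>..s} (\<lambda>x. c g * (k g x * d x)))"
      by (intro integral_ess_bdd_sum ess_bdd_cmult ess_bdd_mult bk bd)
    finally show ?thesis by (simp add: kd)
  qed
  have "integral {\<tau>..s} (\<lambda>x. (d x)\<^sup>2) = integral {\<tau>..s} (\<lambda>x. f x * d x - K x * d x)"
    by (intro integral_cong) (simp add: d_def power2_eq_square algebra_simps)
  also have "\<dots> = integral {\<tau>..s} (\<lambda>x. f x * d x) - integral {\<tau>..s} (\<lambda>x. K x * d x)"
    by (rule integral_ess_bdd_diff[OF ess_bdd_mult[OF bf bd] ess_bdd_mult[OF bK[of c, folded K_def] bd]])
  finally have "integral {\<tau>..s} (\<lambda>x. (d x)\<^sup>2) = 0" using fd Kd by simp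
  hence ae: "AE x in lebesgue_on {\<tau>..s}. d x = 0" by (rule AE_zero_of_integral_square[OF bd])
  \<comment> \<open>Removing the combination from \<open>v\<close> turns the residual into
    \<open>d\<close>, which vanishes almost everywhere.\<close>
  define u where "u = (\<lambda>x. v x - (\<Sum>g\<in>B. c g * g x))"
  define e where "e = e0 - (\<Sum>g\<in>B. c g *\<^sub>R st g)"
  have bu: "ess_bdd \<tau> s u" unfolding u_def by (intro ess_bdd_diff v\<tau> ess_bdd_sum ess_bdd_cmult B\<tau>)
  have tru: "traj X \<tau> e u t = traj X \<tau> e0 v t - (\<Sum>g\<in>B. c g *\<^sub>R traj X \<tau> (st g) g t)" if t: "t \<in> {\<tau>..s}" for t
  proof -
    have sub': "{\<tau>..t} \<subseteq> {\<tau>..s}" using t by auto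
    have i: "(\<lambda>x. g x *\<^sub>R X x) integrable_on {\<tau>..t}" if "ess_bdd \<tau> s g" for g :: "real \<Rightarrow> real"
      by (rule ess_bdd_integrable[OF ess_bdd_subinterval[OF ess_bdd_scaleR[OF that X\<tau>] sub']])
    have "integral {\<tau>..t} (\<lambda>x. u x *\<^sub>R X x) = integral {\<tau>..t} (\<lambda>x. v x *\<^sub>R X x - (\<Sum>g\<in>B. c g *\<^sub>R (g x *\<^sub>R X x)))"
      by (intro integral_cong) (simp add: u_def scaleR_diff_left scaleR_sum_left)
    also have "\<dots> = integral {\<tau>..t} (\<lambda>x. v x *\<^sub>R X x) - (\<Sum>g\<in>B. c g *\<^sub>R integral {\<tau>..t} (\<lambda>x. g x *\<^sub>R X x))"
      by (subst Henstock_Kurzweil_Integration.integral_diff, rule i[OF v\<tau>],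
          intro integrable_sum B(1) integrable_cmul i B\<tau>, assumption,
          subst Henstock_Kurzweil_Integration.integral_sum[OF B(1)], intro integrable_cmul i B\<tau>, assumption)
        (simp only: Henstock_Kurzweil_Integration.integral_cmul)
    finally show ?thesis
      by (simp add: traj_def e_def scaleR_add_right sum.distrib)
  qed
  have resu: "res e u x = d x" if x: "x \<in> {\<tau>..s}" for x
  proof -
    have "res e u x = res e0 v x - (\<Sum>g\<in>B. c g * res (st g) g x)"
      unfolding res_def tru[OF x]
      by (simp add: u_def sigma.diff_left sigma.sum_left sigma.scaleR_left right_diff_distrib sum_distrib_left
          distrib_left sum.distrib mult.left_commute)
    thus ?thesis by (simp add: d_def f_def K_def k_def)
  qed
  show ?thesis
  proof (rule that[OF bu])
    have "traj X \<tau> e u s = traj X \<tau> e0 v s" using tru[of s] \<tau> st by simp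
    thus "traj X \<tau> e u s = \<xi>" using tr[of s] \<tau> v(1) by simp
    have sp: "AE x in lebesgue_on {\<tau>..s}. x \<in> {\<tau>..s}" by (auto intro!: AE_I2)
    show "AE x in lebesgue_on {\<tau>..s}. sigma (traj X \<tau> e u x) (X x) + b x * u x = 0"
      using ae sp by eventually_elim (metis res_def resu)
  qed
qed

end

section \<open>The oscillating case\<close>

lemma continuous_le_of_AE:
  fixes f g :: "real \<Rightarrow> real"
  assumes ab: "a < b" and f: "continuous_on {a..b} f" and g: "continuous_on {a..b} g"
    and le: "AE x in lebesgue_on {a..b}. f x \<le> g x" and x: "x \<in> {a..b}"
  shows "f x \<le> g x"
proof -
  obtain N where N: "negligible N" "\<And>x. x \<in> {a..b} - N \<Longrightarrow> f x \<le> g x"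
    using AE_lebesgue_on_negligible[OF le] by blast
  have "integral {a..b} (\<lambda>x. max 0 (f x - g x)) = integral {a..b} (\<lambda>x. 0)"
    by (rule integral_spike[OF N(1)]) (use N(2) in auto)
  hence "integral {a..b} (\<lambda>x. max 0 (f x - g x)) = 0" by simp
  moreover have "continuous_on {a..b} (\<lambda>x. max 0 (f x - g x))" by (intro continuous_intros f g)
  ultimately have "\<forall>x\<in>{a..b}. max 0 (f x - g x) = 0"
    using integral_eq_0_iff[of a b "\<lambda>x. max 0 (f x - g x)"] ab by simp
  hence "max 0 (f x - g x) = 0" using x by blast
  moreover have "f x - g x \<le> max 0 (f x - g x)" by simp
  ultimately show ?thesis by linarith
qed

text \<open>Nonnegativity of the variance of the modulus of \<open>f\<close> about its mean
  \<open>m\<close>.\<close>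

lemma integral_abs_square_le_length:
  assumes f: "ess_bdd a b (f :: real \<Rightarrow> real)" and ab: "a \<le> b"
  shows "(integral {a..b} (\<lambda>x. \<bar>f x\<bar>))\<^sup>2 \<le> (b - a) * integral {a..b} (\<lambda>x. (f x)\<^sup>2)"
proof (cases "a = b")
  case False
  hence l: "b - a > 0" using ab by simp
  define I where "I = integral {a..b} (\<lambda>x. \<bar>f x\<bar>)"
  define m where "m = I / (b - a)"
  have bf: "ess_bdd a b (\<lambda>x. \<bar>f x\<bar>)" "ess_bdd a b (\<lambda>x. (f x)\<^sup>2)" by (rule ess_bdd_abs[OF f] ess_bdd_power2[OF f])+
  have "0 \<le> integral {a..b} (\<lambda>x. (\<bar>f x\<bar> - m)\<^sup>2)"
    by (rule integral_ess_bdd_nonneg[OF ess_bdd_power2[OF ess_bdd_diff[OF bf(1) ess_bdd_const]]]) simp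
  also have "\<dots> = integral {a..b} (\<lambda>x. ((f x)\<^sup>2 - 2 * m * \<bar>f x\<bar>) + m\<^sup>2)"
    by (intro integral_cong) (simp add: power2_diff)
  also have "\<dots> = integral {a..b} (\<lambda>x. (f x)\<^sup>2) - 2 * m * I + m\<^sup>2 * (b - a)"
    by (subst integral_ess_bdd_add[OF ess_bdd_diff[OF bf(2) ess_bdd_cmult[OF bf(1)]] ess_bdd_const],
        subst integral_ess_bdd_diff[OF bf(2) ess_bdd_cmult[OF bf(1)]]) (use ab in \<open>simp add: I_def\<close>)
  also have "\<dots> = integral {a..b} (\<lambda>x. (f x)\<^sup>2) - I\<^sup>2 / (b - a)"
  proof -
    have "2 * m * I = 2 * (I\<^sup>2 / (b - a))" by (simp add: m_def power2_eq_square)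
    moreover have "m\<^sup>2 * (b - a) = I\<^sup>2 / (b - a)" using l by (simp add: m_def power2_eq_square)
    ultimately show ?thesis by linarith
  qed
  finally have "I\<^sup>2 / (b - a) \<le> integral {a..b} (\<lambda>x. (f x)\<^sup>2)" by simp
  thus ?thesis using l by (simp add: I_def pos_divide_le_eq mult.commute)
qed simp

lemma abs_le_imp_square_le: "\<bar>x\<bar> \<le> y \<Longrightarrow> x\<^sup>2 \<le> (y :: real)\<^sup>2"
  by (metis abs_ge_zero power2_abs power_mono)

lemma sigma_le_mult:
  assumes "norm z \<le> a" "norm w \<le> b" shows "\<bar>sigma z w\<bar> \<le> a * b"
proof -
  have "norm z * norm w \<le> a * b"
    using assms order_trans[OF norm_ge_zero assms(1)] by (intro mult_mono) auto
  thus ?thesis using sigma_le[of z w] by linarith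
qed

text \<open>\<open>kp < 4 * al\<close> puts the form strictly below Hardy's constant, where test
  functions oscillating towards \<open>\<tau>\<close> change its sign. The monotonicity of
  \<open>- b\<close> serves the energy estimate for exact solutions.\<close>

locale oscillating_piece = jacobi_piece +
  fixes X2 :: "real \<Rightarrow> 'a \<times> 'a" and al kp :: real and p' :: "real \<Rightarrow> real"
  assumes X2: "\<And>t. t \<in> {\<tau>..\<tau> + r} \<Longrightarrow> (X1 has_vector_derivative X2 t) (at t within {\<tau>..\<tau> + r})"
    and contX2: "continuous_on {\<tau>..\<tau> + r} X2"
    and al: "0 < al" "\<And>t. t \<in> {\<tau>..\<tau> + r} \<Longrightarrow> A t \<le> - al"
    and kp: "0 < kp" "kp < 4 * al"
    and bneg: "\<And>t. \<tau> < t \<Longrightarrow> t \<le> \<tau> + r \<Longrightarrow> b t < 0"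
    and bquad: "\<And>t. t \<in> {\<tau>..\<tau> + r} \<Longrightarrow> - b t \<le> kp * (t - \<tau>)\<^sup>2"
    and p': "\<And>t. \<tau> < t \<Longrightarrow> t < \<tau> + r \<Longrightarrow> ((\<lambda>t. - b t) has_real_derivative p' t) (at t)"
      "\<And>t. \<tau> < t \<Longrightarrow> t < \<tau> + r \<Longrightarrow> 0 \<le> p' t"
begin

section \<open>Exact solutions of the Jacobi equation with bounded control\<close>

definition Vf :: "(real \<Rightarrow> real) \<Rightarrow> real \<Rightarrow> real" where "Vf u x = integral {\<tau>..x} u"

definition Ef :: "(real \<Rightarrow> real) \<Rightarrow> real \<Rightarrow> 'a \<times> 'a" where "Ef u x = integral {\<tau>..x} (\<lambda>t. Vf u t *\<^sub>R X1 t)"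

definition exact :: "real \<Rightarrow> 'a \<times> 'a \<Rightarrow> (real \<Rightarrow> real) \<Rightarrow> bool" where
  "exact s e u \<longleftrightarrow> ess_bdd \<tau> s u \<and>
     (AE x in lebesgue_on {\<tau>..s}. sigma (traj X \<tau> e u x) (X x) + b x * u x = 0)"

lemma b_nonpos: "t \<in> {\<tau>..\<tau> + r} \<Longrightarrow> b t \<le> 0"
  using bneg[of t] b[of t] by (cases "t = \<tau>") auto

lemma prim_Vf: "ess_bdd \<tau> s u \<Longrightarrow> prim \<tau> s (Vf u) u"
  using prim_integral_left[of \<tau> s u 0] by (simp add: Vf_def[abs_def])

lemma prim_Ef:
  assumes "s \<le> \<tau> + r" "ess_bdd \<tau> s u"
  shows "prim \<tau> s (Ef u) (\<lambda>t. Vf u t *\<^sub>R X1 t)"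
  using prim_integral_left[OF ess_bdd_scaleR[OF ess_bdd_continuous[OF prim_continuous[OF prim_Vf[OF assms(2)]]] bX1[OF assms(1)]], of 0]
  by (simp add: Ef_def[abs_def])

text \<open>Integration by parts with the primitive vanishing at \<open>\<tau>\<close>, not at
  \<open>s\<close> as in the Goh transformation: the initial vector \<open>e\<close> stays visible
  and the solution is expanded forward from \<open>\<tau>\<close>.\<close>

lemma traj_Vf:
  assumes s: "s \<le> \<tau> + r" and u: "ess_bdd \<tau> s u" and x: "x \<in> {\<tau>..s}"
  shows "traj X \<tau> e u x = e + Vf u x *\<^sub>R X x - Ef u x"
proof -
  have P: "prim \<tau> s (\<lambda>x. traj X \<tau> e u x - (Vf u x *\<^sub>R X x - Ef u x)) (\<lambda>x. u x *\<^sub>R X x - ((u x *\<^sub>R X x + Vf u x *\<^sub>R X1 x) - Vf u x *\<^sub>R X1 x))"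
    by (intro prim_diff prim_scaleR prim_traj[OF bX[OF s] bb[OF s] u] prim_Vf[OF u] primX[OF s] prim_Ef[OF s u])
  have "integral {\<tau>..x} (\<lambda>x. u x *\<^sub>R X x - ((u x *\<^sub>R X x + Vf u x *\<^sub>R X1 x) - Vf u x *\<^sub>R X1 x)) = 0" by simp
  hence "traj X \<tau> e u x - (Vf u x *\<^sub>R X x - Ef u x) = e"
    using prim_integral[OF P, of \<tau> x] x by (simp add: Vf_def Ef_def)
  thus ?thesis by (simp add: algebra_simps)
qed

text \<open>The equation holds almost everywhere, but the pairing with \<open>X\<close> and the
  function \<open>b\<close> are continuous, so the resulting inequality holds at every
  point.\<close>

lemma exact_residual:
  assumes s: "\<tau> < s" "s \<le> \<tau> + r" and ex: "exact s e u"
  obtains K where "K \<ge> 0" "\<And>x. x \<in> {\<tau>..s} \<Longrightarrow> \<bar>sigma (traj X \<tau> e u x) (X x)\<bar> \<le> K * - b x"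
    "AE x in lebesgue_on {\<tau>..s}. \<bar>u x\<bar> \<le> K" "\<And>x. x \<in> {\<tau>..s} \<Longrightarrow> \<bar>Vf u x\<bar> \<le> K * (x - \<tau>)"
proof -
  have u: "ess_bdd \<tau> s u" using ex by (simp add: exact_def)
  obtain K where K: "K \<ge> 0" "AE x in lebesgue_on {\<tau>..s}. norm (u x) \<le> K" using u by (rule ess_bdd_bound)
  show ?thesis
  proof (rule that[OF K(1)])
    show "AE x in lebesgue_on {\<tau>..s}. \<bar>u x\<bar> \<le> K" using K(2) by simp
    have c1: "continuous_on {\<tau>..s} (\<lambda>x. \<bar>sigma (traj X \<tau> e u x) (X x)\<bar>)"
      by (intro continuous_on_rabs prim_continuous[OF prim_g[OF s(2) u]])
    have c2: "continuous_on {\<tau>..s} (\<lambda>x. K * - b x)"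
      by (intro continuous_intros continuous_on_subset[OF contb]) (use s in auto)
    have sp: "AE x in lebesgue_on {\<tau>..s}. x \<in> {\<tau>..s}" by (auto intro!: AE_I2)
    have "AE x in lebesgue_on {\<tau>..s}. \<bar>sigma (traj X \<tau> e u x) (X x)\<bar> \<le> K * - b x"
      using ex[unfolded exact_def, THEN conjunct2] K(2) sp
    proof eventually_elim
      case (elim x)
      hence "sigma (traj X \<tau> e u x) (X x) = - (u x * b x)" by (simp add: algebra_simps add_eq_0_iff)
      hence "\<bar>sigma (traj X \<tau> e u x) (X x)\<bar> = \<bar>u x\<bar> * \<bar>b x\<bar>" by (simp add: abs_mult)
      also have "\<bar>b x\<bar> = - b x" using b_nonpos[of x] elim s by simp
      also have "\<bar>u x\<bar> * - b x \<le> K * - b x" using elim b_nonpos[of x] s by (intro mult_right_mono) auto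
      finally show ?case .
    qed
    thus "\<bar>sigma (traj X \<tau> e u x) (X x)\<bar> \<le> K * - b x" if "x \<in> {\<tau>..s}" for x
      using continuous_le_of_AE[OF s(1) c1 c2 _ that] by blast
    show "\<bar>Vf u x\<bar> \<le> K * (x - \<tau>)" if x: "x \<in> {\<tau>..s}" for x
    proof -
      have sub: "{\<tau>..x} \<subseteq> {\<tau>..s}" using x by auto
      have "norm (integral {\<tau>..x} u) \<le> K * (x - \<tau>)"
        using x by (intro integral_bound_ae ess_bdd_subinterval[OF u sub] ess_bdd_AE_sub[OF K(2) sub]) auto
      thus ?thesis by (simp add: Vf_def)
    qed
  qed
qed

lemma Ef_bound:
  assumes s: "s \<le> \<tau> + r" and u: "ess_bdd \<tau> s u" and x: "x \<in> {\<tau>..s}"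
    and C: "C \<ge> 0" "\<And>t. t \<in> {\<tau>..\<tau> + r} \<Longrightarrow> norm (X1 t) \<le> C"
    and M: "M \<ge> 0" "\<And>t. t \<in> {\<tau>..x} \<Longrightarrow> \<bar>Vf u t\<bar> \<le> M"
  shows "norm (Ef u x) \<le> C * M * (x - \<tau>)"
proof -
  have sub: "{\<tau>..x} \<subseteq> {\<tau>..s}" using x by auto
  have "norm (integral {\<tau>..x} (\<lambda>t. Vf u t *\<^sub>R X1 t)) \<le> (C * M) * (x - \<tau>)"
  proof (intro integral_bound_ae ess_bdd_subinterval[OF prim_ess_bdd[OF prim_Ef[OF s u]] sub] AE_I2)
    fix t assume "t \<in> space (lebesgue_on {\<tau>..x})"
    hence t: "t \<in> {\<tau>..x}" by simp
    hence "norm (X1 t) \<le> C" "\<bar>Vf u t\<bar> \<le> M" using C(2) M(2) x s by auto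
    hence "\<bar>Vf u t\<bar> * norm (X1 t) \<le> M * C" using M by (intro mult_mono) auto
    thus "norm (Vf u t *\<^sub>R X1 t) \<le> C * M" by (simp add: mult.commute)
  qed (use x in auto)
  thus ?thesis by (simp add: Ef_def)
qed

text \<open>A bounded control makes \<open>sigma e (X x)\<close> of order
  \<open>(x - \<tau>)^2\<close>: the trajectory pairs with \<open>X\<close> at most like
  \<open>- b\<close>, the summand \<open>V X\<close> pairs to zero, and \<open>Ef\<close> is of
  second order. So the value and the right derivative at \<open>\<tau>\<close> vanish.\<close>

lemma exact_start:
  assumes s: "\<tau> < s" "s \<le> \<tau> + r" and ex: "exact s e u"
  shows "sigma e (X \<tau>) = 0" "sigma e (X1 \<tau>) = 0"
proof -
  have u: "ess_bdd \<tau> s u" using ex by (simp add: exact_def)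
  obtain K where K: "K \<ge> 0" "\<And>x. x \<in> {\<tau>..s} \<Longrightarrow> \<bar>sigma (traj X \<tau> e u x) (X x)\<bar> \<le> K * - b x"
    "\<And>x. x \<in> {\<tau>..s} \<Longrightarrow> \<bar>Vf u x\<bar> \<le> K * (x - \<tau>)" by (rule exact_residual[OF s ex]) blast
  obtain C where C: "C \<ge> 1" "\<And>t. t \<in> {\<tau>..\<tau> + r} \<Longrightarrow> norm (X t) \<le> C" "\<And>t. t \<in> {\<tau>..\<tau> + r} \<Longrightarrow> norm (X1 t) \<le> C"
    by (rule X_bounds) blast
  define D where "D = K * kp + C * K * C"
  have est: "\<bar>sigma e (X x)\<bar> \<le> D * (x - \<tau>)\<^sup>2" if x: "x \<in> {\<tau>..s}" for x
  proof -
    have xr: "x \<in> {\<tau>..\<tau> + r}" using x s by auto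
    have "norm (Ef u x) \<le> C * (K * (x - \<tau>)) * (x - \<tau>)"
    proof (rule Ef_bound[OF s(2) u x _ C(3)])
      fix t assume t: "t \<in> {\<tau>..x}"
      have "\<bar>Vf u t\<bar> \<le> K * (t - \<tau>)" using K(3)[of t] t x by simp
      also have "\<dots> \<le> K * (x - \<tau>)" using t K(1) by (intro mult_left_mono) auto
      finally show "\<bar>Vf u t\<bar> \<le> K * (x - \<tau>)" .
    qed (use C K x in auto)
    hence "norm (Ef u x) * norm (X x) \<le> (C * (K * (x - \<tau>)) * (x - \<tau>)) * C"
      using C(2)[OF xr] by (intro mult_mono) (auto intro: order_trans[OF norm_ge_zero])
    hence 1: "\<bar>sigma (Ef u x) (X x)\<bar> \<le> C * K * C * (x - \<tau>)\<^sup>2"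
      using sigma_le[of "Ef u x" "X x"] by (simp add: power2_eq_square mult_ac)
    have 2: "\<bar>sigma (traj X \<tau> e u x) (X x)\<bar> \<le> K * kp * (x - \<tau>)\<^sup>2"
      using K(2)[OF x] mult_left_mono[OF bquad[OF xr] K(1)] by simp
    have "sigma e (X x) = sigma (traj X \<tau> e u x) (X x) + sigma (Ef u x) (X x)"
      by (simp add: traj_Vf[OF s(2) u x] sigma.diff_left sigma.add_left sigma.scaleR_left)
    thus ?thesis using 1 2 by (simp add: D_def algebra_simps)
  qed
  show e0: "sigma e (X \<tau>) = 0" using est[of \<tau>] s by simp
  have sub: "{\<tau>..s} \<subseteq> {\<tau>..\<tau> + r}" using s by auto
  have "((\<lambda>x. sigma e (X x)) has_vector_derivative sigma e (X1 \<tau>)) (at \<tau> within {\<tau>..s})"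
    using has_vector_derivative_within_subset[OF X sub] r
    by (intro bounded_linear.has_vector_derivative[OF sigma.bounded_linear_right]) simp
  hence "((\<lambda>x. sigma e (X x)) has_field_derivative sigma e (X1 \<tau>)) (at_right \<tau>)"
    unfolding at_within_Icc_at_right[OF s(1)] by (simp add: has_real_derivative_iff_has_vector_derivative)
  hence lim: "((\<lambda>x. (sigma e (X x) - sigma e (X \<tau>)) / (x - \<tau>)) \<longlongrightarrow> sigma e (X1 \<tau>)) (at_right \<tau>)"
    unfolding has_field_derivative_iff .
  have "((\<lambda>x. (sigma e (X x) - sigma e (X \<tau>)) / (x - \<tau>)) \<longlongrightarrow> 0) (at_right \<tau>)"
  proof (rule Lim_null_comparison)
    have "eventually (\<lambda>x. x \<in> {\<tau><..<s}) (at_right \<tau>)" using s by (intro eventually_at_right_real)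
    thus "eventually (\<lambda>x. norm ((sigma e (X x) - sigma e (X \<tau>)) / (x - \<tau>)) \<le> D * (x - \<tau>)) (at_right \<tau>)"
    proof eventually_elim
      case (elim x)
      hence "\<bar>sigma e (X x)\<bar> \<le> D * (x - \<tau>) * (x - \<tau>)" using est[of x] by (simp add: power2_eq_square)
      thus ?case using elim e0 by (simp add: pos_divide_le_eq)
    qed
    have "((\<lambda>x. D * (x - \<tau>)) \<longlongrightarrow> D * (\<tau> - \<tau>)) (at_right \<tau>)" by (intro tendsto_intros)
    thus "((\<lambda>x. D * (x - \<tau>)) \<longlongrightarrow> 0) (at_right \<tau>)" by simp
  qed
  from tendsto_unique[OF _ lim this] show "sigma e (X1 \<tau>) = 0" by simp
qed

text \<open>The energy \<open>- A V\<^sup>2 + y\<^sup>2 / p + 2 e V\<close> of an exact solution issuing from \<open>0\<close> grows at most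
  linearly with the square of the supremum of \<open>V\<close>, because \<open>p\<close> is nondecreasing. This forces \<open>V = 0\<close>.\<close>

lemma exact_unique:
  "\<exists>S>0. S \<le> r \<and> (\<forall>s u. \<tau> < s \<longrightarrow> s \<le> \<tau> + S \<longrightarrow> exact s 0 u \<longrightarrow> traj X \<tau> 0 u s = 0)"
proof -
  obtain C0 where C0: "C0 \<ge> 1" "\<And>t. t \<in> {\<tau>..\<tau> + r} \<Longrightarrow> norm (X t) \<le> C0" "\<And>t. t \<in> {\<tau>..\<tau> + r} \<Longrightarrow> norm (X1 t) \<le> C0"
    "\<And>t. t \<in> {\<tau>..\<tau> + r} \<Longrightarrow> \<bar>A t\<bar> \<le> C0"
    by (rule X_bounds) blast
  obtain C2 where C2: "\<forall>x\<in>X2 ` {\<tau>..\<tau> + r}. norm x \<le> C2"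
    using compact_imp_bounded[OF compact_continuous_image[OF contX2]] by (auto simp only: bounded_iff compact_Icc)
  define C where "C = max C0 C2"
  have C: "C \<ge> 1" "\<And>t. t \<in> {\<tau>..\<tau> + r} \<Longrightarrow> norm (X t) \<le> C" "\<And>t. t \<in> {\<tau>..\<tau> + r} \<Longrightarrow> norm (X1 t) \<le> C"
    "\<And>t. t \<in> {\<tau>..\<tau> + r} \<Longrightarrow> norm (X2 t) \<le> C" "\<And>t. t \<in> {\<tau>..\<tau> + r} \<Longrightarrow> \<bar>A t\<bar> \<le> C"
    using C0 C2 by (auto simp: C_def le_max_iff_disj)
  \<comment> \<open>The energy grows by at most \<open>3 * C^2 * M^2 * S\<close>, and its indefinite
    term costs another \<open>2 * C^2 * M^2 * S\<close>; the choice makes \<open>5 * C^2 * S\<close>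
    smaller than \<open>al\<close>.\<close>
  define S where "S = min (min r 1) (al / (6 * C\<^sup>2))"
  have S: "0 < S" "S \<le> r" "S \<le> 1" "S \<le> al / (6 * C\<^sup>2)" using r al(1) C(1) by (auto simp: S_def)
  have CS: "5 * C\<^sup>2 * S < al"
  proof -
    have "6 * C\<^sup>2 * S \<le> al" using S(4) C(1) by (simp add: pos_le_divide_eq mult.commute)
    moreover have "0 < C\<^sup>2 * S" using S(1) C(1) by simp
    ultimately show ?thesis by linarith
  qed
  have "traj X \<tau> 0 u s = 0" if s: "\<tau> < s" "s \<le> \<tau> + S" and ex: "exact s 0 u" for s u
  proof -
    have sr: "s \<le> \<tau> + r" using s S by simp
    have u: "ess_bdd \<tau> s u" using ex by (simp add: exact_def)
    obtain K where K: "K \<ge> 0" "\<And>x. x \<in> {\<tau>..s} \<Longrightarrow> \<bar>sigma (traj X \<tau> 0 u x) (X x)\<bar> \<le> K * - b x"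
      "AE x in lebesgue_on {\<tau>..s}. \<bar>u x\<bar> \<le> K" "\<And>x. x \<in> {\<tau>..s} \<Longrightarrow> \<bar>Vf u x\<bar> \<le> K * (x - \<tau>)"
      by (rule exact_residual[OF s(1) sr ex]) blast
    define V where "V = Vf u"
    define E where "E = Ef u"
    \<comment> \<open>Since the trajectory starts at 0, \<open>y\<close> is its pairing with
      \<open>X\<close>. The equation becomes the system \<open>V' = y / p\<close>,
      \<open>y' = A V - ev\<close>.\<close>
    define y where "y = (\<lambda>x. - sigma (E x) (X x))"
    define ev where "ev = (\<lambda>x. sigma (E x) (X1 x))"
    define p where "p = (\<lambda>x. - b x)"
    have yt: "sigma (traj X \<tau> 0 u x) (X x) = y x" if "x \<in> {\<tau>..s}" for x
      using traj_Vf[OF sr u that, of 0] by (simp add: y_def V_def E_def sigma.diff_left sigma.scaleR_left sigma.minus_left)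
    have p0: "p x > 0" if "\<tau> < x" "x \<le> s" for x using bneg[of x] that sr by (simp add: p_def)
    have cV: "continuous_on {\<tau>..s} V" unfolding V_def by (rule prim_continuous[OF prim_Vf[OF u]])
    have cE: "continuous_on {\<tau>..s} E" unfolding E_def by (rule prim_continuous[OF prim_Ef[OF sr u]])
    have sub: "{\<tau>..s} \<subseteq> {\<tau>..\<tau> + r}" using sr by auto
    have cX: "continuous_on {\<tau>..s} X" "continuous_on {\<tau>..s} X1" "continuous_on {\<tau>..s} p"
      using continuous_on_subset[OF contX sub] continuous_on_subset[OF X1 sub] continuous_on_subset[OF contb sub]
      by (auto simp: p_def intro: continuous_intros)
    have cy: "continuous_on {\<tau>..s} y" unfolding y_def by (intro continuous_intros sigma.continuous_on cE cX)
    obtain xm where xm: "xm \<in> {\<tau>..s}" "\<And>x. x \<in> {\<tau>..s} \<Longrightarrow> \<bar>V x\<bar> \<le> \<bar>V xm\<bar>"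
    proof -
      have "\<exists>x\<in>{\<tau>..s}. \<forall>y\<in>{\<tau>..s}. \<bar>V y\<bar> \<le> \<bar>V x\<bar>"
        using s by (intro continuous_attains_sup continuous_on_rabs cV) auto
      thus ?thesis using that by blast
    qed
    define M where "M = \<bar>V xm\<bar>"
    have M: "M \<ge> 0" "\<And>x. x \<in> {\<tau>..s} \<Longrightarrow> \<bar>V x\<bar> \<le> M" using xm by (auto simp: M_def)
    have En: "norm (E x) \<le> C * M * (x - \<tau>)" if x: "x \<in> {\<tau>..s}" for x
      unfolding E_def
      by (rule Ef_bound[OF sr u x _ C(3) M(1)]) (use C M x in \<open>auto simp: V_def\<close>)
    have EnS: "norm (E x) \<le> C * M * S" if x: "x \<in> {\<tau>..s}" for x
    proof -
      have "C * M * (x - \<tau>) \<le> C * M * S" using x s C(1) M(1) by (intro mult_left_mono) auto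
      thus ?thesis using En[OF x] by linarith
    qed
    have EnM: "norm (E x) \<le> C * M" if x: "x \<in> {\<tau>..s}" for x
    proof -
      have "C * M * S \<le> C * M * 1" using S(3) C(1) M(1) by (intro mult_left_mono) auto
      thus ?thesis using EnS[OF x] by linarith
    qed
    have interior: "x \<in> {\<tau>..\<tau> + r}" "x \<in> {\<tau><..<\<tau> + r}" if "\<tau> < x" "x < s" for x using that sr by auto
    have at_in: "at x within {\<tau>..\<tau> + r} = at x" if "\<tau> < x" "x < s" for x
      using interior(2)[OF that] by (intro at_within_interior) (simp add: interior_atLeastAtMost_real)
    have dX: "(X has_vector_derivative X1 x) (at x)" "(X1 has_vector_derivative X2 x) (at x)" if "\<tau> < x" "x < s" for x
      using X[OF interior(1)[OF that]] X2[OF interior(1)[OF that]] at_in[OF that] by simp_all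
    have FT: "((\<lambda>x. integral {c..x} g) has_vector_derivative g x) (at x)"
      if g: "continuous_on {c..s} g" and x: "c < x" "x < s" for g :: "real \<Rightarrow> 'z::euclidean_space" and c x
    proof -
      have "((\<lambda>x. integral {c..x} g) has_vector_derivative g x) (at x within {c..s})"
        using x by (intro integral_has_vector_derivative[OF g]) auto
      moreover have "at x within {c..s} = at x" using x by (intro at_within_interior) (simp add: interior_atLeastAtMost_real)
      ultimately show ?thesis by simp
    qed
    have dE: "(E has_vector_derivative V x *\<^sub>R X1 x) (at x)" if "\<tau> < x" "x < s" for x
      unfolding E_def Ef_def[abs_def] V_def[symmetric] using that by (intro FT continuous_intros cV cX)
    \<comment> \<open>Away from \<open>\<tau>\<close> the quotient \<open>y / p\<close> is
      continuous and equals \<open>u\<close> almost everywhere, so \<open>V\<close> is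
      differentiable at each interior point although \<open>u\<close> is only measurable.\<close>
    have dV: "(V has_real_derivative y x / p x) (at x)" if x: "\<tau> < x" "x < s" for x
    proof -
      define m where "m = (\<tau> + x) / 2"
      have m: "\<tau> < m" "m < x" using x by (auto simp: m_def)
      have msub: "{m..s} \<subseteq> {\<tau>..s}" using m by auto
      have cq: "continuous_on {m..s} (\<lambda>x. y x / p x)"
      proof -
        have "\<forall>z\<in>{m..s}. p z \<noteq> 0"
        proof
          fix z assume "z \<in> {m..s}"
          hence "p z > 0" using m by (intro p0) auto
          thus "p z \<noteq> 0" by simp
        qed
        thus ?thesis
          by (intro continuous_on_divide continuous_on_subset[OF cy msub] continuous_on_subset[OF cX(3) msub])
      qed
      have dd: "((\<lambda>z. V m + integral {m..z} (\<lambda>x. y x / p x)) has_vector_derivative y x / p x) (at x)"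
        using has_vector_derivative_add[OF has_vector_derivative_const FT[OF cq m(2) x(2)]] by simp
      obtain N where N: "negligible N" "\<And>x. x \<in> {\<tau>..s} - N \<Longrightarrow> sigma (traj X \<tau> 0 u x) (X x) + b x * u x = 0"
        using AE_lebesgue_on_negligible[OF ex[unfolded exact_def, THEN conjunct2]] by blast
      have eq: "V m + integral {m..z} (\<lambda>x. y x / p x) = V z" if z: "m < z" "z < s" for z
      proof -
        have "integral {m..z} u = V z - V m"
          unfolding V_def using prim_integral[OF prim_Vf[OF u], of m z] m z by simp
        moreover have "integral {m..z} (\<lambda>x. y x / p x) = integral {m..z} u"
        proof (rule integral_spike[OF N(1)])
          fix w assume w: "w \<in> {m..z} - N"
          hence ws: "w \<in> {\<tau>..s}" "\<tau> < w" "w \<le> s" using m z by auto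
          have "y w = p w * u w" using N(2)[of w] w ws yt[OF ws(1)] by (simp add: p_def)
          thus "u w = y w / p w" using p0[OF ws(2,3)] by simp
        qed
        ultimately show ?thesis by simp
      qed
      have "(V has_vector_derivative y x / p x) (at x)"
        by (rule has_vector_derivative_transform_within_open[OF dd, of "{m<..<s}"]) (use eq m x in auto)
      thus ?thesis by (simp add: has_real_derivative_iff_has_vector_derivative)
    qed
    have dsig: "((\<lambda>x. sigma (f x) (g x)) has_real_derivative sigma (f x) g' + sigma f' (g x)) (at x)"
      if "(f has_vector_derivative f') (at x)" "(g has_vector_derivative g') (at x)" for f g f' g' x
      using bounded_bilinear.has_vector_derivative[OF bounded_bilinear_sigma that]
      by (simp add: has_real_derivative_iff_has_vector_derivative)
    have dA: "(A has_real_derivative sigma (X x) (X2 x)) (at x)" if "\<tau> < x" "x < s" for x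
      using dsig[OF dX[OF that]] by (simp add: A_def[abs_def])
    have dy: "(y has_real_derivative V x * A x - ev x) (at x)" if "\<tau> < x" "x < s" for x
    proof -
      have "(y has_real_derivative - (sigma (E x) (X1 x) + sigma (V x *\<^sub>R X1 x) (X x))) (at x)"
        unfolding y_def by (intro DERIV_minus dsig dE dX that)
      also have "- (sigma (E x) (X1 x) + sigma (V x *\<^sub>R X1 x) (X x)) = V x * A x - ev x"
        using sigma_swap[of "X1 x" "X x"] by (simp add: ev_def A_def sigma.scaleR_left)
      finally show ?thesis .
    qed
    have dev: "(ev has_real_derivative sigma (E x) (X2 x)) (at x)" if "\<tau> < x" "x < s" for x
      using dsig[OF dE[OF that] dX(2)[OF that]] by (simp add: ev_def[abs_def] sigma.scaleR_left)
    \<comment> \<open>The term \<open>2 * ev * V\<close> is added so that, in the derivative, all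
      products of \<open>y\<close> with \<open>V\<close> or \<open>ev\<close> cancel. What is left
      is quadratic in the supremum of \<open>V\<close>, except for \<open>- y^2 * p' / p^2\<close>,
      which has the favourable sign.\<close>
    define H where "H = (\<lambda>x. - A x * (V x)\<^sup>2 + (y x)\<^sup>2 / p x + 2 * ev x * V x)"
    define H' where "H' = (\<lambda>x. - sigma (X x) (X2 x) * (V x)\<^sup>2 + 2 * sigma (E x) (X2 x) * V x - (y x)\<^sup>2 * p' x / (p x)\<^sup>2)"
    have dH: "(H has_real_derivative H' x) (at x)" if x: "\<tau> < x" "x < s" for x
    proof -
      have px: "p x \<noteq> 0" using p0[of x] x by simp
      have dp: "(p has_real_derivative p' x) (at x)" using p'(1)[of x] x sr by (simp add: p_def)
      define q where "q = y x / p x"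
      have yq: "y x = q * p x" using px by (simp add: q_def)
      note dV' = dV[OF x, folded q_def]
      note D = DERIV_add[OF DERIV_add[OF DERIV_mult[OF DERIV_minus[OF dA[OF x]] DERIV_mult[OF dV' dV']]
        DERIV_divide[OF DERIV_mult[OF dy[OF x] dy[OF x]] dp px]] DERIV_mult[OF DERIV_cmult[OF dev[OF x], of 2] dV']]
      show ?thesis unfolding H_def power2_eq_square
        by (rule DERIV_cong[OF D]) (use px in \<open>simp add: H'_def yq field_simps power2_eq_square\<close>)
    qed
    define Q where "Q = 3 * C\<^sup>2 * M\<^sup>2"
    have H'Q: "H' x \<le> Q" if x: "\<tau> < x" "x < s" for x
    proof -
      have xr: "x \<in> {\<tau>..\<tau> + r}" and xs: "x \<in> {\<tau>..s}" using interior(1)[OF x] x by auto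
      have V2: "(V x)\<^sup>2 \<le> M\<^sup>2" by (rule abs_le_imp_square_le[OF M(2)[OF xs]])
      have "\<bar>sigma (X x) (X2 x)\<bar> \<le> C * C"
        by (rule sigma_le_mult[OF C(2)[OF xr] C(4)[OF xr]])
      hence "\<bar>sigma (X x) (X2 x)\<bar> * (V x)\<^sup>2 \<le> C * C * M\<^sup>2" using V2 by (intro mult_mono) auto
      moreover have "- sigma (X x) (X2 x) * (V x)\<^sup>2 \<le> \<bar>sigma (X x) (X2 x)\<bar> * (V x)\<^sup>2"
        by (intro mult_right_mono) auto
      ultimately have 1: "- sigma (X x) (X2 x) * (V x)\<^sup>2 \<le> C\<^sup>2 * M\<^sup>2" by (simp add: power2_eq_square)
      have "\<bar>sigma (E x) (X2 x)\<bar> \<le> C * M * C"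
        by (rule sigma_le_mult[OF EnM[OF xs] C(4)[OF xr]])
      hence "\<bar>sigma (E x) (X2 x)\<bar> * \<bar>V x\<bar> \<le> C * M * C * M" using M(2)[OF xs] by (intro mult_mono) auto
      hence "\<bar>sigma (E x) (X2 x) * V x\<bar> \<le> C\<^sup>2 * M\<^sup>2" by (simp add: abs_mult power2_eq_square mult_ac)
      hence 2: "2 * sigma (E x) (X2 x) * V x \<le> 2 * (C\<^sup>2 * M\<^sup>2)" by (simp add: abs_le_iff)
      have "0 \<le> (y x)\<^sup>2 * p' x / (p x)\<^sup>2" using p'(2)[of x] x sr by simp
      thus ?thesis using 1 2 by (simp add: H'_def Q_def)
    qed
    have Q0: "Q \<ge> 0" by (simp add: Q_def)
    have Hmono: "H x \<le> H x0 + Q * S" if x: "\<tau> < x0" "x0 < x" "x < s" for x0 x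
    proof -
      have "(\<lambda>z. H z - Q * z) x \<le> (\<lambda>z. H z - Q * z) x0"
      proof (rule DERIV_nonpos_imp_nonincreasing[where f = "\<lambda>z. H z - Q * z" and a = x0 and b = x])
        show "x0 \<le> x" using x by simp
        fix z assume z: "x0 \<le> z" "z \<le> x"
        have "((\<lambda>z. H z - Q * z) has_real_derivative H' z - Q) (at z)"
          using dH[of z] z x by (auto intro!: derivative_eq_intros)
        moreover have "H' z - Q \<le> 0" using H'Q[of z] z x by simp
        ultimately show "\<exists>y. ((\<lambda>z. H z - Q * z) has_real_derivative y) (at z) \<and> y \<le> 0" by blast
      qed
      moreover have "Q * (x - x0) \<le> Q * S" using x s Q0 by (intro mult_left_mono) auto
      ultimately show ?thesis by (simp add: algebra_simps)
    qed
    \<comment> \<open>Boundedness of the control enters here: \<open>V\<close> is of first order and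
      \<open>y\<close> at most a multiple of \<open>p\<close>, so \<open>y^2 / p\<close> tends to 0
      at \<open>\<tau>\<close> even though \<open>p\<close> vanishes there.\<close>
    have Hbound: "H x0 \<le> (C * K\<^sup>2 + K\<^sup>2 * kp + 2 * C * C * M * K) * (x0 - \<tau>)" if x: "\<tau> < x0" "x0 < s" for x0
    proof -
      have xr: "x0 \<in> {\<tau>..\<tau> + r}" and xs: "x0 \<in> {\<tau>..s}" using interior(1)[OF x] x by auto
      have z: "0 \<le> x0 - \<tau>" "x0 - \<tau> \<le> 1" using x s S by auto
      have z2: "(x0 - \<tau>)\<^sup>2 \<le> x0 - \<tau>" using z by (simp add: power2_eq_square mult_left_le)
      have Vx: "\<bar>V x0\<bar> \<le> K * (x0 - \<tau>)" using K(4)[OF xs] by (simp add: V_def)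
      have "(V x0)\<^sup>2 \<le> (K * (x0 - \<tau>))\<^sup>2" by (rule abs_le_imp_square_le[OF Vx])
      also have "\<dots> \<le> K\<^sup>2 * (x0 - \<tau>)" using z2 by (simp add: power_mult_distrib mult_left_mono)
      finally have V2: "(V x0)\<^sup>2 \<le> K\<^sup>2 * (x0 - \<tau>)" .
      have "- A x0 * (V x0)\<^sup>2 \<le> C * (K\<^sup>2 * (x0 - \<tau>))"
        using C(5)[OF xr] V2 C(1) al(1) al(2)[OF xr] by (intro mult_mono) auto
      moreover have "(y x0)\<^sup>2 / p x0 \<le> K\<^sup>2 * kp * (x0 - \<tau>)"
      proof -
        have pp: "p x0 > 0" using p0[of x0] x by simp
        have "\<bar>y x0\<bar> \<le> K * p x0" using K(2)[OF xs] yt[OF xs] by (simp add: p_def)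
        hence "(y x0)\<^sup>2 \<le> (K * p x0)\<^sup>2" by (rule abs_le_imp_square_le)
        hence "(y x0)\<^sup>2 / p x0 \<le> (K * p x0)\<^sup>2 / p x0" using pp by (intro divide_right_mono) auto
        also have "\<dots> = K\<^sup>2 * p x0" using pp by (simp add: power2_eq_square)
        also have "\<dots> \<le> K\<^sup>2 * (kp * (x0 - \<tau>)\<^sup>2)" using bquad[OF xr] by (intro mult_left_mono) (auto simp: p_def)
        also have "\<dots> \<le> K\<^sup>2 * (kp * (x0 - \<tau>))" using z2 kp(1) by (intro mult_left_mono) auto
        finally show ?thesis by simp
      qed
      moreover have "2 * ev x0 * V x0 \<le> 2 * C * C * M * K * (x0 - \<tau>)"
      proof -
        have "\<bar>ev x0\<bar> \<le> C * M * C" unfolding ev_def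
          by (rule sigma_le_mult[OF EnM[OF xs] C(3)[OF xr]])
        hence "\<bar>ev x0\<bar> * \<bar>V x0\<bar> \<le> (C * M * C) * (K * (x0 - \<tau>))" using Vx by (intro mult_mono) auto
        moreover have "ev x0 * V x0 \<le> \<bar>ev x0\<bar> * \<bar>V x0\<bar>" by (metis abs_ge_self abs_mult)
        moreover have "2 * (C * M * C * (K * (x0 - \<tau>))) = 2 * C * C * M * K * (x0 - \<tau>)" by (simp only: mult_ac)
        moreover have "2 * ev x0 * V x0 = 2 * (ev x0 * V x0)" by simp
        ultimately show ?thesis by linarith
      qed
      ultimately show ?thesis by (simp add: H_def algebra_simps)
    qed
    have HQ: "H x \<le> Q * S" if x: "\<tau> < x" "x < s" for x
    proof (rule tendsto_le[of "at_right \<tau>" "\<lambda>x0. (C * K\<^sup>2 + K\<^sup>2 * kp + 2 * C * C * M * K) * (x0 - \<tau>) + Q * S" _ "\<lambda>_. H x"])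
      have "((\<lambda>x0. (C * K\<^sup>2 + K\<^sup>2 * kp + 2 * C * C * M * K) * (x0 - \<tau>) + Q * S) \<longlongrightarrow>
        (C * K\<^sup>2 + K\<^sup>2 * kp + 2 * C * C * M * K) * (\<tau> - \<tau>) + Q * S) (at_right \<tau>)" by (intro tendsto_intros)
      thus "((\<lambda>x0. (C * K\<^sup>2 + K\<^sup>2 * kp + 2 * C * C * M * K) * (x0 - \<tau>) + Q * S) \<longlongrightarrow> Q * S) (at_right \<tau>)" by simp
      have "eventually (\<lambda>x0. x0 \<in> {\<tau><..<x}) (at_right \<tau>)" using x by (intro eventually_at_right_real)
      thus "eventually (\<lambda>x0. H x \<le> (C * K\<^sup>2 + K\<^sup>2 * kp + 2 * C * C * M * K) * (x0 - \<tau>) + Q * S) (at_right \<tau>)"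
      proof eventually_elim
        case (elim x0)
        thus ?case using Hmono[of x0 x] Hbound[of x0] x by simp
      qed
    qed auto
    have VM: "al * (V x)\<^sup>2 \<le> 5 * C\<^sup>2 * S * M\<^sup>2" if x: "\<tau> < x" "x < s" for x
    proof -
      have xr: "x \<in> {\<tau>..\<tau> + r}" and xs: "x \<in> {\<tau>..s}" using interior(1)[OF x] x by auto
      have "\<bar>ev x\<bar> \<le> (C * M * S) * C" unfolding ev_def
        by (rule sigma_le_mult[OF EnS[OF xs] C(3)[OF xr]])
      hence "\<bar>ev x\<bar> * \<bar>V x\<bar> \<le> (C * M * S) * C * M" using M(2)[OF xs] by (intro mult_mono) auto
      hence "\<bar>ev x * V x\<bar> \<le> C\<^sup>2 * S * M\<^sup>2" by (simp add: abs_mult power2_eq_square mult_ac)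
      hence "- (C\<^sup>2 * S * M\<^sup>2) \<le> ev x * V x" using abs_ge_minus_self[of "ev x * V x"] by linarith
      moreover have "H x = - A x * (V x)\<^sup>2 + (y x)\<^sup>2 / p x + 2 * (ev x * V x)" by (simp add: H_def)
      moreover have "al * (V x)\<^sup>2 \<le> - A x * (V x)\<^sup>2" using al(2)[OF xr] by (intro mult_right_mono) auto
      moreover have "0 \<le> (y x)\<^sup>2 / p x" using p0[of x] x by simp
      ultimately have "al * (V x)\<^sup>2 \<le> H x + 2 * (C\<^sup>2 * S * M\<^sup>2)" by linarith
      also have "\<dots> \<le> Q * S + 2 * (C\<^sup>2 * S * M\<^sup>2)" using HQ[OF x] by simp
      finally show ?thesis by (simp add: Q_def algebra_simps)
    qed
    have "AE x in lebesgue_on {\<tau>..s}. al * (V x)\<^sup>2 \<le> 5 * C\<^sup>2 * S * M\<^sup>2"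
    proof -
      have "AE x in lebesgue. x \<notin> {\<tau>, s}"
        by (rule AE_I'[of "{\<tau>, s}"]) (auto simp: negligible_iff_null_sets[symmetric])
      hence "AE x in lebesgue. x \<in> {\<tau>..s} \<longrightarrow> al * (V x)\<^sup>2 \<le> 5 * C\<^sup>2 * S * M\<^sup>2"
        by eventually_elim (use VM in auto)
      thus ?thesis by (subst AE_restrict_space_iff) auto
    qed
    hence "al * (V xm)\<^sup>2 \<le> 5 * C\<^sup>2 * S * M\<^sup>2"
      by (rule continuous_le_of_AE[OF s(1) _ _ _ xm(1), rotated 2]) (intro continuous_intros cV)+
    hence "(al - 5 * C\<^sup>2 * S) * M\<^sup>2 \<le> 0" by (simp add: M_def algebra_simps)
    hence "M\<^sup>2 \<le> 0" using CS by (simp add: mult_le_0_iff)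
    hence M0: "M = 0" by simp
    have sS: "s \<in> {\<tau>..s}" using s by simp
    have "V s = 0" "E s = 0" using M(2)[OF sS] EnM[OF sS] M0 by auto
    thus ?thesis using traj_Vf[OF sr u sS, of 0] by (simp add: V_def E_def)
  qed
  thus ?thesis using S by blast
qed

end

section \<open>Infinite families on which the form has one sign\<close>

lemma disjoint_sum_square:
  fixes c h :: "nat \<Rightarrow> real"
  assumes "\<And>i j. i < n \<Longrightarrow> j < n \<Longrightarrow> i \<noteq> j \<Longrightarrow> h i * h j = 0"
  shows "(\<Sum>i<n. c i * h i)\<^sup>2 = (\<Sum>i<n. (c i)\<^sup>2 * (h i)\<^sup>2)"
proof -
  have "(\<Sum>i<n. c i * h i)\<^sup>2 = (\<Sum>i<n. \<Sum>j<n. c i * c j * (h i * h j))"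
    by (simp only: power2_eq_square bilinear_sum_expand)
  also have "\<dots> = (\<Sum>i<n. \<Sum>j<n. if i = j then (c i)\<^sup>2 * (h i)\<^sup>2 else 0)"
    using assms by (intro sum.cong refl) (auto simp: power2_eq_square)
  also have "\<dots> = (\<Sum>i<n. (c i)\<^sup>2 * (h i)\<^sup>2)" by (simp add: sum.delta)
  finally show ?thesis .
qed

lemma prim_sum:
  assumes "\<And>i. i \<in> I \<Longrightarrow> prim a b (F i) (f i)"
  shows "prim a b (\<lambda>x. \<Sum>i\<in>I. F i x) (\<lambda>x. \<Sum>i\<in>I. f i x)"
  using assms
proof (induction I rule: infinite_finite_induct)
  case (insert i I)
  thus ?case by (simp add: prim_add)
qed (auto simp: prim_def ess_bdd_const)

lemma prim_cmult: "prim a b F f \<Longrightarrow> prim a b (\<lambda>x. (c::real) * F x) (\<lambda>x. c * f x)"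
  by (rule prim_linear[OF bounded_linear_mult_right])

text \<open>The pieces of \<open>x\<^bsup>-1/2\<^esup> sin (\<omega> ln x)\<close> between consecutive zeros are almost optimal for Hardy's
  inequality: \<open>x\<^sup>2 W'\<^sup>2 - (1/4 + \<omega>\<^sup>2) W\<^sup>2\<close> is the derivative of \<open>x\<^sup>2 W' W\<close>.\<close>

lemma hardy_bumps:
  fixes \<tau> s \<omega> :: real
  assumes s: "\<tau> < s" and \<omega>: "\<omega> > 0"
  obtains v w :: "nat \<Rightarrow> real \<Rightarrow> real" where
    "\<And>j a. ess_bdd a s (v j)" "\<And>j. prim \<tau> s (w j) (v j)" "\<And>j x. x \<le> \<tau> \<Longrightarrow> v j x = 0"
    "\<And>j. w j \<tau> = 0" "\<And>j. w j s = 0"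
    "\<And>i j x. i \<noteq> j \<Longrightarrow> v i x * v j x = 0" "\<And>i j x. i \<noteq> j \<Longrightarrow> w i x * w j x = 0"
    "\<And>j. integral {\<tau>..s} (\<lambda>x. (x - \<tau>)\<^sup>2 * (v j x)\<^sup>2) = (1/4 + \<omega>\<^sup>2) * integral {\<tau>..s} (\<lambda>x. (w j x)\<^sup>2)"
    "\<And>j. 0 < integral {\<tau>..s} (\<lambda>x. (w j x)\<^sup>2)"
proof -
  \<comment> \<open>Shifts the numbering of the zeros so that all of them lie below
    \<open>s - \<tau>\<close>.\<close>
  obtain k0 :: nat where k0: "real k0 > - \<omega> * ln (s - \<tau>) / pi" using reals_Archimedean2 by blast
  define z where "z = (\<lambda>j::nat. exp (- (real (j + k0) * pi / \<omega>)))"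
  have z0: "0 < z j" for j by (simp add: z_def)
  have zs: "z (Suc j) < z j" for j using \<omega> by (simp add: z_def field_simps)
  have zmono: "z j \<le> z i" if "i \<le> j" for i j using that \<omega> by (simp add: z_def divide_right_mono mult_right_mono)
  have zS: "z j < s - \<tau>" for j
  proof -
    have "- \<omega> * ln (s - \<tau>) < real k0 * pi" using mult_strict_right_mono[OF k0 pi_gt_zero] by simp
    also have "\<dots> \<le> real (j + k0) * pi" by (intro mult_right_mono) auto
    finally have "- (real (j + k0) * pi / \<omega>) < ln (s - \<tau>)" using \<omega> by (simp add: field_simps)
    hence "z j < exp (ln (s - \<tau>))" unfolding z_def by simp
    thus ?thesis using s by simp
  qed
  have sinz: "sin (\<omega> * ln (z j)) = 0" for j
  proof -
    have "\<omega> * ln (z j) = - (real (j + k0) * pi)" using \<omega> by (simp add: z_def)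
    thus ?thesis by (simp only: sin_minus sin_npi)
  qed
  define f where "f = (\<lambda>x. sin (\<omega> * ln x) / sqrt x)"
  define g where "g = (\<lambda>x. (\<omega> * cos (\<omega> * ln x) - sin (\<omega> * ln x) / 2) / (x * sqrt x))"
  have df: "(f has_real_derivative g x) (at x)" if x: "x > 0" for x
  proof -
    have sq: "sqrt x * sqrt x = x" "sqrt x > 0" using x by auto
    have "(f has_real_derivative (cos (\<omega> * ln x) * (\<omega> * (1 / x)) * sqrt x - sin (\<omega> * ln x) * (inverse (sqrt x) / 2)) / (sqrt x * sqrt x)) (at x)"
      unfolding f_def using x by (auto intro!: derivative_eq_intros)
    also have "(cos (\<omega> * ln x) * (\<omega> * (1 / x)) * sqrt x - sin (\<omega> * ln x) * (inverse (sqrt x) / 2)) / (sqrt x * sqrt x) = g x"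
    proof -
      define y where "y = sqrt x"
      have y: "y > 0" "x = y * y" using sq by (auto simp: y_def)
      show ?thesis unfolding g_def y_def[symmetric] using y(1) by (simp add: y(2)[symmetric]) (simp add: y(2) field_simps)
    qed
    finally show ?thesis .
  qed
  have cg: "continuous_on {z (Suc j)..} g" for j
    unfolding g_def using z0[of "Suc j"] by (intro continuous_intros) (auto dest: less_le_trans)
  define J where "J = (\<lambda>j. {\<tau> + z (Suc j)<..\<tau> + z j})"
  have Jdisj: "x \<notin> J i \<or> x \<notin> J j" if "i \<noteq> j" for i j x
  proof -
    have "x \<notin> J i \<or> x \<notin> J j" if "i < j" for i j
      using zmono[of "Suc i" j] that by (auto simp: J_def)
    thus ?thesis using that by (metis linorder_neqE_nat)
  qed
  \<comment> \<open>The maximum keeps the argument of \<open>g\<close> away from the singularity at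
    0, which makes \<open>v j\<close> bounded; on \<open>J j\<close> it changes nothing. The
    half-open intervals \<open>J j\<close> are disjoint.\<close>
  define v where "v = (\<lambda>j x. if x \<in> J j then g (max (x - \<tau>) (z (Suc j))) else 0)"
  define w where "w = (\<lambda>j x. if x \<in> J j then f (x - \<tau>) else 0)"
  have vg: "v j x = g (x - \<tau>)" "w j x = f (x - \<tau>)" if "x \<in> J j" for j x
    using that by (auto simp: v_def w_def J_def max_def)
  have v0: "v j x = 0" "w j x = 0" if "x \<notin> J j" for j x using that by (auto simp: v_def w_def)
  have f0: "f (z j) = 0" for j by (simp add: f_def sinz)
  have bv: "ess_bdd a s (v j)" for a j
    unfolding v_def
  proof (rule ess_bdd_restrict)
    show "ess_bdd a s (\<lambda>x. g (max (x - \<tau>) (z (Suc j))))"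
      by (intro ess_bdd_continuous continuous_on_compose2[OF cg[of j]] continuous_intros) auto
    show "J j \<in> sets lebesgue" by (simp add: J_def)
  qed
  define a where "a = (\<lambda>j. \<tau> + z (Suc j))"
  define c where "c = (\<lambda>j. \<tau> + z j)"
  have acs: "\<tau> < a j" "a j < c j" "c j < s" for j using z0[of "Suc j"] zs[of j] zS[of j] by (auto simp: a_def c_def)
  have Jac: "J j = {a j<..c j}" for j by (simp add: J_def a_def c_def)
  have fac: "f (a j - \<tau>) = 0" "f (c j - \<tau>) = 0" for j using f0 by (auto simp: a_def c_def)
  have piece: "(h has_integral G (c j) - G (a j)) {\<tau>..s}"
    if d: "\<And>x. a j \<le> x \<Longrightarrow> x \<le> c j \<Longrightarrow> (G has_real_derivative h' x) (at x)"
      and h: "\<And>x. x \<in> J j \<Longrightarrow> h x = h' x" "\<And>x. x \<notin> J j \<Longrightarrow> h x = 0" for G h h' j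
  proof -
    have "(h' has_integral G (c j) - G (a j)) {a j..c j}"
      using acs[of j] d by (intro fundamental_theorem_of_calculus)
        (auto simp: has_real_derivative_iff_has_vector_derivative[symmetric] intro: has_field_derivative_at_within)
    hence "(h has_integral G (c j) - G (a j)) {a j..c j}"
      by (rule has_integral_spike[of "{a j}", rotated 2]) (use h Jac in auto)
    hence "((\<lambda>x. if x \<in> {a j..c j} then h x else 0) has_integral G (c j) - G (a j)) {\<tau>..s}"
      using acs[of j] by (subst has_integral_restrict) auto
    moreover have "(\<lambda>x. if x \<in> {a j..c j} then h x else 0) = h" using h Jac by fastforce
    ultimately show ?thesis by simp
  qed
  have dft: "((\<lambda>x. f (x - \<tau>)) has_real_derivative g (x - \<tau>)) (at x)" if "\<tau> < x" for x
  proof -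
    have "((\<lambda>x. x - \<tau>) has_real_derivative 1) (at x)" by (auto intro!: derivative_eq_intros)
    from DERIV_chain2[OF df this] that show ?thesis by simp
  qed
  have pw: "prim \<tau> s (w j) (v j)" for j
    unfolding prim_def
  proof (intro conjI ballI bv)
    fix x assume x: "x \<in> {\<tau>..s}"
    have w\<tau>: "w j \<tau> = 0" using acs[of j] by (intro v0) (auto simp: Jac)
    consider "x \<le> a j" | "a j < x" "x \<le> c j" | "c j < x" by linarith
    thus "(v j has_integral w j x - w j \<tau>) {\<tau>..x}"
    proof cases
      case 1
      have "((\<lambda>_. 0) has_integral 0) {\<tau>..x}" by simp
      hence "(v j has_integral 0) {\<tau>..x}" by (rule has_integral_eq[rotated]) (use 1 v0 Jac in auto)
      moreover have "w j x = 0" using 1 by (intro v0) (auto simp: Jac)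
      ultimately show ?thesis using w\<tau> by simp
    next
      case 2
      have "((\<lambda>y. g (y - \<tau>)) has_integral f (x - \<tau>) - f (a j - \<tau>)) {a j..x}"
        using 2 acs[of j] dft by (intro fundamental_theorem_of_calculus)
          (auto simp: has_real_derivative_iff_has_vector_derivative[symmetric] intro!: has_field_derivative_at_within[OF dft])
      hence "(v j has_integral f (x - \<tau>)) {a j..x}"
        unfolding fac diff_zero by (rule has_integral_spike[of "{a j}", rotated 2]) (use vg 2 Jac in auto)
      moreover have "((\<lambda>_. 0) has_integral 0) {\<tau>..a j}" by simp
      hence "(v j has_integral 0) {\<tau>..a j}" by (rule has_integral_eq[rotated]) (use v0 Jac in auto)
      ultimately have "(v j has_integral 0 + f (x - \<tau>)) {\<tau>..x}"
        using 2 acs[of j] by (intro has_integral_combine[of \<tau> "a j" x]) auto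
      moreover have "w j x = f (x - \<tau>)" using 2 by (intro vg) (auto simp: Jac)
      ultimately show ?thesis using w\<tau> by simp
    next
      case 3
      have "(v j has_integral f (c j - \<tau>) - f (a j - \<tau>)) {\<tau>..s}"
        by (rule piece[of j "\<lambda>x. f (x - \<tau>)" "\<lambda>x. g (x - \<tau>)"]) (use vg v0 dft acs[of j] in auto)
      hence tot: "(v j has_integral 0) {\<tau>..s}" by (simp add: fac)
      have "((\<lambda>_. 0) has_integral 0) {x..s}" by simp
      hence r: "(v j has_integral 0) {x..s}" by (rule has_integral_eq[rotated]) (use 3 v0 Jac in auto)
      have i: "v j integrable_on {\<tau>..x}" using x by (intro ess_bdd_integrable ess_bdd_subinterval[OF bv[of \<tau> j]]) auto
      have "integral {\<tau>..x} (v j) + integral {x..s} (v j) = integral {\<tau>..s} (v j)"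
        using x tot by (intro Henstock_Kurzweil_Integration.integral_combine) auto
      hence "integral {\<tau>..x} (v j) = 0" using tot r by (simp add: integral_unique)
      moreover have "w j x = 0" using 3 by (intro v0) (auto simp: Jac)
      ultimately show ?thesis using i w\<tau> by (simp add: has_integral_iff)
    qed
  qed
  have bw: "ess_bdd \<tau> s (w j)" for j by (rule ess_bdd_continuous[OF prim_continuous[OF pw]])
  have hardy: "integral {\<tau>..s} (\<lambda>x. (x - \<tau>)\<^sup>2 * (v j x)\<^sup>2) = (1/4 + \<omega>\<^sup>2) * integral {\<tau>..s} (\<lambda>x. (w j x)\<^sup>2)" for j
  proof -
    define P where "P = (\<lambda>x. x\<^sup>2 * g x * f x)"
    \<comment> \<open>\<open>m = x^2 * f'\<close> and \<open>m' = - (1/4 + \<omega>^2) * f\<close>: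
      the function \<open>f\<close> solves the Euler equation of Hardy's functional.\<close>
    define m where "m = (\<lambda>x. sqrt x * (\<omega> * cos (\<omega> * ln x) - sin (\<omega> * ln x) / 2))"
    have dm: "(m has_real_derivative - (1/4 + \<omega>\<^sup>2) * f x) (at x)" if x: "x > 0" for x
    proof -
      define y where "y = sqrt x"
      have y: "y > 0" "x = y * y" using x by (auto simp: y_def)
      have "(m has_real_derivative (inverse (sqrt x) / 2) * (\<omega> * cos (\<omega> * ln x) - sin (\<omega> * ln x) / 2) +
          (\<omega> * (- sin (\<omega> * ln x) * (\<omega> * (1 / x))) - cos (\<omega> * ln x) * (\<omega> * (1 / x)) / 2) * sqrt x) (at x)"
        unfolding m_def using x by (auto intro!: derivative_eq_intros) (simp add: mult_ac)
      also have "(inverse (sqrt x) / 2) * (\<omega> * cos (\<omega> * ln x) - sin (\<omega> * ln x) / 2) +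
          (\<omega> * (- sin (\<omega> * ln x) * (\<omega> * (1 / x))) - cos (\<omega> * ln x) * (\<omega> * (1 / x)) / 2) * sqrt x = - (1/4 + \<omega>\<^sup>2) * f x"
      proof -
        define S where "S = sin (\<omega> * ln x)"
        define Co where "Co = cos (\<omega> * ln x)"
        have "(inverse y / 2) * (\<omega> * Co - S / 2) + (\<omega> * (- S * (\<omega> * (1 / (y * y)))) - Co * (\<omega> * (1 / (y * y))) / 2) * y = - (1/4 + \<omega>\<^sup>2) * (S / y)"
          using y(1) by (simp add: field_simps power2_eq_square)
        thus ?thesis unfolding f_def S_def[symmetric] Co_def[symmetric] y_def[symmetric] y(2)[symmetric] .
      qed
      finally show ?thesis .
    qed
    have Pm: "P x = m x * f x" "x\<^sup>2 * g x = m x" if "x > 0" for x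
    proof -
      define y where "y = sqrt x"
      have y: "y > 0" "x = y * y" using that by (auto simp: y_def)
      show "x\<^sup>2 * g x = m x" unfolding g_def m_def y_def[symmetric] using y(1)
        by (simp add: power2_eq_square) (simp add: y(2))
      thus "P x = m x * f x" by (simp add: P_def)
    qed
    have dP: "((\<lambda>x. m (x - \<tau>) * f (x - \<tau>)) has_real_derivative
        (x - \<tau>)\<^sup>2 * (g (x - \<tau>))\<^sup>2 - (1/4 + \<omega>\<^sup>2) * (f (x - \<tau>))\<^sup>2) (at x)" if x: "\<tau> < x" for x
    proof -
      have x0: "x - \<tau> > 0" using x by simp
      have sh: "((\<lambda>x. x - \<tau>) has_real_derivative 1) (at x)" by (auto intro!: derivative_eq_intros)
      have "((\<lambda>x. m (x - \<tau>)) has_real_derivative - (1/4 + \<omega>\<^sup>2) * f (x - \<tau>) * 1) (at x)"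
        by (rule DERIV_chain2[OF dm[OF x0] sh])
      from DERIV_mult[OF this dft[OF x]]
      show ?thesis
        by (rule DERIV_cong) (simp add: Pm(2)[OF x0, symmetric] power2_eq_square algebra_simps)
    qed
    have "((\<lambda>x. (x - \<tau>)\<^sup>2 * (v j x)\<^sup>2 - (1/4 + \<omega>\<^sup>2) * (w j x)\<^sup>2) has_integral
        m (c j - \<tau>) * f (c j - \<tau>) - m (a j - \<tau>) * f (a j - \<tau>)) {\<tau>..s}"
      by (rule piece[of j "\<lambda>x. m (x - \<tau>) * f (x - \<tau>)" "\<lambda>x. (x - \<tau>)\<^sup>2 * (g (x - \<tau>))\<^sup>2 - (1/4 + \<omega>\<^sup>2) * (f (x - \<tau>))\<^sup>2"])
        (use vg v0 dP acs[of j] in auto)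
    hence "integral {\<tau>..s} (\<lambda>x. (x - \<tau>)\<^sup>2 * (v j x)\<^sup>2 - (1/4 + \<omega>\<^sup>2) * (w j x)\<^sup>2) = 0"
      by (simp add: fac integral_unique)
    moreover have "ess_bdd \<tau> s (\<lambda>x. (x - \<tau>)\<^sup>2 * (v j x)\<^sup>2)"
      by (intro ess_bdd_mult ess_bdd_power2 bv) (intro ess_bdd_continuous continuous_intros)
    ultimately show ?thesis
      by (simp add: integral_ess_bdd_diff ess_bdd_cmult ess_bdd_power2 bw)
  qed
  have pos: "0 < integral {\<tau>..s} (\<lambda>x. (w j x)\<^sup>2)" for j
  proof (rule ccontr)
    assume "\<not> 0 < integral {\<tau>..s} (\<lambda>x. (w j x)\<^sup>2)"
    moreover have "0 \<le> integral {\<tau>..s} (\<lambda>x. (w j x)\<^sup>2)" by (rule integral_ess_bdd_nonneg[OF ess_bdd_power2[OF bw]]) simp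
    ultimately have "integral {\<tau>..s} (\<lambda>x. (w j x)\<^sup>2) = 0" by simp
    moreover have "continuous_on {\<tau>..s} (\<lambda>x. (w j x)\<^sup>2)" by (intro continuous_intros prim_continuous[OF pw])
    ultimately have all0: "\<forall>x\<in>{\<tau>..s}. (w j x)\<^sup>2 = 0"
      using integral_eq_0_iff[of \<tau> s "\<lambda>x. (w j x)\<^sup>2"] s by simp
    \<comment> \<open>A point between two consecutive zeros, midway on the logarithmic scale, where
      the sine has modulus 1.\<close>
    define x where "x = exp (- ((real (j + k0) + 1/2) * pi / \<omega>))"
    have x: "z (Suc j) < x" "x < z j" using \<omega> by (auto simp: x_def z_def field_simps)
    have "\<tau> + x \<in> J j" using x by (simp add: J_def)
    moreover have "\<tau> + x \<in> {\<tau>..s}" using x z0[of "Suc j"] zS[of j] by simp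
    ultimately have "f x = 0" using all0 vg(2)[of "\<tau> + x" j] by auto
    moreover have "sqrt x > 0" by (simp add: x_def)
    ultimately have s0: "sin (\<omega> * ln x) = 0" by (simp add: f_def)
    have "\<omega> * ln x = - (real (j + k0) * pi + pi / 2)" using \<omega> by (simp add: x_def algebra_simps add_divide_distrib)
    hence "sin (real (j + k0) * pi + pi / 2) = 0" using s0 by (simp only: sin_minus neg_equal_0_iff_equal)
    hence "cos (real (j + k0) * pi) = 0" by (simp add: sin_add)
    thus False using cos_npi[of "j + k0"] by simp
  qed
  show ?thesis
  proof (rule that[of v w])
    show "v j x = 0" if "x \<le> \<tau>" for j x using that acs[of j] by (intro v0) (auto simp: Jac)
    show "w j \<tau> = 0" "w j s = 0" for j using acs[of j] by (auto intro!: v0 simp: Jac)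
    show "v i x * v j x = 0" "w i x * w j x = 0" if "i \<noteq> j" for i j x
      using Jdisj[OF that, of x] v0 by auto
  qed (use bv pw hardy pos in auto)
qed

context oscillating_piece
begin

text \<open>Disjoint supports diagonalise the leading part, so the estimate for one bump extends to
  all combinations. The boundary term drops since \<open>W(\<tau>) = 0\<close>, and the remainder is
  at most \<open>2 * C^2\<close> times the squared mass of \<open>W\<close>, which on a short
  interval is small against the integral of \<open>W^2\<close>.\<close>

lemma positive_family:
  obtains S where "S > 0" "S \<le> r" "\<And>s. \<tau> < s \<Longrightarrow> s \<le> \<tau> + S \<Longrightarrow>
    \<exists>f :: nat \<Rightarrow> real \<Rightarrow> real. (\<forall>j. ess_bdd 0 s (f j)) \<and> (\<forall>j x. x \<le> \<tau> \<longrightarrow> f j x = 0) \<and>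
      (\<forall>n c. (\<exists>i<n. c i \<noteq> 0) \<longrightarrow> 0 < jform X b \<tau> s 0 (\<lambda>x. \<Sum>i<n. c i * f i x) (\<lambda>x. \<Sum>i<n. c i * f i x))"
proof -
  obtain C where C: "C \<ge> 1" "\<And>t. t \<in> {\<tau>..\<tau> + r} \<Longrightarrow> norm (X t) \<le> C" "\<And>t. t \<in> {\<tau>..\<tau> + r} \<Longrightarrow> norm (X1 t) \<le> C"
    by (rule X_bounds) blast
  \<comment> \<open>Makes \<open>kp * (1/4 + \<omega>^2)\<close> equal to
    \<open>al / 2 + kp / 8\<close>, which is still below \<open>al\<close>.\<close>
  define \<omega> where "\<omega> = sqrt ((4 * al - kp) / (8 * kp))"
  have \<omega>2: "\<omega>\<^sup>2 = (4 * al - kp) / (8 * kp)" using kp by (simp add: \<omega>_def)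
  have \<omega>: "\<omega> > 0" using kp by (simp add: \<omega>_def)
  define \<gamma> where "\<gamma> = al - kp * (1/4 + \<omega>\<^sup>2)"
  have \<gamma>: "\<gamma> > 0" using kp by (simp add: \<gamma>_def \<omega>2 field_simps)
  define S where "S = min r (\<gamma> / (4 * C\<^sup>2))"
  have S: "S > 0" "S \<le> r" "S \<le> \<gamma> / (4 * C\<^sup>2)" using r \<gamma> C(1) by (auto simp: S_def)
  have CS: "2 * C\<^sup>2 * S < \<gamma>"
  proof -
    have "4 * C\<^sup>2 * S \<le> \<gamma>" using S(3) C(1) by (simp add: pos_le_divide_eq mult.commute)
    moreover have "0 < C\<^sup>2 * S" using S(1) C(1) by simp
    ultimately show ?thesis by linarith
  qed
  have main: "\<exists>f :: nat \<Rightarrow> real \<Rightarrow> real. (\<forall>j. ess_bdd 0 s (f j)) \<and> (\<forall>j x. x \<le> \<tau> \<longrightarrow> f j x = 0) \<and>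
      (\<forall>n c. (\<exists>i<n. c i \<noteq> 0) \<longrightarrow> 0 < jform X b \<tau> s 0 (\<lambda>x. \<Sum>i<n. c i * f i x) (\<lambda>x. \<Sum>i<n. c i * f i x))"
    if s: "\<tau> < s" "s \<le> \<tau> + S" for s
  proof -
    have sr: "\<tau> \<le> s" "s \<le> \<tau> + r" using s S by auto
    obtain v w :: "nat \<Rightarrow> real \<Rightarrow> real" where bv: "\<And>j a. ess_bdd a s (v j)" and pw: "\<And>j. prim \<tau> s (w j) (v j)"
      and v0: "\<And>j x. x \<le> \<tau> \<Longrightarrow> v j x = 0" and w0: "\<And>j. w j \<tau> = 0" "\<And>j. w j s = 0"
      and dis: "\<And>i j x. i \<noteq> j \<Longrightarrow> v i x * v j x = 0" "\<And>i j x. i \<noteq> j \<Longrightarrow> w i x * w j x = 0"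
      and hardy: "\<And>j. integral {\<tau>..s} (\<lambda>x. (x - \<tau>)\<^sup>2 * (v j x)\<^sup>2) = (1/4 + \<omega>\<^sup>2) * integral {\<tau>..s} (\<lambda>x. (w j x)\<^sup>2)"
      and pos: "\<And>j. 0 < integral {\<tau>..s} (\<lambda>x. (w j x)\<^sup>2)"
      by (rule hardy_bumps[OF s(1) \<omega>]) blast
    have bw: "ess_bdd \<tau> s (w j)" for j by (rule ess_bdd_continuous[OF prim_continuous[OF pw]])
    have "0 < jform X b \<tau> s 0 (\<lambda>x. \<Sum>i<n. c i * v i x) (\<lambda>x. \<Sum>i<n. c i * v i x)" if c: "\<exists>i<n. c i \<noteq> 0" for n c
    proof -
      define V where "V = (\<lambda>x. \<Sum>i<n. c i * v i x)"
      define W where "W = (\<lambda>x. \<Sum>i<n. c i * w i x)"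
      have bV: "ess_bdd \<tau> s V" unfolding V_def by (intro ess_bdd_sum ess_bdd_cmult bv)
      have pW: "prim \<tau> s W V" unfolding V_def W_def by (intro prim_sum prim_cmult pw)
      have tW: "tailW s V x = W x" if "x \<in> {\<tau>..s}" for x
        using prim_integral[OF pW, of x s] that w0(2) by (simp add: tailW_def W_def)
      have W\<tau>: "tailW s V \<tau> = 0" using tW[of \<tau>] s w0(1) by (simp add: W_def)
      define I where "I = integral {\<tau>..s} (\<lambda>x. (W x)\<^sup>2)"
      have W2: "(W x)\<^sup>2 = (\<Sum>i<n. (c i)\<^sup>2 * (w i x)\<^sup>2)" for x
        unfolding W_def by (rule disjoint_sum_square) (use dis in auto)
      have V2: "(V x)\<^sup>2 = (\<Sum>i<n. (c i)\<^sup>2 * (v i x)\<^sup>2)" for x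
        unfolding V_def by (rule disjoint_sum_square) (use dis in auto)
      have I: "I = (\<Sum>i<n. (c i)\<^sup>2 * integral {\<tau>..s} (\<lambda>x. (w i x)\<^sup>2))"
        unfolding I_def W2
        by (subst integral_ess_bdd_sum) (intro ess_bdd_cmult ess_bdd_power2 bw, simp)
      have Ipos: "I > 0"
      proof -
        obtain i where i: "i < n" "c i \<noteq> 0" using c by blast
        have "0 < (c i)\<^sup>2 * integral {\<tau>..s} (\<lambda>x. (w i x)\<^sup>2)" using i(2) pos[of i] by simp
        also have "\<dots> \<le> I" unfolding I
          using pos i(1) by (intro member_le_sum) (auto intro!: mult_nonneg_nonneg less_imp_le[OF pos])
        finally show ?thesis .
      qed
      have bt: "ess_bdd \<tau> s (\<lambda>x. (x - \<tau>)\<^sup>2 * (v i x)\<^sup>2)" for i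
        by (intro ess_bdd_mult ess_bdd_power2 bid bv)
      have HV: "integral {\<tau>..s} (\<lambda>x. (x - \<tau>)\<^sup>2 * (V x)\<^sup>2) = (1/4 + \<omega>\<^sup>2) * I"
      proof -
        have "integral {\<tau>..s} (\<lambda>x. (x - \<tau>)\<^sup>2 * (V x)\<^sup>2) = integral {\<tau>..s} (\<lambda>x. \<Sum>i<n. (c i)\<^sup>2 * ((x - \<tau>)\<^sup>2 * (v i x)\<^sup>2))"
          unfolding V2 by (intro integral_cong) (simp add: sum_distrib_left mult_ac)
        also have "\<dots> = (\<Sum>i<n. integral {\<tau>..s} (\<lambda>x. (c i)\<^sup>2 * ((x - \<tau>)\<^sup>2 * (v i x)\<^sup>2)))"
          by (intro integral_ess_bdd_sum ess_bdd_cmult bt)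
        also have "\<dots> = (\<Sum>i<n. (c i)\<^sup>2 * ((1/4 + \<omega>\<^sup>2) * integral {\<tau>..s} (\<lambda>x. (w i x)\<^sup>2)))" by (simp add: hardy)
        finally show ?thesis unfolding I by (simp add: sum_distrib_left mult_ac)
      qed
      have qle: "qform s V \<le> - \<gamma> * I"
      proof -
        have "qform s V \<le> integral {\<tau>..s} (\<lambda>x. (- al) * (W x)\<^sup>2 + kp * ((x - \<tau>)\<^sup>2 * (V x)\<^sup>2))"
          unfolding qform_def
        proof (rule integral_ess_bdd_le)
          show "ess_bdd \<tau> s (\<lambda>t. A t * (tailW s V t)\<^sup>2 - b t * (V t)\<^sup>2)"
            by (intro ess_bdd_diff ess_bdd_mult ess_bdd_power2 bA[OF sr(2)] bb[OF sr(2)] bW bV)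
          show "ess_bdd \<tau> s (\<lambda>x. (- al) * (W x)\<^sup>2 + kp * ((x - \<tau>)\<^sup>2 * (V x)\<^sup>2))"
            by (intro ess_bdd_add ess_bdd_cmult ess_bdd_mult ess_bdd_power2 bid bV
                ess_bdd_continuous[OF prim_continuous[OF pW]])
          fix x assume x: "x \<in> {\<tau>..s}"
          hence xr: "x \<in> {\<tau>..\<tau> + r}" using sr by auto
          have "A x * (W x)\<^sup>2 \<le> (- al) * (W x)\<^sup>2" using al(2)[OF xr] by (intro mult_right_mono) auto
          moreover have "- b x * (V x)\<^sup>2 \<le> kp * (x - \<tau>)\<^sup>2 * (V x)\<^sup>2" using bquad[OF xr] by (intro mult_right_mono) auto
          ultimately show "A x * (tailW s V x)\<^sup>2 - b x * (V x)\<^sup>2 \<le> (- al) * (W x)\<^sup>2 + kp * ((x - \<tau>)\<^sup>2 * (V x)\<^sup>2)"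
            using tW[OF x] by simp
        qed
        also have "\<dots> = integral {\<tau>..s} (\<lambda>x. (- al) * (W x)\<^sup>2) + integral {\<tau>..s} (\<lambda>x. kp * ((x - \<tau>)\<^sup>2 * (V x)\<^sup>2))"
          by (rule integral_ess_bdd_add; intro ess_bdd_cmult ess_bdd_mult ess_bdd_power2 bid bV
                ess_bdd_continuous[OF prim_continuous[OF pW]])
        also have "\<dots> = (- al) * I + kp * ((1/4 + \<omega>\<^sup>2) * I)"
          by (simp only: Henstock_Kurzweil_Integration.integral_mult_right HV I_def)
        finally show ?thesis by (simp add: \<gamma>_def algebra_simps)
      qed
      let ?N = "massW s V"
      have N0: "?N \<ge> 0" by (rule massW_nonneg[OF bV])
      have NI: "?N\<^sup>2 \<le> S * I"
      proof -
        have "?N = integral {\<tau>..s} (\<lambda>x. \<bar>W x\<bar>)" unfolding massW_def by (intro integral_cong) (simp add: tW)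
        hence "?N\<^sup>2 \<le> (s - \<tau>) * I"
          unfolding I_def using integral_abs_square_le_length[OF ess_bdd_continuous[OF prim_continuous[OF pW]] sr(1)] by simp
        also have "\<dots> \<le> S * I" using s Ipos by (intro mult_right_mono) auto
        finally show ?thesis .
      qed
      have z: "norm (traj X \<tau> 0 V s) \<le> C * ?N"
        using start_close[OF sr bV C(3), of 0] W\<tau> by simp
      have "\<bar>integral {\<tau>..s} (\<lambda>t. sigma (U s 0 V t) (X1 t) * tailW s V t)\<bar> \<le> integral {\<tau>..s} (\<lambda>t. (2 * C * ?N * C) * \<bar>tailW s V t\<bar>)"
        unfolding real_norm_def[symmetric]
      proof (rule integral_ess_bdd_norm_le)
        show "ess_bdd \<tau> s (\<lambda>t. sigma (U s 0 V t) (X1 t) * tailW s V t)"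
          by (rule ess_bdd_mult[OF ess_bdd_bilinear[OF bounded_bilinear_sigma bU[OF sr(2) bV] bX1[OF sr(2)]] bW[OF bV]])
        show "ess_bdd \<tau> s (\<lambda>t. (2 * C * ?N * C) * norm (tailW s V t))" by (rule ess_bdd_cmult[OF ess_bdd_norm[OF bW[OF bV]]])
        fix t assume t: "t \<in> {\<tau>..s}"
        hence tr: "t \<in> {\<tau>..\<tau> + r}" using sr by auto
        have "norm (U s 0 V t) \<le> 2 * C * ?N"
          using U_close[OF sr(2) bV t C(3), of 0] z norm_triangle_sub[of "U s 0 V t" "traj X \<tau> 0 V s"] by linarith
        from sigma_le_mult[OF this C(3)[OF tr]]
        show "norm (sigma (U s 0 V t) (X1 t) * tailW s V t) \<le> (2 * C * ?N * C) * norm (tailW s V t)"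
          by (simp add: abs_mult mult_right_mono)
      qed
      also have "\<dots> = 2 * C\<^sup>2 * ?N\<^sup>2" by (simp add: massW_def power2_eq_square mult_ac)
      also have "\<dots> \<le> 2 * C\<^sup>2 * (S * I)" using NI by (intro mult_left_mono) auto
      finally have err: "\<bar>integral {\<tau>..s} (\<lambda>t. sigma (U s 0 V t) (X1 t) * tailW s V t)\<bar> \<le> 2 * C\<^sup>2 * S * I" by (simp add: mult_ac)
      have "2 * C\<^sup>2 * S * I < \<gamma> * I" using CS Ipos by (intro mult_strict_right_mono)
      hence "0 < jform X b \<tau> s 0 V V"
        using energy_identity[OF sr bV, of 0] qle err W\<tau> by simp
      thus ?thesis by (simp add: V_def)
    qed
    thus ?thesis using bv v0 by (intro exI[of _ v]) blast
  qed
  show ?thesis using that[OF S(1,2) main] by blast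
qed

end

context oscillating_piece
begin

text \<open>Near \<open>s\<close>, away from \<open>\<tau>\<close>, \<open>b\<close> is at most a
  negative constant \<open>- p0\<close>. For variations supported on a length \<open>l\<close> the
  rest of the form is at most \<open>C^2 * l\<close> times the integral of \<open>V^2\<close>, so
  \<open>b\<close> wins for small \<open>l\<close>. Indicators of disjoint intervals accumulating at
  \<open>s\<close> give an infinite family.\<close>

lemma negative_family:
  assumes s: "\<tau> < s" "s \<le> \<tau> + r"
  shows "\<exists>f :: nat \<Rightarrow> real \<Rightarrow> real. (\<forall>j. ess_bdd 0 s (f j)) \<and> (\<forall>j x. x \<le> \<tau> \<longrightarrow> f j x = 0) \<and>
      (\<forall>n c. (\<exists>i<n. c i \<noteq> 0) \<longrightarrow> jform X b \<tau> s 0 (\<lambda>x. \<Sum>i<n. c i * f i x) (\<lambda>x. \<Sum>i<n. c i * f i x) < 0)"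
proof -
  obtain C where C: "C \<ge> 1" "\<And>t. t \<in> {\<tau>..\<tau> + r} \<Longrightarrow> norm (X t) \<le> C" by (rule X_bounds) blast
  define m0 where "m0 = (s + \<tau>) / 2"
  have m0: "\<tau> < m0" "m0 < s" using s by (auto simp: m0_def)
  have "continuous_on {m0..s} b" by (rule continuous_on_subset[OF contb]) (use m0 s in auto)
  then obtain x0 where x0: "x0 \<in> {m0..s}" "\<And>x. x \<in> {m0..s} \<Longrightarrow> b x \<le> b x0"
    using continuous_attains_sup[of "{m0..s}" b] m0 by auto
  define p0 where "p0 = - b x0"
  have p0: "p0 > 0" "\<And>x. x \<in> {m0..s} \<Longrightarrow> b x \<le> - p0" using bneg[of x0] x0 m0 s by (auto simp: p0_def)
  define l where "l = min (s - m0) (p0 / (2 * C\<^sup>2))"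
  have C2: "C\<^sup>2 > 0" using C(1) by simp
  have l: "0 < l" "l \<le> s - m0" "C\<^sup>2 * l < p0"
  proof -
    show "0 < l" using m0 p0(1) C2 by (simp add: l_def)
    show "l \<le> s - m0" by (simp add: l_def)
    have "l \<le> p0 / (2 * C\<^sup>2)" by (simp add: l_def)
    hence "2 * (C\<^sup>2 * l) \<le> p0" using C2 by (simp add: pos_le_divide_eq mult_ac)
    moreover have "0 < C\<^sup>2 * l" using C2 \<open>0 < l\<close> by simp
    ultimately show "C\<^sup>2 * l < p0" by linarith
  qed
  define d where "d = (\<lambda>i::nat. s - l / real (Suc i))"
  have dmono: "d i \<le> d j" if "i \<le> j" for i j using that l(1) by (auto simp: d_def intro!: divide_left_mono)
  have dstrict: "d i < d (Suc i)" for i using l(1) by (auto simp: d_def intro!: divide_strict_left_mono)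
  have d0: "s - l \<le> d i" for i using dmono[of 0 i] by (simp add: d_def)
  have ds: "d i < s" for i using l(1) by (simp add: d_def)
  define J where "J = (\<lambda>i. {d i<..d (Suc i)})"
  define h where "h = (\<lambda>i x. if x \<in> J i then 1 else 0 :: real)"
  have disj: "h i x * h j x = 0" if "i \<noteq> j" for i j x
  proof -
    have "x \<notin> J i \<or> x \<notin> J j" if "i < j" for i j using dmono[of "Suc i" j] that by (auto simp: J_def)
    hence "x \<notin> J i \<or> x \<notin> J j" using that by (metis linorder_neqE_nat)
    thus ?thesis by (auto simp: h_def)
  qed
  have bh: "ess_bdd a s (h i)" for a i
    unfolding h_def by (rule ess_bdd_restrict[OF ess_bdd_const]) (simp add: J_def)
  have h0: "h i x = 0" if "x \<le> s - l" for i x using d0[of i] that by (auto simp: h_def J_def)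
  have Ih: "0 < integral {\<tau>..s} (\<lambda>x. (h i x)\<^sup>2)" for i
  proof -
    have "((\<lambda>x. 1 :: real) has_integral d (Suc i) - d i) {d i..d (Suc i)}"
      using has_integral_const_real[of "1::real" "d i" "d (Suc i)"] dstrict[of i] by simp
    hence "((\<lambda>x. (h i x)\<^sup>2) has_integral d (Suc i) - d i) {d i..d (Suc i)}"
      by (rule has_integral_spike[of "{d i}", rotated 2]) (auto simp: h_def J_def)
    hence "((\<lambda>x. if x \<in> {d i..d (Suc i)} then (h i x)\<^sup>2 else 0) has_integral d (Suc i) - d i) {\<tau>..s}"
      using d0[of i] ds[of "Suc i"] l m0 by (subst has_integral_restrict) auto
    moreover have "(\<lambda>x. if x \<in> {d i..d (Suc i)} then (h i x)\<^sup>2 else 0) = (\<lambda>x. (h i x)\<^sup>2)"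
      by (auto simp: h_def J_def)
    ultimately show ?thesis using dstrict[of i] by (simp add: integral_unique)
  qed
  have "jform X b \<tau> s 0 (\<lambda>x. \<Sum>i<n. c i * h i x) (\<lambda>x. \<Sum>i<n. c i * h i x) < 0" if c: "\<exists>i<n. c i \<noteq> 0" for n c
  proof -
    define V where "V = (\<lambda>x. \<Sum>i<n. c i * h i x)"
    have bV: "ess_bdd a s V" for a unfolding V_def by (intro ess_bdd_sum ess_bdd_cmult bh)
    have V0: "V x = 0" if "x \<le> s - l" for x using h0[OF that] by (simp add: V_def)
    have V2: "(V x)\<^sup>2 = (\<Sum>i<n. (c i)\<^sup>2 * (h i x)\<^sup>2)" for x
      unfolding V_def by (rule disjoint_sum_square) (use disj in auto)
    define I where "I = integral {\<tau>..s} (\<lambda>x. (V x)\<^sup>2)"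
    have I: "I = (\<Sum>i<n. (c i)\<^sup>2 * integral {\<tau>..s} (\<lambda>x. (h i x)\<^sup>2))"
      unfolding I_def V2
      by (subst integral_ess_bdd_sum) (intro ess_bdd_cmult ess_bdd_power2 bh, simp)
    have Ipos: "I > 0"
    proof -
      obtain i where i: "i < n" "c i \<noteq> 0" using c by blast
      have "0 < (c i)\<^sup>2 * integral {\<tau>..s} (\<lambda>x. (h i x)\<^sup>2)" using i(2) Ih[of i] by simp
      also have "\<dots> \<le> I" unfolding I
        using i(1) by (intro member_le_sum) (auto intro!: mult_nonneg_nonneg less_imp_le[OF Ih])
      finally show ?thesis .
    qed
    define N where "N = integral {\<tau>..s} (\<lambda>x. \<bar>V x\<bar>)"
    have N0: "N \<ge> 0" unfolding N_def by (rule integral_ess_bdd_nonneg[OF ess_bdd_abs[OF bV]]) simp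
    have N2: "N\<^sup>2 \<le> l * I"
    proof -
      have split: "integral {\<tau>..s} f = integral {s - l..s} f" if "\<And>x. x \<le> s - l \<Longrightarrow> f x = 0" "ess_bdd \<tau> s f"
        for f :: "real \<Rightarrow> real"
      proof -
        have "integral {\<tau>..s} f = integral {\<tau>..s - l} f + integral {s - l..s} f"
          using l m0 by (intro Henstock_Kurzweil_Integration.integral_combine[symmetric] ess_bdd_integrable[OF that(2)]) auto
        also have "integral {\<tau>..s - l} f = integral {\<tau>..s - l} (\<lambda>x. 0)" by (intro integral_cong that(1)) auto
        finally show ?thesis by simp
      qed
      have "N = integral {s - l..s} (\<lambda>x. \<bar>V x\<bar>)" unfolding N_def by (rule split[OF _ ess_bdd_abs[OF bV]]) (simp add: V0)
      moreover have "I = integral {s - l..s} (\<lambda>x. (V x)\<^sup>2)" unfolding I_def by (rule split[OF _ ess_bdd_power2[OF bV]]) (simp add: V0)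
      ultimately show ?thesis using integral_abs_square_le_length[OF bV, of "s - l"] l by simp
    qed
    have tr: "norm (traj X \<tau> 0 V t) \<le> C * N" if t: "t \<in> {\<tau>..s}" for t
    proof -
      have sub: "{\<tau>..t} \<subseteq> {\<tau>..s}" using t by auto
      have "norm (integral {\<tau>..t} (\<lambda>x. V x *\<^sub>R X x)) \<le> integral {\<tau>..t} (\<lambda>x. C * \<bar>V x\<bar>)"
      proof (rule integral_ess_bdd_norm_le)
        show "ess_bdd \<tau> t (\<lambda>x. V x *\<^sub>R X x)" by (rule ess_bdd_subinterval[OF ess_bdd_scaleR[OF bV bX[OF s(2)]] sub])
        show "ess_bdd \<tau> t (\<lambda>x. C * \<bar>V x\<bar>)" by (rule ess_bdd_subinterval[OF ess_bdd_cmult[OF ess_bdd_abs[OF bV]] sub])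
        fix x assume x: "x \<in> {\<tau>..t}"
        have "norm (X x) \<le> C" using C(2)[of x] x t s by auto
        from mult_right_mono[OF this abs_ge_zero[of "V x"]]
        show "norm (V x *\<^sub>R X x) \<le> C * \<bar>V x\<bar>" by (simp add: mult.commute)
      qed
      also have "\<dots> \<le> integral {\<tau>..s} (\<lambda>x. C * \<bar>V x\<bar>)"
        using C(1) t by (intro integral_le_combine ess_bdd_cmult ess_bdd_abs bV) auto
      finally show ?thesis by (simp add: traj_def N_def)
    qed
    have "jform X b \<tau> s 0 V V \<le> integral {\<tau>..s} (\<lambda>x. (C * N * C) * \<bar>V x\<bar> + - p0 * (V x)\<^sup>2)"
      unfolding jform_def
    proof (rule integral_ess_bdd_le)
      show "ess_bdd \<tau> s (\<lambda>t. sigma (traj X \<tau> 0 V t) (V t *\<^sub>R X t) + b t * V t * V t)"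
        by (rule ess_bdd_jform[OF bX[OF s(2)] bb[OF s(2)] bV bV])
      show "ess_bdd \<tau> s (\<lambda>x. (C * N * C) * \<bar>V x\<bar> + - p0 * (V x)\<^sup>2)"
        by (intro ess_bdd_add ess_bdd_cmult ess_bdd_abs ess_bdd_power2 bV)
      fix x assume x: "x \<in> {\<tau>..s}"
      hence xr: "x \<in> {\<tau>..\<tau> + r}" using s by auto
      have "\<bar>sigma (traj X \<tau> 0 V x) (X x)\<bar> \<le> C * N * C" by (rule sigma_le_mult[OF tr[OF x] C(2)[OF xr]])
      hence "\<bar>sigma (traj X \<tau> 0 V x) (X x)\<bar> * \<bar>V x\<bar> \<le> (C * N * C) * \<bar>V x\<bar>" by (intro mult_right_mono) auto
      hence "\<bar>sigma (traj X \<tau> 0 V x) (X x) * V x\<bar> \<le> (C * N * C) * \<bar>V x\<bar>" by (simp only: abs_mult)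
      hence 1: "sigma (traj X \<tau> 0 V x) (V x *\<^sub>R X x) \<le> (C * N * C) * \<bar>V x\<bar>"
        by (simp add: sigma.scaleR_right mult.commute[of "V x"])
      have 2: "b x * (V x)\<^sup>2 \<le> - p0 * (V x)\<^sup>2"
      proof (cases "x \<le> s - l")
        case False
        hence "b x \<le> - p0" using p0(2)[of x] l x by simp
        thus ?thesis by (rule mult_right_mono) simp
      qed (simp add: V0)
      show "sigma (traj X \<tau> 0 V x) (V x *\<^sub>R X x) + b x * V x * V x \<le> (C * N * C) * \<bar>V x\<bar> + - p0 * (V x)\<^sup>2"
        using add_mono[OF 1 2] by (simp add: power2_eq_square mult.assoc)
    qed
    also have "\<dots> = integral {\<tau>..s} (\<lambda>x. (C * N * C) * \<bar>V x\<bar>) + integral {\<tau>..s} (\<lambda>x. - p0 * (V x)\<^sup>2)"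
      by (rule integral_ess_bdd_add; intro ess_bdd_cmult ess_bdd_abs ess_bdd_power2 bV)
    also have "\<dots> = (C * N * C) * N + - p0 * I"
      by (simp only: Henstock_Kurzweil_Integration.integral_mult_right N_def I_def)
    also have "\<dots> = C\<^sup>2 * N\<^sup>2 + - p0 * I" by (simp add: power2_eq_square)
    also have "\<dots> \<le> C\<^sup>2 * (l * I) + - p0 * I" using mult_left_mono[OF N2, of "C\<^sup>2"] by simp
    also have "\<dots> = (C\<^sup>2 * l - p0) * I" by (simp add: algebra_simps)
    also have "\<dots> < 0" using l(3) Ipos by (intro mult_neg_pos) auto
    finally show ?thesis by (simp add: V_def)
  qed
  moreover have "h j x = 0" if "x \<le> \<tau>" for j x using h0[of x j] that l m0 by simp
  ultimately show ?thesis using bh by (intro exI[of _ h]) blast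
qed

text \<open>If the Jacobi plane at \<open>s\<close> existed, the second variation would be indefinite on the
  variations that do not see a given finite-dimensional space, so that every vector of the plane is
  the end point of an exact field. The initial values of these fields form a Lagrangian plane
  orthogonal to both \<open>X(\<tau>)\<close> and its derivative.\<close>

lemma no_jacobi_plane:
  assumes \<tau>: "0 \<le> \<tau>"
    and glob: "\<And>s. \<tau> < s \<Longrightarrow> s \<le> \<tau> + r \<Longrightarrow> ess_bdd 0 s X" "\<And>s. \<tau> < s \<Longrightarrow> s \<le> \<tau> + r \<Longrightarrow> ess_bdd 0 s b"
  shows "\<exists>S>0. \<forall>s Ls. \<tau> < s \<longrightarrow> s \<le> \<tau> + S \<longrightarrow> \<not> is_jacobi_plane X b s Ls"
proof -
  obtain S1 where S1: "S1 > 0" "S1 \<le> r" "\<And>s. \<tau> < s \<Longrightarrow> s \<le> \<tau> + S1 \<Longrightarrow>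
    \<exists>f :: nat \<Rightarrow> real \<Rightarrow> real. (\<forall>j. ess_bdd 0 s (f j)) \<and> (\<forall>j x. x \<le> \<tau> \<longrightarrow> f j x = 0) \<and>
      (\<forall>n c. (\<exists>i<n. c i \<noteq> 0) \<longrightarrow> 0 < jform X b \<tau> s 0 (\<lambda>x. \<Sum>i<n. c i * f i x) (\<lambda>x. \<Sum>i<n. c i * f i x))"
    by (rule positive_family) blast
  obtain S2 where S2: "S2 > 0" "S2 \<le> r"
    "\<And>s u. \<tau> < s \<Longrightarrow> s \<le> \<tau> + S2 \<Longrightarrow> exact s 0 u \<Longrightarrow> traj X \<tau> 0 u s = 0"
    using exact_unique by blast
  have False if s: "\<tau> < s" "s \<le> \<tau> + S1" "s \<le> \<tau> + S2" and L: "is_jacobi_plane X b s Ls" for s Ls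
  proof -
    have sr: "s \<le> \<tau> + r" "\<tau> \<le> s" "0 \<le> s" using s S1 \<tau> by auto
    note GX = glob(1)[OF s(1) sr(1)] and Gb = glob(2)[OF s(1) sr(1)]
    have LL: "lagrangian_plane Ls" and lim: "((\<lambda>V. plane_dist (jacobi_approx X b s V) Ls) \<longlongrightarrow> 0) (fin_dim_at_top s)"
      using L s \<tau> by (auto simp: is_jacobi_plane_def split: if_splits)
    obtain B where B: "finite B" "\<And>g. g \<in> B \<Longrightarrow> ess_bdd 0 s g"
      and close: "\<And>B'. finite B' \<Longrightarrow> (\<And>g. g \<in> B' \<Longrightarrow> ess_bdd 0 s g) \<Longrightarrow> fspan B \<subseteq> fspan B' \<Longrightarrow>
        \<bar>plane_dist (jacobi_approx X b s (fspan B')) Ls\<bar> < 1/4"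
      by (rule fin_dim_at_top_tendsto_zero[OF lim, of "1/4"]) (simp, blast)
    note ctx = GX Gb sr(3) B LL close
    have tr0: "traj X 0 0 v \<tau> = 0" if "\<And>x. x \<le> \<tau> \<Longrightarrow> v x = 0" for v
    proof -
      have "traj X 0 0 v \<tau> = traj X 0 0 (\<lambda>_. 0) \<tau>" by (rule traj_cong) (use that in auto)
      thus ?thesis by (simp add: traj_def)
    qed
    have late: "jform X b 0 s 0 v v = jform X b \<tau> s 0 v v"
      if "ess_bdd 0 s v" "\<And>x. x \<le> \<tau> \<Longrightarrow> v x = 0" for v
      using jform_late[OF GX Gb \<tau> sr(2) that(1) that(1) that(2), of 0] tr0[of v] that(2) by simp
    obtain f :: "nat \<Rightarrow> real \<Rightarrow> real" where f: "\<And>j. ess_bdd 0 s (f j)" "\<And>j x. x \<le> \<tau> \<Longrightarrow> f j x = 0"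
      "\<And>n c. (\<exists>i<n. c i \<noteq> 0) \<Longrightarrow> 0 < jform X b \<tau> s 0 (\<lambda>x. \<Sum>i<n. c i * f i x) (\<lambda>x. \<Sum>i<n. c i * f i x)"
      using S1(3)[OF s(1,2)] by blast
    obtain g :: "nat \<Rightarrow> real \<Rightarrow> real" where g: "\<And>j. ess_bdd 0 s (g j)" "\<And>j x. x \<le> \<tau> \<Longrightarrow> g j x = 0"
      "\<And>n c. (\<exists>i<n. c i \<noteq> 0) \<Longrightarrow> jform X b \<tau> s 0 (\<lambda>x. \<Sum>i<n. c i * g i x) (\<lambda>x. \<Sum>i<n. c i * g i x) < 0"
      using negative_family[OF s(1) sr(1)] by blast
    obtain n c where c: "\<exists>i<n. c i \<noteq> 0" "Nperp X b s B 0 (\<lambda>x. \<Sum>i<n. c i * f i x)"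
      by (rule Nperp_in_family[OF ctx f(1)])
    obtain n' c' where c': "\<exists>i<n'. c' i \<noteq> 0" "Nperp X b s B 0 (\<lambda>x. \<Sum>i<n'. c' i * g i x)"
      by (rule Nperp_in_family[OF ctx g(1)])
    have p: "0 < jform X b 0 s 0 (\<lambda>x. \<Sum>i<n. c i * f i x) (\<lambda>x. \<Sum>i<n. c i * f i x)"
      using f(3)[OF c(1)] by (subst late) (auto intro!: ess_bdd_sum ess_bdd_cmult f(1) simp: f(2))
    have q: "jform X b 0 s 0 (\<lambda>x. \<Sum>i<n'. c' i * g i x) (\<lambda>x. \<Sum>i<n'. c' i * g i x) < 0"
      using g(3)[OF c'(1)] by (subst late) (auto intro!: ess_bdd_sum ess_bdd_cmult g(1) simp: g(2))
    define J where "J = jacobi_approx X b s (fspan B)"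
    have stat: "traj X 0 0 v s \<in> jacobi_approx X b s (fspan B)"
      if "ess_bdd 0 s v" "\<And>w. w \<in> B \<Longrightarrow> jform X b 0 s 0 v w = 0" for v
      by (rule indefinite_stationary[OF ctx c(2) p c'(2) q that])
    have ex: "\<exists>e u. exact s e u \<and> traj X \<tau> e u s = \<xi>" if "\<xi> \<in> J" for \<xi>
    proof -
      have \<xi>: "\<xi> \<in> jacobi_approx X b s (fspan B)" using that by (simp add: J_def)
      obtain e u where "ess_bdd \<tau> s u" "traj X \<tau> e u s = \<xi>"
        "AE x in lebesgue_on {\<tau>..s}. sigma (traj X \<tau> e u x) (X x) + b x * u x = 0"
      proof (rule exact_fields[where X = X and b = b and s = s and B = B and Ls = Ls and \<xi> = \<xi> and \<tau> = \<tau>])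
        show "ess_bdd 0 s X" by fact
        show "ess_bdd 0 s b" by fact
        show "0 \<le> s" by fact
        show "finite B" by fact
        show "\<And>g. g \<in> B \<Longrightarrow> ess_bdd 0 s g" by fact
        show "lagrangian_plane Ls" by fact
        show "\<And>B'. finite B' \<Longrightarrow> (\<And>g. g \<in> B' \<Longrightarrow> ess_bdd 0 s g) \<Longrightarrow> fspan B \<subseteq> fspan B' \<Longrightarrow>
          \<bar>plane_dist (jacobi_approx X b s (fspan B')) Ls\<bar> < 1/4" by (rule close)
        show "\<And>v. ess_bdd 0 s v \<Longrightarrow> (\<And>w. w \<in> B \<Longrightarrow> jform X b 0 s 0 v w = 0) \<Longrightarrow>
          traj X 0 0 v s \<in> jacobi_approx X b s (fspan B)" by (rule stat)
        show "\<xi> \<in> jacobi_approx X b s (fspan B)" by fact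
        show "0 \<le> \<tau>" by fact
        show "\<tau> \<le> s" by fact
      qed (rule that)
      thus ?thesis unfolding exact_def by blast
    qed
    \<comment> \<open>The linear relation between end points in the plane and initial vectors of
      exact solutions. As a space of pairs it requires no choice of a solution for each end
      point.\<close>
    define Gr where "Gr = {(\<xi>, e). \<xi> \<in> J \<and> (\<exists>u. exact s e u \<and> traj X \<tau> e u s = \<xi>)}"
    have sJ: "subspace J" unfolding J_def by (rule subspace_J0[OF ctx])
    note XB = bX[OF sr(1)] and bB = bb[OF sr(1)]
    have sG: "subspace Gr"
      unfolding subspace_def
    proof (intro conjI ballI allI)
      have "exact s 0 (\<lambda>_. 0)" by (simp add: exact_def ess_bdd_const traj_def sigma.zero_left)
      moreover have "traj X \<tau> 0 (\<lambda>_. 0) s = 0" by (simp add: traj_def)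
      ultimately show "0 \<in> Gr" using subspace_0[OF sJ] by (auto simp: Gr_def zero_prod_def)
      fix x y assume "x \<in> Gr" "y \<in> Gr"
      then obtain \<xi> e u \<xi>' e' u' where x: "x = (\<xi>, e)" "\<xi> \<in> J" "exact s e u" "traj X \<tau> e u s = \<xi>"
        and y: "y = (\<xi>', e')" "\<xi>' \<in> J" "exact s e' u'" "traj X \<tau> e' u' s = \<xi>'"
        unfolding Gr_def by blast
      have bu: "ess_bdd \<tau> s u" "ess_bdd \<tau> s u'" using x(3) y(3) by (auto simp: exact_def)
      have tr: "traj X \<tau> (e + e') (\<lambda>x. u x + u' x) t = traj X \<tau> e u t + traj X \<tau> e' u' t" if "t \<le> s" for t
        by (rule traj_add[OF XB bB bu that])
      have sp: "AE x in lebesgue_on {\<tau>..s}. x \<in> {\<tau>..s}" by (auto intro!: AE_I2)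
      have "AE x in lebesgue_on {\<tau>..s}. sigma (traj X \<tau> (e + e') (\<lambda>x. u x + u' x) x) (X x) + b x * (u x + u' x) = 0"
        using x(3)[unfolded exact_def, THEN conjunct2] y(3)[unfolded exact_def, THEN conjunct2] sp
      proof eventually_elim
        case (elim x)
        hence "traj X \<tau> (e + e') (\<lambda>x. u x + u' x) x = traj X \<tau> e u x + traj X \<tau> e' u' x" by (intro tr) simp
        hence "sigma (traj X \<tau> (e + e') (\<lambda>x. u x + u' x) x) (X x) = sigma (traj X \<tau> e u x) (X x) + sigma (traj X \<tau> e' u' x) (X x)"
          by (simp only: sigma.add_left)
        moreover have "b x * (u x + u' x) = b x * u x + b x * u' x" by (rule distrib_left)
        ultimately show ?case using elim by linarith
      qed
      hence "exact s (e + e') (\<lambda>x. u x + u' x)" using ess_bdd_add[OF bu] by (simp add: exact_def)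
      moreover have "\<xi> + \<xi>' \<in> J" using subspace_add[OF sJ x(2) y(2)] .
      ultimately show "x + y \<in> Gr" using tr[of s] x(1,4) y(1,4) by (auto simp: Gr_def)
    next
      fix k :: real and x assume "x \<in> Gr"
      then obtain \<xi> e u where x: "x = (\<xi>, e)" "\<xi> \<in> J" "exact s e u" "traj X \<tau> e u s = \<xi>"
        unfolding Gr_def by blast
      have bu: "ess_bdd \<tau> s u" using x(3) by (auto simp: exact_def)
      have tr: "traj X \<tau> (k *\<^sub>R e) (\<lambda>x. k * u x) t = k *\<^sub>R traj X \<tau> e u t" for t
        by (rule traj_scale[OF XB bB])
      have "AE x in lebesgue_on {\<tau>..s}. sigma (traj X \<tau> (k *\<^sub>R e) (\<lambda>x. k * u x) x) (X x) + b x * (k * u x) = 0"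
        using x(3)[unfolded exact_def, THEN conjunct2]
      proof eventually_elim
        case (elim x)
        have "sigma (traj X \<tau> (k *\<^sub>R e) (\<lambda>x. k * u x) x) (X x) + b x * (k * u x) = k * (sigma (traj X \<tau> e u x) (X x) + b x * u x)"
          by (simp add: tr sigma.scaleR_left algebra_simps)
        thus ?case using elim by simp
      qed
      hence "exact s (k *\<^sub>R e) (\<lambda>x. k * u x)" using ess_bdd_cmult[OF bu] by (simp add: exact_def)
      moreover have "k *\<^sub>R \<xi> \<in> J" using subspace_scale[OF sJ x(2)] .
      ultimately show "k *\<^sub>R x \<in> Gr" using tr[of s] x(1,4) by (auto simp: Gr_def)
    qed
    define E where "E = snd ` Gr"
    have sE: "subspace E" unfolding E_def by (rule linear_subspace_image[OF linear_snd sG])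
    \<comment> \<open>Uniqueness from the initial vector 0 means that initial vectors determine end
      points, so the space of initial vectors is at least as large as the plane.\<close>
    have "inj_on snd Gr"
    proof (subst linear_inj_on_iff_eq_0[OF linear_snd sG], intro ballI impI)
      fix x assume x: "x \<in> Gr" "snd x = 0"
      then obtain u where "exact s 0 u" "traj X \<tau> 0 u s = fst x" by (auto simp: Gr_def)
      thus "x = 0" using S2(3)[OF s(1,3)] x(2) by (metis prod_eq_iff fst_zero snd_zero)
    qed
    hence "dim E = dim Gr"
      unfolding E_def using sG by (intro dim_image_eq[OF linear_snd]) (simp add: span_eq_iff[THEN iffD2])
    moreover have "dim (fst ` Gr) \<le> dim Gr" by (rule dim_image_le[OF linear_fst])
    moreover have "dim J \<le> dim (fst ` Gr)"
    proof (rule dim_subset)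
      show "J \<subseteq> fst ` Gr"
      proof
        fix \<xi> assume "\<xi> \<in> J"
        moreover from ex[OF this] obtain e u where "exact s e u" "traj X \<tau> e u s = \<xi>" by blast
        ultimately have "(\<xi>, e) \<in> Gr" by (auto simp: Gr_def)
        thus "\<xi> \<in> fst ` Gr" by force
      qed
    qed
    moreover have "DIM('a) \<le> dim J" unfolding J_def by (rule J0_dim[OF ctx])
    ultimately have dE: "DIM('a) \<le> dim E" by linarith
    have Ed: "\<exists>u. exact s e u \<and> traj X \<tau> e u s \<in> J" if "e \<in> E" for e
      using that unfolding E_def Gr_def by force
    \<comment> \<open>With both residuals zero, Green's formula makes the pairing the same at
      \<open>\<tau>\<close> and at \<open>s\<close>, where the plane is isotropic.\<close>
    have iso: "sigma e e' = 0" if ee: "e \<in> E" "e' \<in> E" for e e'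
    proof -
      obtain u where u: "exact s e u" "traj X \<tau> e u s \<in> J" using Ed[OF ee(1)] by blast
      obtain u' where u': "exact s e' u'" "traj X \<tau> e' u' s \<in> J" using Ed[OF ee(2)] by blast
      have jz: "jform X b \<tau> s e u w = 0" if eu: "exact s e u" for e u w
      proof -
        obtain N where N: "negligible N" "\<And>x. x \<in> {\<tau>..s} - N \<Longrightarrow> sigma (traj X \<tau> e u x) (X x) + b x * u x = 0"
          using AE_lebesgue_on_negligible[OF eu[unfolded exact_def, THEN conjunct2]] by blast
        have "jform X b \<tau> s e u w = integral {\<tau>..s} (\<lambda>x. 0)"
          unfolding jform_def
        proof (rule integral_spike[OF N(1)])
          fix x assume "x \<in> {\<tau>..s} - N"
          from N(2)[OF this] have "(sigma (traj X \<tau> e u x) (X x) + b x * u x) * w x = 0" by simp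
          thus "0 = sigma (traj X \<tau> e u x) (w x *\<^sub>R X x) + b x * u x * w x"
            by (simp add: sigma.scaleR_right algebra_simps)
        qed
        thus ?thesis by simp
      qed
      have bu: "ess_bdd \<tau> s u" "ess_bdd \<tau> s u'" using u(1) u'(1) by (auto simp: exact_def)
      have "sigma (traj X \<tau> e u s) (traj X \<tau> e' u' s) = sigma e e'"
        using jform_swap[OF XB bB sr(2) bu, of e e'] jz[OF u(1)] jz[OF u'(1)] by simp
      moreover have "sigma (traj X \<tau> e u s) (traj X \<tau> e' u' s) = 0"
        using isotropic_jacobi_approx[OF GX Gb sr(3) B(2)] u(2) u'(2) unfolding J_def by blast
      ultimately show ?thesis by simp
    qed
    have EE: "skew_compl E = E" by (rule isotropic_maximal[OF sE iso dE])
    have orth: "sigma e (X \<tau>) = 0 \<and> sigma e (X1 \<tau>) = 0" if "e \<in> E" for e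
      using Ed[OF that] exact_start[OF s(1) sr(1)] by blast
    \<comment> \<open>\<open>E\<close> is its own skew complement, so \<open>X \<tau>\<close>
      belongs to it and must itself be orthogonal to \<open>X1 \<tau>\<close>.\<close>
    have "X \<tau> \<in> skew_compl E"
      using orth sigma_swap[of "X \<tau>"] by (auto simp: skew_compl_def)
    hence "X \<tau> \<in> E" using EE by simp
    hence "A \<tau> = 0" using orth by (simp add: A_def)
    thus False using al(1) al(2)[of \<tau>] r by simp
  qed
  hence "\<forall>s Ls. \<tau> < s \<longrightarrow> s \<le> \<tau> + min S1 S2 \<longrightarrow> \<not> is_jacobi_plane X b s Ls" by fastforce
  thus ?thesis using S1(1) S2(1) by (intro exI[of _ "min S1 S2"]) auto
qed

end

section \<open>Power series and piecewise analytic functions\<close>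

definition power_series_on :: "(real \<Rightarrow> 'b::euclidean_space) \<Rightarrow> real \<Rightarrow> real \<Rightarrow> (nat \<Rightarrow> 'b) \<Rightarrow> bool" where
  "power_series_on F x r c \<longleftrightarrow> (\<forall>y. \<bar>y - x\<bar> < r \<longrightarrow> (\<lambda>n. (y - x) ^ n *\<^sub>R c n) sums F y)"

text \<open>Termwise differentiation in each coordinate; the full radius \<open>r\<close> is
  retained, so the step can be iterated.\<close>

lemma power_series_on_deriv:
  fixes F :: "real \<Rightarrow> 'b::euclidean_space"
  assumes F: "power_series_on F x r c"
  obtains F' where "power_series_on F' x r (\<lambda>n. real (Suc n) *\<^sub>R c (Suc n))"
    "\<And>y. \<bar>y - x\<bar> < r \<Longrightarrow> (F has_vector_derivative F' y) (at y)"
proof -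
  have s: "(\<lambda>n. (c n \<bullet> i) * z ^ n) sums (F (x + z) \<bullet> i)" if "\<bar>z\<bar> < r" for z i
  proof -
    have "(\<lambda>n. z ^ n *\<^sub>R c n) sums F (x + z)"
      using F that unfolding power_series_on_def by (elim allE[of _ "x + z"]) simp
    from bounded_linear.sums[OF bounded_linear_inner_left this, of i]
    show ?thesis by (simp add: mult.commute)
  qed
  define g where "g = (\<lambda>i z. \<Sum>n. diffs (\<lambda>n. c n \<bullet> i) n * z ^ n)"
  have g: "(\<lambda>n. diffs (\<lambda>n. c n \<bullet> i) n * z ^ n) sums g i z" if "\<bar>z\<bar> < r" for z i
    unfolding g_def using that sums_summable[OF s]
    by (intro summable_sums termdiff_converges[of z r]) auto
  have dg: "((\<lambda>z. F (x + z) \<bullet> i) has_real_derivative g i z) (at z)" if z: "\<bar>z\<bar> < r" for z i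
  proof -
    obtain K where K: "\<bar>z\<bar> < K" "K < r" using dense z by blast
    have "((\<lambda>z. \<Sum>n. (c n \<bullet> i) * z ^ n) has_real_derivative g i z) (at z)"
      unfolding g_def using K sums_summable[OF s[of K i]] by (intro termdiffs_strong[of _ K]) auto
    thus ?thesis
    proof (rule has_field_derivative_transform_within_open)
      show "open (ball 0 r)" "z \<in> ball 0 r" using z by auto
      show "(\<Sum>n. (c n \<bullet> i) * y ^ n) = F (x + y) \<bullet> i" if "y \<in> ball 0 r" for y
        using sums_unique[OF s[of y i]] that by simp
    qed
  qed
  define F' where "F' = (\<lambda>y. \<Sum>i\<in>Basis. g i (y - x) *\<^sub>R i)"
  show ?thesis
  proof
    show "power_series_on F' x r (\<lambda>n. real (Suc n) *\<^sub>R c (Suc n))"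
      unfolding power_series_on_def
    proof (intro allI impI)
      fix y assume y: "\<bar>y - x\<bar> < r"
      have "(\<lambda>n. \<Sum>i\<in>Basis. (diffs (\<lambda>n. c n \<bullet> i) n * (y - x) ^ n) *\<^sub>R i) sums F' y"
        unfolding F'_def by (intro sums_sum sums_scaleR_left g y)
      moreover have "(\<Sum>i\<in>Basis. (diffs (\<lambda>n. c n \<bullet> i) n * (y - x) ^ n) *\<^sub>R i) = (y - x) ^ n *\<^sub>R (real (Suc n) *\<^sub>R c (Suc n))" for n
      proof -
        have "(\<Sum>i\<in>Basis. (diffs (\<lambda>n. c n \<bullet> i) n * (y - x) ^ n) *\<^sub>R i) =
            (\<Sum>i\<in>Basis. (((y - x) ^ n *\<^sub>R (real (Suc n) *\<^sub>R c (Suc n))) \<bullet> i) *\<^sub>R i)"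
          by (intro sum.cong refl) (simp add: diffs_def mult_ac)
        thus ?thesis by (simp only: euclidean_representation)
      qed
      ultimately show "(\<lambda>n. (y - x) ^ n *\<^sub>R (real (Suc n) *\<^sub>R c (Suc n))) sums F' y" by simp
    qed
    fix y assume y: "\<bar>y - x\<bar> < r"
    have "((\<lambda>w. F w \<bullet> i) has_real_derivative g i (y - x)) (at y)" for i
    proof -
      have "((\<lambda>w. w - x) has_real_derivative 1) (at y)" by (auto intro!: derivative_eq_intros)
      from DERIV_chain2[OF dg[OF y] this] show ?thesis by simp
    qed
    hence "((\<lambda>w. \<Sum>i\<in>Basis. (F w \<bullet> i) *\<^sub>R i) has_vector_derivative F' y) (at y)"
      unfolding F'_def
      by (intro has_vector_derivative_sum bounded_linear.has_vector_derivative[OF bounded_linear_scaleR_left])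
        (simp add: has_real_derivative_iff_has_vector_derivative)
    thus "(F has_vector_derivative F' y) (at y)" by (simp add: euclidean_representation)
  qed
qed

lemma power_series_on_C2:
  fixes F :: "real \<Rightarrow> 'b::euclidean_space"
  assumes F: "power_series_on F x r c"
  obtains F1 F2 where "\<And>y. \<bar>y - x\<bar> < r \<Longrightarrow> (F has_vector_derivative F1 y) (at y)"
    "\<And>y. \<bar>y - x\<bar> < r \<Longrightarrow> (F1 has_vector_derivative F2 y) (at y)" "\<And>y. \<bar>y - x\<bar> < r \<Longrightarrow> isCont F2 y"
proof -
  obtain F1 where 1: "power_series_on F1 x r (\<lambda>n. real (Suc n) *\<^sub>R c (Suc n))"
    "\<And>y. \<bar>y - x\<bar> < r \<Longrightarrow> (F has_vector_derivative F1 y) (at y)" by (rule power_series_on_deriv[OF F]) blast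
  obtain F2 where 2: "power_series_on F2 x r (\<lambda>n. real (Suc n) *\<^sub>R real (Suc (Suc n)) *\<^sub>R c (Suc (Suc n)))"
    "\<And>y. \<bar>y - x\<bar> < r \<Longrightarrow> (F1 has_vector_derivative F2 y) (at y)" by (rule power_series_on_deriv[OF 1(1)]) blast
  obtain F3 where 3: "\<And>y. \<bar>y - x\<bar> < r \<Longrightarrow> (F2 has_vector_derivative F3 y) (at y)" by (rule power_series_on_deriv[OF 2(1)]) blast
  show ?thesis by (rule that[OF 1(2) 2(2)]) (use has_vector_derivative_continuous[OF 3] in auto)
qed

text \<open>On the real line \<open>Basis\<close> consists of the number 1, so a multi-index is a
  single exponent; \<open>e\<close> is this identification.\<close>

lemma real_analytic_at_power_series:
  fixes F :: "real \<Rightarrow> 'b::euclidean_space"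
  assumes "real_analytic_at F x"
  obtains r c where "r > 0" "power_series_on F x r c"
proof -
  obtain r c where r: "r > 0" and c: "\<And>y. y \<in> ball x r \<Longrightarrow>
    ((\<lambda>\<alpha>. (\<Prod>i\<in>Basis. ((y - x) \<bullet> i) ^ \<alpha> i) *\<^sub>R c \<alpha>) has_sum F y) {\<alpha> :: real \<Rightarrow> nat. \<forall>i. i \<notin> Basis \<longrightarrow> \<alpha> i = 0}"
    using assms unfolding real_analytic_at_def by blast
  define e where "e = (\<lambda>(n::nat) (i::real). if i = 1 then n else 0)"
  have bij: "bij_betw e UNIV {\<alpha> :: real \<Rightarrow> nat. \<forall>i. i \<notin> Basis \<longrightarrow> \<alpha> i = 0}"
    by (rule bij_betw_byWitness[where f' = "\<lambda>\<alpha>. \<alpha> 1"]) (auto simp: e_def)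
  have "power_series_on F x r (\<lambda>n. c (e n))"
    unfolding power_series_on_def
  proof (intro allI impI)
    fix y assume "\<bar>y - x\<bar> < r"
    hence "y \<in> ball x r" by (simp add: dist_real_def abs_minus_commute)
    from c[OF this] have "((\<lambda>n. (\<Prod>i\<in>Basis. ((y - x) \<bullet> i) ^ e n i) *\<^sub>R c (e n)) has_sum F y) UNIV"
      by (subst has_sum_reindex_bij_betw[OF bij])
    hence "((\<lambda>n. (y - x) ^ n *\<^sub>R c (e n)) has_sum F y) UNIV" by (simp add: e_def)
    thus "(\<lambda>n. (y - x) ^ n *\<^sub>R c (e n)) sums F y" by (rule has_sum_imp_sums)
  qed
  thus ?thesis using that r by blast
qed

lemma real_analytic_at_isCont:
  fixes F :: "real \<Rightarrow> 'b::euclidean_space"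
  assumes "real_analytic_at F x" shows "isCont F x"
proof -
  obtain r c where r: "r > 0" "power_series_on F x r c" by (rule real_analytic_at_power_series[OF assms])
  obtain F' where "\<And>y. \<bar>y - x\<bar> < r \<Longrightarrow> (F has_vector_derivative F' y) (at y)" by (rule power_series_on_deriv[OF r(2)]) blast
  from has_vector_derivative_continuous[OF this[of x]] r(1) show ?thesis by simp
qed

section \<open>Piecewise analytic functions and the order of vanishing\<close>

lemma piecewise_analytic_right:
  assumes g: "piecewise_analytic T g" and \<tau>: "0 \<le> \<tau>" "\<tau> < T"
  obtains G d where "d > 0" "real_analytic_at G \<tau>" "\<And>t. t \<in> {\<tau>..<\<tau> + d} \<Longrightarrow> g t = G t"
proof -
  obtain N s where s: "s 0 = 0" "s N = T"
    and pc: "\<And>i. i < N \<Longrightarrow> \<exists>G. real_analytic_on G {s i..s (Suc i)} \<and> (\<forall>t\<in>{s i..<s (Suc i)}. g t = G t)"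
    using g unfolding piecewise_analytic_def piecewise_on_def by blast
  define k where "k = (LEAST k. \<tau> < s k)"
  have k: "\<tau> < s k" unfolding k_def by (rule LeastI[of _ N]) (simp add: s \<tau>)
  have kN: "k \<le> N" unfolding k_def by (rule Least_le) (simp add: s \<tau>)
  have "k \<noteq> 0" using k s(1) \<tau>(1) by (metis not_le)
  then obtain i where i: "k = Suc i" by (cases k) auto
  have si: "s i \<le> \<tau>" using not_less_Least[of i "\<lambda>k. \<tau> < s k"] i unfolding k_def by auto
  obtain G where G: "real_analytic_on G {s i..s (Suc i)}" "\<forall>t\<in>{s i..<s (Suc i)}. g t = G t"
    using pc[of i] i kN by auto
  show ?thesis
  proof (rule that[of "s (Suc i) - \<tau>" G])
    show "0 < s (Suc i) - \<tau>" using k i by simp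
    show "real_analytic_at G \<tau>" using G(1) si k i by (simp add: real_analytic_on_def)
    show "g t = G t" if "t \<in> {\<tau>..<\<tau> + (s (Suc i) - \<tau>)}" for t using G(2) that si by auto
  qed
qed

text \<open>Induction over the break points. The inequality \<open>t < T\<close> is strict because
  no piece prescribes the value at \<open>T\<close>.\<close>

lemma piecewise_analytic_ess_bdd:
  fixes g :: "real \<Rightarrow> 'b::euclidean_space"
  assumes g: "piecewise_analytic T g" and t: "t < T"
  shows "ess_bdd 0 t g"
proof -
  obtain N s where s: "s 0 = 0" "s N = T" "\<And>i. i < N \<Longrightarrow> s i < s (Suc i)"
    and pc: "\<And>i. i < N \<Longrightarrow> \<exists>G. real_analytic_on G {s i..s (Suc i)} \<and> (\<forall>t\<in>{s i..<s (Suc i)}. g t = G t)"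
    using g unfolding piecewise_analytic_def piecewise_on_def by blast
  have "0 \<le> s i \<and> (\<lambda>x. indicator {0..<s i} x *\<^sub>R g x) \<in> borel_measurable borel \<and> (\<exists>C. \<forall>x\<in>{0..<s i}. norm (g x) \<le> C)"
    if "i \<le> N" for i
    using that
  proof (induction i)
    case (Suc i)
    obtain G where G: "real_analytic_on G {s i..s (Suc i)}" "\<forall>t\<in>{s i..<s (Suc i)}. g t = G t"
      using pc[of i] Suc by auto
    have lt: "s i < s (Suc i)" using s(3) Suc by simp
    have IH: "0 \<le> s i" "(\<lambda>x. indicator {0..<s i} x *\<^sub>R g x) \<in> borel_measurable borel" using Suc by auto
    obtain C where C: "\<forall>x\<in>{0..<s i}. norm (g x) \<le> C" using Suc by auto
    have cG: "continuous_on {s i..s (Suc i)} G"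
      using G(1) real_analytic_at_isCont unfolding real_analytic_on_def
      by (intro continuous_at_imp_continuous_on) blast
    have "bounded (G ` {s i..s (Suc i)})" by (intro compact_imp_bounded compact_continuous_image cG) simp
    then obtain D where D: "\<forall>x\<in>{s i..s (Suc i)}. norm (G x) \<le> D" by (auto simp: bounded_iff)
    have mG: "(\<lambda>x. indicator {s i..<s (Suc i)} x *\<^sub>R G x) \<in> borel_measurable borel"
      by (rule borel_measurable_continuous_on_indicator[OF _ continuous_on_subset[OF cG]]) auto
    have "(\<lambda>x. indicator {0..<s (Suc i)} x *\<^sub>R g x) =
        (\<lambda>x. indicator {0..<s i} x *\<^sub>R g x + indicator {s i..<s (Suc i)} x *\<^sub>R G x)"
      using G(2) lt IH(1) by (auto simp: indicator_def fun_eq_iff)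
    hence "(\<lambda>x. indicator {0..<s (Suc i)} x *\<^sub>R g x) \<in> borel_measurable borel"
      using borel_measurable_add[OF IH(2) mG] by simp
    moreover have "norm (g x) \<le> max C D" if "x \<in> {0..<s (Suc i)}" for x
      using C D G(2) that by (cases "x < s i") (auto simp: le_max_iff_disj)
    ultimately show ?case using IH(1) lt by fastforce
  qed (simp add: s)
  from this[of N] obtain C where m: "(\<lambda>x. indicator {0..<T} x *\<^sub>R g x) \<in> borel_measurable borel" and C: "\<forall>x\<in>{0..<T}. norm (g x) \<le> C"
    using s(2) by auto
  show ?thesis
  proof (rule ess_bddI)
    have "(\<lambda>x. indicator {0..<T} x *\<^sub>R g x) \<in> borel_measurable lebesgue"
      using m by (intro measurable_completion) simp
    hence "(\<lambda>x. indicator {0..<T} x *\<^sub>R g x) \<in> borel_measurable (lebesgue_on {0..t})"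
      by (rule measurable_restrict_space1)
    thus "g \<in> borel_measurable (lebesgue_on {0..t})"
      by (rule measurable_cong[THEN iffD1, rotated]) (use t in \<open>auto simp: indicator_def\<close>)
    show "norm (g x) \<le> C" if "x \<in> {0..t}" for x using C t that by auto
  qed
qed

text \<open>Convergence at a positive argument gives convergence at all arguments of smaller
  modulus, negative ones included. Hence \<open>R\<close> is a power series around 0 and
  continuously differentiable there, though \<open>b\<close> is expanded only to the right.\<close>

lemma vanishing_order_factor:
  fixes b :: "real \<Rightarrow> real"
  assumes b: "\<forall>\<^sub>F \<epsilon> in at_right 0. (\<lambda>k. \<beta> k * \<epsilon> ^ k) sums b \<epsilon>" and z: "\<forall>k<m. \<beta> k = 0"
  obtains e R R1 where "e > 0" "R 0 = \<beta> m" "\<And>x. 0 < x \<Longrightarrow> x < e \<Longrightarrow> b x = x ^ m * R x"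
    "\<And>x. \<bar>x\<bar> < e \<Longrightarrow> (R has_real_derivative R1 x) (at x)" "\<And>x. \<bar>x\<bar> < e \<Longrightarrow> isCont R1 x"
proof -
  obtain e where e: "e > 0" "\<And>x. 0 < x \<Longrightarrow> x < e \<Longrightarrow> (\<lambda>k. \<beta> k * x ^ k) sums b x"
    using b unfolding eventually_at_right_field by (auto simp: field_simps)
  define R where "R = (\<lambda>x. \<Sum>k. x ^ k * \<beta> (k + m))"
  have sR: "(\<lambda>k. x ^ k * \<beta> (k + m)) sums (b x / x ^ m)" if x: "0 < x" "x < e" for x
  proof -
    have "(\<lambda>k. \<beta> (k + m) * x ^ (k + m)) sums b x"
      using e(2)[OF x] z by (subst sums_zero_iff_shift) auto
    from sums_divide[OF this, of "x ^ m"] show ?thesis using x by (simp add: power_add mult.commute)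
  qed
  have "power_series_on R 0 e (\<lambda>k. \<beta> (k + m))"
    unfolding power_series_on_def
  proof (intro allI impI)
    fix y :: real assume "\<bar>y - 0\<bar> < e"
    then obtain K where K: "\<bar>y\<bar> < K" "K < e" using dense by auto
    have "summable (\<lambda>k. \<beta> (k + m) * K ^ k)" using sums_summable[OF sR[of K]] K by (simp add: mult.commute)
    from powser_inside[OF this, of y] K show "(\<lambda>k. (y - 0) ^ k *\<^sub>R \<beta> (k + m)) sums R y"
      by (simp add: R_def mult.commute summable_sums)
  qed
  then obtain R1 R2 where d: "\<And>y. \<bar>y - 0\<bar> < e \<Longrightarrow> (R has_vector_derivative R1 y) (at y)"
    "\<And>y. \<bar>y - 0\<bar> < e \<Longrightarrow> (R1 has_vector_derivative R2 y) (at y)" by (rule power_series_on_C2) blast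
  have R1: "(R has_real_derivative R1 y) (at y)" "isCont R1 y" if "\<bar>y\<bar> < e" for y
    using d[of y] has_vector_derivative_continuous[OF d(2)[of y]] that
    by (auto simp: has_real_derivative_iff_has_vector_derivative)
  show ?thesis
  proof (rule that[OF e(1) _ _ R1])
    show "R 0 = \<beta> m" by (simp add: R_def powser_zero mult.commute[of "0 ^ _"])
    show "b x = x ^ m * R x" if "0 < x" "x < e" for x
      unfolding R_def sums_unique[OF sR[OF that], symmetric] using that by simp
  qed
qed

lemma right_lipschitz:
  assumes "(f has_real_derivative D) (at_right x)"
  shows "\<forall>\<^sub>F t in at_right x. \<bar>f t - f x\<bar> \<le> (\<bar>D\<bar> + 1) * (t - x)"
proof -
  have "((\<lambda>t. (f t - f x) / (t - x)) \<longlongrightarrow> D) (at_right x)" using assms unfolding has_field_derivative_iff .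
  hence "\<forall>\<^sub>F t in at_right x. dist ((f t - f x) / (t - x)) D < 1" by (rule tendstoD) simp
  moreover have "\<forall>\<^sub>F t in at_right x. x < t" by (rule eventually_at_right_less)
  ultimately show ?thesis
  proof eventually_elim
    case (elim t)
    hence "\<bar>(f t - f x) / (t - x)\<bar> \<le> \<bar>D\<bar> + 1" by (simp add: dist_real_def)
    thus ?case using elim by (simp add: abs_divide pos_divide_le_eq)
  qed
qed

section \<open>The right limit\<close>

lemma eventually_at_right_0_radius:
  assumes "\<forall>\<^sub>F x in at_right (0::real). P x" and "r0 > 0"
  obtains r where "0 < r" "r \<le> r0" "\<And>x. 0 < x \<Longrightarrow> x \<le> r \<Longrightarrow> P x"
proof -
  obtain e where e: "e > 0" "\<And>x. 0 < x \<Longrightarrow> x < e \<Longrightarrow> P x"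
    using assms(1) unfolding eventually_at_right_field by (auto simp: field_simps)
  show ?thesis by (rule that[of "min r0 (e / 2)"]) (use e assms(2) in auto)
qed

theorem jacobi_right_limit:
  fixes X :: "real \<Rightarrow> 'e \<times> 'e::euclidean_space" and b :: "real \<Rightarrow> real"
  assumes analytic: "piecewise_analytic T X" "piecewise_analytic T b"
    and \<tau>: "0 \<le> \<tau>" "\<tau> < T"
    and b0: "b \<tau> = 0"
    and b_taylor: "\<forall>\<^sub>F \<epsilon> in at_right 0. (\<lambda>k. \<beta> k * \<epsilon> ^ k) sums b (\<tau> + \<epsilon>)"
    and b_order: "\<beta> m \<noteq> 0" "\<forall>k<m. \<beta> k = 0"
    and b_neg: "\<forall>\<^sub>F \<epsilon> in at_right 0. b (\<tau> + \<epsilon>) < 0"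
    and nondeg: "sigma (X \<tau>) (right_deriv X \<tau>) \<noteq> 0"
    and at_tau: "is_jacobi_plane X b \<tau> (LL \<tau>)"
    and after: "\<forall>\<^sub>F s in at_right \<tau>. is_jacobi_plane X b s (LL s)"
    and lim: "lagrangian_plane Lp" "((\<lambda>s. plane_dist (LL s) Lp) \<longlongrightarrow> 0) (at_right \<tau>)"
  shows "Lp = plane_add_vector (LL \<tau>) (X \<tau>)"
proof -
  obtain G d where d: "d > 0" "real_analytic_at G \<tau>" and XG: "\<And>t. t \<in> {\<tau>..<\<tau> + d} \<Longrightarrow> X t = G t"
    by (rule piecewise_analytic_right[OF analytic(1) \<tau>]) blast
  obtain \<rho> cG where \<rho>: "\<rho> > 0" "power_series_on G \<tau> \<rho> cG" by (rule real_analytic_at_power_series[OF d(2)])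
  obtain G1 G2 where G1: "\<And>y. \<bar>y - \<tau>\<bar> < \<rho> \<Longrightarrow> (G has_vector_derivative G1 y) (at y)"
    and G2: "\<And>y. \<bar>y - \<tau>\<bar> < \<rho> \<Longrightarrow> (G1 has_vector_derivative G2 y) (at y)"
    and G2c: "\<And>y. \<bar>y - \<tau>\<bar> < \<rho> \<Longrightarrow> isCont G2 y"
    by (rule power_series_on_C2[OF \<rho>(2)]) blast
  obtain e R R1 where e: "e > 0" and R0: "R 0 = \<beta> m" and bR: "\<And>x. 0 < x \<Longrightarrow> x < e \<Longrightarrow> b (\<tau> + x) = x ^ m * R x"
    and dR: "\<And>x. \<bar>x\<bar> < e \<Longrightarrow> (R has_real_derivative R1 x) (at x)" and cR1: "\<And>x. \<bar>x\<bar> < e \<Longrightarrow> isCont R1 x"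
    by (rule vanishing_order_factor[OF b_taylor b_order(2)]) blast
  have cR: "isCont R x" if "\<bar>x\<bar> < e" for x using DERIV_isCont[OF dR[OF that]] .
  have limR: "(R \<longlongrightarrow> \<beta> m) (at_right 0)"
    using cR[of 0] e R0 by (simp add: isCont_def filterlim_at_split)
  have small: "\<forall>\<^sub>F x in at_right 0. 0 < x \<and> x < (l::real)" if "l > 0" for l
    using eventually_at_right_real[OF that] by eventually_elim auto
  have evb: "\<forall>\<^sub>F x in at_right 0. b (\<tau> + x) = x ^ m * R x"
    using small[OF e] by eventually_elim (use bR in auto)
  have Rneg: "\<forall>\<^sub>F x in at_right 0. R x < 0"
    using b_neg evb small[OF e] by eventually_elim (auto simp: mult_less_0_iff dest: zero_less_power[of _ m])
  define \<gamma> where "\<gamma> = - \<beta> m"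
  have \<gamma>: "\<gamma> > 0"
  proof -
    have "\<beta> m \<le> 0" by (rule tendsto_upperbound[OF limR]) (use Rneg in \<open>auto elim: eventually_mono\<close>)
    thus ?thesis using b_order(1) by (simp add: \<gamma>_def)
  qed
  \<comment> \<open>\<open>b_taylor\<close> concerns positive \<open>\<epsilon>\<close> only; right
    continuity of the analytic piece carries \<open>b \<tau> = 0\<close> over to the constant
    coefficient.\<close>
  have m: "m \<ge> 1"
  proof (rule ccontr)
    assume "\<not> m \<ge> 1"
    hence m0: "m = 0" by simp
    obtain H d' where H: "d' > 0" "real_analytic_at H \<tau>" "\<And>t. t \<in> {\<tau>..<\<tau> + d'} \<Longrightarrow> b t = H t"
      by (rule piecewise_analytic_right[OF analytic(2) \<tau>]) blast
    have "isCont (\<lambda>x. H (\<tau> + x)) 0"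
      by (rule isCont_o2[where f = "\<lambda>x. \<tau> + x" and g = H]) (use real_analytic_at_isCont[OF H(2)] in simp_all)
    hence "((\<lambda>x. H (\<tau> + x)) \<longlongrightarrow> 0) (at_right 0)"
      using H(3)[of \<tau>] H(1) b0 by (simp add: isCont_def filterlim_at_split)
    moreover have "\<forall>\<^sub>F x in at_right 0. H (\<tau> + x) = R x"
      using small[OF H(1)] evb by eventually_elim (use H(3) m0 in auto)
    ultimately have "(R \<longlongrightarrow> 0) (at_right 0)" by (rule Lim_transform_eventually)
    hence "\<beta> m = 0" using limR tendsto_unique by (metis trivial_limit_at_right_real)
    thus False using b_order(1) by simp
  qed
  \<comment> \<open>One factor \<open>t - \<tau>\<close> is split off, as
    \<open>jacobi_piece\<close> requires; the exponent \<open>m - 1\<close> makes sense because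
    \<open>m \<ge> 1\<close>.\<close>
  define Bf where "Bf = (\<lambda>t. (t - \<tau>) ^ (m - 1) * R (t - \<tau>))"
  define r0 where "r0 = min (min (\<rho> / 2) (d / 2)) (min (e / 2) ((T - \<tau>) / 2))"
  have r0: "0 < r0" "r0 < \<rho>" "r0 < d" "r0 < e" "\<tau> + r0 < T" using \<rho>(1) d(1) e \<tau>(2) by (auto simp: r0_def min_def field_simps)
  have glob: "ess_bdd 0 s X" "ess_bdd 0 s b" if "s \<le> \<tau> + r0" for s
    using that r0(5) by (auto intro!: piecewise_analytic_ess_bdd analytic)
  have X1: "(X has_vector_derivative G1 t) (at t within {\<tau>..\<tau> + r})" if r: "r \<le> r0" and t: "t \<in> {\<tau>..\<tau> + r}" for r t
  proof (rule has_vector_derivative_transform[OF t])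
    show "X x = G x" if "x \<in> {\<tau>..\<tau> + r}" for x using XG that r r0(3) by simp
    show "(G has_vector_derivative G1 t) (at t within {\<tau>..\<tau> + r})"
      by (rule has_vector_derivative_at_within, rule G1) (use t r r0(2) in auto)
  qed
  have G2': "(G1 has_vector_derivative G2 t) (at t within S)" if "r \<le> r0" "t \<in> {\<tau>..\<tau> + r}" for r t S
    by (rule has_vector_derivative_at_within, rule G2) (use that r0(2) in auto)
  have rd: "right_deriv X \<tau> = G1 \<tau>"
  proof -
    have "(X has_vector_derivative G1 \<tau>) (at_right \<tau>)"
      using X1[OF order_refl, of \<tau>] at_within_Icc_at_right[of \<tau> "\<tau> + r0"] r0(1) by simp
    thus ?thesis unfolding right_deriv_def by (intro vector_derivative_within) auto
  qed
  have bB: "b t = (t - \<tau>) * Bf t" "t \<noteq> \<tau> \<Longrightarrow> b t = (t - \<tau>) ^ m * R (t - \<tau>)" if "r \<le> r0" "t \<in> {\<tau>..\<tau> + r}" for r t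
  proof -
    show *: "b t = (t - \<tau>) ^ m * R (t - \<tau>)" if "t \<noteq> \<tau>"
      using bR[of "t - \<tau>"] \<open>r \<le> r0\<close> \<open>t \<in> {\<tau>..\<tau> + r}\<close> that r0(4) by auto
    show "b t = (t - \<tau>) * Bf t"
      using * b0 m by (cases "t = \<tau>") (auto simp: Bf_def power_eq_if)
  qed
  have jp: "jacobi_piece X G1 b Bf \<tau> r" if r: "0 < r" "r \<le> r0" for r
  proof
    show "continuous_on {\<tau>..\<tau> + r} G1"
      unfolding continuous_on_eq_continuous_within
      using has_vector_derivative_continuous[OF G2'[OF r(2)]] by blast
    show "continuous_on {\<tau>..\<tau> + r} Bf"
      unfolding Bf_def
    proof (intro continuous_intros continuous_at_imp_continuous_on ballI)
      fix t assume "t \<in> {\<tau>..\<tau> + r}"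
      hence c: "isCont R (t - \<tau>)" using cR r r0(4) by auto
      show "isCont (\<lambda>t. R (t - \<tau>)) t" by (rule isCont_o2[where f = "\<lambda>t. t - \<tau>" and g = R and a = t]) (use c in simp_all)
    qed
  qed (use r X1 bB(1) in auto)
  define Af where "Af = (\<lambda>t. sigma (G t) (G1 t))"
  have A: "jacobi_piece.A X G1 t = Af t" if "t \<in> {\<tau>..\<tau> + r0}" for t
    using jacobi_piece.A_def[OF jp[OF r0(1) order_refl]] XG[of t] that r0(3) by (simp add: Af_def)
  define a where "a = Af \<tau>"
  have a: "a \<noteq> 0" using nondeg rd XG[of \<tau>] d(1) by (simp add: a_def Af_def)
  define D where "D = sigma (G \<tau>) (G2 \<tau>)"
  have "(Af has_vector_derivative sigma (G \<tau>) (G2 \<tau>) + sigma (G1 \<tau>) (G1 \<tau>)) (at \<tau>)"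
    unfolding Af_def using \<rho>(1) by (intro bounded_bilinear.has_vector_derivative[OF bounded_bilinear_sigma] G1 G2) auto
  hence dA: "(Af has_real_derivative D) (at (\<tau> + 0))" by (simp add: has_real_derivative_iff_has_vector_derivative D_def)
  have "((\<lambda>x. \<tau> + x) has_real_derivative 1) (at 0)" by (auto intro!: derivative_eq_intros)
  from DERIV_chain2[OF dA this] have dA0: "((\<lambda>x. Af (\<tau> + x)) has_real_derivative D) (at 0)" by simp
  have limA: "((\<lambda>x. Af (\<tau> + x)) \<longlongrightarrow> a) (at_right 0)"
    using DERIV_isCont[OF dA0] by (simp add: isCont_def filterlim_at_split a_def)
  have Bneg: "Bf t \<le> 0" if "r \<le> r0" "\<And>x. 0 < x \<Longrightarrow> x \<le> r \<Longrightarrow> R x < 0" "t \<in> {\<tau>..\<tau> + r}" for r t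
  proof (cases "t = \<tau>")
    case True thus ?thesis using R0 \<gamma> by (auto simp: Bf_def \<gamma>_def power_0_left)
  next
    case False
    hence "R (t - \<tau>) < 0" using that by auto
    thus ?thesis using that(3) by (auto simp: Bf_def intro!: mult_nonneg_nonpos)
  qed
  have coercive: ?thesis if ex: "\<exists>r c. coercive_piece X G1 b Bf \<tau> r c \<and> r \<le> r0"
  proof -
    obtain r c where rc: "coercive_piece X G1 b Bf \<tau> r c" "r \<le> r0" using ex by blast
    have L: "lagrangian_plane (LL \<tau>)"
      using at_tau lagrangian_vertical by (auto simp: is_jacobi_plane_def split: if_splits)
    show ?thesis
      by (rule coercive_piece.coercive_limit[OF rc(1) \<tau>(1) _ _ L at_tau after lim]) (use glob rc(2) in auto)
  qed
  have split: "t = \<tau> \<or> (0 < t - \<tau> \<and> t - \<tau> \<le> r)" if "t \<in> {\<tau>..\<tau> + r}" for t r using that by auto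
  consider "a > 0" | "a < 0" "m = 1" | "a < 0" "m = 2" "4 * - a \<le> \<gamma>" | "a < 0" "m = 2" "\<gamma> < 4 * - a" | "a < 0" "m > 2"
    using a m by fastforce
  \<comment> \<open>\<open>0 ^ (m - 2)\<close> is 1 for \<open>m = 2\<close> and 0 for
    \<open>m > 2\<close>: the subcritical quadratic case and all higher orders become one
    case.\<close>
  hence cases: "a > 0 \<or> m = 1 \<or> (a < 0 \<and> m = 2 \<and> 4 * - a \<le> \<gamma>) \<or> (a < 0 \<and> 2 \<le> m \<and> 0 ^ (m - 2) * \<gamma> < 4 * - a)"
    by cases (auto simp: power_0_left)
  thus ?thesis
  proof (elim disjE conjE)
    assume a: "a > 0"
    have "\<forall>\<^sub>F x in at_right 0. a / 2 < Af (\<tau> + x) \<and> R x < 0"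
      using order_tendstoD(1)[OF limA, of "a / 2"] a Rneg by (auto intro: eventually_conj)
    then obtain r where r: "0 < r" "r \<le> r0" "\<And>x. 0 < x \<Longrightarrow> x \<le> r \<Longrightarrow> a / 2 < Af (\<tau> + x) \<and> R x < 0"
      by (rule eventually_at_right_0_radius[OF _ r0(1)]) blast
    have "\<exists>r' c. coercive_piece X G1 b Bf \<tau> r' c \<and> r' \<le> r"
    proof (rule jacobi_piece.coercive_positive[OF jp[OF r(1,2)], of "a / 2"])
      fix t assume t: "t \<in> {\<tau>..\<tau> + r}"
      show "a / 2 \<le> jacobi_piece.A X G1 t"
        using split[OF t] r(3)[of "t - \<tau>"] A[of t] t r(2) a by (auto simp: a_def)
      show "Bf t \<le> 0" by (rule Bneg[OF r(2) _ t]) (use r in auto)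
    qed (use a in simp)
    thus ?thesis using r(2) by (intro coercive) force
  next
    assume m1: "m = 1"
    have "\<forall>\<^sub>F x in at_right 0. R x < - \<gamma> / 2"
      using order_tendstoD(2)[OF limR, of "- \<gamma> / 2"] \<gamma> by (simp add: \<gamma>_def)
    then obtain r where r: "0 < r" "r \<le> r0" "\<And>x. 0 < x \<Longrightarrow> x \<le> r \<Longrightarrow> R x < - \<gamma> / 2"
      by (rule eventually_at_right_0_radius[OF _ r0(1)]) blast
    have "\<exists>r' c. coercive_piece X G1 b Bf \<tau> r' c \<and> r' \<le> r"
    proof (rule jacobi_piece.coercive_first_order[OF jp[OF r(1,2)], of "\<gamma> / 2"])
      fix t assume t: "t \<in> {\<tau>..\<tau> + r}"
      show "Bf t \<le> - (\<gamma> / 2)"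
        using split[OF t] r(3)[of "t - \<tau>"] R0 \<gamma> m1 by (auto simp: Bf_def \<gamma>_def)
    qed (use \<gamma> in simp)
    thus ?thesis using r(2) by (intro coercive) force
  next
    assume a: "a < 0" and m2: "m = 2" and le: "4 * - a \<le> \<gamma>"
    have "\<forall>\<^sub>F x in at_right 0. \<bar>Af (\<tau> + x) - Af (\<tau> + 0)\<bar> \<le> (\<bar>D\<bar> + 1) * (x - 0) \<and>
        \<bar>R x - R 0\<bar> \<le> (\<bar>R1 0\<bar> + 1) * (x - 0) \<and> R x < 0 \<and> - (2 * \<gamma>) < R x"
      using right_lipschitz[OF has_field_derivative_at_within[OF dA0]]
        right_lipschitz[OF has_field_derivative_at_within[OF dR[of 0]]] e Rneg
        order_tendstoD(1)[OF limR, of "- (2 * \<gamma>)"] \<gamma>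
      by (intro eventually_conj) (auto simp: \<gamma>_def)
    then obtain r where r: "0 < r" "r \<le> r0" "\<And>x. 0 < x \<Longrightarrow> x \<le> r \<Longrightarrow> \<bar>Af (\<tau> + x) - Af (\<tau> + 0)\<bar> \<le> (\<bar>D\<bar> + 1) * (x - 0) \<and>
        \<bar>R x - R 0\<bar> \<le> (\<bar>R1 0\<bar> + 1) * (x - 0) \<and> R x < 0 \<and> - (2 * \<gamma>) < R x"
      by (rule eventually_at_right_0_radius[OF _ r0(1)]) blast
    \<comment> \<open>Measures how fast \<open>- R\<close> may fall below \<open>\<gamma>\<close>,
      relative to \<open>4 * - a\<close>. Since \<open>\<gamma> \<ge> 4 * - a\<close>, this yields
      \<open>- R x \<ge> 4 * (- a) * (1 - k * x)\<close>.\<close>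
    define k where "k = (\<bar>R1 0\<bar> + 1) / (4 * - a)"
    have "\<exists>r' c. coercive_piece X G1 b Bf \<tau> r' c \<and> r' \<le> r"
    proof (rule jacobi_piece.coercive_hardy[OF jp[OF r(1,2)], of "- a" k "\<bar>D\<bar> + 1" "2 * \<gamma>"])
      show "0 < - a" "0 \<le> \<bar>D\<bar> + 1" "0 < 2 * \<gamma>" using a \<gamma> by auto
      show "0 \<le> k" unfolding k_def using a by (intro divide_nonneg_pos) auto
      fix t assume t: "t \<in> {\<tau>..\<tau> + r}"
      show "- (- a) - (\<bar>D\<bar> + 1) * (t - \<tau>) \<le> jacobi_piece.A X G1 t"
        using split[OF t]
      proof
        assume "0 < t - \<tau> \<and> t - \<tau> \<le> r"
        hence "\<bar>Af t - a\<bar> \<le> (\<bar>D\<bar> + 1) * (t - \<tau>)" using r(3)[of "t - \<tau>"] by (simp add: a_def)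
        thus ?thesis using A[of t] t r(2) by (simp add: abs_le_iff)
      qed (use A[of \<tau>] r0(1) in \<open>simp add: a_def\<close>)
      show "Bf t \<le> 0" by (rule Bneg[OF r(2) _ t]) (use r in auto)
      show "\<bar>Bf t\<bar> \<le> 2 * \<gamma> * (t - \<tau>)"
        using split[OF t]
      proof
        assume x: "0 < t - \<tau> \<and> t - \<tau> \<le> r"
        hence "\<bar>R (t - \<tau>)\<bar> \<le> 2 * \<gamma>" using r(3)[of "t - \<tau>"] by simp
        hence "(t - \<tau>) * \<bar>R (t - \<tau>)\<bar> \<le> (t - \<tau>) * (2 * \<gamma>)" using x by (intro mult_left_mono) auto
        thus ?thesis using x m2 by (simp add: Bf_def abs_mult mult.commute)
      qed (simp add: Bf_def m2)
      show "4 * (- a) * (t - \<tau>)\<^sup>2 * (1 - k * (t - \<tau>)) \<le> - b t"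
        using split[OF t]
      proof
        assume x: "0 < t - \<tau> \<and> t - \<tau> \<le> r"
        hence "\<bar>R (t - \<tau>) + \<gamma>\<bar> \<le> (\<bar>R1 0\<bar> + 1) * (t - \<tau>)" using r(3)[of "t - \<tau>"] R0 by (simp add: \<gamma>_def)
        moreover have "4 * (- a) * (k * (t - \<tau>)) = (\<bar>R1 0\<bar> + 1) * (t - \<tau>)" using a by (simp add: k_def)
        ultimately have "4 * (- a) * (1 - k * (t - \<tau>)) \<le> - R (t - \<tau>)"
          using le by (simp add: right_diff_distrib abs_le_iff)
        hence "(t - \<tau>)\<^sup>2 * (4 * (- a) * (1 - k * (t - \<tau>))) \<le> (t - \<tau>)\<^sup>2 * - R (t - \<tau>)" by (intro mult_left_mono) auto
        moreover have "b t = (t - \<tau>)\<^sup>2 * R (t - \<tau>)" using bB(2)[OF r(2) t] x m2 by auto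
        moreover have "4 * (- a) * (t - \<tau>)\<^sup>2 * (1 - k * (t - \<tau>)) = (t - \<tau>)\<^sup>2 * (4 * (- a) * (1 - k * (t - \<tau>)))"
          by (simp only: mult_ac)
        ultimately show ?thesis by linarith
      qed (simp add: b0)
    qed
    thus ?thesis using r(2) by (intro coercive) force
  next
    assume a: "a < 0" and m2: "2 \<le> m" and lt: "0 ^ (m - 2) * \<gamma> < 4 * - a"
    \<comment> \<open>The limit of \<open>- b / (t - \<tau>)^2\<close> at \<open>\<tau>\<close>. The
      constants are midpoints: \<open>kp\<close> lies strictly between \<open>q0\<close> and
      \<open>4 * - a\<close>, then \<open>al\<close> strictly between \<open>kp / 4\<close> and
      \<open>- a\<close>.\<close>
    define q0 where "q0 = 0 ^ (m - 2) * \<gamma>"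
    have q0: "0 \<le> q0" "q0 < 4 * - a" using \<gamma> lt by (auto simp: q0_def)
    define kp where "kp = (q0 + 4 * - a) / 2"
    have kp: "0 < kp" "kp < 4 * - a" "q0 < kp" using a q0 by (auto simp: kp_def)
    define al where "al = (kp / 4 + - a) / 2"
    have al: "0 < al" "kp < 4 * al" "al < - a" using kp a by (auto simp: al_def)
    have "((\<lambda>x. x ^ (m - 2) * - R x) \<longlongrightarrow> 0 ^ (m - 2) * - \<beta> m) (at_right 0)"
      by (intro tendsto_intros limR)
    hence evQ: "\<forall>\<^sub>F x in at_right 0. x ^ (m - 2) * - R x < kp" by (rule order_tendstoD(2)) (use kp(3) in \<open>simp add: q0_def \<gamma>_def\<close>)
    have "((\<lambda>x. real m * R x + x * R1 x) \<longlongrightarrow> real m * \<beta> m + 0 * R1 0) (at_right 0)"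
      using cR1[of 0] e by (intro tendsto_intros limR) (simp add: isCont_def filterlim_at_split)
    hence evp: "\<forall>\<^sub>F x in at_right 0. real m * R x + x * R1 x < 0"
      by (rule order_tendstoD(2)) (use \<gamma> m in \<open>auto simp: \<gamma>_def mult_pos_neg\<close>)
    have "\<forall>\<^sub>F x in at_right 0. x ^ (m - 2) * - R x < kp \<and> real m * R x + x * R1 x < 0 \<and> Af (\<tau> + x) < - al \<and> R x < 0"
      using order_tendstoD(2)[OF limA, of "- al"] al(3) by (intro eventually_conj evQ evp Rneg) auto
    then obtain r where r: "0 < r" "r \<le> r0" "\<And>x. 0 < x \<Longrightarrow> x \<le> r \<Longrightarrow>
        x ^ (m - 2) * - R x < kp \<and> real m * R x + x * R1 x < 0 \<and> Af (\<tau> + x) < - al \<and> R x < 0"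
      by (rule eventually_at_right_0_radius[OF _ r0(1)]) blast
    \<comment> \<open>The derivative of \<open>- b\<close> by the product rule. Its bracket tends to
      \<open>m * \<beta> m < 0\<close>, so \<open>- b\<close> increases near
      \<open>\<tau>\<close>.\<close>
    define p' where "p' = (\<lambda>t. - ((t - \<tau>) ^ (m - 1) * (real m * R (t - \<tau>) + (t - \<tau>) * R1 (t - \<tau>))))"
    have osc: "oscillating_piece X G1 b Bf \<tau> r G2 al kp p'"
    proof (intro oscillating_piece.intro jp r(1,2) oscillating_piece_axioms.intro)
      show "(G1 has_vector_derivative G2 t) (at t within {\<tau>..\<tau> + r})" if "t \<in> {\<tau>..\<tau> + r}" for t
        by (rule G2'[OF r(2) that])
      show "continuous_on {\<tau>..\<tau> + r} G2"
        using G2c r(2) r0(2) by (intro continuous_at_imp_continuous_on) auto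
      show "jacobi_piece.A X G1 t \<le> - al" if t: "t \<in> {\<tau>..\<tau> + r}" for t
        using split[OF t] r(3)[of "t - \<tau>"] A[of t] t r(2) al(3) by (auto simp: a_def)
      show "b t < 0" if "\<tau> < t" "t \<le> \<tau> + r" for t
        using bB(2)[OF r(2), of t] r(3)[of "t - \<tau>"] that by (simp add: mult_pos_neg)
      show "- b t \<le> kp * (t - \<tau>)\<^sup>2" if t: "t \<in> {\<tau>..\<tau> + r}" for t
        using split[OF t]
      proof
        assume x: "0 < t - \<tau> \<and> t - \<tau> \<le> r"
        have "(t - \<tau>)\<^sup>2 * ((t - \<tau>) ^ (m - 2) * - R (t - \<tau>)) \<le> (t - \<tau>)\<^sup>2 * kp"
          using r(3)[of "t - \<tau>"] x by (intro mult_left_mono) auto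
        moreover have "(t - \<tau>) ^ m = (t - \<tau>)\<^sup>2 * (t - \<tau>) ^ (m - 2)" by (simp only: power_add[symmetric] le_add_diff_inverse[OF m2])
        moreover have "b t = (t - \<tau>) ^ m * R (t - \<tau>)" using bB(2)[OF r(2) t] x by auto
        ultimately show ?thesis by (simp add: mult_ac)
      qed (simp add: b0)
      fix t assume t: "\<tau> < t" "t < \<tau> + r"
      have x: "0 < t - \<tau>" "t - \<tau> \<le> r" "\<bar>t - \<tau>\<bar> < e" using t r r0(4) by auto
      have sh: "((\<lambda>t. t - \<tau>) has_real_derivative 1) (at t)" by (auto intro!: derivative_eq_intros)
      have "((\<lambda>t. (t - \<tau>) ^ m * R (t - \<tau>)) has_real_derivative
          (real m * (t - \<tau>) ^ (m - 1)) * R (t - \<tau>) + R1 (t - \<tau>) * (t - \<tau>) ^ m) (at t)"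
        using DERIV_mult[OF DERIV_chain2[OF DERIV_pow sh, of m] DERIV_chain2[OF dR[OF x(3)] sh]] by simp
      moreover have "(real m * (t - \<tau>) ^ (m - 1)) * R (t - \<tau>) + R1 (t - \<tau>) * (t - \<tau>) ^ m = - p' t"
        using m by (simp add: p'_def power_eq_if algebra_simps)
      ultimately have "((\<lambda>t. - ((t - \<tau>) ^ m * R (t - \<tau>))) has_real_derivative p' t) (at t)"
        using DERIV_minus by fastforce
      thus "((\<lambda>t. - b t) has_real_derivative p' t) (at t)"
      proof (rule has_field_derivative_transform_within_open)
        show "open {\<tau><..<\<tau> + r}" "t \<in> {\<tau><..<\<tau> + r}" using t by auto
        show "- ((y - \<tau>) ^ m * R (y - \<tau>)) = - b y" if "y \<in> {\<tau><..<\<tau> + r}" for y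
          using bB(2)[OF r(2), of y] that by auto
      qed
      have "(t - \<tau>) ^ (m - 1) * (real m * R (t - \<tau>) + (t - \<tau>) * R1 (t - \<tau>)) \<le> 0"
        using r(3)[OF x(1,2)] x(1) by (intro mult_nonneg_nonpos) auto
      thus "0 \<le> p' t" by (simp add: p'_def)
    qed (use al kp in auto)
    obtain S where S: "S > 0" "\<And>s Ls. \<tau> < s \<Longrightarrow> s \<le> \<tau> + S \<Longrightarrow> \<not> is_jacobi_plane X b s Ls"
      using oscillating_piece.no_jacobi_plane[OF osc \<tau>(1)] glob r(2) by force
    have "\<forall>\<^sub>F s in at_right \<tau>. s \<in> {\<tau><..<\<tau> + S}" using S(1) by (intro eventually_at_right_real) simp
    with after have "\<forall>\<^sub>F s in at_right \<tau>. False" by eventually_elim (use S(2) in fastforce)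
    thus ?thesis by simp
  qed
qed

theorem theorem6p1:
  fixes P :: "('m::{t2_space, second_countable_topology}, 'n::finite, 'u::euclidean_space) control_problem"
    and \<nu> \<tau> :: real and m :: nat
    and u :: "real \<Rightarrow> 'u" and var :: "real \<Rightarrow> 'u variation"
    and q :: "real \<Rightarrow> 'm" and lam :: "real \<Rightarrow> ('m, 'n) cot_point"
    and \<Phi> :: "real \<Rightarrow> ('m, 'n) cot_point \<Rightarrow> ('m, 'n) cot_point"
    and \<kappa> :: "('m, 'n) chart"
    and X :: "real \<Rightarrow> (real ^ 'n) \<times> (real ^ 'n)" and b \<beta>
    and \<L> :: "real \<Rightarrow> ((real ^ 'n) \<times> (real ^ 'n)) set"
    and \<L>plus :: "((real ^ 'n) \<times> (real ^ 'n)) set"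
  assumes problem: "optimal_control_problem P"
    and extremal: "extremal P \<nu> u var q lam"
    and chart: "\<kappa> \<in> atlas P" "q_start P \<in> chart_dom \<kappa>"
    and flow: "hamiltonian_flow P \<nu> u \<kappa> (lam 0) \<Phi>"
    and X_def: "X = second_variation_X P \<nu> u var lam \<Phi> \<kappa>"
    and b_def: "b = second_variation_b P \<nu> u var lam"
    and analytic: "piecewise_analytic (horizon P) u" "piecewise_analytic (horizon P) X"
      "piecewise_analytic (horizon P) b"
    and tau: "0 \<le> \<tau>" "\<tau> < horizon P"
    and b_zero: "b \<tau> = 0"
    and b_taylor: "\<forall>\<^sub>F \<epsilon> in at_right 0. (\<lambda>k. \<beta> k * \<epsilon> ^ k) sums b (\<tau> + \<epsilon>)"
    and b_order: "\<beta> m \<noteq> 0" "\<forall>k<m. \<beta> k = 0"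
    and b_neg: "\<forall>\<^sub>F \<epsilon> in at_right 0. b (\<tau> + \<epsilon>) < 0"
    and cond1: "sigma (X \<tau>) (right_deriv X \<tau>) \<noteq> 0"
      "m = 2 \<longrightarrow> 4 * sigma (X \<tau>) (right_deriv X \<tau>) + \<beta> 2 \<noteq> 0"
    and cond2: "\<exists>\<epsilon>>0. \<exists>d. \<forall>s\<in>{\<tau>..\<tau> + \<epsilon>}.
      dim (span {right_deriv (right_deriv X) s, right_deriv X s, X s}) = d"
    and jacobi_at_tau: "is_jacobi_plane X b \<tau> (\<L> \<tau>)"
    and jacobi_after_tau: "\<forall>\<^sub>F s in at_right \<tau>. is_jacobi_plane X b s (\<L> s)"
    and right_limit: "lagrangian_plane \<L>plus" "((\<lambda>s. plane_dist (\<L> s) \<L>plus) \<longlongrightarrow> 0) (at_right \<tau>)"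
  shows "\<L>plus = plane_add_vector (\<L> \<tau>) (X \<tau>)"
  by (rule jacobi_right_limit[OF analytic(2,3) tau b_zero b_taylor b_order b_neg cond1(1)
      jacobi_at_tau jacobi_after_tau right_limit])

end
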